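(* Assume that the coefficients $a^\ell_{m,s}$ ($\ell\in\frac12\mathbb{N}$, $m,s\in\{-\ell,\dots,\ell\}$) of a square integrable random field $X=\sum_{\ell,m,s}a^\ell_{m,s}\phi^\ell_{m,s}:SU(2)\cong S^3\to\mathbb{C}$ are independent and centrally symmetric. Then $X$ is bi-invariant if and only if it is complex Gaussian and the variance of $a^\ell_{m,s}$ depends only on $\ell$.
   Context: $\frac12\mathbb{N}=\{0,\frac12,1,\dots\}$; $m,s\in\{-\ell,-\ell+1,\dots,\ell\}$. Elements of $SU(2)$ are $h(\alpha,\beta)=\begin{pmatrix}\alpha&-\overline\beta\\ \beta&\overline\alpha\end{pmatrix}$, $|\alpha|^2+|\beta|^2=1$; $SU(2)\cong S^3$ carries the round metric of radius 2 (volume $16\pi^2$). Wigner functions: with $\psi^\ell_m(z_0,z_1)=\binom{2\ell}{\ell+m}^{1/2}z_0^{\ell+m}z_1^{\ell-m}$, $D^\ell_{m,s}:SU(2)\to\mathbb{C}$ is defined by $\sum_m\psi^\ell_m(z_0,z_1)D^\ell_{m,s}(h(\alpha,\beta))=\psi^\ell_s(\overline\alpha z_0+\overline\beta z_1,-\beta z_0+\alpha z_1)$ for all $z_0,z_1\in\mathbb{C}$. The functions $\phi^\ell_{m,s}=\frac{\sqrt{2\ell+1}}{4\pi}D^\ell_{m,s}$ form an orthonormal basis of $L^2(SU(2))$. A random field is a measurable $X:\Omega\times SU(2)\to\mathbb{C}$, with $\Omega$ a probability space; it is square integrable if $X(\omega,\cdot)\in L^2(SU(2))$ almost surely. $X$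 is bi-invariant if $X(g^{-1}\cdot g')$ has the same law as $X$ for all $g,g'\in SU(2)$. A complex random variable $a$ is centrally symmetric if $-a$ has the same law as $a$. A complex random variable is complex Gaussian if it is a centred, circularly symmetric Gaussian vector of $\mathbb{R}^2=\mathbb{C}$; a random vector in $\mathbb{C}^N$ is complex Gaussian if all $\mathbb{C}$-linear combinations of its components are complex Gaussian; $X$ is complex Gaussian if $(X(g_1),\dots,X(g_N))$ is a complex Gaussian vector for every finite set of points $g_1,\dots,g_N\in SU(2)$.
   Formalization: The coefficient a^0_{0,0} is assumed complex Gaussian (the claim fails for a^0_{0,0}=±1 with all others 0), and X=Σaφ means a.s. L² convergence plus: at each point where the series converges a.s., X equals its sum a.s. (changing X at one point breaks the claim otherwise). *)

theory Defs
  imports "HOL-Probability.Probability"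
begin

definition su2_mat :: "complex \<Rightarrow> complex \<Rightarrow> complex^2^2" where
  "su2_mat \<alpha> \<beta> = vector [vector [\<alpha>, - cnj \<beta>], vector [\<beta>, cnj \<alpha>]]"

definition SU2 :: "(complex^2^2) set" where
  "SU2 = {su2_mat \<alpha> \<beta> | \<alpha> \<beta>. (cmod \<alpha>)\<^sup>2 + (cmod \<beta>)\<^sup>2 = 1}"

text \<open>Volume measure of the round metric of radius 2 on \<open>SU2\<close>, identified with the unit sphere of
  \<open>complex \<times> complex\<close>. The area of a subset of the unit 3-sphere is 4 times the Lebesgue measure
  of the cone over it in the unit ball; radius 2 gives a further factor \<open>2 ^ 3\<close>, hence the factor 32.\<close>

definition su2_vol :: "(complex^2^2) measure" where
  "su2_vol = distr (scale_measure 32 (restrict_space lborel (ball (0 :: complex \<times> complex) 1 - {0})))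
     (restrict_space borel SU2)
     (\<lambda>z. su2_mat (fst z /\<^sub>R norm z) (snd z /\<^sub>R norm z))"

lemma space_su2_vol [simp]: "space su2_vol = SU2"
  by (simp add: su2_vol_def space_restrict_space)

lemma sets_su2_vol [measurable_cong]: "sets su2_vol = sets (restrict_space borel SU2)"
  by (simp add: su2_vol_def)

definition half_nats :: "real set" where
  "half_nats = {real n / 2 | n. True}"

definition weights :: "real \<Rightarrow> real set" where
  "weights l = {- l + real k | k. real k \<le> 2 * l}"

definition wigner_idx :: "(real \<times> real \<times> real) set" where
  "wigner_idx = {(l, m, s). l \<in> half_nats \<and> m \<in> weights l \<and> s \<in> weights l}"

text \<open>For \<open>l \<in> half_nats\<close> and \<open>m \<in> weights l\<close> the numbers \<open>2 * l\<close>, \<open>l + m\<close> and \<open>l - m\<close> are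
  natural, so that rounding below is exact.\<close>

definition wigner_psi :: "real \<Rightarrow> real \<Rightarrow> complex \<Rightarrow> complex \<Rightarrow> complex" where
  "wigner_psi l m z\<^sub>0 z\<^sub>1 =
     complex_of_real (sqrt (real (nat \<lfloor>2 * l\<rfloor> choose nat \<lfloor>l + m\<rfloor>)))
       * z\<^sub>0 ^ nat \<lfloor>l + m\<rfloor> * z\<^sub>1 ^ nat \<lfloor>l - m\<rfloor>"

text \<open>The family chosen below exists, because the right-hand side is a homogeneous polynomial of degree
  \<open>2 * l\<close> in \<open>z\<^sub>0\<close>, \<open>z\<^sub>1\<close>, and its values at \<open>m \<in> weights l\<close> are unique, because the \<open>wigner_psi l m\<close>
  are linearly independent. For \<open>g = su2_mat \<alpha> \<beta>\<close> the entries \<open>g $ 1 $ 1\<close> and \<open>g $ 2 $ 1\<close> are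
  \<open>\<alpha>\<close> and \<open>\<beta>\<close>.\<close>

definition wigner_D :: "real \<Rightarrow> real \<Rightarrow> real \<Rightarrow> complex^2^2 \<Rightarrow> complex" where
  "wigner_D l m s g =
     (SOME D. \<forall>z\<^sub>0 z\<^sub>1. (\<Sum>m\<in>weights l. wigner_psi l m z\<^sub>0 z\<^sub>1 * D m) =
        wigner_psi l s (cnj (g $ 1 $ 1) * z\<^sub>0 + cnj (g $ 2 $ 1) * z\<^sub>1)
                       (- (g $ 2 $ 1) * z\<^sub>0 + (g $ 1 $ 1) * z\<^sub>1)) m"

definition wigner_phi :: "real \<Rightarrow> real \<Rightarrow> real \<Rightarrow> complex^2^2 \<Rightarrow> complex" where
  "wigner_phi l m s g = complex_of_real (sqrt (2 * l + 1) / (4 * pi)) * wigner_D l m s g"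

definition random_field :: "'w measure \<Rightarrow> ('w \<Rightarrow> complex^2^2 \<Rightarrow> complex) \<Rightarrow> bool" where
  "random_field M X \<longleftrightarrow> (\<lambda>(\<omega>, g). X \<omega> g) \<in> borel_measurable (M \<Otimes>\<^sub>M su2_vol)"

definition square_integrable_field :: "'w measure \<Rightarrow> ('w \<Rightarrow> complex^2^2 \<Rightarrow> complex) \<Rightarrow> bool" where
  "square_integrable_field M X \<longleftrightarrow>
     random_field M X \<and> (AE \<omega> in M. integrable su2_vol (\<lambda>g. (cmod (X \<omega> g))\<^sup>2))"

definition wigner_partial_sum ::
    "(real \<Rightarrow> real \<Rightarrow> real \<Rightarrow> 'w \<Rightarrow> complex) \<Rightarrow> nat \<Rightarrow> 'w \<Rightarrow> complex^2^2 \<Rightarrow> complex" where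
  "wigner_partial_sum a N \<omega> g =
     (\<Sum>l | l \<in> half_nats \<and> l \<le> real N / 2.
        \<Sum>m\<in>weights l. \<Sum>s\<in>weights l. a l m s \<omega> * wigner_phi l m s g)"

text \<open>Meaning of \<open>X = (\<Sum>l m s. a l m s * wigner_phi l m s)\<close>. Almost surely the series converges to
  \<open>X \<omega>\<close> in \<open>L\<^sup>2\<close>, so \<open>X \<omega>\<close> is determined only up to null sets of \<open>SU2\<close>. The second clause fixes
  the version of the field: its value at a point where the series converges almost surely is the sum of
  the series there. Every expansion in the sense of the first clause has such a version, and without it
  pointwise properties (finite-dimensional laws) would not be determined by the coefficients.\<close>

definition has_wigner_expansion ::
    "'w measure \<Rightarrow> ('w \<Rightarrow> complex^2^2 \<Rightarrow> complex) \<Rightarrow> (real \<Rightarrow> real \<Rightarrow> real \<Rightarrow> 'w \<Rightarrow> complex) \<Rightarrow> bool" where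
  "has_wigner_expansion M X a \<longleftrightarrow>
     (AE \<omega> in M.
        (\<lambda>N. \<integral>g. (cmod (X \<omega> g - wigner_partial_sum a N \<omega> g))\<^sup>2 \<partial>su2_vol) \<longlonglongrightarrow> 0) \<and>
     (\<forall>g\<in>SU2. (AE \<omega> in M. convergent (\<lambda>N. wigner_partial_sum a N \<omega> g)) \<longrightarrow>
        (AE \<omega> in M. (\<lambda>N. wigner_partial_sum a N \<omega> g) \<longlonglongrightarrow> X \<omega> g))"

text \<open>The law of a field on the product \<open>\<sigma>\<close>-algebra; two fields have the same law iff they have the same
  finite-dimensional distributions.\<close>

definition field_law ::
    "'w measure \<Rightarrow> ('w \<Rightarrow> complex^2^2 \<Rightarrow> complex) \<Rightarrow> (complex^2^2 \<Rightarrow> complex) measure" where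
  "field_law M X = distr M (Pi\<^sub>M SU2 (\<lambda>_. borel)) (\<lambda>\<omega>. \<lambda>x\<in>SU2. X \<omega> x)"

definition bi_invariant :: "'w measure \<Rightarrow> ('w \<Rightarrow> complex^2^2 \<Rightarrow> complex) \<Rightarrow> bool" where
  "bi_invariant M X \<longleftrightarrow>
     (\<forall>g\<in>SU2. \<forall>g'\<in>SU2. field_law M (\<lambda>\<omega> x. X \<omega> (matrix_inv g ** x ** g')) = field_law M X)"

definition centrally_symmetric :: "'w measure \<Rightarrow> ('w \<Rightarrow> complex) \<Rightarrow> bool" where
  "centrally_symmetric M a \<longleftrightarrow> distr M borel (\<lambda>\<omega>. - a \<omega>) = distr M borel a"

text \<open>Gaussian variables and vectors may be degenerate.\<close>

definition real_gaussian :: "'w measure \<Rightarrow> ('w \<Rightarrow> real) \<Rightarrow> bool" where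
  "real_gaussian M Y \<longleftrightarrow> Y \<in> borel_measurable M \<and>
     (\<exists>\<mu> \<sigma>. (\<sigma> = 0 \<and> (AE \<omega> in M. Y \<omega> = \<mu>)) \<or>
            (\<sigma> > 0 \<and> distributed M lborel Y (\<lambda>x. ennreal (normal_density \<mu> \<sigma> x))))"

definition complex_gaussian :: "'w measure \<Rightarrow> ('w \<Rightarrow> complex) \<Rightarrow> bool" where
  "complex_gaussian M a \<longleftrightarrow> a \<in> borel_measurable M \<and>
     (\<forall>u v. real_gaussian M (\<lambda>\<omega>. u * Re (a \<omega>) + v * Im (a \<omega>))) \<and>
     (\<integral>\<omega>. a \<omega> \<partial>M) = 0 \<and>
     (\<forall>\<theta>. distr M borel (\<lambda>\<omega>. cis \<theta> * a \<omega>) = distr M borel a)"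

definition complex_gaussian_field :: "'w measure \<Rightarrow> ('w \<Rightarrow> complex^2^2 \<Rightarrow> complex) \<Rightarrow> bool" where
  "complex_gaussian_field M X \<longleftrightarrow>
     (\<forall>J c. finite J \<and> J \<subseteq> SU2 \<longrightarrow> complex_gaussian M (\<lambda>\<omega>. \<Sum>g\<in>J. c g * X \<omega> g))"

text \<open>Valued in \<open>ennreal\<close>, so that an infinite variance is not read as 0.\<close>

definition complex_variance :: "'w measure \<Rightarrow> ('w \<Rightarrow> complex) \<Rightarrow> ennreal" where
  "complex_variance M a = (\<integral>\<^sup>+\<omega>. ennreal ((cmod (a \<omega> - (\<integral>\<omega>'. a \<omega>' \<partial>M)))\<^sup>2) \<partial>M)"

end

theory Submission
  imports Defs "HOL-Computational_Algebra.Polynomial" "HOL-Real_Asymp.Real_Asymp"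
begin

text \<open>If \<open>X\<close> is bi-invariant, then every row and, after conjugation, every column of the coefficients of degree
  \<open>l\<close> is a vector of independent symmetric variables whose law is invariant under the Wigner matrices
  \<open>D\<close>. After convolution with a Gaussian these variables have smooth positive densities, and the
  logarithms \<open>\<phi> k\<close> of the densities satisfy \<open>(\<Sum>k. \<phi> k ((D t) k)) = (\<Sum>k. \<phi> k (t k))\<close>. Differentiation along
  one-parameter subgroups couples neighbouring indices and forces every \<open>\<phi> k\<close> to be the same multiple of the
  squared norm, so the coefficients are Gaussian with a variance depending only on \<open>l\<close>. For \<open>l = 0\<close> the
  representation is trivial, which is why \<open>a 0 0 0\<close> is Gaussian by hypothesis.

  The coefficients are integrals of the field, whereas its law only gives access to finitely many points; the
  integrals are recovered as limits of empirical means over random sample points. In the opposite direction,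
  \<open>L\<^sup>2\<close> convergence gives almost sure convergence at almost every point of the group along a subsequence, and
  translation by a generic group element carries the Gaussian property to every finite set of points.

  If the coefficients are Gaussian with variances depending only on \<open>l\<close>, then convergence in law at one generic
  point makes the variances of the terms of the series summable. By Kolmogorov's theorem the series converges almost
  surely at every point, and unitarity of \<open>D\<close> makes the characteristic functions of the finite-dimensional
  laws invariant.\<close>

section \<open>The group and its volume\<close>

text \<open>The Gaussian kernel avoids both problems: its convolution with any law is positive and
  differentiable, and since it depends only on distances, a unitary matrix acting on the random
  vector can be moved to the argument of the density. The smoothing is undone by dividing Fourier
  transforms, where the Gaussian factor has no zeros. Central symmetry makes the gradient of each
  smoothed density vanish at 0; a derivative of the functional equation, tested on a vector with two
  nonzero entries, then sees just the two corresponding densities. For the same lack of moments,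
  limits over the probability space are taken with bounded functionals: the kernel
  \<open>gk\<close>, characteristic functions, or a distance truncated by \<open>min 1\<close>. A
  row of coefficients gives a rate that could depend on the row, a column one that could depend on
  the column; every column meets row 0, so a single rate is left for each degree.\<close>

lemma su2_mat_nth [simp]:
  "su2_mat a b $ 1 $ 1 = a" "su2_mat a b $ 2 $ 1 = b"
  "su2_mat a b $ 1 $ 2 = - cnj b" "su2_mat a b $ 2 $ 2 = cnj a"
  by (simp_all add: su2_mat_def)

lemma su2_mat_eqI:
  assumes "x $ 1 $ 1 = a" "x $ 2 $ 1 = b" "x $ 1 $ 2 = - cnj b" "x $ 2 $ 2 = cnj a"
  shows "x = su2_mat a b"
  using assms by (simp add: vec_eq_iff forall_2)

lemma su2_mat_mult: "su2_mat a b ** su2_mat c d = su2_mat (a * c - cnj b * d) (b * c + cnj a * d)"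
  by (rule su2_mat_eqI) (simp_all add: matrix_matrix_mult_def sum_2)

lemma su2_mat_1: "su2_mat 1 0 = mat 1"
  by (rule su2_mat_eqI[symmetric]) (simp_all add: mat_def)

lemma SU2E:
  assumes "g \<in> SU2"
  obtains a b where "g = su2_mat a b" "a * cnj a + b * cnj b = 1"
proof -
  obtain a b where *: "g = su2_mat a b" "(cmod a)\<^sup>2 + (cmod b)\<^sup>2 = 1"
    using assms by (auto simp: SU2_def)
  have "a * cnj a + b * cnj b = of_real ((cmod a)\<^sup>2 + (cmod b)\<^sup>2)"
    by (simp only: complex_norm_square of_real_add)
  with * that show ?thesis by simp
qed

lemma su2_mat_in_SU2_iff: "su2_mat a b \<in> SU2 \<longleftrightarrow> (cmod a)\<^sup>2 + (cmod b)\<^sup>2 = 1"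
proof -
  have "a = c \<and> b = d" if "su2_mat a b = su2_mat c d" for c d
    using that by (metis su2_mat_nth(1,2))
  then show ?thesis by (auto simp: SU2_def)
qed

lemma su2_mat_in_SU2: "a * cnj a + b * cnj b = 1 \<Longrightarrow> su2_mat a b \<in> SU2"
  unfolding su2_mat_in_SU2_iff
  by (simp only: complex_norm_square[symmetric] of_real_add[symmetric] of_real_eq_1_iff)

lemma SU2_mult: "g \<in> SU2 \<Longrightarrow> h \<in> SU2 \<Longrightarrow> g ** h \<in> SU2"
proof (elim SU2E)
  fix a b c d assume *: "g = su2_mat a b" "h = su2_mat c d" and 1: "a * cnj a + b * cnj b = 1"
    and 2: "c * cnj c + d * cnj d = 1"
  have "(a * c - cnj b * d) * cnj (a * c - cnj b * d) + (b * c + cnj a * d) * cnj (b * c + cnj a * d)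
    = (a * cnj a + b * cnj b) * (c * cnj c + d * cnj d)"
    by (simp add: algebra_simps)
  then show ?thesis using 1 2 unfolding * su2_mat_mult by (intro su2_mat_in_SU2) simp
qed

lemma one_in_SU2: "mat 1 \<in> SU2"
  unfolding su2_mat_1[symmetric] by (intro su2_mat_in_SU2) simp

lemma su2_mat_mult_inv:
  assumes "a * cnj a + b * cnj b = 1"
  shows "su2_mat a b ** su2_mat (cnj a) (- b) = mat 1" "su2_mat (cnj a) (- b) ** su2_mat a b = mat 1"
proof -
  have "a * cnj a - cnj b * - b = 1" "cnj a * a - cnj (- b) * b = 1"
    "b * cnj a + cnj a * - b = 0" "- b * a + cnj (cnj a) * b = 0"
    using assms
    by (simp_all add: mult.commute[of "cnj a" a] mult.commute[of "cnj b" b] mult.commute[of b "cnj a"] mult.commute[of b a])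
  then show "su2_mat a b ** su2_mat (cnj a) (- b) = mat 1" "su2_mat (cnj a) (- b) ** su2_mat a b = mat 1"
    by (simp_all only: su2_mat_mult su2_mat_1)
qed

lemma SU2_inv:
  assumes "a * cnj a + b * cnj b = 1"
  shows "matrix_inv (su2_mat a b) = su2_mat (cnj a) (- b)"
proof -
  have eq: "su2_mat a b ** su2_mat (cnj a) (- b) = mat 1" "su2_mat (cnj a) (- b) ** su2_mat a b = mat 1"
    by (rule su2_mat_mult_inv[OF assms])+
  \<comment> \<open>\<open>matrix_inv\<close> is a Hilbert choice among two-sided inverses, so the
    explicit formula needs uniqueness of the inverse.\<close>
  have uniq: "B = su2_mat (cnj a) (- b)" if "su2_mat a b ** B = mat 1" for B
  proof -
    have "B = (su2_mat (cnj a) (- b) ** su2_mat a b) ** B" by (simp only: eq matrix_mul_lid)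
    also have "\<dots> = su2_mat (cnj a) (- b)" by (simp only: that matrix_mul_assoc[symmetric] matrix_mul_rid)
    finally show ?thesis .
  qed
  show ?thesis
    unfolding matrix_inv_def by (rule some_equality) (simp add: eq, erule conjE, erule uniq)
qed

lemma SU2_matrix_inv: "g \<in> SU2 \<Longrightarrow> matrix_inv g \<in> SU2"
  by (elim SU2E) (simp add: SU2_inv su2_mat_in_SU2 mult.commute)

lemma SU2_inv_mult:
  assumes "g \<in> SU2"
  shows "matrix_inv g ** g = mat 1" "g ** matrix_inv g = mat 1"
proof -
  obtain a b where ab: "g = su2_mat a b" "a * cnj a + b * cnj b = 1" using assms by (rule SU2E)
  show "matrix_inv g ** g = mat 1" "g ** matrix_inv g = mat 1"
    unfolding ab(1) SU2_inv[OF ab(2)] by (rule su2_mat_mult_inv[OF ab(2)])+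
qed

lemma SU2_inv_mult_cancel:
  assumes "g \<in> SU2"
  shows "matrix_inv g ** (g ** x) = x" "g ** (matrix_inv g ** x) = x"
    "(x ** g) ** matrix_inv g = x" "(x ** matrix_inv g) ** g = x"
  using SU2_inv_mult[OF assms] by (metis matrix_mul_assoc matrix_mul_lid matrix_mul_rid)+

lemma continuous_su2_mat [continuous_intros]:
  assumes "continuous_on S f" "continuous_on S h"
  shows "continuous_on S (\<lambda>x. su2_mat (f x) (h x))"
proof -
  have *: "su2_mat (f x) (h x) = (\<chi> i. \<chi> j. if i = 1 then (if j = 1 then f x else - cnj (h x))
      else (if j = 1 then h x else cnj (f x)))" for x
    by (rule su2_mat_eqI[symmetric]) simp_all
  have "continuous_on S (\<lambda>x. if i = (1::2) then (if j = (1::2) then f x else - cnj (h x))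
      else (if j = 1 then h x else cnj (f x)))" for i j
    using assms by (cases "i = 1"; cases "j = 1") (auto intro!: continuous_intros)
  then show ?thesis unfolding * by (intro continuous_on_vec_lambda)
qed

lemma continuous_matrix_mult [continuous_intros]:
  fixes f h :: "'a::topological_space \<Rightarrow> complex^2^2"
  assumes "continuous_on S f" "continuous_on S h"
  shows "continuous_on S (\<lambda>x. f x ** h x)"
  unfolding matrix_matrix_mult_def using assms
  by (intro continuous_on_vec_lambda continuous_intros continuous_on_component)

lemma measurable_su2_volI:
  assumes "continuous_on SU2 f" "\<And>x. x \<in> SU2 \<Longrightarrow> f x \<in> SU2"
  shows "f \<in> su2_vol \<rightarrow>\<^sub>M su2_vol"
proof -
  have "f \<in> restrict_space borel SU2 \<rightarrow>\<^sub>M restrict_space borel SU2"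
    using assms by (intro measurable_restrict_space2 borel_measurable_continuous_on_restrict)
      (auto simp: space_restrict_space)
  then show ?thesis by (simp add: measurable_cong_sets[OF sets_su2_vol sets_su2_vol])
qed

lemma borel_measurable_su2_volI:
  assumes "continuous_on SU2 f"
  shows "f \<in> borel_measurable su2_vol"
  using borel_measurable_continuous_on_restrict[OF assms]
  by (simp add: measurable_cong_sets[OF sets_su2_vol refl])

section \<open>Lebesgue measure under shears\<close>

lemma emeasure_pair_lborel:
  assumes "A \<in> sets borel"
  shows "emeasure (lborel :: ('a::euclidean_space \<times> 'b::euclidean_space) measure) A
    = (\<integral>\<^sup>+x. emeasure lborel (Pair x -` A) \<partial>lborel)"
    "emeasure (lborel :: ('a::euclidean_space \<times> 'b::euclidean_space) measure) A
    = (\<integral>\<^sup>+y. emeasure lborel ((\<lambda>x. (x, y)) -` A) \<partial>lborel)"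
proof -
  have A: "A \<in> sets (lborel \<Otimes>\<^sub>M lborel :: ('a \<times> 'b) measure)"
    using assms unfolding lborel_prod by simp
  show "emeasure lborel A = (\<integral>\<^sup>+x. emeasure lborel (Pair x -` A) \<partial>lborel)"
    using lborel.emeasure_pair_measure_alt[OF A] by (simp add: lborel_prod)
  show "emeasure lborel A = (\<integral>\<^sup>+y. emeasure lborel ((\<lambda>x. (x, y)) -` A) \<partial>lborel)"
    using lborel_pair.emeasure_pair_measure_alt2[OF A] by (simp add: lborel_prod)
qed

lemma emeasure_lborel_translate:
  fixes A :: "'a::euclidean_space set"
  assumes "A \<in> sets borel"
  shows "emeasure lborel ((\<lambda>y. y + c) -` A) = emeasure lborel A"
proof -
  have "emeasure lborel A = emeasure (distr lborel borel ((+) c)) A" by (simp add: lborel_distr_plus)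
  also have "\<dots> = emeasure lborel ((\<lambda>y. y + c) -` A)"
  proof -
    have "(\<lambda>y. y + c) = (+) c" by (simp add: fun_eq_iff add.commute)
    then show ?thesis using assms by (subst emeasure_distr) simp_all
  qed
  finally show ?thesis ..
qed

lemma sets_borel_Pair_vimage:
  fixes A :: "('a::second_countable_topology \<times> 'b::second_countable_topology) set"
  assumes A: "A \<in> sets borel"
  shows "Pair x -` A \<in> sets borel" "(\<lambda>x. (x, y)) -` A \<in> sets borel"
proof -
  have "A \<in> sets (borel \<Otimes>\<^sub>M borel :: ('a \<times> 'b) measure)"
    using A unfolding borel_prod .
  from sets_Pair1[OF this] sets_Pair2[OF this]
  show "Pair x -` A \<in> sets borel" "(\<lambda>x. (x, y)) -` A \<in> sets borel" by auto
qed

lemma borel_measurable_fst_snd [measurable]: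
  "(fst :: 'a::topological_space \<times> 'b::topological_space \<Rightarrow> 'a) \<in> borel_measurable borel"
  "(snd :: 'a::topological_space \<times> 'b::topological_space \<Rightarrow> 'b) \<in> borel_measurable borel"
  by (auto intro!: borel_measurable_continuous_onI continuous_intros)

lemma emeasure_shear_snd:
  fixes f :: "'a::euclidean_space \<Rightarrow> 'b::euclidean_space"
  assumes f [measurable]: "f \<in> borel_measurable borel" and A: "A \<in> sets borel"
  shows "emeasure lborel ((\<lambda>z. (fst z, snd z + f (fst z))) -` A) = emeasure lborel A"
proof -
  have "(\<lambda>z. (fst z, snd z + f (fst z))) -` A \<in> sets borel"
    by (intro measurable_sets_borel[OF _ A] borel_measurable_Pair) simp_all
  then show ?thesis
    using emeasure_lborel_translate[OF sets_borel_Pair_vimage(1)[OF A]]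
    by (simp add: emeasure_pair_lborel(1) A vimage_def)
qed

lemma emeasure_shear_fst:
  fixes f :: "'b::euclidean_space \<Rightarrow> 'a::euclidean_space"
  assumes f [measurable]: "f \<in> borel_measurable borel" and A: "A \<in> sets borel"
  shows "emeasure lborel ((\<lambda>z. (fst z + f (snd z), snd z)) -` A) = emeasure lborel A"
proof -
  have "(\<lambda>z. (fst z + f (snd z), snd z)) -` A \<in> sets borel"
    by (intro measurable_sets_borel[OF _ A] borel_measurable_Pair) simp_all
  then show ?thesis
    using emeasure_lborel_translate[OF sets_borel_Pair_vimage(2)[OF A]]
    by (simp add: emeasure_pair_lborel(2) A vimage_def)
qed

text \<open>Phrased through preimages, so that invariance composes without inverses or
  images.\<close>

definition lebesgue_invariant :: "('a::euclidean_space \<Rightarrow> 'a) \<Rightarrow> bool" where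
  "lebesgue_invariant T \<longleftrightarrow> T \<in> borel_measurable borel \<and>
     (\<forall>A\<in>sets borel. emeasure lborel (T -` A) = emeasure lborel A)"

lemma lebesgue_invariant_comp:
  assumes "lebesgue_invariant S" "lebesgue_invariant T"
  shows "lebesgue_invariant (\<lambda>z. S (T z))"
proof -
  have [measurable]: "S \<in> borel_measurable borel" "T \<in> borel_measurable borel"
    using assms by (auto simp: lebesgue_invariant_def)
  have "emeasure lborel ((\<lambda>z. S (T z)) -` A) = emeasure lborel A" if A: "A \<in> sets borel" for A
  proof -
    have "S -` A \<in> sets borel" by (rule measurable_sets_borel[OF _ A]) measurable
    then have "emeasure lborel (T -` (S -` A)) = emeasure lborel (S -` A)"
      using assms(2) by (simp add: lebesgue_invariant_def)
    then show ?thesis using assms(1) A by (simp add: lebesgue_invariant_def vimage_def)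
  qed
  then show ?thesis by (simp add: lebesgue_invariant_def)
qed

lemma lebesgue_invariant_shear:
  "f \<in> borel_measurable borel \<Longrightarrow> lebesgue_invariant (\<lambda>z. (fst z, snd z + f (fst z)))"
  "f' \<in> borel_measurable borel \<Longrightarrow> lebesgue_invariant (\<lambda>z. (fst z + f' (snd z), snd z))"
  by (simp_all add: lebesgue_invariant_def emeasure_shear_snd emeasure_shear_fst)

text \<open>A group element is determined by its first column; this is left multiplication read on
  first columns, extended to all of C^2.\<close>

definition su2_lmul :: "complex \<Rightarrow> complex \<Rightarrow> complex \<times> complex \<Rightarrow> complex \<times> complex" where
  "su2_lmul a b z = (a * fst z - cnj b * snd z, b * fst z + cnj a * snd z)"

text \<open>Right multiplication on first columns. It involves conjugates of the coordinates, so it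
  is only real linear.\<close>

definition su2_rmul :: "complex \<Rightarrow> complex \<Rightarrow> complex \<times> complex \<Rightarrow> complex \<times> complex" where
  "su2_rmul c d z = (fst z * c - cnj (snd z) * d, snd z * c + cnj (fst z) * d)"

text \<open>A matrix of determinant 1 with nonzero lower left entry is a product of three shears, and
  shears preserve Lebesgue measure by Fubini and translation invariance. The two multiplications
  are of this kind, the right one after conjugation of the second coordinate.\<close>

lemma lebesgue_invariant_lmul:
  assumes "a * cnj a + b * cnj b = 1"
  shows "lebesgue_invariant (su2_lmul a b)"
proof -
  have 1: "lebesgue_invariant (su2_lmul a b)" if "a * cnj a + b * cnj b = 1" "b \<noteq> 0" for a b
  proof -
    define S T where "S k z = (fst z + k * snd z, snd z)" and "T k z = (fst z, snd z + k * fst z)" for k :: complex and z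
have "su2_lmul a b z = S ((a - 1) / b) (T b (S ((cnj a - 1) / b) z))" for z
    proof -
      have "fst z + (cnj a - 1) / b * snd z + (a - 1) / b *
          (snd z + b * (fst z + (cnj a - 1) / b * snd z))
        = a * fst z + ((a - 1) + (cnj a - 1) + (a - 1) * (cnj a - 1)) / b * snd z"
        using that(2) by (simp add: divide_simps) (simp add: algebra_simps)
      \<comment> \<open>The numerator is \<open>a * cnj a - 1\<close>, which is
        \<open>- b * cnj b\<close> on the group; this is what makes the three shears reproduce the
        upper right entry.\<close>
      also have "(a - 1) + (cnj a - 1) + (a - 1) * (cnj a - 1) = - b * cnj b"
        using that by (simp add: algebra_simps)
      finally show ?thesis using that(2) by (simp add: S_def T_def su2_lmul_def distrib_left right_diff_distrib)
        (simp add: algebra_simps)?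
    qed
    then have eq: "su2_lmul a b = (\<lambda>z. S ((a - 1) / b) (T b (S ((cnj a - 1) / b) z)))" by blast
    have inv: "lebesgue_invariant (S k)" "lebesgue_invariant (T k)" for k
      unfolding S_def[abs_def] T_def[abs_def]
      by (intro lebesgue_invariant_shear borel_measurable_continuous_onI continuous_intros)+
    show ?thesis unfolding eq
      by (rule lebesgue_invariant_comp[OF inv(1) lebesgue_invariant_comp[OF inv(2) inv(1)]])
  qed
  show ?thesis
  proof (cases "b = 0")
    case True
    \<comment> \<open>A diagonal element has lower left entry 0, so the factorisation above would
      divide by 0. It is a product of two antidiagonal elements, to which the factorisation
      applies.\<close>
    then have eq: "su2_lmul a b = (\<lambda>z. su2_lmul 0 1 (su2_lmul 0 (- a) z))"
      by (auto simp: su2_lmul_def)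
    moreover have "a \<noteq> 0" using assms True by auto
    ultimately show ?thesis using assms True
      by (auto intro!: lebesgue_invariant_comp[of "su2_lmul 0 1"] 1)
  qed (use 1 assms in auto)
qed

lemma lebesgue_invariant_rmul:
  assumes "c * cnj c + d * cnj d = 1"
  shows "lebesgue_invariant (su2_rmul c d)"
proof -
  have 1: "lebesgue_invariant (su2_rmul c d)" if *: "c * cnj c + d * cnj d = 1" "d \<noteq> 0" for c d
  proof -
    define S T where "S k z = (fst z + k * cnj (snd z), snd z)" and "T k z = (fst z, snd z + k * cnj (fst z))" for k :: complex and z
    have "su2_rmul c d z = S ((c - 1) / cnj d) (T d (S ((cnj c - 1) / cnj d) z))" for z
    proof -
      have 2: "d * cnj ((cnj c - 1) / cnj d) = c - 1" using * by simp
      have "fst z + (cnj c - 1) / cnj d * cnj (snd z) + (c - 1) / cnj d *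
          cnj (snd z + d * cnj (fst z + (cnj c - 1) / cnj d * cnj (snd z)))
        = c * fst z + ((c - 1) + (cnj c - 1) + (c - 1) * (cnj c - 1)) / cnj d * cnj (snd z)"
        using that(2) by (simp add: divide_simps) (simp add: algebra_simps)
      also have "(c - 1) + (cnj c - 1) + (c - 1) * (cnj c - 1) = - d * cnj d"
        using * by (simp add: algebra_simps)
      finally show ?thesis using that(2) by (simp add: S_def T_def su2_rmul_def distrib_left right_diff_distrib)
        (simp add: algebra_simps)?
    qed
    then have eq: "su2_rmul c d = (\<lambda>z. S ((c - 1) / cnj d) (T d (S ((cnj c - 1) / cnj d) z)))" by blast
    have inv: "lebesgue_invariant (S k)" "lebesgue_invariant (T k)" for k
      unfolding S_def[abs_def] T_def[abs_def]
      by (intro lebesgue_invariant_shear borel_measurable_continuous_onI continuous_intros)+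
    show ?thesis unfolding eq
      by (rule lebesgue_invariant_comp[OF inv(1) lebesgue_invariant_comp[OF inv(2) inv(1)]])
  qed
  show ?thesis
  proof (cases "d = 0")
    case True
    then have eq: "su2_rmul c d = (\<lambda>z. su2_rmul 0 1 (su2_rmul 0 (- cnj c) z))"
      by (auto simp: su2_rmul_def)
    moreover have "c \<noteq> 0" using assms True by auto
    ultimately show ?thesis using assms True
      by (auto intro!: lebesgue_invariant_comp[of "su2_rmul 0 1"] 1 simp: mult.commute)
  qed (use 1 assms in auto)
qed

section \<open>Invariance of the volume\<close>

lemma norm_su2_mul:
  assumes "a * cnj a + b * cnj b = 1"
  shows "norm (su2_lmul a b z) = norm z" "norm (su2_rmul a b z) = norm z"
proof -
  have n: "complex_of_real ((norm w)\<^sup>2) = fst w * cnj (fst w) + snd w * cnj (snd w)"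
    for w :: "complex \<times> complex"
    by (simp add: norm_prod_def complex_norm_square del: of_real_power)
  have "complex_of_real ((norm (su2_lmul a b z))\<^sup>2)
    = (a * cnj a + b * cnj b) * complex_of_real ((norm z)\<^sup>2)"
    unfolding n by (simp add: su2_lmul_def algebra_simps)
  moreover have "complex_of_real ((norm (su2_rmul a b z))\<^sup>2)
    = (a * cnj a + b * cnj b) * complex_of_real ((norm z)\<^sup>2)"
    unfolding n by (simp add: su2_rmul_def algebra_simps)
  ultimately show "norm (su2_lmul a b z) = norm z" "norm (su2_rmul a b z) = norm z"
    using assms by (simp_all add: of_real_eq_iff del: of_real_power)
qed

text \<open>The radial projection of the cone construction in \<open>su2_vol\<close>. It carries
  \<open>su2_lmul\<close> and \<open>su2_rmul\<close> to multiplication in the group.\<close>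

definition su2_proj :: "complex \<times> complex \<Rightarrow> complex^2^2" where
  "su2_proj z = su2_mat (fst z /\<^sub>R norm z) (snd z /\<^sub>R norm z)"

lemma su2_proj_in_SU2: "z \<noteq> 0 \<Longrightarrow> su2_proj z \<in> SU2"
  unfolding su2_proj_def su2_mat_in_SU2_iff
proof -
  assume "z \<noteq> 0"
  have "(norm z)\<^sup>2 = (cmod (fst z))\<^sup>2 + (cmod (snd z))\<^sup>2" by (simp add: norm_prod_def)
  then show "(cmod (fst z /\<^sub>R norm z))\<^sup>2 + (cmod (snd z /\<^sub>R norm z))\<^sup>2 = 1"
    using \<open>z \<noteq> 0\<close> by (simp add: power_mult_distrib power_inverse flip: distrib_left)
      (metis left_inverse norm_eq_zero power_not_zero)
qed

lemma su2_proj_mul: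
  assumes "a * cnj a + b * cnj b = 1"
  shows "su2_mat a b ** su2_proj z = su2_proj (su2_lmul a b z)"
    "su2_proj z ** su2_mat a b = su2_proj (su2_rmul a b z)"
  by (simp_all add: su2_proj_def su2_mat_mult norm_su2_mul[OF assms])
    (simp_all add: su2_lmul_def su2_rmul_def scaleR_diff_right scaleR_add_right)

abbreviation "punctured_ball \<equiv> ball (0 :: complex \<times> complex) 1 - {0}"

lemma measurable_su2_proj [measurable]:
  "su2_proj \<in> restrict_space borel punctured_ball \<rightarrow>\<^sub>M su2_vol"
proof -
  have "continuous_on punctured_ball su2_proj"
    unfolding su2_proj_def by (auto intro!: continuous_intros)
  then have "su2_proj \<in> restrict_space borel punctured_ball \<rightarrow>\<^sub>M restrict_space borel SU2"
    by (intro measurable_restrict_space2 borel_measurable_continuous_on_restrict)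
      (auto simp: space_restrict_space su2_proj_in_SU2)
  then show ?thesis by (simp add: measurable_cong_sets[OF refl sets_su2_vol])
qed

lemma emeasure_su2_vol:
  assumes A: "A \<in> sets su2_vol"
  shows "emeasure su2_vol A = 32 * emeasure lborel {z \<in> punctured_ball. su2_proj z \<in> A}"
    and "{z \<in> punctured_ball. su2_proj z \<in> A} \<in> sets borel"
proof -
  let ?\<mu> = "scale_measure 32 (restrict_space lborel punctured_ball)"
  have [simp]: "space (restrict_space lborel punctured_ball) = punctured_ball"
    by (simp add: space_restrict_space)
  have m: "su2_proj \<in> ?\<mu> \<rightarrow>\<^sub>M restrict_space borel SU2"
  proof -
    have "su2_proj \<in> restrict_space borel punctured_ball \<rightarrow>\<^sub>M restrict_space borel SU2"
      using measurable_su2_proj by (simp add: measurable_cong_sets[OF refl sets_su2_vol])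
    then show ?thesis
      by (subst measurable_cong_sets[where M' = "restrict_space borel punctured_ball"])
        (simp_all add: sets_restrict_space)
  qed
  have eq: "su2_vol = distr ?\<mu> (restrict_space borel SU2) su2_proj"
    by (simp add: su2_vol_def su2_proj_def[abs_def])
  have v: "su2_proj -` A \<inter> punctured_ball = {z \<in> punctured_ball. su2_proj z \<in> A}" by auto
  have A': "A \<in> sets (restrict_space borel SU2)" using A by (simp add: sets_su2_vol)
  have "su2_proj -` A \<inter> space ?\<mu> \<in> sets ?\<mu>" using measurable_sets[OF m A'] .
  then show *: "{z \<in> punctured_ball. su2_proj z \<in> A} \<in> sets borel"
    unfolding v[symmetric] by (simp add: sets_restrict_space_iff space_scale_measure)
  show "emeasure su2_vol A = 32 * emeasure lborel {z \<in> punctured_ball. su2_proj z \<in> A}"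
    unfolding eq
    unfolding v[symmetric]
    by (subst emeasure_distr[OF m A']) (simp add: space_scale_measure emeasure_restrict_space)
qed

text \<open>Multiplication lifts along the radial projection to a map preserving both the norm and
  Lebesgue measure, so the cone over a preimage is the preimage of the cone.\<close>

lemma su2_vol_invariant:
  assumes g: "g \<in> SU2"
  shows "distr su2_vol su2_vol (\<lambda>x. g ** x) = su2_vol"
    and "distr su2_vol su2_vol (\<lambda>x. x ** g) = su2_vol"
proof -
  have *: "distr su2_vol su2_vol f = su2_vol"
    if f: "continuous_on SU2 f" "\<And>x. x \<in> SU2 \<Longrightarrow> f x \<in> SU2"
      and L: "lebesgue_invariant L" "\<And>z. norm (L z) = norm z" "\<And>z. f (su2_proj z) = su2_proj (L z)" for f L
  proof (rule measure_eqI)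
    fix A assume "A \<in> sets (distr su2_vol su2_vol f)"
    then have A: "A \<in> sets su2_vol" by simp
    have L0: "L z = 0 \<longleftrightarrow> z = 0" for z using L(2)[of z] by (metis norm_eq_zero)
    have m: "f \<in> su2_vol \<rightarrow>\<^sub>M su2_vol" using f by (rule measurable_su2_volI)
    have B: "f -` A \<inter> space su2_vol \<in> sets su2_vol" using measurable_sets[OF m A] .
    have "emeasure (distr su2_vol su2_vol f) A = emeasure su2_vol (f -` A \<inter> space su2_vol)"
      using m A by (rule emeasure_distr)
    also have "\<dots> = 32 * emeasure lborel {z \<in> punctured_ball. su2_proj z \<in> f -` A \<inter> space su2_vol}"
      by (rule emeasure_su2_vol[OF B])
    also have "{z \<in> punctured_ball. su2_proj z \<in> f -` A \<inter> space su2_vol}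
      = L -` {z \<in> punctured_ball. su2_proj z \<in> A}"
      using L0 by (auto simp: L(2,3) su2_proj_in_SU2)
    also have "emeasure lborel \<dots> = emeasure lborel {z \<in> punctured_ball. su2_proj z \<in> A}"
      using L(1) emeasure_su2_vol(2)[OF A] unfolding lebesgue_invariant_def by blast
    also have "32 * \<dots> = emeasure su2_vol A" by (rule emeasure_su2_vol(1)[OF A, symmetric])
    finally show "emeasure (distr su2_vol su2_vol f) A = emeasure su2_vol A" .
  qed simp
  obtain a b where ab: "g = su2_mat a b" "a * cnj a + b * cnj b = 1" using g by (rule SU2E)
  show "distr su2_vol su2_vol (\<lambda>x. g ** x) = su2_vol"
    using g by (intro *[where L = "su2_lmul a b"] lebesgue_invariant_lmul)
      (auto simp: ab su2_proj_mul norm_su2_mul intro!: continuous_intros SU2_mult)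
  show "distr su2_vol su2_vol (\<lambda>x. x ** g) = su2_vol"
    using g by (intro *[where L = "su2_rmul a b"] lebesgue_invariant_rmul)
      (auto simp: ab su2_proj_mul norm_su2_mul intro!: continuous_intros SU2_mult)
qed

text \<open>Positivity and finiteness of the total mass suffice for passing to the normalised
  measure; its exact value is not computed.\<close>

lemma emeasure_su2_vol_space: "0 < emeasure su2_vol SU2" "emeasure su2_vol SU2 < \<infinity>"
proof -
  have eq: "{z \<in> punctured_ball. su2_proj z \<in> SU2} = punctured_ball"
    by (auto simp: su2_proj_in_SU2)
  have e: "emeasure su2_vol SU2 = 32 * emeasure lborel punctured_ball"
    using emeasure_su2_vol(1)[OF sets.top] unfolding space_su2_vol eq .
  have "emeasure lborel punctured_ball = emeasure lborel (ball (0 :: complex \<times> complex) 1)"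
    by (subst emeasure_Diff) auto
  moreover have "0 < emeasure lborel (ball (0 :: complex \<times> complex) 1)"
    using content_ball_pos[of 1 "0 :: complex \<times> complex"]
    by (simp add: measure_def enn2real_positive_iff)
  moreover have "emeasure lborel (ball (0 :: complex \<times> complex) 1) < \<infinity>"
    using emeasure_bounded_finite[of "ball (0 :: complex \<times> complex) 1"] by simp
  ultimately show "0 < emeasure su2_vol SU2" "emeasure su2_vol SU2 < \<infinity>"
    by (auto simp: e ennreal_mult_less_top ennreal_zero_less_mult_iff)
qed

section \<open>Normalised Haar measure\<close>

definition su2_prob :: "(complex^2^2) measure" where
  "su2_prob = density su2_vol (\<lambda>_. ennreal (1 / measure su2_vol SU2))"

lemma measure_su2_vol_pos: "0 < measure su2_vol SU2"
  using emeasure_su2_vol_space by (simp add: measure_def enn2real_positive_iff)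

lemma space_su2_prob [simp]: "space su2_prob = SU2"
  by (simp add: su2_prob_def)

lemma sets_su2_prob [measurable_cong, simp]: "sets su2_prob = sets su2_vol"
  by (simp add: su2_prob_def)

lemma prob_space_su2_prob: "prob_space su2_prob"
proof
  have "emeasure su2_prob (space su2_prob) = ennreal (1 / measure su2_vol SU2) * emeasure su2_vol SU2"
    using sets.top[of su2_vol] by (simp add: su2_prob_def emeasure_density nn_integral_cmult)
  also have "emeasure su2_vol SU2 = ennreal (measure su2_vol SU2)"
    using emeasure_su2_vol_space by (intro emeasure_eq_ennreal_measure) auto
  also have "ennreal (1 / measure su2_vol SU2) * \<dots> = 1"
    using measure_su2_vol_pos by (simp flip: ennreal_mult)
  finally show "emeasure su2_prob (space su2_prob) = 1" .
qed

interpretation su2: prob_space su2_prob by (rule prob_space_su2_prob)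

lemma integrable_su2_prob:
  fixes f :: "complex^2^2 \<Rightarrow> 'b :: {banach, second_countable_topology}"
  shows "integrable su2_prob f \<longleftrightarrow> integrable su2_vol f"
proof -
  have "integrable su2_prob f \<longleftrightarrow> integrable su2_vol (\<lambda>x. (1 / measure su2_vol SU2) *\<^sub>R f x)"
    if "f \<in> borel_measurable su2_vol"
    unfolding su2_prob_def using that by (intro integrable_density) auto
  moreover have "f \<in> borel_measurable su2_vol" if "integrable su2_prob f"
    using borel_measurable_integrable[OF that] by simp
  moreover have "integrable su2_vol (\<lambda>x. (1 / measure su2_vol SU2) *\<^sub>R f x) \<longleftrightarrow> integrable su2_vol f"
    using measure_su2_vol_pos integrable_scaleR_right[of "measure su2_vol SU2" su2_vol "\<lambda>x. (1 / measure su2_vol SU2) *\<^sub>R f x"]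
    by auto
  ultimately show ?thesis using borel_measurable_integrable by blast
qed

lemma integral_su2_prob:
  fixes f :: "complex^2^2 \<Rightarrow> real"
  assumes "f \<in> borel_measurable su2_vol"
  shows "integral\<^sup>L su2_prob f = integral\<^sup>L su2_vol f / measure su2_vol SU2"
  using assms unfolding su2_prob_def by (subst integral_density) auto

lemma measurable_su2_mult [measurable]:
  "g \<in> SU2 \<Longrightarrow> (\<lambda>x. g ** x) \<in> su2_prob \<rightarrow>\<^sub>M su2_prob"
  "g \<in> SU2 \<Longrightarrow> (\<lambda>x. x ** g) \<in> su2_prob \<rightarrow>\<^sub>M su2_prob"
proof -
  assume g: "g \<in> SU2"
  have "(\<lambda>x. g ** x) \<in> su2_vol \<rightarrow>\<^sub>M su2_vol" "(\<lambda>x. x ** g) \<in> su2_vol \<rightarrow>\<^sub>M su2_vol"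
    using g by (auto intro!: measurable_su2_volI SU2_mult continuous_matrix_mult continuous_on_const continuous_on_id)
  then show "(\<lambda>x. g ** x) \<in> su2_prob \<rightarrow>\<^sub>M su2_prob" "(\<lambda>x. x ** g) \<in> su2_prob \<rightarrow>\<^sub>M su2_prob"
    by (simp_all cong: measurable_cong_sets)
qed

lemma su2_prob_invariant:
  assumes g: "g \<in> SU2"
  shows "distr su2_prob su2_prob (\<lambda>x. g ** x) = su2_prob"
    and "distr su2_prob su2_prob (\<lambda>x. x ** g) = su2_prob"
proof -
  let ?c = "\<lambda>_ :: complex^2^2. ennreal (1 / measure su2_vol SU2)"
  have *: "distr su2_prob su2_prob f = su2_prob"
    if "f \<in> su2_prob \<rightarrow>\<^sub>M su2_prob" "distr su2_vol su2_vol f = su2_vol" for f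
  proof -
    have f: "f \<in> su2_vol \<rightarrow>\<^sub>M su2_vol" using that(1) by (simp cong: measurable_cong_sets)
    have "distr su2_prob su2_prob f = distr (density su2_vol (\<lambda>x. ?c (f x))) su2_vol f"
      by (intro distr_cong) (auto simp: su2_prob_def)
    also have "\<dots> = density (distr su2_vol su2_vol f) ?c"
      using f by (intro density_distr[symmetric]) auto
    finally show ?thesis by (simp add: that su2_prob_def)
  qed
  show "distr su2_prob su2_prob (\<lambda>x. g ** x) = su2_prob" "distr su2_prob su2_prob (\<lambda>x. x ** g) = su2_prob"
    using g by (intro * su2_vol_invariant measurable_su2_mult; assumption)+
qed

lemma integral_su2_prob_invariant:
  fixes f :: "complex^2^2 \<Rightarrow> 'b :: {banach, second_countable_topology}"
  assumes g: "g \<in> SU2" and f: "f \<in> borel_measurable su2_prob"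
  shows "(\<integral>x. f (g ** x) \<partial>su2_prob) = integral\<^sup>L su2_prob f"
    "(\<integral>x. f (x ** g) \<partial>su2_prob) = integral\<^sup>L su2_prob f"
  using integral_distr[OF measurable_su2_mult(1)[OF g] f]
    integral_distr[OF measurable_su2_mult(2)[OF g] f]
  by (simp_all add: su2_prob_invariant[OF g])

text \<open>Finitely many prescribed points can thus be moved by one generic translation to points
  where an almost sure property holds.\<close>

lemma AE_su2_prob_invariant:
  assumes g: "g \<in> SU2" and P: "AE x in su2_prob. P x"
  shows "AE x in su2_prob. P (g ** x)" "AE x in su2_prob. P (x ** g)"
proof -
  show "AE x in su2_prob. P (g ** x)"
    by (rule AE_distrD[OF measurable_su2_mult(1)[OF g]], unfold su2_prob_invariant[OF g], rule P)
  show "AE x in su2_prob. P (x ** g)"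
    by (rule AE_distrD[OF measurable_su2_mult(2)[OF g]], unfold su2_prob_invariant[OF g], rule P)
qed

lemma compact_SU2: "compact SU2"
proof -
  have "compact {z :: complex \<times> complex. norm z = 1}"
    using compact_sphere[of "0 :: complex \<times> complex" 1] by (simp add: sphere_def dist_norm norm_minus_commute)
  then have "compact ((\<lambda>z. su2_mat (fst z) (snd z)) ` {z. norm z = 1})"
    by (intro compact_continuous_image continuous_intros)
  also have "(\<lambda>z. su2_mat (fst z) (snd z)) ` {z. norm z = 1} = SU2"
    by (auto simp: SU2_def norm_prod_def image_def)
  finally show ?thesis .
qed

lemma integrable_su2_continuous:
  fixes f :: "complex^2^2 \<Rightarrow> complex"
  assumes "continuous_on SU2 f"
  shows "integrable su2_prob f"
proof -
  obtain B where "\<And>x. x \<in> SU2 \<Longrightarrow> norm (f x) \<le> B"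
    using compact_imp_bounded[OF compact_continuous_image[OF assms compact_SU2]]
    by (auto simp: bounded_iff)
  then show ?thesis
    using borel_measurable_su2_volI[OF assms]
    by (intro su2.integrable_const_bound[where B = B]) auto
qed

section \<open>Wigner matrices\<close>

definition bc :: "nat \<Rightarrow> nat \<Rightarrow> complex" where
  "bc n j = complex_of_real (sqrt (real (n choose j)))"

text \<open>On the group this is the inverse of \<open>g\<close> acting on C^2. It reverses
  products, which makes \<open>wD\<close> preserve them.\<close>

definition su2_act :: "complex^2^2 \<Rightarrow> complex \<times> complex \<Rightarrow> complex \<times> complex" where
  "su2_act g z = (cnj (g $ 1 $ 1) * fst z + cnj (g $ 2 $ 1) * snd z, - (g $ 2 $ 1) * fst z + (g $ 1 $ 1) * snd z)"

definition wmon :: "nat \<Rightarrow> nat \<Rightarrow> complex \<times> complex \<Rightarrow> complex" where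
  "wmon n j z = bc n j * fst z ^ j * snd z ^ (n - j)"

text \<open>Reindexing by natural numbers: \<open>n = 2 * l\<close>, \<open>j = l + m\<close>, \<open>k = l + s\<close>.\<close>

definition wD :: "nat \<Rightarrow> nat \<Rightarrow> nat \<Rightarrow> complex^2^2 \<Rightarrow> complex" where
  "wD n j k g = wigner_D (real n / 2) (real j - real n / 2) (real k - real n / 2) g"

lemma bc_nonzero [simp]: "j \<le> n \<Longrightarrow> bc n j \<noteq> 0"
  by (simp add: bc_def)

lemma bc_square: "bc n j * bc n j = of_nat (n choose j)"
proof -
  have "bc n j * bc n j = complex_of_real (sqrt (real (n choose j)) * sqrt (real (n choose j)))"
    unfolding bc_def by (rule of_real_mult[symmetric])
  then show ?thesis by simp
qed

lemma cnj_bc [simp]: "cnj (bc n j) = bc n j"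
  by (simp add: bc_def)

lemma weights_half: "weights (real n / 2) = (\<lambda>j. real j - real n / 2) ` {..n}"
  by (auto simp: weights_def image_def)

lemma sum_weights_half: "(\<Sum>m\<in>weights (real n / 2). f m) = (\<Sum>j\<le>n. f (real j - real n / 2))"
  unfolding weights_half by (subst sum.reindex) (auto simp: inj_on_def)

lemma wigner_psi_half:
  assumes "j \<le> n"
  shows "wigner_psi (real n / 2) (real j - real n / 2) z0 z1 = wmon n j (z0, z1)"
proof -
  have "\<lfloor>real n / 2 - (real j - real n / 2)\<rfloor> = int (n - j)"
  proof -
    have "real n / 2 - (real j - real n / 2) = of_int (int (n - j))" using assms by (simp add: of_nat_diff)
    then show ?thesis by (metis floor_of_int)
  qed
  then show ?thesis by (simp add: wigner_psi_def wmon_def bc_def)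
qed

section \<open>Existence and uniqueness of the matrix entries\<close>

lemma wmon_coeffs_unique:
  assumes "\<And>z. (\<Sum>j\<le>n. wmon n j z * x j) = (\<Sum>j\<le>n. wmon n j z * y j)" and "j \<le> n"
  shows "x j = y j"
proof -
  \<comment> \<open>At \<open>snd z = 1\<close> the identity is one between polynomials in a single
    variable, and the factors \<open>bc n j\<close> do not vanish.\<close>
  have "\<forall>z. (\<Sum>j\<le>n. (bc n j * (x j - y j)) * z ^ j) = 0"
  proof
    fix z
    show "(\<Sum>j\<le>n. (bc n j * (x j - y j)) * z ^ j) = 0"
      using assms(1)[of "(z, 1)"] by (simp add: wmon_def algebra_simps sum_subtractf)
  qed
  then have "bc n j * (x j - y j) = 0" using \<open>j \<le> n\<close> unfolding polyfun_eq_0 by blast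
  then show ?thesis using \<open>j \<le> n\<close> by simp
qed

text \<open>Homogenisation to degree \<open>n\<close>, so that forms in two variables can be handled
  through the coefficients of a polynomial in one.\<close>

definition hom_poly :: "nat \<Rightarrow> complex poly \<Rightarrow> complex \<times> complex \<Rightarrow> complex" where
  "hom_poly n p z = (\<Sum>i\<le>n. coeff p i * fst z ^ i * snd z ^ (n - i))"

lemma hom_poly_mult_linear:
  assumes "degree p \<le> n"
  shows "hom_poly (Suc n) ([:y, x:] * p) z = (x * fst z + y * snd z) * hom_poly n p z"
    and "degree ([:y, x:] * p) \<le> Suc n"
proof -
  have c: "coeff ([:y, x:] * p) i = y * coeff p i + (case i of 0 \<Rightarrow> 0 | Suc i' \<Rightarrow> x * coeff p i')" for i
    by (cases i) (simp_all add: mult_pCons_left)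
  have "hom_poly (Suc n) ([:y, x:] * p) z
    = (\<Sum>i\<le>Suc n. y * coeff p i * fst z ^ i * snd z ^ (Suc n - i))
      + (\<Sum>i\<le>Suc n. (case i of 0 \<Rightarrow> 0 | Suc i' \<Rightarrow> x * coeff p i') * fst z ^ i * snd z ^ (Suc n - i))"
    unfolding hom_poly_def c by (simp only: distrib_right sum.distrib)
  also have "(\<Sum>i\<le>Suc n. y * coeff p i * fst z ^ i * snd z ^ (Suc n - i)) = y * snd z * hom_poly n p z"
  proof -
    \<comment> \<open>The sum runs one degree further than \<open>hom_poly n p\<close>; the degree
      bound makes the extra term 0.\<close>
    have "coeff p (Suc n) = 0" using assms by (simp add: coeff_eq_0)
    then show ?thesis
      by (auto simp: hom_poly_def sum_distrib_left Suc_diff_le intro!: sum.cong)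
  qed
  also have "(\<Sum>i\<le>Suc n. (case i of 0 \<Rightarrow> 0 | Suc i' \<Rightarrow> x * coeff p i') * fst z ^ i * snd z ^ (Suc n - i))
    = x * fst z * hom_poly n p z"
    unfolding sum.atMost_Suc_shift by (auto simp: hom_poly_def sum_distrib_left intro!: sum.cong)
  finally show "hom_poly (Suc n) ([:y, x:] * p) z = (x * fst z + y * snd z) * hom_poly n p z"
    by (simp add: algebra_simps)
  show "degree ([:y, x:] * p) \<le> Suc n"
    using degree_mult_le[of "[:y, x:]" p] assms by (simp split: if_splits)
qed

text \<open>The form on the right of the defining equation of \<open>wigner_D\<close>, without its
  binomial factor and dehomogenised at \<open>snd z = 1\<close>.\<close>

definition wpoly :: "nat \<Rightarrow> nat \<Rightarrow> complex \<Rightarrow> complex \<Rightarrow> complex poly" where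
  "wpoly i j a b = [:cnj b, cnj a:] ^ i * [:a, - b:] ^ j"

lemma hom_poly_wpoly:
  "hom_poly (i + j) (wpoly i j a b) z = (cnj a * fst z + cnj b * snd z) ^ i * (- b * fst z + a * snd z) ^ j
   \<and> degree (wpoly i j a b) \<le> i + j"
proof (induction i)
  case 0
  show ?case
  proof (induction j)
    case (Suc j)
    have eq: "wpoly 0 (Suc j) a b = [:a, - b:] * wpoly 0 j a b" by (simp add: wpoly_def)
    show ?case using Suc hom_poly_mult_linear[of "wpoly 0 j a b" j a "- b"]
      unfolding eq by (simp add: mult.commute)
  qed (simp add: wpoly_def hom_poly_def)
next
  case (Suc i)
  have eq: "wpoly (Suc i) j a b = [:cnj b, cnj a:] * wpoly i j a b" by (simp only: wpoly_def power_Suc mult.assoc)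
  show ?case using Suc hom_poly_mult_linear[of "wpoly i j a b" "i + j" "cnj b" "cnj a"]
    unfolding eq by (simp add: mult.assoc)
qed

text \<open>\<open>wigner_D\<close> is a Hilbert choice. The coefficients of \<open>wpoly\<close>
  provide a family that satisfies the equation, hence the chosen one satisfies it too.\<close>

lemma wD_expand:
  assumes "k \<le> n"
  shows "(\<Sum>j\<le>n. wmon n j z * wD n j k g) = wmon n k (su2_act g z)"
proof -
  let ?P = "\<lambda>D. \<forall>z\<^sub>0 z\<^sub>1. (\<Sum>m\<in>weights (real n / 2). wigner_psi (real n / 2) m z\<^sub>0 z\<^sub>1 * D m) =
        wigner_psi (real n / 2) (real k - real n / 2) (cnj (g $ 1 $ 1) * z\<^sub>0 + cnj (g $ 2 $ 1) * z\<^sub>1)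
                       (- (g $ 2 $ 1) * z\<^sub>0 + (g $ 1 $ 1) * z\<^sub>1)"
  have P_iff: "?P D \<longleftrightarrow> (\<forall>z. (\<Sum>j\<le>n. wmon n j z * D (real j - real n / 2)) = wmon n k (su2_act g z))" for D
    using assms by (simp add: sum_weights_half wigner_psi_half su2_act_def)
  define p where "p = wpoly k (n - k) (g $ 1 $ 1) (g $ 2 $ 1)"
  \<comment> \<open>The quotient of binomial roots converts plain monomials into normalised ones,
    and \<open>nat \<lfloor>m + real n / 2\<rfloor>\<close> recovers the natural index from the
    weight \<open>m\<close>.\<close>
  define D where "D m = bc n k / bc n (nat \<lfloor>m + real n / 2\<rfloor>) * coeff p (nat \<lfloor>m + real n / 2\<rfloor>)" for m
  have "?P D"
    unfolding P_iff D_def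
  proof
    fix z
    have "(\<Sum>j\<le>n. wmon n j z * (bc n k / bc n j * coeff p j)) = bc n k * hom_poly n p z"
      unfolding hom_poly_def sum_distrib_left by (intro sum.cong) (auto simp: wmon_def)
    also have "hom_poly n p z = (cnj (g $ 1 $ 1) * fst z + cnj (g $ 2 $ 1) * snd z) ^ k * (- (g $ 2 $ 1) * fst z + (g $ 1 $ 1) * snd z) ^ (n - k)"
      using hom_poly_wpoly[of k "n - k"] assms by (simp add: p_def)
    finally show "(\<Sum>j\<le>n. wmon n j z * (bc n k / bc n (nat \<lfloor>real j - real n / 2 + real n / 2\<rfloor>) * coeff p (nat \<lfloor>real j - real n / 2 + real n / 2\<rfloor>))) = wmon n k (su2_act g z)"
      by (simp add: wmon_def su2_act_def)
  qed
  then have "\<exists>D. ?P D" by (rule exI[of ?P D])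
  then have "?P (SOME D. ?P D)" by (rule someI_ex)
  then show ?thesis unfolding wD_def wigner_D_def by (rule P_iff[THEN iffD1, THEN spec])
qed

lemma wD_unique:
  assumes "k \<le> n" "\<And>z. (\<Sum>j\<le>n. wmon n j z * x j) = wmon n k (su2_act g z)" "j \<le> n"
  shows "wD n j k g = x j"
  by (rule wmon_coeffs_unique[of n "\<lambda>j. wD n j k g"]) (use assms wD_expand in auto)

lemma wD_explicit:
  assumes "k \<le> n" "j \<le> n"
  shows "wD n j k g = bc n k / bc n j * coeff (wpoly k (n - k) (g $ 1 $ 1) (g $ 2 $ 1)) j"
proof (rule wD_unique[OF assms(1) _ assms(2)])
  fix z
  let ?p = "wpoly k (n - k) (g $ 1 $ 1) (g $ 2 $ 1)"
  have "(\<Sum>j\<le>n. wmon n j z * (bc n k / bc n j * coeff ?p j)) = bc n k * hom_poly n ?p z"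
    unfolding hom_poly_def sum_distrib_left by (intro sum.cong) (auto simp: wmon_def)
  then show "(\<Sum>j\<le>n. wmon n j z * (bc n k / bc n j * coeff ?p j)) = wmon n k (su2_act g z)"
    using hom_poly_wpoly[of k "n - k"] assms by (simp add: wmon_def su2_act_def)
qed

section \<open>Homomorphism property and unitarity\<close>

lemma su2_act_mult:
  assumes "g \<in> SU2" "h \<in> SU2"
  shows "su2_act (g ** h) z = su2_act h (su2_act g z)"
  using assms by (elim SU2E) (simp add: su2_mat_mult su2_act_def algebra_simps)

text \<open>Expanding first for \<open>h\<close> and then for \<open>g\<close> writes the same form
  with the product entries as coefficients, and coefficients are unique.\<close>

lemma wD_mult:
  assumes "g \<in> SU2" "h \<in> SU2" "j \<le> n" "k \<le> n"
  shows "wD n j k (g ** h) = (\<Sum>l\<le>n. wD n j l g * wD n l k h)"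
proof (rule wD_unique)
  fix z
  have "wmon n k (su2_act (g ** h) z) = (\<Sum>l\<le>n. wmon n l (su2_act g z) * wD n l k h)"
    using assms by (simp add: su2_act_mult wD_expand)
  also have "\<dots> = (\<Sum>l\<le>n. \<Sum>j\<le>n. wmon n j z * wD n j l g * wD n l k h)"
    by (intro sum.cong refl) (simp add: wD_expand[symmetric] sum_distrib_right)
  also have "\<dots> = (\<Sum>j\<le>n. wmon n j z * (\<Sum>l\<le>n. wD n j l g * wD n l k h))"
    by (subst sum.swap) (simp add: sum_distrib_left mult.assoc)
  finally show "(\<Sum>j\<le>n. wmon n j z * (\<Sum>l\<le>n. wD n j l g * wD n l k h)) = wmon n k (su2_act (g ** h) z)" ..
qed (use assms in auto)

lemma sum_delta_atMost [simp]:
  fixes f :: "nat \<Rightarrow> 'a::semiring_1"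
  shows "(\<Sum>j\<le>n. f j * (if j = k then 1 else 0)) = (if k \<le> n then f k else 0)"
    "(\<Sum>j\<le>n. f j * (if k = j then 1 else 0)) = (if k \<le> n then f k else 0)"
    "(\<Sum>j\<le>n. (if j = k then 1 else 0) * f j) = (if k \<le> n then f k else 0)"
    "(\<Sum>j\<le>n. (if k = j then 1 else 0) * f j) = (if k \<le> n then f k else 0)"
  by (simp_all add: if_distrib[of "\<lambda>x. _ * x"] if_distrib[of "\<lambda>x. x * _"] cong: if_cong)

text \<open>The diagonal torus acts on monomials by characters; for unimodular \<open>a\<close> the
  exponent is the weight \<open>n - 2 * k\<close>.\<close>

lemma wD_diag:
  assumes "j \<le> n" "k \<le> n"
  shows "wD n j k (su2_mat a 0) = cnj a ^ k * a ^ (n - k) * (if j = k then 1 else 0)"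
proof (rule wD_unique)
  fix z
  have "(\<Sum>j\<le>n. wmon n j z * (cnj a ^ k * a ^ (n - k) * (if j = k then 1 else 0))) = wmon n k z * (cnj a ^ k * a ^ (n - k))"
    using assms by (simp add: mult.assoc[symmetric])
  also have "\<dots> = wmon n k (su2_act (su2_mat a 0) z)"
    by (simp add: su2_act_def wmon_def power_mult_distrib)
  finally show "(\<Sum>j\<le>n. wmon n j z * (cnj a ^ k * a ^ (n - k) * (if j = k then 1 else 0))) = wmon n k (su2_act (su2_mat a 0) z)" .
qed (use assms in auto)

lemma wD_1: "j \<le> n \<Longrightarrow> k \<le> n \<Longrightarrow> wD n j k (mat 1) = (if j = k then 1 else 0)"
  using wD_diag[of j n k 1] by (simp add: su2_mat_1)

text \<open>The last column expands a pure power, so the binomial theorem gives it in closed form.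
  Its entries can all be nonzero at once, which takes the place of irreducibility in the
  orthogonality proof.\<close>

lemma wD_last:
  assumes "j \<le> n"
  shows "wD n j n g = bc n j * cnj (g $ 1 $ 1) ^ j * cnj (g $ 2 $ 1) ^ (n - j)"
proof (rule wD_unique)
  fix z
  show "(\<Sum>j\<le>n. wmon n j z * (bc n j * cnj (g $ 1 $ 1) ^ j * cnj (g $ 2 $ 1) ^ (n - j))) = wmon n n (su2_act g z)"
  proof -
    have "wmon n j z * (bc n j * cnj (g $ 1 $ 1) ^ j * cnj (g $ 2 $ 1) ^ (n - j))
      = of_nat (n choose j) * (cnj (g $ 1 $ 1) * fst z) ^ j * (cnj (g $ 2 $ 1) * snd z) ^ (n - j)" for j
      by (simp add: wmon_def bc_square[symmetric] power_mult_distrib)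
    then show ?thesis
      by (simp add: binomial_ring wmon_def su2_act_def bc_def)
  qed
qed (use assms in auto)

text \<open>The square roots in \<open>bc\<close> are there for this: the reproducing kernel becomes
  a power of the Hermitian form.\<close>

lemma wmon_kernel:
  "(\<Sum>j\<le>n. wmon n j z * cnj (wmon n j w)) = (fst z * cnj (fst w) + snd z * cnj (snd w)) ^ n"
proof -
  have "wmon n j z * cnj (wmon n j w)
    = of_nat (n choose j) * (fst z * cnj (fst w)) ^ j * (snd z * cnj (snd w)) ^ (n - j)" for j
    by (simp add: wmon_def bc_square[symmetric] power_mult_distrib)
  then show ?thesis by (simp add: binomial_ring)
qed

lemma su2_act_inner:
  assumes "g \<in> SU2"
  shows "fst (su2_act g z) * cnj (fst (su2_act g w)) + snd (su2_act g z) * cnj (snd (su2_act g w))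
    = fst z * cnj (fst w) + snd z * cnj (snd w)"
proof -
  obtain a b where ab: "g = su2_mat a b" "a * cnj a + b * cnj b = 1" using assms by (rule SU2E)
  have "fst (su2_act g z) * cnj (fst (su2_act g w)) + snd (su2_act g z) * cnj (snd (su2_act g w))
    = (a * cnj a + b * cnj b) * (fst z * cnj (fst w) + snd z * cnj (snd w))"
    unfolding ab(1) by (simp add: su2_act_def algebra_simps)
  then show ?thesis by (simp add: ab(2))
qed

text \<open>The kernel is invariant because the Hermitian form is. Comparing coefficients in
  \<open>z\<close> and then in \<open>w\<close> turns the invariance into orthonormality of the
  rows.\<close>

lemma wD_unitary:
  assumes g: "g \<in> SU2" and ij: "i \<le> n" "j \<le> n"
  shows "(\<Sum>k\<le>n. wD n i k g * cnj (wD n j k g)) = (if i = j then 1 else 0)"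
proof -
  have 1: "(\<Sum>i\<le>n. wmon n i z * (\<Sum>j\<le>n. cnj (wmon n j w) * (\<Sum>k\<le>n. wD n i k g * cnj (wD n j k g))))
    = (\<Sum>i\<le>n. wmon n i z * cnj (wmon n i w))" for z w
  proof -
    have "(\<Sum>i\<le>n. wmon n i z * cnj (wmon n i w))
      = (\<Sum>k\<le>n. wmon n k (su2_act g z) * cnj (wmon n k (su2_act g w)))"
      unfolding wmon_kernel su2_act_inner[OF g] ..
    also have "\<dots> = (\<Sum>k\<le>n. (\<Sum>i\<le>n. wmon n i z * wD n i k g) * cnj (\<Sum>j\<le>n. wmon n j w * wD n j k g))"
      by (intro sum.cong) (simp_all add: wD_expand)
    also have "\<dots> = (\<Sum>k\<le>n. \<Sum>i\<le>n. \<Sum>j\<le>n. wmon n i z * (cnj (wmon n j w) * (wD n i k g * cnj (wD n j k g))))"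
      by (simp add: sum_product mult_ac)
    also have "\<dots> = (\<Sum>i\<le>n. \<Sum>j\<le>n. \<Sum>k\<le>n. wmon n i z * (cnj (wmon n j w) * (wD n i k g * cnj (wD n j k g))))"
      by (rule trans[OF sum.swap]) (intro sum.cong refl sum.swap)
    finally show ?thesis by (simp add: sum_distrib_left)
  qed
  have 2: "(\<Sum>j\<le>n. cnj (wmon n j w) * (\<Sum>k\<le>n. wD n i k g * cnj (wD n j k g))) = cnj (wmon n i w)" for w
    by (rule wmon_coeffs_unique[OF 1 ij(1)])
  have "cnj (\<Sum>k\<le>n. wD n i k g * cnj (wD n j k g)) = (if j = i then 1 else 0)"
  proof (rule wmon_coeffs_unique[OF _ ij(2), where y = "\<lambda>j. if j = i then 1 else 0"])
    fix w
    have "(\<Sum>j\<le>n. wmon n j w * cnj (\<Sum>k\<le>n. wD n i k g * cnj (wD n j k g))) = wmon n i w"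
      using arg_cong[OF 2[of w], of cnj] by simp
    then show "(\<Sum>j\<le>n. wmon n j w * cnj (\<Sum>k\<le>n. wD n i k g * cnj (wD n j k g))) = (\<Sum>j\<le>n. wmon n j w * (if j = i then 1 else 0))"
      using ij by simp
  qed
  from arg_cong[OF this, of cnj] show ?thesis by (simp split: if_splits)
qed

lemma wD_inv:
  assumes g: "g \<in> SU2" and jk: "j \<le> n" "k \<le> n"
  shows "wD n j k (matrix_inv g) = cnj (wD n k j g)"
proof -
  \<comment> \<open>Unitarity is inserted as an identity matrix, and multiplicativity then contracts
    the inverse with \<open>g\<close>.\<close>
  have "wD n j k (matrix_inv g) = (\<Sum>l\<le>n. wD n j l (matrix_inv g) * (\<Sum>m\<le>n. wD n l m g * cnj (wD n k m g)))"
    using jk by (simp add: wD_unitary[OF g])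
  also have "\<dots> = (\<Sum>l\<le>n. \<Sum>m\<le>n. wD n j l (matrix_inv g) * wD n l m g * cnj (wD n k m g))"
    by (simp add: sum_distrib_left mult.assoc)
  also have "\<dots> = (\<Sum>m\<le>n. (\<Sum>l\<le>n. wD n j l (matrix_inv g) * wD n l m g) * cnj (wD n k m g))"
    by (subst sum.swap) (simp add: sum_distrib_right)
  also have "\<dots> = (\<Sum>m\<le>n. (if j = m then 1 else 0) * cnj (wD n k m g))"
    using jk g by (intro sum.cong refl) (simp add: wD_mult[symmetric] SU2_matrix_inv SU2_inv_mult wD_1)
  finally show ?thesis using jk by simp
qed

lemma wD_unitary':
  assumes g: "g \<in> SU2" and ij: "i \<le> n" "j \<le> n"
  shows "(\<Sum>k\<le>n. cnj (wD n k i g) * wD n k j g) = (if i = j then 1 else 0)"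
proof -
  have "(\<Sum>k\<le>n. cnj (wD n k i g) * wD n k j g) = (\<Sum>k\<le>n. wD n i k (matrix_inv g) * wD n k j g)"
    using ij g by (intro sum.cong refl) (simp add: wD_inv)
  also have "\<dots> = (if i = j then 1 else 0)"
    using ij g by (simp add: wD_mult[symmetric] SU2_matrix_inv SU2_inv_mult wD_1)
  finally show ?thesis .
qed

lemma norm_wD_le_1:
  assumes g: "g \<in> SU2" and jk: "j \<le> n" "k \<le> n"
  shows "norm (wD n j k g) \<le> 1"
proof -
  have "complex_of_real (\<Sum>k\<le>n. (norm (wD n j k g))\<^sup>2) = 1"
    using wD_unitary[OF g jk(1) jk(1)] by (simp add: complex_norm_square del: of_real_power)
  then have "(\<Sum>k\<le>n. (norm (wD n j k g))\<^sup>2) = 1" by (simp only: of_real_eq_1_iff)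
  moreover have "(norm (wD n j k g))\<^sup>2 \<le> (\<Sum>k\<le>n. (norm (wD n j k g))\<^sup>2)"
    using jk by (intro member_le_sum) auto
  ultimately show ?thesis by (simp add: abs_square_le_1)
qed

text \<open>Every entry is a polynomial in \<open>a\<close>, \<open>b\<close> and their conjugates.
  The induction is kept abstract because it yields both continuity on the group and
  differentiability along paths.\<close>

lemma coeff_wpoly_induct:
  fixes P :: "('x \<Rightarrow> complex) \<Rightarrow> bool" and a b :: "'x \<Rightarrow> complex"
  assumes const: "\<And>c. P (\<lambda>_. c)" and add: "\<And>f h. P f \<Longrightarrow> P h \<Longrightarrow> P (\<lambda>x. f x + h x)"
    and mult: "\<And>f h. P f \<Longrightarrow> P h \<Longrightarrow> P (\<lambda>x. f x * h x)"
    and a: "P a" "P (\<lambda>x. cnj (a x))" and b: "P b" "P (\<lambda>x. cnj (b x))"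
  shows "P (\<lambda>x. coeff (wpoly i j (a x) (b x)) m)"
proof -
  have step: "P (\<lambda>x. coeff ([:y x, w x:] * p x) m)"
    if "P y" "P w" "\<And>m. P (\<lambda>x. coeff (p x) m)" for y w p m
    using that by (cases m) (auto simp: mult_pCons_left intro!: add mult)
  have mb: "P (\<lambda>x. - b x)" using mult[OF const[of "- 1"] b(1)] by simp
  have 1: "P (\<lambda>x. coeff ([:a x, - b x:] ^ j) m)" for m
  proof (induction j arbitrary: m)
    case 0 show ?case by (simp add: const)
  next
    case (Suc j) show ?case unfolding power_Suc by (intro step a mb Suc)
  qed
  show ?thesis
  proof (induction i arbitrary: m)
    case 0 show ?case using 1 by (simp add: wpoly_def)
  next
    case (Suc i) show ?case unfolding wpoly_def power_Suc mult.assoc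
      by (intro step a b Suc[unfolded wpoly_def])
  qed
qed

lemma continuous_wD:
  assumes "j \<le> n" "k \<le> n"
  shows "continuous_on S (wD n j k)"
proof -
  have "continuous_on S (\<lambda>g. coeff (wpoly k (n - k) (g $ 1 $ 1) (g $ 2 $ 1)) j)"
    by (rule coeff_wpoly_induct[where P = "continuous_on S"])
      (auto intro!: continuous_intros continuous_on_component)
  then have "continuous_on S (\<lambda>g. bc n k / bc n j * coeff (wpoly k (n - k) (g $ 1 $ 1) (g $ 2 $ 1)) j)"
    by (intro continuous_intros)
  then show ?thesis
    by (rule continuous_on_eq) (simp add: wD_explicit assms)
qed

section \<open>Orthogonality relations\<close>

lemma integrable_wD_cnj [simp]:
  assumes "j \<le> n" "k \<le> n" "j' \<le> n'" "k' \<le> n'"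
  shows "integrable su2_prob (\<lambda>g. wD n j k g * cnj (wD n' j' k' g))"
  by (intro integrable_su2_continuous continuous_intros continuous_wD assms)

text \<open>For fixed \<open>j\<close> and \<open>j'\<close> the matrix of the integrals below intertwines two Wigner matrices. By the
  diagonal elements it is supported where the weights agree, and comparing the column of index
  \<open>n\<close>, whose entries are monomials, kills it for \<open>n \<noteq> n'\<close> and makes it scalar for \<open>n = n'\<close>.\<close>

definition wD_inner :: "nat \<Rightarrow> nat \<Rightarrow> nat \<Rightarrow> nat \<Rightarrow> nat \<Rightarrow> nat \<Rightarrow> complex" where
  "wD_inner n j k n' j' k' = (\<integral>g. wD n j k g * cnj (wD n' j' k' g) \<partial>su2_prob)"

lemma wD_inner_cnj: "cnj (wD_inner n j k n' j' k') = wD_inner n' j' k' n j k"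
  unfolding wD_inner_def by (subst Bochner_Integration.integral_cnj[symmetric]) (simp add: mult.commute)

lemma integral_double_sum:
  fixes f :: "'i \<Rightarrow> 'j \<Rightarrow> 'a \<Rightarrow> complex"
  assumes "\<And>i j. i \<in> I \<Longrightarrow> j \<in> J \<Longrightarrow> integrable M (f i j)"
  shows "(\<integral>x. (\<Sum>i\<in>I. \<Sum>j\<in>J. c i j * f i j x) \<partial>M) = (\<Sum>i\<in>I. \<Sum>j\<in>J. c i j * (\<integral>x. f i j x \<partial>M))"
proof -
  have "(\<integral>x. (\<Sum>i\<in>I. \<Sum>j\<in>J. c i j * f i j x) \<partial>M) = (\<Sum>i\<in>I. (\<integral>x. (\<Sum>j\<in>J. c i j * f i j x) \<partial>M))"
    using assms by (intro Bochner_Integration.integral_sum Bochner_Integration.integrable_sum integrable_mult_right) auto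
  also have "\<dots> = (\<Sum>i\<in>I. \<Sum>j\<in>J. (\<integral>x. c i j * f i j x \<partial>M))"
    using assms by (intro sum.cong refl Bochner_Integration.integral_sum integrable_mult_right) auto
  finally show ?thesis by simp
qed

lemma wD_inner_left:
  assumes g: "g \<in> SU2" and le: "j \<le> n" "k \<le> n" "j' \<le> n'" "k' \<le> n'"
  shows "wD_inner n j k n' j' k' = (\<Sum>l\<le>n. \<Sum>l'\<le>n'. wD n j l g * cnj (wD n' j' l' g) * wD_inner n l k n' l' k')"
proof -
  have "wD_inner n j k n' j' k' = (\<integral>x. wD n j k (g ** x) * cnj (wD n' j' k' (g ** x)) \<partial>su2_prob)"
    unfolding wD_inner_def using le
    by (intro integral_su2_prob_invariant[symmetric] g borel_measurable_integrable integrable_wD_cnj)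
  also have "\<dots> = (\<integral>x. (\<Sum>l\<le>n. \<Sum>l'\<le>n'. wD n j l g * cnj (wD n' j' l' g) * (wD n l k x * cnj (wD n' l' k' x))) \<partial>su2_prob)"
    using le g by (intro Bochner_Integration.integral_cong refl) (simp add: wD_mult sum_product mult_ac)
  also have "\<dots> = (\<Sum>l\<le>n. \<Sum>l'\<le>n'. wD n j l g * cnj (wD n' j' l' g) * wD_inner n l k n' l' k')"
    unfolding wD_inner_def using le by (intro integral_double_sum integrable_wD_cnj) auto
  finally show ?thesis .
qed

lemma wD_inner_right:
  assumes g: "g \<in> SU2" and le: "j \<le> n" "k \<le> n" "j' \<le> n'" "k' \<le> n'"
  shows "wD_inner n j k n' j' k' = (\<Sum>l\<le>n. \<Sum>l'\<le>n'. wD n l k g * cnj (wD n' l' k' g) * wD_inner n j l n' j' l')"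
proof -
  have "wD_inner n j k n' j' k' = (\<integral>x. wD n j k (x ** g) * cnj (wD n' j' k' (x ** g)) \<partial>su2_prob)"
    unfolding wD_inner_def using le
    by (intro integral_su2_prob_invariant[symmetric] g borel_measurable_integrable integrable_wD_cnj)
  also have "\<dots> = (\<integral>x. (\<Sum>l\<le>n. \<Sum>l'\<le>n'. wD n l k g * cnj (wD n' l' k' g) * (wD n j l x * cnj (wD n' j' l' x))) \<partial>su2_prob)"
    using le g by (intro Bochner_Integration.integral_cong refl) (simp add: wD_mult sum_product mult_ac)
  also have "\<dots> = (\<Sum>l\<le>n. \<Sum>l'\<le>n'. wD n l k g * cnj (wD n' l' k' g) * wD_inner n j l n' j' l')"
    unfolding wD_inner_def using le by (intro integral_double_sum integrable_wD_cnj) auto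
  finally show ?thesis .
qed

text \<open>Right invariance, with the conjugated factor moved to the other side by
  unitarity.\<close>

lemma wD_inner_intertwine:
  assumes g: "g \<in> SU2" and le: "j \<le> n" "k \<le> n" "j' \<le> n'" "m \<le> n'"
  shows "(\<Sum>k'\<le>n'. wD_inner n j k n' j' k' * wD n' m k' g) = (\<Sum>l\<le>n. wD n l k g * wD_inner n j l n' j' m)"
proof -
  have "(\<Sum>k'\<le>n'. wD_inner n j k n' j' k' * wD n' m k' g)
    = (\<Sum>k'\<le>n'. \<Sum>l\<le>n. \<Sum>l'\<le>n'. wD n l k g * wD_inner n j l n' j' l' * (wD n' m k' g * cnj (wD n' l' k' g)))"
  proof (intro sum.cong refl)
    fix k' assume "k' \<in> {..n'}"
    then show "wD_inner n j k n' j' k' * wD n' m k' g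
      = (\<Sum>l\<le>n. \<Sum>l'\<le>n'. wD n l k g * wD_inner n j l n' j' l' * (wD n' m k' g * cnj (wD n' l' k' g)))"
      using le by (subst wD_inner_right[OF g]) (simp_all add: sum_distrib_right mult.assoc, simp add: mult_ac)
  qed
  also have "\<dots> = (\<Sum>l\<le>n. \<Sum>l'\<le>n'. \<Sum>k'\<le>n'. wD n l k g * wD_inner n j l n' j' l' * (wD n' m k' g * cnj (wD n' l' k' g)))"
    by (rule trans[OF sum.swap]) (intro sum.cong refl sum.swap)
  also have "\<dots> = (\<Sum>l\<le>n. \<Sum>l'\<le>n'. wD n l k g * wD_inner n j l n' j' l' * (if m = l' then 1 else 0))"
    using le by (intro sum.cong refl) (simp add: sum_distrib_left[symmetric] wD_unitary[OF g])
  finally show ?thesis using le by simp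
qed

lemma cis_weights_neq:
  assumes "int n - 2 * int k \<noteq> int n' - 2 * int k'" "k \<le> n" "k' \<le> n'"
  obtains t where "cnj (cis t) ^ k * cis t ^ (n - k) * cnj (cnj (cis t) ^ k' * cis t ^ (n' - k')) \<noteq> 1"
proof -
  define d where "d = (int n - 2 * int k) - (int n' - 2 * int k')"
  have d: "d \<noteq> 0" using assms by (simp add: d_def)
  have "cnj (cis t) ^ k * cis t ^ (n - k) * cnj (cnj (cis t) ^ k' * cis t ^ (n' - k')) = cis (real_of_int d * t)" for t
  proof -
    show ?thesis
      unfolding complex_cnj_mult complex_cnj_power complex_cnj_cnj cis_cnj Complex.DeMoivre cis_mult
      using assms(2,3) by (intro arg_cong[of _ _ cis]) (simp add: d_def of_nat_diff algebra_simps)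
  qed
  \<comment> \<open>At this \<open>t\<close> the character takes the value \<open>cis pi\<close>,
    which is -1.\<close>
  moreover have "cis (real_of_int d * (pi / real_of_int d)) \<noteq> 1"
    using d by simp
  ultimately show ?thesis using that[of "pi / real_of_int d"] by simp
qed

lemma wD_inner_eq_0_right:
  assumes "int n - 2 * int k \<noteq> int n' - 2 * int k'" and le: "j \<le> n" "k \<le> n" "j' \<le> n'" "k' \<le> n'"
  shows "wD_inner n j k n' j' k' = 0"
proof -
  obtain t where t: "cnj (cis t) ^ k * cis t ^ (n - k) * cnj (cnj (cis t) ^ k' * cis t ^ (n' - k')) \<noteq> 1"
    using cis_weights_neq[OF assms(1,3,5)] .
  have g: "su2_mat (cis t) 0 \<in> SU2" by (simp add: su2_mat_in_SU2_iff)
  have "wD_inner n j k n' j' k' = (\<Sum>l\<le>n. \<Sum>l'\<le>n'. wD n l k (su2_mat (cis t) 0) * cnj (wD n' l' k' (su2_mat (cis t) 0)) * wD_inner n j l n' j' l')"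
    by (rule wD_inner_right[OF g le])
  also have "\<dots> = (\<Sum>l\<le>n. \<Sum>l'\<le>n'. cnj (cis t) ^ k * cis t ^ (n - k) * cnj (cnj (cis t) ^ k' * cis t ^ (n' - k')) * wD_inner n j l n' j' l' * (if l = k then 1 else 0) * (if l' = k' then 1 else 0))"
    using le by (intro sum.cong refl) (auto simp: wD_diag)
  also have "\<dots> = cnj (cis t) ^ k * cis t ^ (n - k) * cnj (cnj (cis t) ^ k' * cis t ^ (n' - k')) * wD_inner n j k n' j' k'"
    using le by simp
  finally show ?thesis using t by (metis mult_cancel_right2)
qed

lemma wD_inner_eq_0_left:
  assumes "int n - 2 * int j \<noteq> int n' - 2 * int j'" and le: "j \<le> n" "k \<le> n" "j' \<le> n'" "k' \<le> n'"
  shows "wD_inner n j k n' j' k' = 0"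
proof -
  obtain t where t: "cnj (cis t) ^ j * cis t ^ (n - j) * cnj (cnj (cis t) ^ j' * cis t ^ (n' - j')) \<noteq> 1"
    using cis_weights_neq[OF assms(1,2,4)] .
  have g: "su2_mat (cis t) 0 \<in> SU2" by (simp add: su2_mat_in_SU2_iff)
  have "wD_inner n j k n' j' k' = (\<Sum>l\<le>n. \<Sum>l'\<le>n'. wD n j l (su2_mat (cis t) 0) * cnj (wD n' j' l' (su2_mat (cis t) 0)) * wD_inner n l k n' l' k')"
    by (rule wD_inner_left[OF g le])
  also have "\<dots> = (\<Sum>l\<le>n. \<Sum>l'\<le>n'. cnj (cis t) ^ j * cis t ^ (n - j) * cnj (cnj (cis t) ^ j' * cis t ^ (n' - j')) * wD_inner n l k n' l' k' * (if l = j then 1 else 0) * (if l' = j' then 1 else 0))"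
    using le by (intro sum.cong refl) (auto simp: wD_diag)
  also have "\<dots> = cnj (cis t) ^ j * cis t ^ (n - j) * cnj (cnj (cis t) ^ j' * cis t ^ (n' - j')) * wD_inner n j k n' j' k'"
    using le by simp
  finally show ?thesis using t by (metis mult_cancel_right2)
qed

text \<open>Any element whose first column has no zero would do: what counts is that no entry of the
  last column of \<open>wD n\<close> vanishes.\<close>

definition su2_half :: "complex^2^2" where
  "su2_half = su2_mat (complex_of_real (1 / sqrt 2)) (complex_of_real (1 / sqrt 2))"

lemma su2_half: "su2_half \<in> SU2" "j \<le> n \<Longrightarrow> wD n j n su2_half \<noteq> 0"
  by (simp_all add: su2_half_def su2_mat_in_SU2_iff norm_divide power_divide wD_last)

lemma wD_inner_neq_aux:
  assumes "n' < n" and le: "j \<le> n" "k \<le> n" "j' \<le> n'" "k' \<le> n'"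
  shows "wD_inner n j k n' j' k' = 0"
proof (cases "int n - 2 * int k = int n' - 2 * int k'")
  case True
  \<comment> \<open>The index \<open>n\<close> has weight \<open>- n\<close>, while the weights of
    the smaller matrix are at least \<open>- n'\<close>; so every term of the sum is 0.\<close>
  have "0 = (\<Sum>m\<le>n'. wD_inner n j n n' j' m * wD n' k' m su2_half)"
    using le assms(1) by (intro sum.neutral[symmetric]) (auto intro!: wD_inner_eq_0_right)
  also have "\<dots> = (\<Sum>l\<le>n. wD n l n su2_half * wD_inner n j l n' j' k')"
    using le assms(1) by (intro wD_inner_intertwine su2_half) auto
  \<comment> \<open>Among the indices \<open>l\<close> only \<open>k\<close> has the same weight as
    \<open>k'\<close>.\<close>
  also have "\<dots> = (\<Sum>l\<le>n. wD n l n su2_half * wD_inner n j l n' j' k' * (if l = k then 1 else 0))"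
    using le True by (intro sum.cong refl) (auto intro!: wD_inner_eq_0_right)
  also have "\<dots> = wD n k n su2_half * wD_inner n j k n' j' k'" using le by simp
  finally show ?thesis using su2_half(2)[of k n] le by simp
qed (use le wD_inner_eq_0_right in blast)

theorem wD_orthogonal:
  assumes le: "j \<le> n" "k \<le> n" "j' \<le> n'" "k' \<le> n'"
  shows "(\<integral>g. wD n j k g * cnj (wD n' j' k' g) \<partial>su2_prob) = (if n = n' \<and> j = j' \<and> k = k' then 1 / of_nat (n + 1) else 0)"
proof -
  consider "n' < n" | "n < n'" | "n = n'" "j \<noteq> j' \<or> k \<noteq> k'" | "n = n'" "j = j'" "k = k'" by linarith
  then have "wD_inner n j k n' j' k' = (if n = n' \<and> j = j' \<and> k = k' then 1 / of_nat (n + 1) else 0)"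
  proof cases
    case 1 then show ?thesis using le by (simp add: wD_inner_neq_aux)
  next
    case 2
    then have "wD_inner n' j' k' n j k = 0" using le by (simp add: wD_inner_neq_aux)
    then show ?thesis using 2 wD_inner_cnj[of n' j' k' n j k] by simp
  next
    case 3
    then have "wD_inner n j k n' j' k' = 0"
      using le wD_inner_eq_0_left[of n j n' j' k k'] wD_inner_eq_0_right[of n k n' k' j j'] by auto
    with 3 show ?thesis by auto
  next
    case 4
    \<comment> \<open>The intertwining relation at the index \<open>n\<close> has one surviving term
      on each side, both with the nonzero factor \<open>wD n m n su2_half\<close>.\<close>
    have const: "wD_inner n j m n j m = wD_inner n j n n j n" if m: "m \<le> n" for m
    proof -
      have "wD_inner n j n n j n * wD n m n su2_half = (\<Sum>k'\<le>n. wD_inner n j n n j k' * wD n m k' su2_half * (if k' = n then 1 else 0))"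
        by simp
      also have "\<dots> = (\<Sum>k'\<le>n. wD_inner n j n n j k' * wD n m k' su2_half)"
        using le by (intro sum.cong refl) (auto simp: wD_inner_eq_0_right)
      also have "\<dots> = (\<Sum>l\<le>n. wD n l n su2_half * wD_inner n j l n j m)"
        using le m by (intro wD_inner_intertwine su2_half) auto
      also have "\<dots> = (\<Sum>l\<le>n. wD n l n su2_half * wD_inner n j l n j m * (if l = m then 1 else 0))"
        using le m by (intro sum.cong refl) (auto simp: wD_inner_eq_0_right)
      also have "\<dots> = wD n m n su2_half * wD_inner n j m n j m" using m by simp
      finally show ?thesis using su2_half(2)[OF m] by simp
    qed
    \<comment> \<open>Row \<open>j\<close> has norm 1 at every point, so its \<open>n + 1\<close>
      equal squared norms add up to 1; this is the origin of \<open>1 / (n + 1)\<close>.\<close>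
    have "(\<Sum>m\<le>n. wD_inner n j m n j m) = (\<integral>g. (\<Sum>m\<le>n. wD n j m g * cnj (wD n j m g)) \<partial>su2_prob)"
      using le by (simp add: wD_inner_def)
    also have "\<dots> = (\<integral>g. 1 \<partial>su2_prob)"
      using le by (intro Bochner_Integration.integral_cong refl) (simp add: wD_unitary)
    also have "\<dots> = 1" using su2.prob_space by simp
    finally have "(\<Sum>m\<le>n. wD_inner n j m n j m) = 1" .
    moreover have "(\<Sum>m\<le>n. wD_inner n j m n j m) = (\<Sum>m\<le>n. wD_inner n j n n j n)"
      by (intro sum.cong refl const) simp
    ultimately have "of_nat (n + 1) * wD_inner n j n n j n = 1" by simp
    moreover have "(of_nat (n + 1) :: complex) \<noteq> 0" by (simp only: of_nat_eq_0_iff)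
    ultimately have "wD_inner n j n n j n = 1 / of_nat (n + 1)"
      by (metis nonzero_eq_divide_eq mult.commute)
    then show ?thesis using 4 const[OF le(2)] by simp
  qed
  then show ?thesis by (simp add: wD_inner_def)
qed

section \<open>Derivatives along one-parameter subgroups\<close>

definition su2_path :: "complex \<Rightarrow> real \<Rightarrow> complex^2^2" where
  "su2_path u t = su2_mat (complex_of_real (cos t)) (u * complex_of_real (sin t))"

lemma su2_path_in_SU2: "norm u = 1 \<Longrightarrow> su2_path u t \<in> SU2"
  by (simp add: su2_path_def su2_mat_in_SU2_iff norm_mult)

lemma su2_path_0: "su2_path u 0 = mat 1"
  by (simp add: su2_path_def su2_mat_1)

text \<open>For \<open>k \<le> n\<close> this is \<open>sqrt ((k + 1) * (n - k))\<close>, the entry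
  of a ladder operator in the normalised basis; in particular it is 0 at \<open>k = n\<close>. As a
  quotient of binomial roots it cancels directly against \<open>bc\<close>.\<close>

definition ladder :: "nat \<Rightarrow> nat \<Rightarrow> complex" where
  "ladder n k = of_nat (k + 1) * bc n (k + 1) / bc n k"

lemma bc_ladder:
  "k \<le> n \<Longrightarrow> bc n k * ladder n k = of_nat (k + 1) * bc n (k + 1)"
  "k < n \<Longrightarrow> bc n (k + 1) * ladder n k = of_nat (n - k) * bc n k"
proof -
  assume k: "k < n"
  have "(k + 1) * (n choose (k + 1)) = (n - k) * (n choose k)"
    by (simp only: Suc_eq_plus1[symmetric] binomial_absorb_comp binomial_absorption)
  then have "of_nat (k + 1) * (bc n (k + 1) * bc n (k + 1)) = of_nat (n - k) * (bc n k * bc n k)"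
    by (simp only: bc_square of_nat_mult[symmetric])
  then show "bc n (k + 1) * ladder n k = of_nat (n - k) * bc n k"
    using k unfolding ladder_def
    by (simp only: times_divide_eq_right nonzero_divide_eq_eq[OF bc_nonzero[OF less_imp_le[OF k]]])
      (simp only: mult_ac)
qed (simp add: ladder_def)

lemma ladder_pos: "k < n \<Longrightarrow> \<exists>r>0. ladder n k = complex_of_real r"
  by (intro exI[of _ "real (k + 1) * sqrt (real (n choose (k + 1))) / sqrt (real (n choose k))"])
    (simp add: ladder_def bc_def)

text \<open>The generator of \<open>su2_path u\<close> is off-diagonal and combines raising and
  lowering operators, hence only neighbouring indices appear. The entries are differentiable as
  polynomials; the value of the derivative is read off by differentiating the defining expansion and
  comparing coefficients.\<close>

lemma wD_su2_path_derivative: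
  assumes jk: "j \<le> n" "k \<le> n"
  shows "((\<lambda>t. wD n j k (su2_path u t)) has_vector_derivative
    (if j = k + 1 then - ladder n k * u else if k = j + 1 then ladder n j * cnj u else 0)) (at 0)"
proof -
  let ?f = "\<lambda>j t. wD n j k (su2_path u t)"
  define x where "x j = vector_derivative (?f j) (at 0)" for j
  define c d where "c = - ladder n k * u" and "d j = ladder n j * cnj u" for j
  define y where "y j = (if j = k + 1 then c else if k = j + 1 then d j else 0)" for j
  have cs: "(\<lambda>t. complex_of_real (cos t)) differentiable at 0" "(\<lambda>t. complex_of_real (sin t)) differentiable at 0"
  proof -
    have "((\<lambda>t. cos (complex_of_real t)) has_vector_derivative - sin 0) (at 0)"
      "((\<lambda>t. sin (complex_of_real t)) has_vector_derivative cos 0) (at 0)"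
      by (rule has_vector_derivative_real_field, auto intro!: derivative_eq_intros)+
    then show "(\<lambda>t. complex_of_real (cos t)) differentiable at 0" "(\<lambda>t. complex_of_real (sin t)) differentiable at 0"
      unfolding cos_of_real sin_of_real by (auto intro: differentiableI_vector)
  qed
  have D: "(?f j has_vector_derivative x j) (at 0)" if j: "j \<le> n" for j
  proof -
    have "(\<lambda>t. coeff (wpoly k (n - k) (complex_of_real (cos t)) (u * complex_of_real (sin t))) j) differentiable at 0"
      by (rule coeff_wpoly_induct[where P = "\<lambda>f. f differentiable at 0"])
        (simp_all add: cs)
    then have "(\<lambda>t. bc n k / bc n j * coeff (wpoly k (n - k) (complex_of_real (cos t)) (u * complex_of_real (sin t))) j) differentiable at 0"
      by (intro differentiable_mult) simp_all
    moreover have "?f j = (\<lambda>t. bc n k / bc n j * coeff (wpoly k (n - k) (complex_of_real (cos t)) (u * complex_of_real (sin t))) j)"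
      by (simp add: fun_eq_iff wD_explicit[OF jk(2) j] su2_path_def)
    ultimately show ?thesis unfolding x_def by (simp add: vector_derivative_works)
  qed
  have xy: "x j = y j"
  proof (rule wmon_coeffs_unique[OF _ jk(1)])
    fix z
    have 1: "((\<lambda>t. \<Sum>j\<le>n. wmon n j z * ?f j t) has_vector_derivative (\<Sum>j\<le>n. wmon n j z * x j)) (at 0)"
      by (auto intro!: derivative_eq_intros D)
    \<comment> \<open>\<open>h\<close> takes complex arguments, so that the rules for complex
      derivatives apply; the path is its restriction to the real line.\<close>
    define h where "h s = bc n k * (cos s * fst z + cnj u * sin s * snd z) ^ k * (- u * sin s * fst z + cos s * snd z) ^ (n - k)" for s
    have eq: "(\<lambda>t. \<Sum>j\<le>n. wmon n j z * ?f j t) = (\<lambda>t. h (complex_of_real t))"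
      unfolding wD_expand[OF jk(2)]
      by (simp add: wmon_def su2_act_def su2_path_def h_def fun_eq_iff cos_of_real sin_of_real)
    have 2: "(h has_field_derivative (\<Sum>j\<le>n. wmon n j z * y j)) (at (of_real 0))"
    proof -
      have "(\<Sum>j\<le>n. wmon n j z * y j) = (\<Sum>j\<le>n. wmon n j z * c * (if j = k + 1 then 1 else 0))
          + (\<Sum>j\<le>n. wmon n j z * (if k > 0 then d j else 0) * (if j = k - 1 then 1 else 0))"
        unfolding sum.distrib[symmetric] by (intro sum.cong refl) (auto simp: y_def)
      \<comment> \<open>At \<open>k = n\<close> or \<open>k = 0\<close> one of the two neighbours
        does not exist and its term drops out.\<close>
      also have "\<dots> = (if k < n then wmon n (k + 1) z * c else 0) + (if k > 0 then wmon n (k - 1) z * d (k - 1) else 0)"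
        using jk by (auto simp: Suc_le_eq)
      also have "(if k < n then wmon n (k + 1) z * c else 0)
          = bc n k * (fst z ^ k * (of_nat (n - k) * snd z ^ (n - k - 1) * (- u * fst z)))"
      proof (cases "k < n")
        case True
        have "wmon n (k + 1) z * c = - ((bc n (k + 1) * ladder n k) * (fst z ^ (k + 1) * snd z ^ (n - (k + 1)) * u))"
          by (simp add: wmon_def c_def)
        also have "\<dots> = bc n k * (fst z ^ k * (of_nat (n - k) * snd z ^ (n - k - 1) * (- u * fst z)))"
          unfolding bc_ladder(2)[OF True] by simp
        finally show ?thesis using True by simp
      qed (use jk in auto)
      also have "(if k > 0 then wmon n (k - 1) z * d (k - 1) else 0)
          = bc n k * (of_nat k * fst z ^ (k - 1) * (cnj u * snd z) * snd z ^ (n - k))"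
      proof (cases k)
        case (Suc m)
        have "wmon n m z * d m = (bc n m * ladder n m) * (fst z ^ m * snd z ^ (n - m) * cnj u)"
          by (simp add: wmon_def d_def)
        also have "n - m = Suc (n - k)" using Suc jk by simp
        also have "bc n m * ladder n m = of_nat k * bc n k"
          using bc_ladder(1)[of m n] jk unfolding Suc by simp
        finally show ?thesis using Suc by simp
      qed simp
      finally have sum: "(\<Sum>j\<le>n. wmon n j z * y j)
        = bc n k * (fst z ^ k * (of_nat (n - k) * snd z ^ (n - k - 1) * (- u * fst z)))
          + bc n k * (of_nat k * fst z ^ (k - 1) * (cnj u * snd z) * snd z ^ (n - k))" .
      define A B where "A s = cos s * fst z + cnj u * sin s * snd z" and "B s = - u * sin s * fst z + cos s * snd z" for s
      have AB: "(A has_field_derivative cnj u * snd z) (at 0)" "(B has_field_derivative - u * fst z) (at 0)"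
        unfolding A_def B_def by (auto intro!: derivative_eq_intros)
      have AB0: "A 0 = fst z" "B 0 = snd z" by (simp_all add: A_def B_def)
      have "((\<lambda>s. bc n k * (A s ^ k * B s ^ (n - k))) has_field_derivative
          bc n k * ((of_nat k * (cnj u * snd z * A 0 ^ (k - Suc 0))) * B 0 ^ (n - k)
            + (of_nat (n - k) * (- u * fst z * B 0 ^ (n - k - Suc 0))) * A 0 ^ k)) (at 0)"
        by (intro DERIV_cmult DERIV_mult DERIV_power AB)
      moreover have "h = (\<lambda>s. bc n k * (A s ^ k * B s ^ (n - k)))"
        by (simp add: h_def A_def B_def fun_eq_iff)
      moreover have "bc n k * ((of_nat k * (cnj u * snd z * A 0 ^ (k - Suc 0))) * B 0 ^ (n - k)
            + (of_nat (n - k) * (- u * fst z * B 0 ^ (n - k - Suc 0))) * A 0 ^ k) = (\<Sum>j\<le>n. wmon n j z * y j)"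
        unfolding sum AB0 by (simp add: distrib_left right_diff_distrib)
      ultimately show ?thesis by simp
    qed
    have "((\<lambda>t. h (complex_of_real t)) has_vector_derivative (\<Sum>j\<le>n. wmon n j z * y j)) (at 0)"
      using has_vector_derivative_real_field[OF 2] .
    then show "(\<Sum>j\<le>n. wmon n j z * x j) = (\<Sum>j\<le>n. wmon n j z * y j)"
      using 1 unfolding eq by (rule vector_derivative_unique_at[rotated])
  qed
  show ?thesis using D[OF jk(1)] unfolding xy y_def c_def d_def .
qed

section \<open>Characteristic functions\<close>

lemma borel_measurable_cis [measurable]: "cis \<in> borel_measurable borel"
  by (intro borel_measurable_continuous_onI continuous_intros)

lemma borel_measurable_cnj [measurable]: "cnj \<in> borel_measurable borel"
  by (intro borel_measurable_continuous_onI continuous_intros)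

lemma iexp_eq_cis: "iexp x = cis x"
  by (simp add: cis_conv_exp)

context prob_space
begin

lemma integrable_bounded_complex:
  fixes f :: "'a \<Rightarrow> complex"
  assumes "f \<in> borel_measurable M" "\<And>x. norm (f x) \<le> B"
  shows "integrable M f"
  using assms by (intro integrable_const_bound[where B = B]) auto

lemma char_distr:
  assumes [measurable]: "Y \<in> borel_measurable M"
  shows "char (distr M borel Y) s = (\<integral>\<omega>. cis (s * Y \<omega>) \<partial>M)"
  unfolding char_def iexp_eq_cis by (subst integral_distr) auto

lemma distr_eq_of_char:
  assumes [measurable]: "Y \<in> borel_measurable M" "Y' \<in> borel_measurable M"
    and eq: "\<And>s. (\<integral>\<omega>. cis (s * Y \<omega>) \<partial>M) = (\<integral>\<omega>. cis (s * Y' \<omega>) \<partial>M)"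
  shows "distr M borel Y = distr M borel Y'"
proof (rule Levy_uniqueness)
  show "real_distribution (distr M borel Y)" "real_distribution (distr M borel Y')"
    by (auto intro!: real_distribution_distr)
  show "char (distr M borel Y) = char (distr M borel Y')"
    by (simp add: fun_eq_iff char_distr eq)
qed

text \<open>Levy's uniqueness theorem for a law with a bounded weight. It serves to exchange one
  factor \<open>cis\<close> for an indicator while the other coordinates stay in the weight.\<close>

lemma expectation_indicator_eq_of_char_real:
  fixes W W' B B' :: "'a \<Rightarrow> real"
  assumes [measurable]: "W \<in> borel_measurable M" "W' \<in> borel_measurable M"
      "B \<in> borel_measurable M" "B' \<in> borel_measurable M"
    and W: "\<And>\<omega>. \<bar>W \<omega>\<bar> \<le> 1" and W': "\<And>\<omega>. \<bar>W' \<omega>\<bar> \<le> 1"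
    and eq: "\<And>s. (\<integral>\<omega>. complex_of_real (W \<omega>) * cis (s * B \<omega>) \<partial>M)
        = (\<integral>\<omega>. complex_of_real (W' \<omega>) * cis (s * B' \<omega>) \<partial>M)"
    and eq': "\<And>s. (\<integral>\<omega>. cis (s * B \<omega>) \<partial>M) = (\<integral>\<omega>. cis (s * B' \<omega>) \<partial>M)"
    and A [measurable]: "A \<in> sets borel"
  shows "(\<integral>\<omega>. W \<omega> * indicator A (B \<omega>) \<partial>M) = (\<integral>\<omega>. W' \<omega> * indicator A (B' \<omega>) \<partial>M)"
proof -
  \<comment> \<open>the shift by 2 makes the weight a probability density, so that uniqueness on the line applies\<close>
  define m where "m = (\<integral>\<omega>. W \<omega> \<partial>M) + 2"
  define N where "N V Y = distr (density M (\<lambda>\<omega>. ennreal ((V \<omega> + 2) / m))) borel Y"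
    for V Y :: "'a \<Rightarrow> real"
  have iW: "integrable M W" "integrable M W'"
    using W W' by (auto intro!: integrable_const_bound[where B = 1])
  have m': "m = (\<integral>\<omega>. W' \<omega> \<partial>M) + 2"
    using eq[of 0] by (simp add: m_def)
  have "-1 \<le> (\<integral>\<omega>. W \<omega> \<partial>M)"
    using integral_mono[OF _ iW(1), of "\<lambda>_. - 1"] W by (simp add: prob_space abs_le_iff minus_le_iff)
  then have m: "m > 0" by (simp add: m_def)
  have *: "real_distribution (N V Y) \<and> (\<forall>s. char (N V Y) s = ((\<integral>\<omega>. complex_of_real (V \<omega>) * cis (s * Y \<omega>) \<partial>M) + 2 * (\<integral>\<omega>. cis (s * Y \<omega>) \<partial>M)) / m)
     \<and> measure (N V Y) A = ((\<integral>\<omega>. V \<omega> * indicator A (Y \<omega>) \<partial>M) + 2 * (\<integral>\<omega>. indicator A (Y \<omega>) \<partial>M)) / m"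
    if [measurable]: "V \<in> borel_measurable M" "Y \<in> borel_measurable M"
      and V: "\<And>\<omega>. \<bar>V \<omega>\<bar> \<le> 1" and mV: "m = (\<integral>\<omega>. V \<omega> \<partial>M) + 2" for V Y
  proof (intro conjI allI)
    have V2: "0 \<le> (V \<omega> + 2) / m" for \<omega> using V[of \<omega>] m by (simp add: abs_le_iff)
    have iV: "integrable M V" using V by (auto intro!: integrable_const_bound[where B = 1])
    have "emeasure (density M (\<lambda>\<omega>. ennreal ((V \<omega> + 2) / m))) (space M) = (\<integral>\<^sup>+\<omega>. ennreal ((V \<omega> + 2) / m) \<partial>M)"
      by (subst emeasure_density) (auto intro!: nn_integral_cong)
    also have "\<dots> = ennreal (\<integral>\<omega>. (V \<omega> + 2) / m \<partial>M)"
      using iV V2 by (intro nn_integral_eq_integral) auto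
    also have "(\<integral>\<omega>. (V \<omega> + 2) / m \<partial>M) = 1" using iV m by (simp add: mV prob_space)
    finally have "prob_space (density M (\<lambda>\<omega>. ennreal ((V \<omega> + 2) / m)))"
      by (intro prob_spaceI) simp
    then have "prob_space (N V Y)" unfolding N_def by (rule prob_space.prob_space_distr) simp
    then show "real_distribution (N V Y)"
      by (auto simp: real_distribution_def real_distribution_axioms_def N_def)
    interpret N: prob_space "N V Y" by fact
    fix s
    have i1: "integrable M (\<lambda>\<omega>. cis (s * Y \<omega>))" by (rule integrable_bounded_complex[where B = 1]) auto
    have i2: "integrable M (\<lambda>\<omega>. complex_of_real (V \<omega>) * cis (s * Y \<omega>))"
      using V by (intro integrable_bounded_complex[where B = 1]) (auto simp: norm_mult)
    have "char (N V Y) s = (\<integral>\<omega>. ((V \<omega> + 2) / m) *\<^sub>R cis (s * Y \<omega>) \<partial>M)"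
      unfolding char_def N_def iexp_eq_cis using V2 by (subst integral_distr) (auto simp: integral_density)
    also have "\<dots> = (\<integral>\<omega>. (complex_of_real (V \<omega>) * cis (s * Y \<omega>) + 2 * cis (s * Y \<omega>)) / m \<partial>M)"
      by (intro Bochner_Integration.integral_cong) (auto simp: scaleR_conv_of_real distrib_right)
    also have "\<dots> = ((\<integral>\<omega>. complex_of_real (V \<omega>) * cis (s * Y \<omega>) \<partial>M) + 2 * (\<integral>\<omega>. cis (s * Y \<omega>) \<partial>M)) / m"
      using i1 i2 by simp
    finally show "char (N V Y) s = \<dots>" .
    have j1: "integrable M (\<lambda>\<omega>. indicator A (Y \<omega>) :: real)"
      by (rule integrable_const_bound[where B = 1]) auto
    have j2: "integrable M (\<lambda>\<omega>. V \<omega> * indicator A (Y \<omega>))"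
      using V by (intro integrable_const_bound[where B = 1]) (auto simp: abs_mult indicator_def)
    have "measure (N V Y) A = (\<integral>x. indicator A x \<partial>N V Y)"
      by (simp add: N_def)
    also have "\<dots> = (\<integral>\<omega>. ((V \<omega> + 2) / m) *\<^sub>R indicator A (Y \<omega>) \<partial>M)"
      unfolding N_def using V2 by (subst integral_distr) (auto simp: integral_density)
    also have "\<dots> = (\<integral>\<omega>. (V \<omega> * indicator A (Y \<omega>) + 2 * indicator A (Y \<omega>)) / m \<partial>M)"
      by (intro Bochner_Integration.integral_cong) (auto simp: distrib_right)
    also have "\<dots> = ((\<integral>\<omega>. V \<omega> * indicator A (Y \<omega>) \<partial>M) + 2 * (\<integral>\<omega>. indicator A (Y \<omega>) \<partial>M)) / m"
      using j1 j2 by simp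
    finally show "measure (N V Y) A = \<dots>" .
  qed
  note N = *[of W B, OF _ _ W m_def] and N' = *[of W' B', OF _ _ W' m']
  have "N W B = N W' B'"
    using N N' by (intro Levy_uniqueness) (auto simp: fun_eq_iff eq eq')
  then have "(\<integral>\<omega>. W \<omega> * indicator A (B \<omega>) \<partial>M) + 2 * (\<integral>\<omega>. indicator A (B \<omega>) \<partial>M)
    = (\<integral>\<omega>. W' \<omega> * indicator A (B' \<omega>) \<partial>M) + 2 * (\<integral>\<omega>. indicator A (B' \<omega>) \<partial>M)"
    using N N' m by (auto simp: divide_eq_eq)
  moreover have "(\<integral>\<omega>. indicator A (B \<omega>) \<partial>M) = (\<integral>\<omega>. indicator A (B' \<omega>) \<partial>M :: real)"
  proof -
    have "(\<integral>x. indicator A x \<partial>distr M borel B) = (\<integral>x. indicator A x \<partial>distr M borel B' :: real)"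
      using distr_eq_of_char[of B B'] eq' by simp
    then show ?thesis by (subst (asm) (1 2) integral_distr) auto
  qed
  ultimately show ?thesis by simp
qed

lemma expectation_indicator_eq_of_char:
  fixes W W' :: "'a \<Rightarrow> complex" and B B' :: "'a \<Rightarrow> real"
  assumes [measurable]: "W \<in> borel_measurable M" "W' \<in> borel_measurable M"
      "B \<in> borel_measurable M" "B' \<in> borel_measurable M"
    and W: "\<And>\<omega>. norm (W \<omega>) \<le> 1" and W': "\<And>\<omega>. norm (W' \<omega>) \<le> 1"
    and eq: "\<And>s. (\<integral>\<omega>. W \<omega> * cis (s * B \<omega>) \<partial>M) = (\<integral>\<omega>. W' \<omega> * cis (s * B' \<omega>) \<partial>M)"
    and eq': "\<And>s. (\<integral>\<omega>. cis (s * B \<omega>) \<partial>M) = (\<integral>\<omega>. cis (s * B' \<omega>) \<partial>M)"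
    and A [measurable]: "A \<in> sets borel"
  shows "(\<integral>\<omega>. W \<omega> * indicator A (B \<omega>) \<partial>M) = (\<integral>\<omega>. W' \<omega> * indicator A (B' \<omega>) \<partial>M)"
proof -
  have i: "integrable M (\<lambda>\<omega>. V \<omega> * cis (s * Y \<omega>))"
    if [measurable]: "V \<in> borel_measurable M" "Y \<in> borel_measurable M" and "\<And>\<omega>. norm (V \<omega>) \<le> 1" for V Y s
    using that(3) by (intro integrable_bounded_complex[where B = 1]) (auto simp: norm_mult)
  \<comment> \<open>Conjugating the weight amounts to reflecting \<open>s\<close>, so the hypothesis
    passes to the conjugate weight and from there to the real and imaginary parts.\<close>
  have cnj: "(\<integral>\<omega>. cnj (V \<omega>) * cis (s * Y \<omega>) \<partial>M) = cnj (\<integral>\<omega>. V \<omega> * cis (- s * Y \<omega>) \<partial>M)" for V Y s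
    by (subst Bochner_Integration.integral_cnj[symmetric]) (simp add: cis_cnj)
  have eqc: "(\<integral>\<omega>. cnj (W \<omega>) * cis (s * B \<omega>) \<partial>M) = (\<integral>\<omega>. cnj (W' \<omega>) * cis (s * B' \<omega>) \<partial>M)" for s
    unfolding cnj eq ..
  have ic: "integrable M (\<lambda>\<omega>. cnj (W \<omega>) * cis (s * B \<omega>))" "integrable M (\<lambda>\<omega>. cnj (W' \<omega>) * cis (s * B' \<omega>))" for s
    using W W' by (auto intro!: i)
  have iw: "integrable M (\<lambda>\<omega>. W \<omega> * cis (s * B \<omega>))" "integrable M (\<lambda>\<omega>. W' \<omega> * cis (s * B' \<omega>))" for s
    using W W' by (auto intro!: i)
  have re: "(\<integral>\<omega>. complex_of_real (Re (W \<omega>)) * cis (s * B \<omega>) \<partial>M)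
     = (\<integral>\<omega>. complex_of_real (Re (W' \<omega>)) * cis (s * B' \<omega>) \<partial>M)" for s
  proof -
    have 1: "complex_of_real (Re z) * w = (z * w + cnj z * w) / 2" for z w
      by (simp add: complex_add_cnj flip: distrib_right)
    show ?thesis unfolding 1 using ic iw eq eqc by simp
  qed
  have im: "(\<integral>\<omega>. complex_of_real (Im (W \<omega>)) * cis (s * B \<omega>) \<partial>M)
     = (\<integral>\<omega>. complex_of_real (Im (W' \<omega>)) * cis (s * B' \<omega>) \<partial>M)" for s
  proof -
    have "complex_of_real (Im z) = (z - cnj z) / (2 * \<i>)" for z
      by (subst nonzero_eq_divide_eq) (simp_all add: complex_diff_cnj)
    then have 1: "complex_of_real (Im z) * w = (z * w - cnj z * w) / (2 * \<i>)" for z w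
      by (simp only: left_diff_distrib times_divide_eq_left)
    show ?thesis unfolding 1 using ic iw eq eqc by simp
  qed
  have R: "(\<integral>\<omega>. Re (W \<omega>) * indicator A (B \<omega>) \<partial>M) = (\<integral>\<omega>. Re (W' \<omega>) * indicator A (B' \<omega>) \<partial>M)"
    using order_trans[OF abs_Re_le_cmod W] order_trans[OF abs_Re_le_cmod W']
    by (intro expectation_indicator_eq_of_char_real re eq') measurable
  have I: "(\<integral>\<omega>. Im (W \<omega>) * indicator A (B \<omega>) \<partial>M) = (\<integral>\<omega>. Im (W' \<omega>) * indicator A (B' \<omega>) \<partial>M)"
    using order_trans[OF abs_Im_le_cmod W] order_trans[OF abs_Im_le_cmod W']
    by (intro expectation_indicator_eq_of_char_real im eq') measurable
  have ind: "integrable M (\<lambda>\<omega>. W \<omega> * indicator A (B \<omega>))" "integrable M (\<lambda>\<omega>. W' \<omega> * indicator A (B' \<omega>))"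
    by (auto intro!: integrable_bounded_complex[where B = 1] simp: norm_mult indicator_def W W')
  have RI: "Re (w * indicator A x) = Re w * indicator A x" "Im (w * indicator A x) = Im w * indicator A x"
    for w and x :: real by (auto simp: indicator_def)
  show ?thesis
    using integral_Re[OF ind(1)] integral_Re[OF ind(2)] integral_Im[OF ind(1)] integral_Im[OF ind(2)] R I
    by (intro complex_eqI) (simp_all only: RI)
qed

text \<open>Uniqueness in finite dimension is reduced to the line: an induction exchanges
  exponentials for indicators one coordinate at a time, until only the probability of a box is
  left.\<close>

lemma distr_PiM_eq_of_char:
  fixes Y Y' :: "'k \<Rightarrow> 'a \<Rightarrow> real"
  assumes K: "finite K"
    and meas: "\<And>k. k \<in> K \<Longrightarrow> Y k \<in> borel_measurable M" "\<And>k. k \<in> K \<Longrightarrow> Y' k \<in> borel_measurable M"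
    and eq: "\<And>\<theta>. (\<integral>\<omega>. cis (\<Sum>k\<in>K. \<theta> k * Y k \<omega>) \<partial>M) = (\<integral>\<omega>. cis (\<Sum>k\<in>K. \<theta> k * Y' k \<omega>) \<partial>M)"
  shows "distr M (Pi\<^sub>M K (\<lambda>_. borel)) (\<lambda>\<omega>. \<lambda>k\<in>K. Y k \<omega>) = distr M (Pi\<^sub>M K (\<lambda>_. borel)) (\<lambda>\<omega>. \<lambda>k\<in>K. Y' k \<omega>)"
proof -
  have main: "(\<integral>\<omega>. (\<Prod>k\<in>J. indicator (A k) (Y k \<omega>)) * cis (\<Sum>k\<in>K - J. \<theta> k * Y k \<omega>) \<partial>M)
     = (\<integral>\<omega>. (\<Prod>k\<in>J. indicator (A k) (Y' k \<omega>)) * cis (\<Sum>k\<in>K - J. \<theta> k * Y' k \<omega>) \<partial>M)"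
    if "finite J" "J \<subseteq> K" "\<And>k. k \<in> K \<Longrightarrow> A k \<in> sets borel" for J \<theta> and A :: "'k \<Rightarrow> real set"
    using that(1,2)
  proof (induction J arbitrary: \<theta> rule: finite_induct)
    case empty
    then show ?case by (simp add: eq)
  next
    case (insert j J)
    have A: "\<And>k. k \<in> K \<Longrightarrow> A k \<in> sets borel" by fact
    have jK: "j \<in> K" "J \<subseteq> K" using insert by auto
    \<comment> \<open>Everything except coordinate \<open>j\<close>. The frequency \<open>s\<close>
      of that coordinate stays free, so the one-dimensional statement applies with weight
      \<open>W\<close>.\<close>
    define W where "W Z \<omega> = (\<Prod>k\<in>J. indicator (A k) (Z k \<omega>)) * cis (\<Sum>k\<in>K - insert j J. \<theta> k * Z k \<omega>)"
      for Z :: "'k \<Rightarrow> 'a \<Rightarrow> real" and \<omega>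
    have Wm: "W Z \<in> borel_measurable M" if Z: "\<And>k. k \<in> K \<Longrightarrow> Z k \<in> borel_measurable M" for Z
    proof -
      have a: "(\<lambda>\<omega>. indicator (A k) (Z k \<omega>) :: complex) \<in> borel_measurable M" if "k \<in> J" for k
        using that jK by (intro measurable_compose[OF Z borel_measurable_indicator[OF A]]) auto
      have b: "(\<lambda>\<omega>. \<Sum>k\<in>K - insert j J. \<theta> k * Z k \<omega>) \<in> borel_measurable M"
        by (intro borel_measurable_sum borel_measurable_times borel_measurable_const Z) auto
      show ?thesis unfolding W_def[abs_def]
        by (intro borel_measurable_times borel_measurable_prod a measurable_compose[OF b borel_measurable_cis])
    qed
    have Wb: "norm (W Z \<omega>) \<le> 1" for Z \<omega>
    proof -
      have "norm (\<Prod>k\<in>J. indicator (A k) (Z k \<omega>) :: complex) \<le> 1"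
        unfolding prod_norm[symmetric] by (intro prod_le_1) (auto simp: indicator_def)
      then show ?thesis by (simp add: W_def norm_mult)
    qed
    have *: "(\<integral>\<omega>. W Z \<omega> * cis (s * Z j \<omega>) \<partial>M)
      = (\<integral>\<omega>. (\<Prod>k\<in>J. indicator (A k) (Z k \<omega>)) * cis (\<Sum>k\<in>K - J. (\<theta>(j := s)) k * Z k \<omega>) \<partial>M)" for Z s
    proof -
      have KJ: "K - J = insert j (K - insert j J)" using insert by auto
      have "(\<Sum>k\<in>K - insert j J. (\<theta>(j := s)) k * Z k \<omega>) = (\<Sum>k\<in>K - insert j J. \<theta> k * Z k \<omega>)" for \<omega>
        by (intro sum.cong refl) simp
      then have sum: "(\<Sum>k\<in>K - J. (\<theta>(j := s)) k * Z k \<omega>) = s * Z j \<omega> + (\<Sum>k\<in>K - insert j J. \<theta> k * Z k \<omega>)" for \<omega>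
        unfolding KJ using K by (subst sum.insert) simp_all
      show ?thesis unfolding W_def sum cis_mult[symmetric] by (simp only: mult_ac)
    qed
    have eqW: "(\<integral>\<omega>. W Y \<omega> * cis (s * Y j \<omega>) \<partial>M) = (\<integral>\<omega>. W Y' \<omega> * cis (s * Y' j \<omega>) \<partial>M)" for s
      unfolding * using insert.IH jK by simp
    have eqj: "(\<integral>\<omega>. cis (s * Y j \<omega>) \<partial>M) = (\<integral>\<omega>. cis (s * Y' j \<omega>) \<partial>M)" for s
    proof -
      have "(\<Sum>k\<in>K. (if k = j then s else 0) * Z k \<omega>) = s * Z j \<omega>" for Z :: "'k \<Rightarrow> 'a \<Rightarrow> real" and \<omega>
        using K jK by (simp add: if_distrib[of "\<lambda>x. x * _"] cong: if_cong)
      then show ?thesis using eq[of "\<lambda>k. if k = j then s else 0"] by simp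
    qed
    have "(\<integral>\<omega>. W Y \<omega> * indicator (A j) (Y j \<omega>) \<partial>M) = (\<integral>\<omega>. W Y' \<omega> * indicator (A j) (Y' j \<omega>) \<partial>M)"
      using jK meas by (intro expectation_indicator_eq_of_char Wm Wb eqW eqj A) auto
    then show ?case
      using insert.hyps by (simp add: W_def mult_ac)
  qed
  show ?thesis
  proof (rule measure_eqI_PiM_finite[OF K, where A = "\<lambda>_. Pi\<^sub>E K (\<lambda>_. UNIV)"])
    have m: "(\<lambda>\<omega>. \<lambda>k\<in>K. Y k \<omega>) \<in> M \<rightarrow>\<^sub>M Pi\<^sub>M K (\<lambda>_. borel)" "(\<lambda>\<omega>. \<lambda>k\<in>K. Y' k \<omega>) \<in> M \<rightarrow>\<^sub>M Pi\<^sub>M K (\<lambda>_. borel)"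
      by (auto intro!: measurable_restrict meas)
    show "range (\<lambda>i::nat. Pi\<^sub>E K (\<lambda>_. UNIV)) \<subseteq> prod_algebra K (\<lambda>_. borel :: real measure)"
      using prod_algebraI_finite[OF K, of "\<lambda>_. UNIV" "\<lambda>_. borel :: real measure"] by auto
    show "emeasure (distr M (Pi\<^sub>M K (\<lambda>_. borel)) (\<lambda>\<omega>. \<lambda>k\<in>K. Y k \<omega>)) (Pi\<^sub>E K (\<lambda>_. UNIV)) \<noteq> \<infinity>"
      using finite_measure.emeasure_finite[OF prob_space.finite_measure[OF prob_space_distr[OF m(1)]]]
      unfolding infinity_ennreal_def .
    fix A :: "'k \<Rightarrow> real set" assume A: "\<And>k. k \<in> K \<Longrightarrow> A k \<in> sets borel"
    have "emeasure (distr M (Pi\<^sub>M K (\<lambda>_. borel)) (\<lambda>\<omega>. \<lambda>k\<in>K. Z k \<omega>)) (Pi\<^sub>E K A)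
       = ennreal (Re (\<integral>\<omega>. (\<Prod>k\<in>K. indicator (A k) (Z k \<omega>)) \<partial>M))"
      if Z: "\<And>k. k \<in> K \<Longrightarrow> Z k \<in> borel_measurable M" for Z :: "'k \<Rightarrow> 'a \<Rightarrow> real"
    proof -
      have mZ: "(\<lambda>\<omega>. \<lambda>k\<in>K. Z k \<omega>) \<in> M \<rightarrow>\<^sub>M Pi\<^sub>M K (\<lambda>_. borel)" using Z by (auto intro!: measurable_restrict)
      have PA: "Pi\<^sub>E K A \<in> sets (Pi\<^sub>M K (\<lambda>_. borel))" using K A by (intro sets_PiM_I_finite) auto
      let ?E = "(\<lambda>\<omega>. \<lambda>k\<in>K. Z k \<omega>) -` Pi\<^sub>E K A \<inter> space M"
      have E: "?E \<in> sets M" using measurable_sets[OF mZ PA] .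
      have "(\<integral>\<omega>. (\<Prod>k\<in>K. indicator (A k) (Z k \<omega>)) \<partial>M) = (\<integral>\<omega>. complex_of_real (indicator ?E \<omega>) \<partial>M)"
        using K by (intro Bochner_Integration.integral_cong refl) (auto simp: indicator_def prod_eq_1_iff PiE_iff split: if_splits)
      also have "\<dots> = complex_of_real (measure M ?E)" using E by (subst integral_complex_of_real) simp
      finally show ?thesis
        using emeasure_distr[OF mZ PA] by (simp add: emeasure_eq_measure)
    qed
    then show "emeasure (distr M (Pi\<^sub>M K (\<lambda>_. borel)) (\<lambda>\<omega>. \<lambda>k\<in>K. Y k \<omega>)) (Pi\<^sub>E K A)
      = emeasure (distr M (Pi\<^sub>M K (\<lambda>_. borel)) (\<lambda>\<omega>. \<lambda>k\<in>K. Y' k \<omega>)) (Pi\<^sub>E K A)"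
      using main[OF K order_refl, of A "\<lambda>_. 0"] A meas by simp
  qed (simp_all add: space_PiM)
qed

end

context prob_space
begin

lemma distr_PiM_complex_eq_of_char:
  fixes Y Y' :: "'k \<Rightarrow> 'a \<Rightarrow> complex"
  assumes J: "finite J"
    and meas: "\<And>j. j \<in> J \<Longrightarrow> Y j \<in> borel_measurable M" "\<And>j. j \<in> J \<Longrightarrow> Y' j \<in> borel_measurable M"
    and eq: "\<And>c. (\<integral>\<omega>. cis (Re (\<Sum>j\<in>J. c j * Y j \<omega>)) \<partial>M) = (\<integral>\<omega>. cis (Re (\<Sum>j\<in>J. c j * Y' j \<omega>)) \<partial>M)"
  shows "distr M (Pi\<^sub>M J (\<lambda>_. borel)) (\<lambda>\<omega>. \<lambda>j\<in>J. Y j \<omega>) = distr M (Pi\<^sub>M J (\<lambda>_. borel)) (\<lambda>\<omega>. \<lambda>j\<in>J. Y' j \<omega>)"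
proof -
  define K where "K = J \<times> (UNIV :: bool set)"
  define R where "R Z p \<omega> = (if snd p then Im (Z (fst p) \<omega>) else Re (Z (fst p) \<omega>))"
    for Z :: "'k \<Rightarrow> 'a \<Rightarrow> complex" and p :: "'k \<times> bool" and \<omega>
  define \<phi> where "\<phi> x = (\<lambda>j\<in>J. Complex (x (j, False)) (x (j, True)))" for x :: "'k \<times> bool \<Rightarrow> real"
  have K: "finite K" using J by (simp add: K_def)
  have Rm: "R Z p \<in> borel_measurable M" if "\<And>j. j \<in> J \<Longrightarrow> Z j \<in> borel_measurable M" "p \<in> K" for Z p
  proof -
    have [measurable]: "Z (fst p) \<in> borel_measurable M" using that by (auto simp: K_def)
    show ?thesis unfolding R_def[abs_def] by (cases "snd p") simp_all
  qed
  \<comment> \<open>The minus sign comes from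
    \<open>Re (Complex p q * w) = p * Re w - q * Im w\<close>. Real frequencies for both parts are
    thus complex coefficients under \<open>Re\<close>.\<close>
  have sum: "(\<Sum>p\<in>K. \<theta> p * R Z p \<omega>) = Re (\<Sum>j\<in>J. Complex (\<theta> (j, False)) (- \<theta> (j, True)) * Z j \<omega>)" for \<theta> Z \<omega>
    unfolding K_def sum.cartesian_product[symmetric, where g = "\<lambda>j b. \<theta> (j, b) * R Z (j, b) \<omega>", unfolded case_prod_beta prod.collapse]
    by (simp add: R_def UNIV_bool)
  have "distr M (Pi\<^sub>M K (\<lambda>_. borel)) (\<lambda>\<omega>. \<lambda>p\<in>K. R Y p \<omega>) = distr M (Pi\<^sub>M K (\<lambda>_. borel)) (\<lambda>\<omega>. \<lambda>p\<in>K. R Y' p \<omega>)"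
    using meas by (intro distr_PiM_eq_of_char K Rm) (auto simp only: sum eq)
  moreover have \<phi>m: "\<phi> \<in> Pi\<^sub>M K (\<lambda>_. borel) \<rightarrow>\<^sub>M Pi\<^sub>M J (\<lambda>_. borel)"
  proof -
    have "(\<lambda>x. Complex (x (j, False)) (x (j, True))) \<in> borel_measurable (Pi\<^sub>M K (\<lambda>_. borel))" if "j \<in> J" for j
    proof -
      have [measurable]: "(\<lambda>x. x (j, b)) \<in> borel_measurable (Pi\<^sub>M K (\<lambda>_. borel :: real measure))" for b
        using that by (intro measurable_component_singleton) (auto simp: K_def)
      show ?thesis unfolding Complex_eq by measurable
    qed
    then show ?thesis unfolding \<phi>_def[abs_def] by (intro measurable_restrict)
  qed
  moreover have "distr (distr M (Pi\<^sub>M K (\<lambda>_. borel)) (\<lambda>\<omega>. \<lambda>p\<in>K. R Z p \<omega>)) (Pi\<^sub>M J (\<lambda>_. borel)) \<phi>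
      = distr M (Pi\<^sub>M J (\<lambda>_. borel)) (\<lambda>\<omega>. \<lambda>j\<in>J. Z j \<omega>)" if "\<And>j. j \<in> J \<Longrightarrow> Z j \<in> borel_measurable M" for Z
  proof (subst distr_distr)
    show "(\<lambda>\<omega>. \<lambda>p\<in>K. R Z p \<omega>) \<in> M \<rightarrow>\<^sub>M Pi\<^sub>M K (\<lambda>_. borel)"
      using that by (intro measurable_restrict Rm)
    show "distr M (Pi\<^sub>M J (\<lambda>_. borel)) (\<phi> \<circ> (\<lambda>\<omega>. \<lambda>p\<in>K. R Z p \<omega>)) = distr M (Pi\<^sub>M J (\<lambda>_. borel)) (\<lambda>\<omega>. \<lambda>j\<in>J. Z j \<omega>)"
      by (intro arg_cong[of _ _ "distr M (Pi\<^sub>M J (\<lambda>_. borel))"])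
        (auto simp: \<phi>_def R_def K_def fun_eq_iff)
  qed (rule \<phi>m)
  ultimately show ?thesis using meas by metis
qed

text \<open>The characteristic function on the plane: \<open>Re (cnj t * w)\<close> is the real
  inner product of \<open>t\<close> and \<open>w\<close>.\<close>

definition ccf :: "('a \<Rightarrow> complex) \<Rightarrow> complex \<Rightarrow> complex" where
  "ccf W t = (\<integral>\<omega>. cis (Re (cnj t * W \<omega>)) \<partial>M)"

lemma distr_complex_eq_of_ccf:
  assumes [measurable]: "W \<in> borel_measurable M" "W' \<in> borel_measurable M"
    and eq: "\<And>t. ccf W t = ccf W' t"
  shows "distr M borel W = distr M borel W'"
proof -
  have "(\<integral>\<omega>. cis (Re (\<Sum>j\<in>{()}. c j * W \<omega>)) \<partial>M) = (\<integral>\<omega>. cis (Re (\<Sum>j\<in>{()}. c j * W' \<omega>)) \<partial>M)" for c :: "unit \<Rightarrow> complex"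
    using eq[of "cnj (c ())"] by (simp add: ccf_def)
  then have eq: "distr M (Pi\<^sub>M {()} (\<lambda>_. borel)) (\<lambda>\<omega>. \<lambda>j\<in>{()}. W \<omega>) = distr M (Pi\<^sub>M {()} (\<lambda>_. borel)) (\<lambda>\<omega>. \<lambda>j\<in>{()}. W' \<omega>)"
    by (intro distr_PiM_complex_eq_of_char) auto
  have *: "distr (distr M (Pi\<^sub>M {()} (\<lambda>_. borel)) (\<lambda>\<omega>. \<lambda>j\<in>{()}. Z \<omega>)) borel (\<lambda>x. x ()) = distr M borel Z"
    if [measurable]: "Z \<in> borel_measurable M" for Z :: "'a \<Rightarrow> complex"
  proof (subst distr_distr)
    show "(\<lambda>x. x ()) \<in> Pi\<^sub>M {()} (\<lambda>_. borel) \<rightarrow>\<^sub>M borel" by (intro measurable_component_singleton) simp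
    show "(\<lambda>\<omega>. \<lambda>j\<in>{()}. Z \<omega>) \<in> M \<rightarrow>\<^sub>M Pi\<^sub>M {()} (\<lambda>_. borel)" by (intro measurable_restrict) simp
  qed (simp add: comp_def)
  show ?thesis using *[of W] *[of W'] eq by simp
qed

lemma ccf_0 [simp]: "ccf W 0 = 1"
  by (simp add: ccf_def prob_space)

lemma ccf_distr:
  assumes [measurable]: "W \<in> borel_measurable M" "W' \<in> borel_measurable M"
    and "distr M borel W = distr M borel W'"
  shows "ccf W t = ccf W' t"
proof -
  have "(\<integral>z. cis (Re (cnj t * z)) \<partial>distr M borel W) = (\<integral>z. cis (Re (cnj t * z)) \<partial>distr M borel W')"
    using assms(3) by simp
  then show ?thesis by (subst (asm) (1 2) integral_distr) (auto simp: ccf_def)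
qed

lemma norm_ccf_le_1: "norm (ccf W t) \<le> 1"
proof -
  have "norm (ccf W t) \<le> (\<integral>\<omega>. norm (cis (Re (cnj t * W \<omega>))) \<partial>M)"
    unfolding ccf_def by (rule integral_norm_bound)
  then show ?thesis by (simp add: prob_space)
qed

section \<open>Gaussian variables and their characteristic functions\<close>

lemma distributed_normal_char:
  assumes Y: "distributed M lborel Y (normal_density \<mu> \<sigma>)" and \<sigma>: "\<sigma> > 0"
  shows "(\<integral>\<omega>. cis (s * Y \<omega>) \<partial>M) = cis (s * \<mu>) * exp (- (\<sigma>\<^sup>2 * s\<^sup>2 / 2))"
proof -
  have [measurable]: "Y \<in> borel_measurable M" using Y by (auto simp: distributed_def)
  define Z where "Z \<omega> = (Y \<omega> - \<mu>) / \<sigma>" for \<omega>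
  have [measurable]: "Z \<in> borel_measurable M" unfolding Z_def by measurable
  have "distributed M lborel Z std_normal_density"
    using Y \<sigma> normal_standard_normal_convert[of \<sigma> Y \<mu>] unfolding Z_def by blast
  then have "distr M borel Z = std_normal_distribution"
    by (simp add: distributed_def cong: distr_cong)
  then have Zc: "(\<integral>\<omega>. cis (r * Z \<omega>) \<partial>M) = exp (- (r\<^sup>2) / 2)" for r
    using char_distr[of Z r] by (simp add: char_std_normal_distribution)
  have "cis (s * Y \<omega>) = cis (s * \<mu>) * cis (s * \<sigma> * Z \<omega>)" for \<omega>
  proof -
    have "\<sigma> * Z \<omega> = Y \<omega> - \<mu>" using \<sigma> by (simp add: Z_def)
    then have "s * \<mu> + s * \<sigma> * Z \<omega> = s * Y \<omega>" by (simp add: mult.assoc flip: distrib_left)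
    then show ?thesis by (simp add: cis_mult)
  qed
  then have "(\<integral>\<omega>. cis (s * Y \<omega>) \<partial>M) = cis (s * \<mu>) * (\<integral>\<omega>. cis (s * \<sigma> * Z \<omega>) \<partial>M)" by simp
  then show ?thesis unfolding Zc by (simp add: power_mult_distrib mult.commute)
qed

lemma real_gaussian_char:
  assumes "real_gaussian M Y"
  obtains \<mu> \<sigma> where "\<And>s. (\<integral>\<omega>. cis (s * Y \<omega>) \<partial>M) = cis (s * \<mu>) * exp (- (\<sigma>\<^sup>2 * s\<^sup>2 / 2))"
proof -
  from assms obtain \<mu> \<sigma> where [measurable]: "Y \<in> borel_measurable M"
    and *: "(\<sigma> = 0 \<and> (AE \<omega> in M. Y \<omega> = \<mu>)) \<or> (\<sigma> > 0 \<and> distributed M lborel Y (normal_density \<mu> \<sigma>))"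
    by (auto simp: real_gaussian_def)
  from * have "(\<integral>\<omega>. cis (s * Y \<omega>) \<partial>M) = cis (s * \<mu>) * exp (- (\<sigma>\<^sup>2 * s\<^sup>2 / 2))" for s
  proof
    assume Y: "\<sigma> = 0 \<and> (AE \<omega> in M. Y \<omega> = \<mu>)"
    then have "(\<integral>\<omega>. cis (s * Y \<omega>) \<partial>M) = (\<integral>\<omega>. cis (s * \<mu>) \<partial>M)"
      by (intro integral_cong_AE) auto
    then show ?thesis using Y by (simp add: prob_space)
  qed (use distributed_normal_char in blast)
  then show ?thesis by (rule that)
qed

text \<open>The moments are extracted together with normality, because
  \<open>complex_gaussian\<close> speaks of a mean and the variance is an integral.\<close>

lemma normal_of_char:
  assumes [measurable]: "Y \<in> borel_measurable M" and v: "v \<ge> 0"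
    and char: "\<And>s. (\<integral>\<omega>. cis (s * Y \<omega>) \<partial>M) = exp (- (v * s\<^sup>2 / 2))"
  shows "real_gaussian M Y" "integrable M (\<lambda>\<omega>. (Y \<omega>)\<^sup>2)" "(\<integral>\<omega>. (Y \<omega>)\<^sup>2 \<partial>M) = v"
    "integrable M Y" "(\<integral>\<omega>. Y \<omega> \<partial>M) = 0"
proof -
  have "real_gaussian M Y \<and> integrable M (\<lambda>\<omega>. (Y \<omega>)\<^sup>2) \<and> (\<integral>\<omega>. (Y \<omega>)\<^sup>2 \<partial>M) = v
    \<and> integrable M Y \<and> (\<integral>\<omega>. Y \<omega> \<partial>M) = 0"
  proof (cases "v = 0")
    \<comment> \<open>Variance 0 gives the constant 0, which has no density and is the degenerate
      case of \<open>real_gaussian\<close>.\<close>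
    case True
    have "distr M borel Y = distr M borel (\<lambda>_. 0)"
      using char True by (intro distr_eq_of_char) (simp_all add: prob_space)
    then have "AE x in distr M borel Y. x = 0"
      by (simp only:) (subst AE_distr_iff, auto)
    then have AE: "AE \<omega> in M. Y \<omega> = 0" by (subst (asm) AE_distr_iff) auto
    then have "real_gaussian M Y" by (auto simp: real_gaussian_def)
    moreover have "(\<integral>\<omega>. (Y \<omega>)\<^sup>2 \<partial>M) = (\<integral>\<omega>. 0 \<partial>M)"
      using AE by (intro integral_cong_AE) auto
    moreover have "(\<integral>\<omega>. Y \<omega> \<partial>M) = (\<integral>\<omega>. 0 \<partial>M)"
      using AE by (intro integral_cong_AE) auto
    moreover have "integrable M (\<lambda>\<omega>. (Y \<omega>)\<^sup>2) \<longleftrightarrow> integrable M (\<lambda>_. 0 :: real)"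
      using AE by (intro integrable_cong_AE) auto
    moreover have "integrable M Y \<longleftrightarrow> integrable M (\<lambda>_. 0 :: real)"
      using AE by (intro integrable_cong_AE) auto
    ultimately show ?thesis using True by simp
  next
    case False
    define \<sigma> where "\<sigma> = sqrt v"
    have \<sigma>: "\<sigma> > 0" "\<sigma>\<^sup>2 = v" using False v by (auto simp: \<sigma>_def)
    have "distr M borel (\<lambda>\<omega>. Y \<omega> / \<sigma>) = std_normal_distribution"
    proof (rule Levy_uniqueness[OF _ real_dist_normal_dist])
      show "real_distribution (distr M borel (\<lambda>\<omega>. Y \<omega> / \<sigma>))" by (auto intro!: real_distribution_distr)
      show "char (distr M borel (\<lambda>\<omega>. Y \<omega> / \<sigma>)) = char std_normal_distribution"
      proof
        fix s
        have "char (distr M borel (\<lambda>\<omega>. Y \<omega> / \<sigma>)) s = (\<integral>\<omega>. cis ((s / \<sigma>) * Y \<omega>) \<partial>M)"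
          by (subst char_distr) auto
        also have "\<dots> = exp (- (s\<^sup>2) / 2)"
          unfolding char using \<sigma> False by (simp add: power_divide)
        finally show "char (distr M borel (\<lambda>\<omega>. Y \<omega> / \<sigma>)) s = char std_normal_distribution s"
          by (simp add: char_std_normal_distribution)
      qed
    qed
    then have "distributed M lborel (\<lambda>\<omega>. Y \<omega> / \<sigma>) std_normal_density"
      by (simp add: distributed_def cong: distr_cong)
    then have D: "distributed M lborel Y (normal_density 0 \<sigma>)"
      using normal_standard_normal_convert[of \<sigma> Y 0] \<sigma> by simp
    then have "real_gaussian M Y" using \<sigma> by (auto simp: real_gaussian_def)
    moreover have "(\<integral>\<omega>. Y \<omega> \<partial>M) = 0" by (rule normal_distributed_expectation[OF \<sigma>(1) D])
    moreover have "(\<integral>\<omega>. (Y \<omega>)\<^sup>2 \<partial>M) = v"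
      using normal_distributed_variance[OF \<sigma>(1) D] calculation \<sigma> by simp
    moreover have "integrable M Y"
      using distributed_integrable[OF D, of "\<lambda>x. x"] integrable_normal_moment[OF \<sigma>(1), of 0 1] \<sigma> by simp
    moreover have "integrable M (\<lambda>\<omega>. (Y \<omega>)\<^sup>2)"
      using distributed_integrable[OF D, of "\<lambda>x. x\<^sup>2"] integrable_normal_moment[OF \<sigma>(1), of 0 2] \<sigma> by simp
    ultimately show ?thesis by blast
  qed
  then show "real_gaussian M Y" "integrable M (\<lambda>\<omega>. (Y \<omega>)\<^sup>2)" "(\<integral>\<omega>. (Y \<omega>)\<^sup>2 \<partial>M) = v"
    "integrable M Y" "(\<integral>\<omega>. Y \<omega> \<partial>M) = 0" by auto
qed

text \<open>Circular symmetry rotates \<open>t\<close> to the positive real axis, where only the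
  real part of \<open>W\<close> is seen.\<close>

lemma complex_gaussian_ccf:
  assumes "complex_gaussian M W"
  obtains c where "c \<ge> 0" "\<And>t. ccf W t = exp (- (c * (norm t)\<^sup>2))"
proof -
  have [measurable]: "W \<in> borel_measurable M" using assms by (simp add: complex_gaussian_def)
  have "real_gaussian M (\<lambda>\<omega>. 1 * Re (W \<omega>) + 0 * Im (W \<omega>))"
    using assms unfolding complex_gaussian_def by blast
  then have "real_gaussian M (\<lambda>\<omega>. Re (W \<omega>))" by simp
  then obtain \<mu> \<sigma> where char: "\<And>s. (\<integral>\<omega>. cis (s * Re (W \<omega>)) \<partial>M) = cis (s * \<mu>) * exp (- (\<sigma>\<^sup>2 * s\<^sup>2 / 2))"
    by (rule real_gaussian_char) blast
  have rot: "ccf (\<lambda>\<omega>. cis \<theta> * W \<omega>) t = ccf W t" for \<theta> t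
    using assms by (intro ccf_distr) (auto simp: complex_gaussian_def)
  have norm: "ccf W t = cis (norm t * \<mu>) * exp (- (\<sigma>\<^sup>2 * (norm t)\<^sup>2 / 2))" for t
  proof -
    have t: "t = norm t * cis (Arg t)" using rcis_cmod_Arg[of t] by (simp add: rcis_def)
    have "ccf W t = ccf (\<lambda>\<omega>. cis (Arg t) * W \<omega>) t" by (simp add: rot)
    also have "\<dots> = (\<integral>\<omega>. cis (norm t * Re (W \<omega>)) \<partial>M)"
    proof -
      have "cnj t * cis (Arg t) = complex_of_real (norm t)"
        by (subst (1) t) (simp add: cis_cnj cis_mult)
      then have "Re (cnj t * cis (Arg t) * w) = Re (complex_of_real (norm t) * w)" for w by (simp only:)
      then have "Re (cnj t * (cis (Arg t) * w)) = norm t * Re w" for w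
        by (simp only: mult.assoc times_complex.sel(1)[of "complex_of_real (norm t)"] Re_complex_of_real Im_complex_of_real mult_zero_left diff_zero)
      then show ?thesis unfolding ccf_def by (simp only:)
    qed
    finally show ?thesis by (simp add: char)
  qed
  have "\<mu> = 0"
  proof (rule ccontr)
    assume "\<mu> \<noteq> 0"
    \<comment> \<open>Chosen so that \<open>2 * s * \<mu>\<close> equals \<open>pi\<close>: symmetry
      under the rotation by \<open>pi\<close> would then force \<open>cis pi = 1\<close>.\<close>
    define s where "s = pi / (2 * \<mu>)"
    have "(\<integral>\<omega>. cis (s * Re (W \<omega>)) \<partial>M) = (\<integral>\<omega>. cis (- s * Re (W \<omega>)) \<partial>M)"
      using rot[of pi "complex_of_real s"] by (simp add: ccf_def)
    then have "cis (s * \<mu>) = cis (- s * \<mu>)" unfolding char by simp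
    then have "cis (s * \<mu>) * cis (s * \<mu>) = 1" by (metis cis_mult add.left_inverse cis_zero mult_minus_left)
    then have "cis pi = 1" using \<open>\<mu> \<noteq> 0\<close> by (simp add: cis_mult s_def)
    then show False by simp
  qed
  then have "ccf W t = exp (- (\<sigma>\<^sup>2 / 2 * (norm t)\<^sup>2))" for t
    using norm[of t] by simp
  then show ?thesis using that[of "\<sigma>\<^sup>2 / 2"] by simp
qed

text \<open>The rate \<open>c\<close> in the exponent means variance \<open>2 * c\<close> for each
  of the two real coordinates, hence complex variance \<open>4 * c\<close>.\<close>

lemma complex_gaussian_of_ccf:
  assumes W [measurable]: "W \<in> borel_measurable M" and c: "c \<ge> 0"
    and ccf: "\<And>t. ccf W t = exp (- (c * (norm t)\<^sup>2))"
  shows "complex_gaussian M W" "complex_variance M W = ennreal (4 * c)"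
    "integrable M (\<lambda>\<omega>. (Re (W \<omega>))\<^sup>2)" "integrable M (\<lambda>\<omega>. (Im (W \<omega>))\<^sup>2)"
    "(\<integral>\<omega>. (Re (W \<omega>))\<^sup>2 \<partial>M) = 2 * c" "(\<integral>\<omega>. (Im (W \<omega>))\<^sup>2 \<partial>M) = 2 * c"
    "(\<integral>\<omega>. Re (W \<omega>) \<partial>M) = 0" "(\<integral>\<omega>. Im (W \<omega>) \<partial>M) = 0"
proof -
  have char: "(\<integral>\<omega>. cis (s * (u * Re (W \<omega>) + v * Im (W \<omega>))) \<partial>M) = exp (- (2 * c * (u\<^sup>2 + v\<^sup>2) * s\<^sup>2 / 2))" for u v s
  proof -
    have "Re (cnj (Complex (s * u) (s * v)) * w) = s * (u * Re w + v * Im w)" for w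
      by (simp add: algebra_simps)
    then have "(\<integral>\<omega>. cis (s * (u * Re (W \<omega>) + v * Im (W \<omega>))) \<partial>M) = ccf W (Complex (s * u) (s * v))"
      by (simp add: ccf_def)
    moreover have "(norm (Complex (s * u) (s * v)))\<^sup>2 = (u\<^sup>2 + v\<^sup>2) * s\<^sup>2"
      by (simp add: cmod_power2 power_mult_distrib algebra_simps)
    ultimately show ?thesis unfolding ccf by simp
  qed
  note normal = normal_of_char[OF _ _ char]
  have N: "real_gaussian M (\<lambda>\<omega>. u * Re (W \<omega>) + v * Im (W \<omega>))" for u v
    using c by (intro normal) auto
  have R: "integrable M (\<lambda>\<omega>. Re (W \<omega>))" "(\<integral>\<omega>. Re (W \<omega>) \<partial>M) = 0" "integrable M (\<lambda>\<omega>. (Re (W \<omega>))\<^sup>2)"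
      "(\<integral>\<omega>. (Re (W \<omega>))\<^sup>2 \<partial>M) = 2 * c"
    using normal(2-)[of 1 0] c by auto
  have I: "integrable M (\<lambda>\<omega>. Im (W \<omega>))" "(\<integral>\<omega>. Im (W \<omega>) \<partial>M) = 0" "integrable M (\<lambda>\<omega>. (Im (W \<omega>))\<^sup>2)"
      "(\<integral>\<omega>. (Im (W \<omega>))\<^sup>2 \<partial>M) = 2 * c"
    using normal(2-)[of 0 1] c by auto
  show "integrable M (\<lambda>\<omega>. (Re (W \<omega>))\<^sup>2)" "integrable M (\<lambda>\<omega>. (Im (W \<omega>))\<^sup>2)"
    "(\<integral>\<omega>. (Re (W \<omega>))\<^sup>2 \<partial>M) = 2 * c" "(\<integral>\<omega>. (Im (W \<omega>))\<^sup>2 \<partial>M) = 2 * c"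
    "(\<integral>\<omega>. Re (W \<omega>) \<partial>M) = 0" "(\<integral>\<omega>. Im (W \<omega>) \<partial>M) = 0"
    using R I by auto
  have "integrable M W"
  proof -
    have "integrable M (\<lambda>\<omega>. complex_of_real (Re (W \<omega>)) + \<i> * complex_of_real (Im (W \<omega>)))"
      using R(1) I(1) by simp
    then show ?thesis by (simp add: complex_eq[symmetric])
  qed
  then have mean: "(\<integral>\<omega>. W \<omega> \<partial>M) = 0"
    using R(2) I(2) by (intro complex_eqI) simp_all
  have "distr M borel (\<lambda>\<omega>. cis \<theta> * W \<omega>) = distr M borel W" for \<theta>
  proof (rule distr_complex_eq_of_ccf)
    fix t
    have "ccf (\<lambda>\<omega>. cis \<theta> * W \<omega>) t = ccf W (cis (- \<theta>) * t)"
      by (simp add: ccf_def cis_cnj mult_ac)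
    then show "ccf (\<lambda>\<omega>. cis \<theta> * W \<omega>) t = ccf W t" by (simp add: ccf norm_mult)
  qed simp_all
  with N mean show "complex_gaussian M W" by (simp add: complex_gaussian_def)
  have "complex_variance M W = (\<integral>\<^sup>+\<omega>. ennreal ((Re (W \<omega>))\<^sup>2 + (Im (W \<omega>))\<^sup>2) \<partial>M)"
    by (simp add: complex_variance_def mean cmod_power2)
  also have "\<dots> = ennreal (\<integral>\<omega>. (Re (W \<omega>))\<^sup>2 + (Im (W \<omega>))\<^sup>2 \<partial>M)"
    using R I by (intro nn_integral_eq_integral) auto
  also have "\<dots> = ennreal (4 * c)" using R I by simp
  finally show "complex_variance M W = ennreal (4 * c)" .
qed

text \<open>The limit is the characteristic function of an actual variable and so is continuous at
  0. This keeps the rates from running off to infinity and forces them to converge.\<close>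

lemma ccf_gaussian_limit:
  assumes W [measurable]: "W \<in> borel_measurable M" and c: "\<And>k. c k \<ge> 0"
    and lim: "\<And>t. (\<lambda>k. complex_of_real (exp (- (c k * (norm t)\<^sup>2)))) \<longlonglongrightarrow> ccf W t"
  obtains d where "d \<ge> 0" "\<And>t. ccf W t = exp (- (d * (norm t)\<^sup>2))" "c \<longlonglongrightarrow> d"
proof -
  define r where "r = Re (ccf W 1)"
  have r: "(\<lambda>k. exp (- c k)) \<longlonglongrightarrow> r"
    using tendsto_Re[OF lim[of 1]] by (simp add: r_def)
  have r1: "r \<le> 1" using c by (intro LIMSEQ_le_const2[OF r]) auto
  have r0: "r \<ge> 0" by (intro LIMSEQ_le_const[OF r]) auto
  \<comment> \<open>If \<open>r\<close> were 0, the rates would tend to infinity and the limit would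
    vanish away from 0 while being 1 at 0.\<close>
  have "r \<noteq> 0"
  proof
    assume "r = 0"
    have z: "char (distr M borel (\<lambda>\<omega>. Re (W \<omega>))) s = 0" if "s \<noteq> 0" for s
    proof -
      have "(\<lambda>k. exp (- c k) powr s\<^sup>2) \<longlonglongrightarrow> r powr s\<^sup>2"
        using that \<open>r = 0\<close> by (intro tendsto_powr' r tendsto_const) auto
      then have "(\<lambda>k. complex_of_real (exp (- c k) powr s\<^sup>2)) \<longlonglongrightarrow> complex_of_real (r powr s\<^sup>2)"
        by (rule tendsto_of_real)
      moreover have "(\<lambda>k. complex_of_real (exp (- c k) powr s\<^sup>2)) \<longlonglongrightarrow> ccf W (complex_of_real s)"
        using lim[of "complex_of_real s"] by (simp add: powr_def mult.commute)
      ultimately have "ccf W (complex_of_real s) = 0"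
        using LIMSEQ_unique \<open>r = 0\<close> by fastforce
      then show ?thesis by (subst char_distr) (auto simp: ccf_def)
    qed
    interpret D: real_distribution "distr M borel (\<lambda>\<omega>. Re (W \<omega>))" by (auto intro!: real_distribution_distr)
    have "((\<lambda>s. char (distr M borel (\<lambda>\<omega>. Re (W \<omega>))) s) \<longlongrightarrow> 1) (at 0)"
      using D.isCont_char[of 0] D.char_zero by (simp add: isCont_def)
    moreover have "((\<lambda>s. char (distr M borel (\<lambda>\<omega>. Re (W \<omega>))) s) \<longlongrightarrow> 0) (at 0)"
      by (rule tendsto_eventually) (auto simp: eventually_at_filter z)
    ultimately have "(1 :: complex) = 0" by (rule tendsto_unique[rotated]) simp
    then show False by simp
  qed
  with r0 have "r > 0" by simp
  define d where "d = - ln r"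
  have "(\<lambda>k. - ln (exp (- c k))) \<longlonglongrightarrow> d"
    unfolding d_def using \<open>r > 0\<close> by (intro tendsto_intros r) auto
  then have cd: "c \<longlonglongrightarrow> d" by simp
  have "ccf W t = exp (- (d * (norm t)\<^sup>2))" for t
  proof (rule LIMSEQ_unique[OF lim])
    show "(\<lambda>k. complex_of_real (exp (- (c k * (norm t)\<^sup>2)))) \<longlonglongrightarrow> complex_of_real (exp (- (d * (norm t)\<^sup>2)))"
      by (intro tendsto_intros cd)
  qed
  moreover have "d \<ge> 0" using r1 \<open>r > 0\<close> by (simp add: d_def)
  ultimately show ?thesis using cd that by blast
qed

lemma ccf_tendsto_AE:
  assumes [measurable]: "W \<in> borel_measurable M" "\<And>k. V k \<in> borel_measurable M"
    and "AE \<omega> in M. (\<lambda>k. V k \<omega>) \<longlonglongrightarrow> W \<omega>"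
  shows "(\<lambda>k. ccf (V k) t) \<longlonglongrightarrow> ccf W t"
  unfolding ccf_def
proof (rule integral_dominated_convergence[where w = "\<lambda>_. 1"])
  show "AE \<omega> in M. (\<lambda>k. cis (Re (cnj t * V k \<omega>))) \<longlonglongrightarrow> cis (Re (cnj t * W \<omega>))"
    using assms(3)
  proof eventually_elim
    case (elim \<omega>)
    have "isCont cis x" for x
      using continuous_on_cis[OF continuous_on_id, of UNIV] by (simp add: continuous_on_eq_continuous_at)
    then show ?case by (rule isCont_tendsto_compose) (intro tendsto_intros elim)
  qed
qed auto

end

section \<open>A functional equation for Wigner matrices\<close>

text \<open>The invariance is differentiated at the identity along \<open>su2_path u\<close>, on a
  vector with two neighbouring nonzero entries. The positive factor \<open>ladder n k\<close> is
  common to the two surviving terms and cancels.\<close>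

lemma wD_path_coupling:
  fixes \<phi> :: "nat \<Rightarrow> complex \<Rightarrow> real" and \<phi>' :: "nat \<Rightarrow> complex \<Rightarrow> complex \<Rightarrow> real"
  assumes deriv: "\<And>k z. k \<le> n \<Longrightarrow> (\<phi> k has_derivative \<phi>' k z) (at z)"
    and zero: "\<And>k v. k \<le> n \<Longrightarrow> \<phi>' k 0 v = 0"
    and inv: "\<And>g t. g \<in> SU2 \<Longrightarrow> (\<Sum>k\<le>n. \<phi> k (\<Sum>q\<le>n. wD n k q g * t q)) = (\<Sum>k\<le>n. \<phi> k (t k))"
    and k: "k < n" and u: "norm u = 1"
  shows "\<phi>' k z (cnj u * w) = \<phi>' (Suc k) w (u * z)"
proof -
  define t where "t q = (if q = k then z else if q = Suc k then w else 0)" for q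
  define \<gamma> where "\<gamma> r \<tau> = (\<Sum>q\<le>n. wD n r q (su2_path u \<tau>) * t q)" for r \<tau>
  define J where "J j k = (if j = k + 1 then - ladder n k * u else if k = j + 1 then ladder n j * cnj u else 0)" for j k
  obtain l where l: "l > 0" "ladder n k = complex_of_real l" using ladder_pos[OF k] by blast
  have J: "(\<Sum>q\<le>n. J r q * t q) = J r k * z + J r (Suc k) * w" for r
  proof -
    have "(\<Sum>q\<le>n. J r q * t q) = (\<Sum>q\<in>{k, Suc k}. J r q * t q)"
      using k by (intro sum.mono_neutral_right) (auto simp: t_def)
    then show ?thesis by (simp add: t_def)
  qed
  have \<gamma>0: "\<gamma> r 0 = t r" if "r \<le> n" for r
    using that by (simp add: \<gamma>_def su2_path_0 wD_1)
  have "(\<phi> r \<circ> \<gamma> r has_vector_derivative \<phi>' r (t r) (\<Sum>q\<le>n. J r q * t q)) (at 0)" if r: "r \<le> n" for r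
  proof -
    have "(\<gamma> r has_vector_derivative (\<Sum>q\<le>n. J r q * t q)) (at 0)"
      unfolding \<gamma>_def J_def using r
      by (intro has_vector_derivative_sum has_vector_derivative_mult_left wD_su2_path_derivative) auto
    moreover have "(\<phi> r has_derivative \<phi>' r (t r)) (at (\<gamma> r 0))"
      using deriv[OF r] by (simp add: \<gamma>0[OF r])
    ultimately show ?thesis
      using has_derivative_at_withinI by (intro vector_derivative_diff_chain_within) auto
  qed
  then have "((\<lambda>\<tau>. \<Sum>r\<le>n. (\<phi> r \<circ> \<gamma> r) \<tau>) has_vector_derivative (\<Sum>r\<le>n. \<phi>' r (t r) (\<Sum>q\<le>n. J r q * t q))) (at 0)"
    by (intro has_vector_derivative_sum) (simp add: comp_def)
  moreover have "(\<lambda>\<tau>. \<Sum>r\<le>n. (\<phi> r \<circ> \<gamma> r) \<tau>) = (\<lambda>\<tau>. \<Sum>r\<le>n. \<phi> r (t r))"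
    using inv[OF su2_path_in_SU2[OF u]] by (simp add: \<gamma>_def)
  ultimately have "((\<lambda>\<tau>. \<Sum>r\<le>n. \<phi> r (t r)) has_vector_derivative (\<Sum>r\<le>n. \<phi>' r (t r) (\<Sum>q\<le>n. J r q * t q))) (at (0 :: real))"
    by (simp only:)
  then have "(\<Sum>r\<le>n. \<phi>' r (t r) (\<Sum>q\<le>n. J r q * t q)) = 0"
    by (rule vector_derivative_unique_at[OF _ has_vector_derivative_const])
  \<comment> \<open>Where \<open>t\<close> vanishes, the derivative of \<open>\<phi>\<close>
    vanishes as well by \<open>zero\<close>; so the outer neighbours of \<open>k\<close> and
    \<open>Suc k\<close> do not contribute.\<close>
  also have "(\<Sum>r\<le>n. \<phi>' r (t r) (\<Sum>q\<le>n. J r q * t q)) = (\<Sum>r\<in>{k, Suc k}. \<phi>' r (t r) (\<Sum>q\<le>n. J r q * t q))"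
    using k by (intro sum.mono_neutral_right) (auto simp: t_def zero)
  also have "\<dots> = \<phi>' k z (l *\<^sub>R (cnj u * w)) + \<phi>' (Suc k) w (- l *\<^sub>R (u * z))"
    unfolding J by (simp add: t_def J_def l scaleR_conv_of_real mult.assoc)
  also have "\<dots> = l * \<phi>' k z (cnj u * w) - l * \<phi>' (Suc k) w (u * z)"
  proof -
    have "linear (\<phi>' k z)" "linear (\<phi>' (Suc k) w)"
      using deriv[of k z] deriv[of "Suc k" w] k by (auto dest: has_derivative_linear)
    then show ?thesis by (simp add: linear_cmul linear_neg)
  qed
  finally show ?thesis using l by simp
qed

text \<open>The coupling shows that \<open>\<phi>' k z w\<close>, which is linear in \<open>w\<close>, is linear in \<open>z\<close> too; hence \<open>\<phi> k\<close>
  is quadratic, and the phases \<open>1\<close> and \<open>\<i>\<close> make the quadratic form a multiple of the norm.\<close>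

lemma wD_invariant_imp_quadratic:
  fixes \<phi> :: "nat \<Rightarrow> complex \<Rightarrow> real" and \<phi>' :: "nat \<Rightarrow> complex \<Rightarrow> complex \<Rightarrow> real"
  assumes n: "n \<ge> 1"
    and deriv: "\<And>k z. k \<le> n \<Longrightarrow> (\<phi> k has_derivative \<phi>' k z) (at z)"
    and zero: "\<And>k v. k \<le> n \<Longrightarrow> \<phi>' k 0 v = 0"
    and inv: "\<And>g t. g \<in> SU2 \<Longrightarrow> (\<Sum>k\<le>n. \<phi> k (\<Sum>q\<le>n. wD n k q g * t q)) = (\<Sum>k\<le>n. \<phi> k (t k))"
  obtains \<kappa> where "\<And>k z. k \<le> n \<Longrightarrow> \<phi> k z = \<phi> k 0 + \<kappa> * (norm z)\<^sup>2"
proof -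
  have lin: "linear (\<phi>' k z)" if "k \<le> n" for k z
    using deriv[OF that] by (rule has_derivative_linear)
  \<comment> \<open>The phase 1 exchanges the arguments of neighbouring derivatives; compared with
    it, the phase \<open>\<i>\<close> relates multiplication by \<open>\<i>\<close> in one argument
    to that in the other.\<close>
  have E1: "\<phi>' k z w = \<phi>' (Suc k) w z" if "k < n" for k z w
    using wD_path_coupling[OF deriv zero inv that, of 1 z w] by simp
  have E2: "\<phi>' k z (- \<i> * w) = \<phi>' (Suc k) w (\<i> * z)" if "k < n" for k z w
    using wD_path_coupling[OF deriv zero inv that, of \<i> z w] by simp
  have props: "linear (\<lambda>z. \<phi>' k z w) \<and> \<phi>' k z (\<i> * w) = - \<phi>' k (\<i> * z) w" if k: "k \<le> n" for k z w
  proof -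
    have i: "\<phi>' k z (\<i> * w) = - \<phi>' k (\<i> * z) w" if "k < n" for k z w
    proof -
      have "\<phi>' k (\<i> * z) w = \<phi>' k z (- \<i> * w)" using E1[OF that] E2[OF that] by simp
      also have "\<dots> = - \<phi>' k z (\<i> * w)" using lin[of k z] that by (simp add: linear_neg)
      finally show ?thesis by simp
    qed
    \<comment> \<open>The last index has no upper neighbour and uses the lower one, which exists
      because \<open>n \<ge> 1\<close>.\<close>
    consider "k < n" | k' where "k = Suc k'" "k' < n" using k n by (cases k) auto
    then show ?thesis
    proof cases
      case 1
      have "(\<lambda>z. \<phi>' k z w) = \<phi>' (Suc k) w" using E1[OF 1] by auto
      then show ?thesis using lin[of "Suc k" w] 1 i[OF 1, of z w] by auto
    next
      case 2
      have e: "\<phi>' k x y = \<phi>' k' y x" for x y using E1[OF 2(2)] 2(1) by simp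
      have "(\<lambda>z. \<phi>' k z w) = \<phi>' k' w" using e by auto
      moreover have "\<phi>' k z (\<i> * w) = - \<phi>' k (\<i> * z) w"
        using i[OF 2(2), of w z] e[of z "\<i> * w"] e[of "\<i> * z" w] by linarith
      ultimately show ?thesis using lin[of k' w] 2 by auto
    qed
  qed
  define b where "b k = \<phi>' k 1 1" for k
  have bz: "\<phi>' k z z = b k * (norm z)\<^sup>2" if k: "k \<le> n" for k z
  proof -
    have z: "z = Re z *\<^sub>R 1 + Im z *\<^sub>R \<i>" by (simp add: complex_eq_iff)
    have exp: "\<phi>' k (x *\<^sub>R 1 + y *\<^sub>R \<i>) (x' *\<^sub>R 1 + y' *\<^sub>R \<i>)
      = x * x' * \<phi>' k 1 1 + x * y' * \<phi>' k 1 \<i> + y * x' * \<phi>' k \<i> 1 + y * y' * \<phi>' k \<i> \<i>" for x y x' y'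
    proof -
      have l: "linear (\<lambda>z. \<phi>' k z w)" for w using props[OF k] by blast
      have "\<phi>' k (x *\<^sub>R 1 + y *\<^sub>R \<i>) w = x * \<phi>' k 1 w + y * \<phi>' k \<i> w" for w
        using linear_add[OF l, of "x *\<^sub>R 1" "y *\<^sub>R \<i>" w] linear_cmul[OF l, of x 1 w] linear_cmul[OF l, of y \<i> w] by simp
      moreover have "\<phi>' k v (x' *\<^sub>R 1 + y' *\<^sub>R \<i>) = x' * \<phi>' k v 1 + y' * \<phi>' k v \<i>" for v
        using linear_add[OF lin[OF k], of v "x' *\<^sub>R 1" "y' *\<^sub>R \<i>"] linear_cmul[OF lin[OF k], of v x' 1] linear_cmul[OF lin[OF k], of v y' \<i>] by simp
      ultimately show ?thesis by (simp add: algebra_simps)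
    qed
    \<comment> \<open>The mixed terms are opposite and the diagonal ones equal, so for equal
      arguments only a multiple of the squared norm survives.\<close>
    have i1: "\<phi>' k 1 \<i> = - \<phi>' k \<i> 1" using props[OF k, of 1 1] by simp
    have i2: "\<phi>' k \<i> \<i> = \<phi>' k 1 1"
    proof -
      have "\<phi>' k (- 1) 1 = - \<phi>' k 1 1" using props[OF k, of 1 1] linear_neg[of "\<lambda>z. \<phi>' k z 1" 1] by auto
      then show ?thesis using props[OF k, of 1 \<i>] by simp
    qed
    have "\<phi>' k z z = \<phi>' k (Re z *\<^sub>R 1 + Im z *\<^sub>R \<i>) (Re z *\<^sub>R 1 + Im z *\<^sub>R \<i>)" using z by simp
    also have "\<dots> = b k * (norm z)\<^sup>2"
      unfolding exp i1 i2 b_def cmod_power2 by (simp add: power2_eq_square algebra_simps)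
    finally show ?thesis .
  qed
  have bk: "b k = b 0" if "k \<le> n" for k
    using that
  proof (induction k)
    case (Suc k)
    then show ?case using E1[of k 1 1] by (simp add: b_def)
  qed simp
  have "\<phi> k z = \<phi> k 0 + b 0 / 2 * (norm z)\<^sup>2" if k: "k \<le> n" for k z
  proof -
    \<comment> \<open>Along the ray through \<open>z\<close> the derivative of
      \<open>\<phi> k\<close> is linear in \<open>s\<close>, so subtracting a parabola leaves a
      constant.\<close>
    define h where "h s = \<phi> k (s *\<^sub>R z) - s\<^sup>2 * (b 0 / 2 * (norm z)\<^sup>2)" for s :: real
    have "(h has_real_derivative 0) (at s)" for s
    proof -
      have "((\<lambda>s. \<phi> k (s *\<^sub>R z)) has_vector_derivative \<phi>' k (s *\<^sub>R z) z) (at s)"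
      proof -
        have "((\<lambda>s. s *\<^sub>R z) has_vector_derivative z) (at s)"
          by (auto intro!: derivative_eq_intros)
        from vector_derivative_diff_chain_within[OF this, of "\<phi> k" "\<phi>' k (s *\<^sub>R z)"]
        show ?thesis using has_derivative_at_withinI[OF deriv[OF k, of "s *\<^sub>R z"]] by (simp add: comp_def)
      qed
      moreover have "\<phi>' k (s *\<^sub>R z) z = s * (b 0 * (norm z)\<^sup>2)"
        using props[OF k] linear_cmul[of "\<lambda>v. \<phi>' k v z" s z] bz[OF k, of z] bk[OF k] by simp
      ultimately have "((\<lambda>s. \<phi> k (s *\<^sub>R z)) has_real_derivative s * (b 0 * (norm z)\<^sup>2)) (at s)"
        by (simp add: has_real_derivative_iff_has_vector_derivative)
      then show ?thesis unfolding h_def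
        by (auto intro!: derivative_eq_intros)
    qed
    then have "h 1 = h 0" by (intro DERIV_isconst_all) auto
    then show ?thesis by (simp add: h_def)
  qed
  then show ?thesis by (rule that)
qed

section \<open>Gaussian smoothing\<close>

lemma sq_exp_neg_le: "x\<^sup>2 * exp (- (x\<^sup>2 / 2)) \<le> (1 :: real)"
proof -
  define v where "v = x\<^sup>2 / 2"
  have "v \<ge> 0" by (simp add: v_def)
  then have "1 + v + v\<^sup>2 / 2 \<le> exp v" by (rule exp_lower_Taylor_quadratic)
  \<comment> \<open>Twice the difference of \<open>1 + v + v^2 / 2\<close> and \<open>2 * v\<close>
    is \<open>(v - 1)^2 + 1\<close>.\<close>
  moreover have "0 \<le> (v - 1)\<^sup>2" by simp
  then have "2 * v \<le> 1 + v + v\<^sup>2 / 2" by (simp add: power2_eq_square algebra_simps)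
  ultimately have "2 * v \<le> exp v" by simp
  then have "2 * v * exp (- v) \<le> exp v * exp (- v)" by (intro mult_right_mono) auto
  then show ?thesis by (simp add: v_def exp_minus)
qed

text \<open>A first-order expansion whose remainder is uniform in \<open>x\<close>: it can be
  integrated against any law, without moments.\<close>

lemma gauss_kernel_taylor:
  fixes x h :: complex
  shows "\<bar>exp (- ((norm (x + h))\<^sup>2 / 2)) - exp (- ((norm x)\<^sup>2 / 2)) + (x \<bullet> h) * exp (- ((norm x)\<^sup>2 / 2))\<bar> \<le> (norm h)\<^sup>2"
proof -
  \<comment> \<open>The kernel along the line through \<open>x\<close> in direction
    \<open>h\<close>; \<open>d\<close> lists it and its first two derivatives for Maclaurin's
    formula on the unit interval.\<close>
  define f where "f u = exp (- ((norm x)\<^sup>2 / 2) - u * (x \<bullet> h) - u\<^sup>2 * ((norm h)\<^sup>2 / 2))" for u :: real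
  define d where "d m u = (if m = 0 then f u else if m = 1 then - (x \<bullet> h + u * (norm h)\<^sup>2) * f u
     else ((x \<bullet> h + u * (norm h)\<^sup>2)\<^sup>2 - (norm h)\<^sup>2) * f u)" for m :: nat and u
  have fe: "f u = exp (- ((norm (x + u *\<^sub>R h))\<^sup>2 / 2))" for u
  proof -
    have "(norm (x + u *\<^sub>R h))\<^sup>2 = (norm x)\<^sup>2 + 2 * u * (x \<bullet> h) + u\<^sup>2 * (norm h)\<^sup>2"
      unfolding power2_norm_eq_inner by (simp add: inner_add_left inner_add_right inner_commute power2_eq_square algebra_simps)
    then have "- ((norm x)\<^sup>2 / 2) - u * (x \<bullet> h) - u\<^sup>2 * ((norm h)\<^sup>2 / 2) = - ((norm (x + u *\<^sub>R h))\<^sup>2 / 2)"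
      by (simp add: add_divide_distrib)
    then show ?thesis by (simp only: f_def)
  qed
  have "\<exists>t. 0 < t \<and> t \<le> 1 \<and> f 1 = (\<Sum>m<2. d m 0 / fact m * 1 ^ m) + d 2 t / fact 2 * 1 ^ 2"
  proof (rule Maclaurin2)
    show "\<forall>m t. m < 2 \<and> 0 \<le> t \<and> t \<le> 1 \<longrightarrow> DERIV (d m) t :> d (Suc m) t"
    proof (intro allI impI)
      fix m :: nat and t :: real assume "m < 2 \<and> 0 \<le> t \<and> t \<le> 1"
      have f: "(f has_real_derivative - (x \<bullet> h + t * (norm h)\<^sup>2) * f t) (at t)"
      proof -
        have "((\<lambda>u. - ((norm x)\<^sup>2 / 2) - u * (x \<bullet> h) - u\<^sup>2 * ((norm h)\<^sup>2 / 2)) has_real_derivative - (x \<bullet> h + t * (norm h)\<^sup>2)) (at t)"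
          by (auto intro!: derivative_eq_intros)
        from DERIV_chain2[OF DERIV_exp this] show ?thesis unfolding f_def by (simp only: mult.commute)
      qed
      have "m = 0 \<or> m = 1" using \<open>m < 2 \<and> 0 \<le> t \<and> t \<le> 1\<close> by auto
      then show "DERIV (d m) t :> d (Suc m) t"
      proof
        assume "m = 0"
        then show ?thesis using f by (simp add: d_def[abs_def])
      next
        assume "m = 1"
        moreover have "((\<lambda>u. - (x \<bullet> h + u * (norm h)\<^sup>2) * f u) has_real_derivative ((x \<bullet> h + t * (norm h)\<^sup>2)\<^sup>2 - (norm h)\<^sup>2) * f t) (at t)"
        proof -
          have g: "((\<lambda>u. - (x \<bullet> h + u * (norm h)\<^sup>2)) has_real_derivative - (norm h)\<^sup>2) (at t)"
            by (auto intro!: derivative_eq_intros)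
          show ?thesis
            by (rule DERIV_cong[OF DERIV_mult[OF g f]]) (simp add: power2_eq_square[of "x \<bullet> h + t * (norm h)\<^sup>2"] algebra_simps)
        qed
        ultimately show ?thesis by (simp add: d_def[abs_def])
      qed
    qed
  qed (auto simp: d_def)
  then obtain t where t: "f 1 = f 0 - (x \<bullet> h) * f 0 + d 2 t / 2"
    by (auto simp: numeral_2_eq_2 d_def)
  have "\<bar>d 2 t\<bar> \<le> (norm h)\<^sup>2 + (norm h)\<^sup>2"
  proof -
    let ?y = "x + t *\<^sub>R h"
    have "x \<bullet> h + t * (norm h)\<^sup>2 = ?y \<bullet> h"
      by (simp add: inner_add_left power2_norm_eq_inner)
    then have "(x \<bullet> h + t * (norm h)\<^sup>2)\<^sup>2 \<le> (norm ?y * norm h)\<^sup>2"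
      using Cauchy_Schwarz_ineq[of ?y h] by (simp add: power_mult_distrib power2_norm_eq_inner)
    then have "(x \<bullet> h + t * (norm h)\<^sup>2)\<^sup>2 * f t \<le> (norm h)\<^sup>2 * ((norm ?y)\<^sup>2 * exp (- ((norm ?y)\<^sup>2 / 2)))"
      unfolding fe using mult_right_mono[of _ _ "exp (- ((norm ?y)\<^sup>2 / 2))"]
      by (simp add: power_mult_distrib mult_ac)
    also have "\<dots> \<le> (norm h)\<^sup>2"
      using mult_left_mono[OF sq_exp_neg_le[of "norm ?y"], of "(norm h)\<^sup>2"] by simp
    finally have 1: "(x \<bullet> h + t * (norm h)\<^sup>2)\<^sup>2 * f t \<le> (norm h)\<^sup>2" .
    have "f t \<le> 1" "f t \<ge> 0" unfolding fe by auto
    then have 2: "(norm h)\<^sup>2 * f t \<le> (norm h)\<^sup>2" "(norm h)\<^sup>2 * f t \<ge> 0" "(x \<bullet> h + t * (norm h)\<^sup>2)\<^sup>2 * f t \<ge> 0"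
      by (auto intro!: mult_left_le)
    have "d 2 t = (x \<bullet> h + t * (norm h)\<^sup>2)\<^sup>2 * f t - (norm h)\<^sup>2 * f t"
      by (simp add: d_def left_diff_distrib)
    then show ?thesis using 1 2 by linarith
  qed
  then show ?thesis using t fe[of 1] fe[of 0] by simp
qed

context prob_space
begin

text \<open>Up to the factor \<open>1 / (2 * pi)\<close>, the density of \<open>A\<close> plus an
  independent standard Gaussian of the plane.\<close>

definition gsm :: "('a \<Rightarrow> complex) \<Rightarrow> complex \<Rightarrow> real" where
  "gsm A z = (\<integral>\<omega>. exp (- ((norm (z - A \<omega>))\<^sup>2 / 2)) \<partial>M)"

lemma integrable_gsm:
  fixes A :: "'a \<Rightarrow> complex"
  assumes [measurable]: "A \<in> borel_measurable M"
  shows "integrable M (\<lambda>\<omega>. exp (- ((norm (z - A \<omega>))\<^sup>2 / 2)))"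
  by (rule integrable_const_bound[where B = 1]) auto

lemma gsm_pos:
  fixes A :: "'a \<Rightarrow> complex"
  assumes [measurable]: "A \<in> borel_measurable M"
  shows "gsm A z > 0"
proof -
  have "gsm A z \<ge> 0" unfolding gsm_def by (intro integral_nonneg_AE) auto
  moreover have "gsm A z \<noteq> 0"
    unfolding gsm_def by (subst integral_nonneg_eq_0_iff_AE[OF integrable_gsm]) auto
  ultimately show ?thesis by simp
qed

text \<open>Minus the gradient of \<open>gsm A\<close>, as obtained by differentiating under the
  integral.\<close>

definition gsm_grad :: "('a \<Rightarrow> complex) \<Rightarrow> complex \<Rightarrow> complex" where
  "gsm_grad A z = (\<integral>\<omega>. exp (- ((norm (z - A \<omega>))\<^sup>2 / 2)) *\<^sub>R (z - A \<omega>) \<partial>M)"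

lemma integrable_gsm_grad:
  fixes A :: "'a \<Rightarrow> complex"
  assumes [measurable]: "A \<in> borel_measurable M"
  shows "integrable M (\<lambda>\<omega>. exp (- ((norm (z - A \<omega>))\<^sup>2 / 2)) *\<^sub>R (z - A \<omega>))"
proof (rule integrable_bounded_complex[where B = 1])
  have "norm x * exp (- ((norm x)\<^sup>2 / 2)) \<le> 1" for x :: complex
  proof (cases "norm x \<le> 1")
    case True
    then show ?thesis by (intro mult_le_one) auto
  next
    case False
    then have "norm x \<le> (norm x)\<^sup>2" by (intro self_le_power) auto
    then show ?thesis by (intro order_trans[OF mult_right_mono sq_exp_neg_le]) auto
  qed
  then show "norm (exp (- ((norm (z - A \<omega>))\<^sup>2 / 2)) *\<^sub>R (z - A \<omega>)) \<le> 1" for \<omega>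
    by (simp add: mult.commute)
qed simp

lemma gsm_has_derivative:
  fixes A :: "'a \<Rightarrow> complex"
  assumes [measurable]: "A \<in> borel_measurable M"
  shows "(gsm A has_derivative (\<lambda>h. - (gsm_grad A z \<bullet> h))) (at z)"
  unfolding has_derivative_at_alt
proof (intro conjI allI impI)
  show "bounded_linear (\<lambda>h. - (gsm_grad A z \<bullet> h))"
    by (intro bounded_linear_minus bounded_linear_inner_right)
  fix e :: real assume e: "0 < e"
  show "\<exists>d>0. \<forall>y. norm (y - z) < d \<longrightarrow> norm (gsm A y - gsm A z - - (gsm_grad A z \<bullet> (y - z))) \<le> e * norm (y - z)"
  \<comment> \<open>The remainder is at most the square of \<open>norm (y - z)\<close>, so
    \<open>e\<close> itself serves as the radius.\<close>
  proof (intro exI[of _ e] conjI allI impI e)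
    fix y assume y: "norm (y - z) < e"
    have i: "integrable M (\<lambda>\<omega>. (exp (- ((norm (z - A \<omega>))\<^sup>2 / 2)) *\<^sub>R (z - A \<omega>)) \<bullet> (y - z))"
      by (intro integrable_inner_left integrable_gsm_grad) simp
    define G where "G \<omega> = exp (- ((norm (y - A \<omega>))\<^sup>2 / 2)) - exp (- ((norm (z - A \<omega>))\<^sup>2 / 2)) + (exp (- ((norm (z - A \<omega>))\<^sup>2 / 2)) *\<^sub>R (z - A \<omega>)) \<bullet> (y - z)" for \<omega>
    have iG: "integrable M G"
      unfolding G_def
      by (intro Bochner_Integration.integrable_add Bochner_Integration.integrable_diff i integrable_gsm) simp_all
    have "gsm_grad A z \<bullet> (y - z) = (\<integral>\<omega>. (exp (- ((norm (z - A \<omega>))\<^sup>2 / 2)) *\<^sub>R (z - A \<omega>)) \<bullet> (y - z) \<partial>M)"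
      unfolding gsm_grad_def by (rule integral_inner_left[symmetric]) (simp add: integrable_gsm_grad)
    then have eq: "gsm A y - gsm A z - - (gsm_grad A z \<bullet> (y - z)) = integral\<^sup>L M G"
      unfolding gsm_def G_def using i integrable_gsm[of A y] integrable_gsm[of A z]
      by (simp only: minus_diff_eq diff_minus_eq_add Bochner_Integration.integral_add Bochner_Integration.integral_diff Bochner_Integration.integrable_diff assms)
    have "norm (integral\<^sup>L M G) \<le> (\<integral>\<omega>. norm (G \<omega>) \<partial>M)"
      by (rule integral_norm_bound)
    also have "\<dots> \<le> (\<integral>\<omega>. (norm (y - z))\<^sup>2 \<partial>M)"
    proof (rule integral_mono)
      show "norm (G \<omega>) \<le> (norm (y - z))\<^sup>2" for \<omega>
        using gauss_kernel_taylor[of "z - A \<omega>" "y - z"] by (simp add: G_def mult.commute)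
    qed (use iG in simp_all)
    also have "\<dots> = norm (y - z) * norm (y - z)" by (simp add: prob_space power2_eq_square)
    also have "\<dots> \<le> e * norm (y - z)" using y by (intro mult_right_mono) auto
    finally show "norm (gsm A y - gsm A z - - (gsm_grad A z \<bullet> (y - z))) \<le> e * norm (y - z)"
      unfolding eq .
  qed
qed

text \<open>Central symmetry enters here: the integrand is an odd function of \<open>A\<close>, so
  its expectation is its own negative.\<close>

lemma gsm_grad_0:
  fixes A :: "'a \<Rightarrow> complex"
  assumes [measurable]: "A \<in> borel_measurable M" and sym: "centrally_symmetric M A"
  shows "gsm_grad A 0 = 0"
proof -
  define f where "f z = exp (- ((norm z)\<^sup>2 / 2)) *\<^sub>R z" for z :: complex
  have [measurable]: "f \<in> borel_measurable borel" unfolding f_def by measurable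
  have "(\<integral>\<omega>. f (- A \<omega>) \<partial>M) = (\<integral>z. f z \<partial>distr M borel (\<lambda>\<omega>. - A \<omega>))"
    by (subst integral_distr) auto
  also have "\<dots> = (\<integral>z. f z \<partial>distr M borel A)" using sym by (simp add: centrally_symmetric_def)
  also have "\<dots> = (\<integral>\<omega>. f (A \<omega>) \<partial>M)" by (subst integral_distr) auto
  also have "\<dots> = - (\<integral>\<omega>. f (- A \<omega>) \<partial>M)" by (simp add: f_def)
  finally have "(\<integral>\<omega>. f (- A \<omega>) \<partial>M) = 0" by simp
  then show ?thesis by (simp add: gsm_grad_def f_def)
qed

text \<open>Decay in one direction is enough to decide the sign of the exponent once
  \<open>gsm A\<close> is known to be a multiple of the exponential of a quadratic.\<close>

lemma gsm_tendsto_0: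
  fixes A :: "'a \<Rightarrow> complex"
  assumes [measurable]: "A \<in> borel_measurable M"
  shows "(\<lambda>m. gsm A (of_nat m)) \<longlonglongrightarrow> 0"
proof -
  have "(\<lambda>m. gsm A (of_nat m)) \<longlonglongrightarrow> (\<integral>\<omega>. 0 \<partial>M)"
    unfolding gsm_def
  proof (rule integral_dominated_convergence[where w = "\<lambda>_. 1"])
    have "(\<lambda>m. exp (- ((norm (of_nat m - a))\<^sup>2 / 2))) \<longlonglongrightarrow> 0" for a :: complex
    proof -
      have "(\<lambda>m. exp (- (((real m - Re a)\<^sup>2 + (Im a)\<^sup>2) / 2))) \<longlonglongrightarrow> 0" by real_asymp
      then show ?thesis by (simp add: cmod_power2)
    qed
    then show "AE \<omega> in M. (\<lambda>m. exp (- ((norm (of_nat m - A \<omega>))\<^sup>2 / 2))) \<longlonglongrightarrow> 0" by simp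
  qed auto
  then show ?thesis by simp
qed

end

section \<open>Undoing the smoothing\<close>

lemma gauss_fourier:
  assumes \<kappa>: "\<kappa> > 0"
  shows "(\<integral>y. cis (s * y) * complex_of_real (exp (- (\<kappa> * (y - b)\<^sup>2))) \<partial>lborel)
      = complex_of_real (sqrt (pi / \<kappa>)) * cis (s * b) * complex_of_real (exp (- (s\<^sup>2 / (4 * \<kappa>))))"
    and "integrable lborel (\<lambda>y. exp (- (\<kappa> * (y - b)\<^sup>2)))"
    and "(\<integral>y. exp (- (\<kappa> * (y - b)\<^sup>2)) \<partial>lborel) = sqrt (pi / \<kappa>)"
proof -
  define \<sigma> where "\<sigma> = sqrt (1 / (2 * \<kappa>))"
  have \<sigma>: "\<sigma> > 0" "\<sigma>\<^sup>2 = 1 / (2 * \<kappa>)" using \<kappa> by (simp_all add: \<sigma>_def)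
  have e: "exp (- (\<kappa> * (y - b)\<^sup>2)) = sqrt (pi / \<kappa>) * normal_density b \<sigma> y" for y
    using \<kappa> by (simp add: normal_density_def \<sigma>)
  show "integrable lborel (\<lambda>y. exp (- (\<kappa> * (y - b)\<^sup>2)))"
    unfolding e using \<sigma> by simp
  show "(\<integral>y. exp (- (\<kappa> * (y - b)\<^sup>2)) \<partial>lborel) = sqrt (pi / \<kappa>)"
    unfolding e using \<sigma> by simp
  let ?N = "density lborel (normal_density b \<sigma>)"
  interpret N: prob_space ?N by (rule prob_space_normal_density[OF \<sigma>(1)])
  have "distributed ?N lborel (\<lambda>x. x) (normal_density b \<sigma>)"
    by (simp add: distributed_def distr_id2)
  from N.distributed_normal_char[OF this \<sigma>(1), of s]
  have "(\<integral>y. normal_density b \<sigma> y *\<^sub>R cis (s * y) \<partial>lborel) = cis (s * b) * exp (- (\<sigma>\<^sup>2 * s\<^sup>2 / 2))"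
    by (subst (asm) integral_density) auto
  moreover have "(\<integral>y. cis (s * y) * complex_of_real (exp (- (\<kappa> * (y - b)\<^sup>2))) \<partial>lborel)
    = complex_of_real (sqrt (pi / \<kappa>)) * (\<integral>y. normal_density b \<sigma> y *\<^sub>R cis (s * y) \<partial>lborel)"
    unfolding integral_mult_right_zero[symmetric]
    by (intro Bochner_Integration.integral_cong refl) (simp only: e of_real_mult scaleR_conv_of_real mult_ac)
  ultimately show "(\<integral>y. cis (s * y) * complex_of_real (exp (- (\<kappa> * (y - b)\<^sup>2))) \<partial>lborel)
      = complex_of_real (sqrt (pi / \<kappa>)) * cis (s * b) * complex_of_real (exp (- (s\<^sup>2 / (4 * \<kappa>))))"
    by (simp only: \<sigma> mult.assoc) (simp add: mult.commute)
qed

context prob_space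
begin

text \<open>Deconvolution: by Fubini the Fourier transform of the smoothed function is the wanted
  expectation times a Gaussian factor, which has no zeros and is divided out. The weight
  \<open>W\<close> carries the other real coordinate.\<close>

lemma fourier_of_smoothed:
  fixes W :: "'a \<Rightarrow> complex" and B :: "'a \<Rightarrow> real"
  assumes [measurable]: "W \<in> borel_measurable M" "B \<in> borel_measurable M"
    and W: "\<And>\<omega>. norm (W \<omega>) \<le> 1" and \<kappa>: "\<kappa> > 0"
    and eq: "\<And>y. (\<integral>\<omega>. W \<omega> * complex_of_real (exp (- ((y - B \<omega>)\<^sup>2 / 2))) \<partial>M) = C * complex_of_real (exp (- (\<kappa> * y\<^sup>2)))"
  shows "(\<integral>\<omega>. W \<omega> * cis (s * B \<omega>) \<partial>M)
    = C * complex_of_real (sqrt (pi / \<kappa>) / sqrt (2 * pi) * exp (- ((1 / (4 * \<kappa>) - 1 / 2) * s\<^sup>2)))"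
proof -
  interpret P: pair_sigma_finite M lborel ..
  let ?f = "\<lambda>\<omega> y. W \<omega> * (cis (s * y) * complex_of_real (exp (- (1 / 2 * (y - B \<omega>)\<^sup>2))))"
  note G = gauss_fourier[of "1 / 2", simplified]
  have n: "norm (?f \<omega> y) = norm (W \<omega>) * exp (- (1 / 2 * (y - B \<omega>)\<^sup>2))" for \<omega> y
    by (simp add: norm_mult)
  have int: "integrable (M \<Otimes>\<^sub>M lborel) (case_prod ?f)"
  proof (rule P.Fubini_integrable)
    have "(\<integral>y. norm (?f \<omega> y) \<partial>lborel) = norm (W \<omega>) * sqrt (2 * pi)" for \<omega>
      unfolding n using gauss_fourier(3)[of "1 / 2" "B \<omega>"] by (simp add: mult.commute)
    moreover have "integrable M (\<lambda>\<omega>. norm (W \<omega>) * sqrt (2 * pi))"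
      using W by (intro integrable_mult_left integrable_norm integrable_bounded_complex[where B = 1]) simp
    ultimately show "integrable M (\<lambda>\<omega>. \<integral>y. norm (case_prod ?f (\<omega>, y)) \<partial>lborel)" by simp
    show "AE \<omega> in M. integrable lborel (\<lambda>y. case_prod ?f (\<omega>, y))"
    proof (rule AE_I2)
      fix \<omega>
      have "integrable lborel (\<lambda>y. norm (W \<omega>) * exp (- (1 / 2 * (y - B \<omega>)\<^sup>2)))"
        by (intro integrable_mult_right gauss_fourier) simp
      then show "integrable lborel (\<lambda>y. case_prod ?f (\<omega>, y))"
        by (rule Bochner_Integration.integrable_bound) (auto simp: norm_mult)
    qed
  qed measurable
  have F: "(\<integral>y. \<integral>\<omega>. ?f \<omega> y \<partial>M \<partial>lborel) = (\<integral>\<omega>. \<integral>y. ?f \<omega> y \<partial>lborel \<partial>M)"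
    by (rule P.Fubini_integral[OF int])
  have a: "(\<integral>\<omega>. ?f \<omega> y \<partial>M) = C * (cis (s * y) * complex_of_real (exp (- (\<kappa> * (y - 0)\<^sup>2))))" for y
  proof -
    have "(\<integral>\<omega>. ?f \<omega> y \<partial>M) = cis (s * y) * (\<integral>\<omega>. W \<omega> * complex_of_real (exp (- ((y - B \<omega>)\<^sup>2 / 2))) \<partial>M)"
      unfolding integral_mult_right_zero[symmetric]
      by (intro Bochner_Integration.integral_cong refl) simp
    then show ?thesis unfolding eq by simp
  qed
  have b: "(\<integral>y. C * (cis (s * y) * complex_of_real (exp (- (\<kappa> * (y - 0)\<^sup>2)))) \<partial>lborel)
    = C * (complex_of_real (sqrt (pi / \<kappa>)) * complex_of_real (exp (- (s\<^sup>2 / (4 * \<kappa>)))))"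
    using gauss_fourier(1)[OF \<kappa>, of s 0] by simp
  have c: "(\<integral>y. ?f \<omega> y \<partial>lborel) = complex_of_real (sqrt (2 * pi) * exp (- (s\<^sup>2 / 2))) * (W \<omega> * cis (s * B \<omega>))" for \<omega>
    using gauss_fourier(1)[of "1 / 2" s "B \<omega>"] by (simp add: mult_ac)
  have "complex_of_real (sqrt (2 * pi) * exp (- (s\<^sup>2 / 2))) * (\<integral>\<omega>. W \<omega> * cis (s * B \<omega>) \<partial>M)
    = C * complex_of_real (sqrt (pi / \<kappa>) * exp (- (s\<^sup>2 / (4 * \<kappa>))))"
    using F unfolding a b c by (simp only: integral_mult_right_zero of_real_mult)
  also have "sqrt (pi / \<kappa>) * exp (- (s\<^sup>2 / (4 * \<kappa>)))
    = sqrt (2 * pi) * exp (- (s\<^sup>2 / 2)) * (sqrt (pi / \<kappa>) / sqrt (2 * pi) * exp (- ((1 / (4 * \<kappa>) - 1 / 2) * s\<^sup>2)))"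
  proof -
    have "exp (- (s\<^sup>2 / (4 * \<kappa>))) = exp (- (s\<^sup>2 / 2)) * exp (- ((1 / (4 * \<kappa>) - 1 / 2) * s\<^sup>2))"
      by (simp add: exp_add[symmetric] left_diff_distrib)
    then show ?thesis by simp
  qed
  also have "C * complex_of_real \<dots> = complex_of_real (sqrt (2 * pi) * exp (- (s\<^sup>2 / 2))) * (C * complex_of_real (sqrt (pi / \<kappa>) / sqrt (2 * pi) * exp (- ((1 / (4 * \<kappa>) - 1 / 2) * s\<^sup>2))))"
    by (simp only: of_real_mult mult_ac)
  finally have "complex_of_real (sqrt (2 * pi) * exp (- (s\<^sup>2 / 2))) * (\<integral>\<omega>. W \<omega> * cis (s * B \<omega>) \<partial>M)
    = complex_of_real (sqrt (2 * pi) * exp (- (s\<^sup>2 / 2))) * (C * complex_of_real (sqrt (pi / \<kappa>) / sqrt (2 * pi) * exp (- ((1 / (4 * \<kappa>) - 1 / 2) * s\<^sup>2))))" .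
  then show ?thesis by (rule mult_left_cancel[THEN iffD1, rotated]) simp
qed

text \<open>The two real coordinates are deconvolved one after the other. Smoothing adds 1 to the
  variance of each: the smoothed variance is \<open>1 / (2 * \<kappa>)\<close>, and half of
  \<open>1 / (2 * \<kappa>) - 1\<close> is the rate that remains.\<close>

lemma ccf_of_gsm:
  fixes A :: "'a \<Rightarrow> complex"
  assumes A [measurable]: "A \<in> borel_measurable M" and \<kappa>: "\<kappa> > 0"
    and eq: "\<And>z. gsm A z = p * exp (- (\<kappa> * (norm z)\<^sup>2))"
  shows "0 \<le> 1 / (4 * \<kappa>) - 1 / 2" "ccf A t = exp (- ((1 / (4 * \<kappa>) - 1 / 2) * (norm t)\<^sup>2))"
proof -
  define q where "q = 1 / (4 * \<kappa>) - 1 / 2"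
  define c where "c = sqrt (pi / \<kappa>) / sqrt (2 * pi)"
  have 1: "(\<integral>\<omega>. complex_of_real (exp (- ((y - Im (A \<omega>))\<^sup>2 / 2))) * complex_of_real (exp (- ((x - Re (A \<omega>))\<^sup>2 / 2))) \<partial>M)
    = complex_of_real (p * exp (- (\<kappa> * y\<^sup>2))) * complex_of_real (exp (- (\<kappa> * x\<^sup>2)))" for x y
  proof -
    have "exp (- ((y - Im a)\<^sup>2 / 2)) * exp (- ((x - Re a)\<^sup>2 / 2)) = exp (- ((norm (Complex x y - a))\<^sup>2 / 2))" for a
      unfolding exp_add[symmetric] by (simp add: cmod_power2 add_divide_distrib)
    then have "(\<integral>\<omega>. complex_of_real (exp (- ((y - Im (A \<omega>))\<^sup>2 / 2))) * complex_of_real (exp (- ((x - Re (A \<omega>))\<^sup>2 / 2))) \<partial>M)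
      = complex_of_real (gsm A (Complex x y))"
      unfolding gsm_def by (simp only: of_real_mult[symmetric] integral_complex_of_real)
    also have "gsm A (Complex x y) = p * exp (- (\<kappa> * y\<^sup>2)) * exp (- (\<kappa> * x\<^sup>2))"
      unfolding eq mult.assoc exp_add[symmetric] by (simp add: cmod_power2 distrib_left)
    finally show ?thesis by simp
  qed
  have 2: "(\<integral>\<omega>. complex_of_real (exp (- ((y - Im (A \<omega>))\<^sup>2 / 2))) * cis (s * Re (A \<omega>)) \<partial>M)
    = complex_of_real (p * exp (- (\<kappa> * y\<^sup>2))) * complex_of_real (c * exp (- (q * s\<^sup>2)))" for y s
    unfolding c_def q_def by (rule fourier_of_smoothed[OF _ _ _ \<kappa> 1]) simp_all
  have 3: "(\<integral>\<omega>. cis (s * Re (A \<omega>)) * cis (r * Im (A \<omega>)) \<partial>M)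
    = complex_of_real (p * (c * exp (- (q * s\<^sup>2)))) * complex_of_real (c * exp (- (q * r\<^sup>2)))" for r s
    unfolding c_def[of] q_def[of]
  proof (rule fourier_of_smoothed[OF _ _ _ \<kappa>])
    fix y
    show "(\<integral>\<omega>. cis (s * Re (A \<omega>)) * complex_of_real (exp (- ((y - Im (A \<omega>))\<^sup>2 / 2))) \<partial>M)
      = complex_of_real (p * (sqrt (pi / \<kappa>) / sqrt (2 * pi) * exp (- ((1 / (4 * \<kappa>) - 1 / 2) * s\<^sup>2)))) * complex_of_real (exp (- (\<kappa> * y\<^sup>2)))"
      using 2[of y s] by (simp add: c_def q_def mult_ac)
  qed simp_all
  \<comment> \<open>Total mass 1, read at frequency 0, fixes the unknown prefactor
    \<open>p\<close>.\<close>
  have "complex_of_real (p * c * c) = 1"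
    using 3[of 0 0] by (simp add: prob_space mult_ac)
  then have pcc: "p * c * c = 1" by (simp only: of_real_eq_1_iff)
  have cc: "ccf A t = exp (- (q * (norm t)\<^sup>2))" for t
  proof -
    have "ccf A t = (\<integral>\<omega>. cis (Re t * Re (A \<omega>)) * cis (Im t * Im (A \<omega>)) \<partial>M)"
      by (simp add: ccf_def cis_mult)
    also have "\<dots> = complex_of_real ((p * c * c) * (exp (- (q * (Re t)\<^sup>2)) * exp (- (q * (Im t)\<^sup>2))))"
      unfolding 3 by (simp add: mult_ac)
    also have "\<dots> = exp (- (q * (norm t)\<^sup>2))"
      unfolding pcc exp_add[symmetric] by (simp add: cmod_power2 distrib_left)
    finally show ?thesis .
  qed
  then show "ccf A t = exp (- ((1 / (4 * \<kappa>) - 1 / 2) * (norm t)\<^sup>2))" by (simp add: q_def)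
  \<comment> \<open>A negative rate would make the characteristic function exceed 1 in norm.\<close>
  show "0 \<le> 1 / (4 * \<kappa>) - 1 / 2"
    using norm_ccf_le_1[of A 1] by (simp add: cc q_def[symmetric])
qed

lemma wD_invariant_imp_gaussian:
  fixes A :: "nat \<Rightarrow> 'a \<Rightarrow> complex"
  assumes n: "n \<ge> 1" and A: "\<And>k. k \<le> n \<Longrightarrow> A k \<in> borel_measurable M"
    and sym: "\<And>k. k \<le> n \<Longrightarrow> centrally_symmetric M (A k)"
    and inv: "\<And>g t. g \<in> SU2 \<Longrightarrow> (\<Prod>k\<le>n. gsm (A k) (\<Sum>q\<le>n. wD n k q g * t q)) = (\<Prod>k\<le>n. gsm (A k) (t k))"
  obtains c where "c \<ge> 0" "\<And>k t. k \<le> n \<Longrightarrow> ccf (A k) t = exp (- (c * (norm t)\<^sup>2))"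
proof -
  \<comment> \<open>The logarithm exists because \<open>gsm\<close> is positive, and it turns the
    product into the sum to which the functional equation applies.\<close>
  define \<phi> where "\<phi> k z = ln (gsm (A k) z)" for k z
  define \<phi>' where "\<phi>' k z h = - (gsm_grad (A k) z \<bullet> h) / gsm (A k) z" for k z h
  have d: "(\<phi> k has_derivative \<phi>' k z) (at z)" if "k \<le> n" for k z
    unfolding \<phi>_def \<phi>'_def
    using has_derivative_ln[OF gsm_pos[OF A[OF that]] gsm_has_derivative[OF A[OF that]], of z]
    by (simp add: divide_inverse mult.commute)
  have 0: "\<phi>' k 0 v = 0" if "k \<le> n" for k v
    using gsm_grad_0[OF A[OF that] sym[OF that]] by (simp add: \<phi>'_def)
  have i: "(\<Sum>k\<le>n. \<phi> k (\<Sum>q\<le>n. wD n k q g * t q)) = (\<Sum>k\<le>n. \<phi> k (t k))" if "g \<in> SU2" for g t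
  proof -
    have "(\<Sum>k\<le>n. \<phi> k (x k)) = ln (\<Prod>k\<le>n. gsm (A k) (x k))" for x
      unfolding \<phi>_def using gsm_pos[OF A] by (subst ln_prod) (auto simp: less_imp_neq[symmetric])
    then show ?thesis using inv[OF that] by simp
  qed
  obtain \<kappa> where \<kappa>: "\<And>k z. k \<le> n \<Longrightarrow> \<phi> k z = \<phi> k 0 + \<kappa> * (norm z)\<^sup>2"
    using wD_invariant_imp_quadratic[OF n d 0 i] by blast
  have g: "gsm (A k) z = gsm (A k) 0 * exp (- (- \<kappa> * (norm z)\<^sup>2))" if k: "k \<le> n" for k z
  proof -
    have "gsm (A k) z = exp (\<phi> k z)" using gsm_pos[OF A[OF k]] by (simp add: \<phi>_def)
    also have "\<dots> = exp (\<phi> k 0) * exp (- (- \<kappa> * (norm z)\<^sup>2))" unfolding \<kappa>[OF k, of z] by (simp add: exp_add)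
    finally show ?thesis using gsm_pos[OF A[OF k]] by (simp add: \<phi>_def)
  qed
  \<comment> \<open>Otherwise the smoothed density would nowhere be below its value at 0, against
    its decay.\<close>
  have "- \<kappa> > 0"
  proof (rule ccontr)
    assume "\<not> - \<kappa> > 0"
    then have "gsm (A 0) 0 \<le> gsm (A 0) (of_nat m)" for m
      using g[of 0 "of_nat m"] gsm_pos[OF A[of 0], of 0] by (simp add: mult_le_cancel_left1)
    then have "gsm (A 0) 0 \<le> 0"
      by (intro LIMSEQ_le_const[OF gsm_tendsto_0[OF A[of 0]]]) auto
    then show False using gsm_pos[OF A[of 0], of 0] by simp
  qed
  then show ?thesis using ccf_of_gsm[OF A _ g] that[of "1 / (4 * - \<kappa>) - 1 / 2"] n by (metis le0)
qed

end

section \<open>Sums of independent random variables\<close>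

context prob_space
begin

definition L2 :: "('a \<Rightarrow> real) \<Rightarrow> bool" where
  "L2 f \<longleftrightarrow> f \<in> borel_measurable M \<and> integrable M (\<lambda>\<omega>. (f \<omega>)\<^sup>2)"

lemma L2_mult_integrable:
  assumes "L2 f" "L2 h"
  shows "integrable M (\<lambda>\<omega>. f \<omega> * h \<omega>)"
proof (rule Bochner_Integration.integrable_bound)
  show "integrable M (\<lambda>\<omega>. (f \<omega>)\<^sup>2 + (h \<omega>)\<^sup>2)" using assms by (auto simp: L2_def)
  have "\<bar>x * y\<bar> \<le> x\<^sup>2 + y\<^sup>2" for x y :: real
  proof -
    have "2 * (\<bar>x\<bar> * \<bar>y\<bar>) \<le> x\<^sup>2 + y\<^sup>2" using sum_squares_bound[of "\<bar>x\<bar>" "\<bar>y\<bar>"] by simp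
    moreover have "0 \<le> \<bar>x\<bar> * \<bar>y\<bar>" by simp
    ultimately show ?thesis by (simp only: abs_mult)
  qed
  then show "AE \<omega> in M. norm (f \<omega> * h \<omega>) \<le> norm ((f \<omega>)\<^sup>2 + (h \<omega>)\<^sup>2)" by simp
qed (use assms in \<open>auto simp: L2_def\<close>)

lemma L2_integrable: "L2 f \<Longrightarrow> integrable M f"
  using L2_mult_integrable[of f "\<lambda>_. 1"] by (simp add: L2_def)

lemma L2_add: "L2 f \<Longrightarrow> L2 h \<Longrightarrow> L2 (\<lambda>\<omega>. f \<omega> + h \<omega>)"
  using L2_mult_integrable[of f h] by (auto simp: L2_def power2_sum mult.assoc)

lemma L2_sum: "finite I \<Longrightarrow> (\<And>i. i \<in> I \<Longrightarrow> L2 (T i)) \<Longrightarrow> L2 (\<lambda>\<omega>. \<Sum>i\<in>I. T i \<omega>)"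
proof (induction I rule: finite_induct)
  case (insert i I)
  then show ?case using L2_add[of "T i" "\<lambda>\<omega>. \<Sum>i\<in>I. T i \<omega>"] by simp
qed (simp add: L2_def)

text \<open>A centred variable is orthogonal to every integrable function of other members of the
  family. Taking \<open>f\<close> on the product over \<open>I\<close> lets independence of the
  block \<open>I\<close> from \<open>T i\<close> be used.\<close>

lemma indep_vars_past_orthogonal:
  fixes T :: "nat \<Rightarrow> 'a \<Rightarrow> real"
  assumes T: "indep_vars (\<lambda>_. borel) T UNIV" and i: "i \<notin> I"
    and f: "f \<in> borel_measurable (Pi\<^sub>M I (\<lambda>_. borel))"
    and int: "integrable M (\<lambda>\<omega>. f (\<lambda>j\<in>I. T j \<omega>))" "integrable M (T i)" and mean: "(\<integral>\<omega>. T i \<omega> \<partial>M) = 0"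
  shows "(\<integral>\<omega>. f (\<lambda>j\<in>I. T j \<omega>) * T i \<omega> \<partial>M) = 0"
proof -
  have "indep_var borel (f \<circ> (\<lambda>\<omega>. \<lambda>j\<in>I. T j \<omega>)) borel ((\<lambda>x. x i) \<circ> (\<lambda>\<omega>. \<lambda>j\<in>{i}. T j \<omega>))"
    using i by (intro indep_var_compose[OF indep_var_restrict[OF T]] f measurable_component_singleton) auto
  then have "indep_var borel (\<lambda>\<omega>. f (\<lambda>j\<in>I. T j \<omega>)) borel (T i)"
    by (simp add: comp_def)
  from indep_var_lebesgue_integral[OF this int] mean show ?thesis by simp
qed

text \<open>The event is split by the first time \<open>k\<close> at which the sum from
  \<open>m\<close> reaches \<open>\<epsilon>\<close>. The increments after \<open>k\<close> are
  orthogonal to what is known at \<open>k\<close>, so on each piece the mean square at time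
  \<open>n\<close> is at least that at time \<open>k\<close>.\<close>

lemma Kolmogorov_inequality:
  fixes T :: "nat \<Rightarrow> 'a \<Rightarrow> real"
  assumes T: "indep_vars (\<lambda>_. borel) T UNIV" and L2: "\<And>i. L2 (T i)"
    and mean: "\<And>i. (\<integral>\<omega>. T i \<omega> \<partial>M) = 0" and \<epsilon>: "\<epsilon> > 0"
  shows "\<P>(\<omega> in M. \<exists>k\<in>{m..n}. \<epsilon> \<le> \<bar>\<Sum>i\<in>{m..<k}. T i \<omega>\<bar>) \<le> (\<Sum>i\<in>{m..<n}. (\<integral>\<omega>. (T i \<omega>)\<^sup>2 \<partial>M)) / \<epsilon>\<^sup>2"
proof -
  define U where "U x k = (\<Sum>i\<in>{m..<k}. x i)" for x :: "nat \<Rightarrow> real" and k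
  \<comment> \<open>The indicator that \<open>k\<close> is the first passage time.\<close>
  define a where "a x k = (if \<epsilon> \<le> \<bar>U x k\<bar> \<and> (\<forall>j\<in>{m..<k}. \<bar>U x j\<bar> < \<epsilon>) then 1 else 0 :: real)" for x k
  have Tm [measurable]: "T i \<in> borel_measurable M" for i using L2[of i] by (simp add: L2_def)
  let ?T = "\<lambda>\<omega> i. T i \<omega>"
  have UL2: "L2 (\<lambda>\<omega>. U (?T \<omega>) k)" for k unfolding U_def using L2 by (intro L2_sum) auto
  have Um [measurable]: "(\<lambda>\<omega>. U (?T \<omega>) k) \<in> borel_measurable M" for k unfolding U_def by measurable
  have am [measurable]: "(\<lambda>\<omega>. a (?T \<omega>) k) \<in> borel_measurable M" for k unfolding a_def by measurable
  have a01: "0 \<le> a x k" "a x k \<le> 1" "a x k * a x k = a x k" for x k by (auto simp: a_def)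
  \<comment> \<open>At time \<open>k\<close> both \<open>U\<close> and \<open>a\<close> see only
    coordinates below \<open>k\<close>, so they are functions on the product over
    \<open>{m..<k}\<close>, as orthogonality to the past requires.\<close>
  have restrict: "U (\<lambda>i\<in>{m..<k}. x i) j = U x j" if "j \<le> k" for x j k
    unfolding U_def using that by (intro sum.cong) auto
  have restrict_a: "a (\<lambda>i\<in>{m..<k}. x i) k = a x k" for x k
    unfolding a_def using restrict[of _ k x] by (auto simp: restrict)
  have aU_L2: "L2 (\<lambda>\<omega>. a (?T \<omega>) k * U (?T \<omega>) l)" for k l
    unfolding L2_def
  proof
    show "integrable M (\<lambda>\<omega>. (a (?T \<omega>) k * U (?T \<omega>) l)\<^sup>2)"
    proof (rule Bochner_Integration.integrable_bound)
      show "integrable M (\<lambda>\<omega>. (U (?T \<omega>) l)\<^sup>2)" using UL2 by (simp add: L2_def)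
      show "AE \<omega> in M. norm ((a (?T \<omega>) k * U (?T \<omega>) l)\<^sup>2) \<le> norm ((U (?T \<omega>) l)\<^sup>2)"
        by (auto simp: a_def)
    qed measurable
  qed measurable
  have Uorth: "(\<integral>\<omega>. U (?T \<omega>) k * T i \<omega> \<partial>M) = 0" if "k \<le> i" for k i
  proof -
    have "(\<lambda>x. U x k) \<in> borel_measurable (Pi\<^sub>M {m..<k} (\<lambda>_. borel))"
      unfolding U_def by (intro borel_measurable_sum measurable_component_singleton)
    moreover have "integrable M (\<lambda>\<omega>. U (\<lambda>j\<in>{m..<k}. T j \<omega>) k)"
      using L2_integrable[OF UL2] by (simp only: restrict[OF order_refl])
    ultimately have "(\<integral>\<omega>. U (\<lambda>j\<in>{m..<k}. T j \<omega>) k * T i \<omega> \<partial>M) = 0"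
      using indep_vars_past_orthogonal[OF T, of i "{m..<k}" "\<lambda>x. U x k"] L2_integrable[OF L2] mean that
      by (metis atLeastLessThan_iff not_less)
    then show ?thesis by (simp only: restrict[OF order_refl])
  qed
  have aUorth: "(\<integral>\<omega>. a (?T \<omega>) k * U (?T \<omega>) k * T i \<omega> \<partial>M) = 0" if "k \<le> i" for k i
  proof -
    have [measurable]: "(\<lambda>x. U x j) \<in> borel_measurable (Pi\<^sub>M {m..<k} (\<lambda>_. borel))" if "j \<le> k" for j
      unfolding U_def using that by (intro borel_measurable_sum measurable_component_singleton) auto
    have "(\<lambda>x. a x k * U x k) \<in> borel_measurable (Pi\<^sub>M {m..<k} (\<lambda>_. borel))"
    proof -
      have "{x \<in> space (Pi\<^sub>M {m..<k} (\<lambda>_. borel)). \<epsilon> \<le> \<bar>U x k\<bar> \<and> (\<forall>j\<in>{m..<k}. \<bar>U x j\<bar> < \<epsilon>)} \<in> sets (Pi\<^sub>M {m..<k} (\<lambda>_. borel))"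
        by (intro sets.sets_Collect_conj sets.sets_Collect_finite_All) auto
      then have "(\<lambda>x. a x k) \<in> borel_measurable (Pi\<^sub>M {m..<k} (\<lambda>_. borel))"
        unfolding a_def by (intro measurable_If) auto
      then show ?thesis by measurable
    qed
    moreover have "integrable M (\<lambda>\<omega>. a (\<lambda>j\<in>{m..<k}. T j \<omega>) k * U (\<lambda>j\<in>{m..<k}. T j \<omega>) k)"
      using L2_integrable[OF aU_L2] by (simp only: restrict[OF order_refl] restrict_a)
    ultimately have "(\<integral>\<omega>. a (\<lambda>j\<in>{m..<k}. T j \<omega>) k * U (\<lambda>j\<in>{m..<k}. T j \<omega>) k * T i \<omega> \<partial>M) = 0"
      using indep_vars_past_orthogonal[OF T, of i "{m..<k}" "\<lambda>x. a x k * U x k"] L2_integrable[OF L2] mean that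
      by (metis atLeastLessThan_iff not_less)
    then show ?thesis by (simp only: restrict[OF order_refl] restrict_a)
  qed
  have var: "(\<integral>\<omega>. (U (?T \<omega>) (m + d))\<^sup>2 \<partial>M) = (\<Sum>i\<in>{m..<m + d}. (\<integral>\<omega>. (T i \<omega>)\<^sup>2 \<partial>M))" for d
  proof (induction d)
    case (Suc d)
    have "U x (m + Suc d) = U x (m + d) + x (m + d)" for x by (simp add: U_def)
    then have "(\<integral>\<omega>. (U (?T \<omega>) (m + Suc d))\<^sup>2 \<partial>M) = (\<integral>\<omega>. (U (?T \<omega>) (m + d))\<^sup>2 + (T (m + d) \<omega>)\<^sup>2 + 2 * (U (?T \<omega>) (m + d) * T (m + d) \<omega>) \<partial>M)"
      by (simp add: power2_sum mult.assoc)
    also have "\<dots> = (\<integral>\<omega>. (U (?T \<omega>) (m + d))\<^sup>2 \<partial>M) + (\<integral>\<omega>. (T (m + d) \<omega>)\<^sup>2 \<partial>M) + 2 * (\<integral>\<omega>. U (?T \<omega>) (m + d) * T (m + d) \<omega> \<partial>M)"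
      using UL2[of "m + d"] L2[of "m + d"] L2_mult_integrable[OF UL2[of "m + d"] L2[of "m + d"]]
      by (simp add: L2_def)
    finally show ?case using Suc by (simp add: Uorth)
  qed (simp add: U_def)
  have mono: "\<epsilon>\<^sup>2 * (\<integral>\<omega>. a (?T \<omega>) k \<partial>M) \<le> (\<integral>\<omega>. a (?T \<omega>) k * (U (?T \<omega>) n)\<^sup>2 \<partial>M)" if k: "k \<in> {m..n}" for k
  proof -
    define V where "V \<omega> = (\<Sum>i\<in>{k..<n}. T i \<omega>)" for \<omega>
    have VL2: "L2 V" unfolding V_def using L2 by (intro L2_sum) auto
    have UV: "U (?T \<omega>) n = U (?T \<omega>) k + V \<omega>" for \<omega>
      unfolding U_def V_def using k by (simp add: sum.atLeastLessThan_concat)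
    have "(\<integral>\<omega>. a (?T \<omega>) k * U (?T \<omega>) k * V \<omega> \<partial>M) = (\<integral>\<omega>. (\<Sum>i\<in>{k..<n}. a (?T \<omega>) k * U (?T \<omega>) k * T i \<omega>) \<partial>M)"
      by (simp add: V_def sum_distrib_left)
    also have "\<dots> = (\<Sum>i\<in>{k..<n}. (\<integral>\<omega>. a (?T \<omega>) k * U (?T \<omega>) k * T i \<omega> \<partial>M))"
      by (intro Bochner_Integration.integral_sum L2_mult_integrable aU_L2 L2)
    also have "\<dots> = 0" by (intro sum.neutral) (auto simp: aUorth)
    finally have orth: "(\<integral>\<omega>. a (?T \<omega>) k * U (?T \<omega>) k * V \<omega> \<partial>M) = 0" .
    have ia: "integrable M (\<lambda>\<omega>. a (?T \<omega>) k)" by (rule integrable_const_bound[where B = 1]) (auto simp: a_def)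
    have iU: "integrable M (\<lambda>\<omega>. a (?T \<omega>) k * (U (?T \<omega>) l)\<^sup>2)" for l
      using L2_mult_integrable[OF aU_L2[of k l] UL2[of l]] by (simp add: power2_eq_square mult.assoc)
    have iV: "integrable M (\<lambda>\<omega>. a (?T \<omega>) k * U (?T \<omega>) k * V \<omega>)" by (intro L2_mult_integrable aU_L2 VL2)
    have "\<epsilon>\<^sup>2 * (\<integral>\<omega>. a (?T \<omega>) k \<partial>M) = (\<integral>\<omega>. \<epsilon>\<^sup>2 * a (?T \<omega>) k + 2 * (a (?T \<omega>) k * U (?T \<omega>) k * V \<omega>) \<partial>M)"
      using ia iV orth by simp
    \<comment> \<open>The cross term, of mean 0, was added so that the inequality holds pointwise:
      it only drops the square of \<open>V \<omega>\<close> and the overshoot at time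
      \<open>k\<close>.\<close>
    also have "\<dots> \<le> (\<integral>\<omega>. a (?T \<omega>) k * (U (?T \<omega>) n)\<^sup>2 \<partial>M)"
    proof (rule integral_mono)
      fix \<omega>
      show "\<epsilon>\<^sup>2 * a (?T \<omega>) k + 2 * (a (?T \<omega>) k * U (?T \<omega>) k * V \<omega>) \<le> a (?T \<omega>) k * (U (?T \<omega>) n)\<^sup>2"
      proof (cases "a (?T \<omega>) k = 0")
        case False
        then have a1: "a (?T \<omega>) k = 1" and "\<epsilon> \<le> \<bar>U (?T \<omega>) k\<bar>" by (auto simp: a_def split: if_splits)
        then have "\<epsilon>\<^sup>2 \<le> (U (?T \<omega>) k)\<^sup>2" using \<epsilon> by (metis less_imp_le power2_abs power_mono)
        moreover have "(U (?T \<omega>) n)\<^sup>2 = (U (?T \<omega>) k)\<^sup>2 + (V \<omega>)\<^sup>2 + 2 * (U (?T \<omega>) k * V \<omega>)"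
          unfolding UV by (simp add: power2_sum)
        moreover have "0 \<le> (V \<omega>)\<^sup>2" by simp
        ultimately have "\<epsilon>\<^sup>2 + 2 * (U (?T \<omega>) k * V \<omega>) \<le> (U (?T \<omega>) n)\<^sup>2" by linarith
        then show ?thesis unfolding a1 by simp
      qed simp
    qed (use ia iV iU in auto)
    finally show ?thesis .
  qed
  \<comment> \<open>At most one index is the first passage time.\<close>
  have sum_le: "(\<Sum>k\<in>{m..n}. a x k) \<le> 1" for x
  proof (cases "\<exists>k\<in>{m..n}. a x k \<noteq> 0")
    case True
    then obtain k where k: "k \<in> {m..n}" "a x k \<noteq> 0" by blast
    have "a x l = 0" if "l \<in> {m..n} - {k}" for l
    proof (rule ccontr)
      assume "a x l \<noteq> 0"
      then have "\<epsilon> \<le> \<bar>U x l\<bar>" "\<forall>j\<in>{m..<l}. \<bar>U x j\<bar> < \<epsilon>" "\<epsilon> \<le> \<bar>U x k\<bar>" "\<forall>j\<in>{m..<k}. \<bar>U x j\<bar> < \<epsilon>"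
        using k by (auto simp: a_def split: if_splits)
      then show False using k(1) that by (cases l k rule: linorder_cases) force+
    qed
    then have "(\<Sum>k\<in>{m..n}. a x k) = (\<Sum>k\<in>{k}. a x k)" using k by (intro sum.mono_neutral_right) auto
    then show ?thesis using a01 by simp
  qed (simp add: sum.neutral)
  define E where "E = {\<omega> \<in> space M. \<exists>k\<in>{m..n}. \<epsilon> \<le> \<bar>U (?T \<omega>) k\<bar>}"
  have E: "E \<in> sets M" unfolding E_def by measurable
  have ind: "indicator E \<omega> \<le> (\<Sum>k\<in>{m..n}. a (?T \<omega>) k)" for \<omega>
  proof (cases "\<omega> \<in> E")
    case True
    then obtain k0 where k0: "k0 \<in> {m..n}" "\<epsilon> \<le> \<bar>U (?T \<omega>) k0\<bar>" by (auto simp: E_def)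
    define k where "k = (LEAST k. k \<in> {m..n} \<and> \<epsilon> \<le> \<bar>U (?T \<omega>) k\<bar>)"
    have k: "k \<in> {m..n} \<and> \<epsilon> \<le> \<bar>U (?T \<omega>) k\<bar>" unfolding k_def by (rule LeastI[of _ k0]) (use k0 in auto)
    have "\<bar>U (?T \<omega>) j\<bar> < \<epsilon>" if "j \<in> {m..<k}" for j
      using not_less_Least[of j "\<lambda>k. k \<in> {m..n} \<and> \<epsilon> \<le> \<bar>U (?T \<omega>) k\<bar>"] that k unfolding k_def[symmetric] by auto
    then have "a (?T \<omega>) k = 1" using k by (simp add: a_def)
    then have "1 \<le> (\<Sum>k\<in>{m..n}. a (?T \<omega>) k)"
      using member_le_sum[of k "{m..n}" "a (?T \<omega>)"] k a01 by simp
    then show ?thesis using True by simp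
  qed (simp add: sum_nonneg a01)
  have ia: "integrable M (\<lambda>\<omega>. a (?T \<omega>) k)" for k by (rule integrable_const_bound[where B = 1]) (auto simp: a_def)
  have iU: "integrable M (\<lambda>\<omega>. a (?T \<omega>) k * (U (?T \<omega>) l)\<^sup>2)" for k l
    using L2_mult_integrable[OF aU_L2[of k l] UL2[of l]] by (simp add: power2_eq_square mult.assoc)
  have "measure M E = (\<integral>\<omega>. indicator E \<omega> \<partial>M)" using E by simp
  also have "\<dots> \<le> (\<integral>\<omega>. (\<Sum>k\<in>{m..n}. a (?T \<omega>) k) \<partial>M)"
  proof (rule integral_mono)
    show "integrable M (indicator E :: 'a \<Rightarrow> real)"
      by (rule integrable_const_bound[where B = 1]) (use E in auto)
  qed (use ind ia in auto)
  also have "\<dots> = (\<Sum>k\<in>{m..n}. (\<integral>\<omega>. a (?T \<omega>) k \<partial>M))" using ia by simp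
  finally have "\<epsilon>\<^sup>2 * measure M E \<le> \<epsilon>\<^sup>2 * (\<Sum>k\<in>{m..n}. (\<integral>\<omega>. a (?T \<omega>) k \<partial>M))"
    by (intro mult_left_mono) auto
  also have "\<dots> \<le> (\<Sum>k\<in>{m..n}. (\<integral>\<omega>. a (?T \<omega>) k * (U (?T \<omega>) n)\<^sup>2 \<partial>M))"
    unfolding sum_distrib_left by (intro sum_mono mono)
  also have "\<dots> = (\<integral>\<omega>. (\<Sum>k\<in>{m..n}. a (?T \<omega>) k) * (U (?T \<omega>) n)\<^sup>2 \<partial>M)"
    unfolding sum_distrib_right using iU by (intro Bochner_Integration.integral_sum[symmetric])
  also have "\<dots> \<le> (\<integral>\<omega>. (U (?T \<omega>) n)\<^sup>2 \<partial>M)"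
  proof (rule integral_mono)
    show "integrable M (\<lambda>\<omega>. (\<Sum>k\<in>{m..n}. a (?T \<omega>) k) * (U (?T \<omega>) n)\<^sup>2)"
      unfolding sum_distrib_right using iU by (intro Bochner_Integration.integrable_sum)
    show "(\<Sum>k\<in>{m..n}. a (?T \<omega>) k) * (U (?T \<omega>) n)\<^sup>2 \<le> (U (?T \<omega>) n)\<^sup>2" for \<omega>
      using mult_right_mono[OF sum_le[of "?T \<omega>"], of "(U (?T \<omega>) n)\<^sup>2"] by simp
  qed (use UL2 in \<open>simp add: L2_def\<close>)
  also have "\<dots> = (\<Sum>i\<in>{m..<n}. (\<integral>\<omega>. (T i \<omega>)\<^sup>2 \<partial>M))"
    using var[of "n - m"] by (cases "m \<le> n") (simp_all add: U_def)
  finally show ?thesis using \<epsilon> by (simp add: E_def U_def pos_le_divide_eq mult.commute)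
qed

text \<open>\<open>Q \<epsilon> m\<close> is the event that the sums move by at least
  \<open>\<epsilon>\<close> after time \<open>m\<close>. Its probability is bounded through a tail
  of the variances, so almost surely some \<open>m\<close> avoids it for each
  \<open>\<epsilon>\<close> of the form \<open>1 / real (Suc r)\<close>, and the sums are
  Cauchy.\<close>

lemma AE_convergent_sum_indep:
  fixes T :: "nat \<Rightarrow> 'a \<Rightarrow> real"
  assumes T: "indep_vars (\<lambda>_. borel) T UNIV" and L2: "\<And>i. L2 (T i)"
    and mean: "\<And>i. (\<integral>\<omega>. T i \<omega> \<partial>M) = 0" and sum: "summable (\<lambda>i. (\<integral>\<omega>. (T i \<omega>)\<^sup>2 \<partial>M))"
  shows "AE \<omega> in M. convergent (\<lambda>n. \<Sum>i<n. T i \<omega>)"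
proof -
  have Tm [measurable]: "T i \<in> borel_measurable M" for i using L2[of i] by (simp add: L2_def)
  define v where "v i = (\<integral>\<omega>. (T i \<omega>)\<^sup>2 \<partial>M)" for i
  have v: "v i \<ge> 0" for i by (simp add: v_def)
  have sv: "summable v" using sum by (simp add: v_def[abs_def])
  define Q where "Q \<epsilon> m = {\<omega> \<in> space M. \<exists>k\<ge>m. \<epsilon> \<le> \<bar>\<Sum>i\<in>{m..<k}. T i \<omega>\<bar>}" for \<epsilon> m
  have Qm [measurable]: "Q \<epsilon> m \<in> sets M" for \<epsilon> m unfolding Q_def by measurable
  have Q: "measure M (Q \<epsilon> m) \<le> (\<Sum>i. v (i + m)) / \<epsilon>\<^sup>2" if \<epsilon>: "\<epsilon> > 0" for \<epsilon> m
  proof -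
    \<comment> \<open>Kolmogorov's inequality has a finite horizon; \<open>Q \<epsilon> m\<close> is
      reached by continuity from below.\<close>
    define E where "E n = {\<omega> \<in> space M. \<exists>k\<in>{m..m + n}. \<epsilon> \<le> \<bar>\<Sum>i\<in>{m..<k}. T i \<omega>\<bar>}" for n
    have "Q \<epsilon> m = (\<Union>n. E n)"
    proof (intro equalityI subsetI)
      fix \<omega> assume "\<omega> \<in> Q \<epsilon> m"
      then obtain k where "\<omega> \<in> space M" "k \<ge> m" "\<epsilon> \<le> \<bar>\<Sum>i\<in>{m..<k}. T i \<omega>\<bar>" by (auto simp: Q_def)
      then have "\<omega> \<in> E (k - m)" by (auto simp: E_def intro!: bexI[of _ k])
      then show "\<omega> \<in> (\<Union>n. E n)" by blast
    qed (force simp: E_def Q_def)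
    moreover have "(\<lambda>n. measure M (E n)) \<longlonglongrightarrow> measure M (\<Union>n. E n)"
    proof (rule finite_Lim_measure_incseq)
      show "range E \<subseteq> sets M" unfolding E_def by auto
      show "incseq E" unfolding E_def incseq_def by force
    qed
    moreover have "measure M (E n) \<le> (\<Sum>i. v (i + m)) / \<epsilon>\<^sup>2" for n
    proof -
      have "measure M (E n) \<le> (\<Sum>i\<in>{m..<m + n}. v i) / \<epsilon>\<^sup>2"
        unfolding E_def v_def by (rule Kolmogorov_inequality[OF T L2 mean \<epsilon>])
      also have "(\<Sum>i\<in>{m..<m + n}. v i) = (\<Sum>i<n. v (i + m))"
        using sum.shift_bounds_nat_ivl[of v 0 m n] by (simp add: lessThan_atLeast0 add.commute)
      also have "\<dots> \<le> (\<Sum>i. v (i + m))"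
        using sv v by (intro sum_le_suminf) (auto simp: summable_iff_shift)
      finally show ?thesis using \<epsilon> by (simp add: divide_right_mono)
    qed
    ultimately show ?thesis by (auto intro: LIMSEQ_le_const2)
  qed
  have "AE \<omega> in M. \<exists>m. \<omega> \<notin> Q (1 / real (Suc r)) m" for r
  proof -
    let ?N = "\<Inter>m. Q (1 / real (Suc r)) m"
    have N: "?N \<in> sets M" by measurable
    have lim: "(\<lambda>m. (\<Sum>i. v (i + m)) / (1 / real (Suc r))\<^sup>2) \<longlonglongrightarrow> 0 / (1 / real (Suc r))\<^sup>2"
      by (intro tendsto_divide suminf_exist_split2[OF sv] tendsto_const) simp
    have b: "measure M ?N \<le> (\<Sum>i. v (i + m)) / (1 / real (Suc r))\<^sup>2" for m
      by (rule order_trans[OF finite_measure_mono Q]) auto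
    have "measure M ?N \<le> 0 / (1 / real (Suc r))\<^sup>2"
      by (rule LIMSEQ_le_const[OF lim]) (use b in blast)
    then have "emeasure M ?N = 0" by (simp add: emeasure_eq_measure measure_le_0_iff)
    then have "AE \<omega> in M. \<omega> \<notin> ?N" using N by (intro AE_not_in) (auto simp: null_sets_def)
    then show ?thesis by auto
  qed
  then have "AE \<omega> in M. \<forall>r. \<exists>m. \<omega> \<notin> Q (1 / real (Suc r)) m" unfolding AE_all_countable by blast
  then show ?thesis
  proof (rule AE_mp[OF _ AE_I2[OF impI]])
    fix \<omega> assume \<omega>: "\<omega> \<in> space M" and *: "\<forall>r. \<exists>m. \<omega> \<notin> Q (1 / real (Suc r)) m"
    have "Cauchy (\<lambda>n. \<Sum>i<n. T i \<omega>)"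
    proof (rule metric_CauchyI)
      fix e :: real assume "0 < e"
      then obtain r where r: "inverse (real (Suc r)) < e / 2" using reals_Archimedean[of "e / 2"] by auto
      obtain m where m: "\<omega> \<notin> Q (1 / real (Suc r)) m" using * by blast
      have d: "\<bar>(\<Sum>i<k. T i \<omega>) - (\<Sum>i<m. T i \<omega>)\<bar> < e / 2" if "m \<le> k" for k
      proof -
        have "(\<Sum>i<k. T i \<omega>) - (\<Sum>i<m. T i \<omega>) = (\<Sum>i\<in>{m..<k}. T i \<omega>)"
          using sum_diff_nat_ivl[of 0 m k "\<lambda>i. T i \<omega>"] that by (simp add: lessThan_atLeast0)
        moreover have "\<not> 1 / real (Suc r) \<le> \<bar>\<Sum>i\<in>{m..<k}. T i \<omega>\<bar>"
          using m \<omega> that unfolding Q_def by blast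
        ultimately show ?thesis using r by (simp add: inverse_eq_divide)
      qed
      show "\<exists>N. \<forall>k\<ge>N. \<forall>l\<ge>N. dist (\<Sum>i<k. T i \<omega>) (\<Sum>i<l. T i \<omega>) < e"
      proof (intro exI[of _ m] allI impI)
        fix k l assume "m \<le> k" "m \<le> l"
        then show "dist (\<Sum>i<k. T i \<omega>) (\<Sum>i<l. T i \<omega>) < e"
          using d[of k] d[of l] unfolding dist_real_def by linarith
      qed
    qed
    then show "convergent (\<lambda>n. \<Sum>i<n. T i \<omega>)" by (simp add: Cauchy_convergent_iff)
  qed
qed

section \<open>Sampling\<close>

text \<open>A function of one coordinate is written as a product over all coordinates with the other
  factors 1, so that the product formula for integrals applies.\<close>

lemma integral_PiM_component:
  fixes f :: "'a \<Rightarrow> complex"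
  assumes "finite I" "k \<in> I" "integrable M f"
  shows "(\<integral>x. f (x k) \<partial>Pi\<^sub>M I (\<lambda>_. M)) = integral\<^sup>L M f" "integrable (Pi\<^sub>M I (\<lambda>_. M)) (\<lambda>x. f (x k))"
proof -
  interpret P: product_sigma_finite "\<lambda>_::'i. M" ..
  define F where "F i = (if i = k then f else (\<lambda>_. 1))" for i
  have F: "(\<Prod>i\<in>I. F i (x i)) = f (x k)" for x
    using assms by (subst prod.remove[of I k]) (auto simp: F_def intro!: prod.neutral)
  have i: "integrable M (F i)" for i using assms by (simp add: F_def)
  have "(\<Prod>i\<in>I. integral\<^sup>L M (F i)) = integral\<^sup>L M f"
    using assms by (subst prod.remove[of I k]) (auto simp: F_def prob_space intro!: prod.neutral)
  then show "(\<integral>x. f (x k) \<partial>Pi\<^sub>M I (\<lambda>_. M)) = integral\<^sup>L M f"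
    using P.product_integral_prod[of I F] assms i by (simp add: F)
  show "integrable (Pi\<^sub>M I (\<lambda>_. M)) (\<lambda>x. f (x k))"
    using P.product_integrable_prod[of I F] assms i by (simp add: F)
qed

lemma integral_PiM_component2:
  fixes f h :: "'a \<Rightarrow> complex"
  assumes "finite I" "k \<in> I" "l \<in> I" "k \<noteq> l" "integrable M f" "integrable M h"
  shows "(\<integral>x. f (x k) * h (x l) \<partial>Pi\<^sub>M I (\<lambda>_. M)) = integral\<^sup>L M f * integral\<^sup>L M h"
    "integrable (Pi\<^sub>M I (\<lambda>_. M)) (\<lambda>x. f (x k) * h (x l))"
proof -
  interpret P: product_sigma_finite "\<lambda>_::'i. M" ..
  define F where "F i = (if i = k then f else if i = l then h else (\<lambda>_. 1))" for i
  have F: "(\<Prod>i\<in>I. F i (x i)) = f (x k) * h (x l)" for x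
  proof -
    have "(\<Prod>i\<in>I. F i (x i)) = (\<Prod>i\<in>{k, l}. F i (x i))"
      using assms by (intro prod.mono_neutral_right) (auto simp: F_def)
    then show ?thesis using assms by (simp add: F_def)
  qed
  have i: "integrable M (F i)" for i using assms by (simp add: F_def)
  have "(\<Prod>i\<in>I. integral\<^sup>L M (F i)) = (\<Prod>i\<in>{k, l}. integral\<^sup>L M (F i))"
    using assms by (intro prod.mono_neutral_right) (auto simp: F_def prob_space)
  then have "(\<Prod>i\<in>I. integral\<^sup>L M (F i)) = integral\<^sup>L M f * integral\<^sup>L M h"
    using assms by (simp add: F_def)
  then show "(\<integral>x. f (x k) * h (x l) \<partial>Pi\<^sub>M I (\<lambda>_. M)) = integral\<^sup>L M f * integral\<^sup>L M h"
    using P.product_integral_prod[of I F] assms i by (simp add: F)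
  show "integrable (Pi\<^sub>M I (\<lambda>_. M)) (\<lambda>x. f (x k) * h (x l))"
    using P.product_integrable_prod[of I F] assms i by (simp add: F)
qed

text \<open>A law of large numbers in mean with a rate: the variance of the average is of order
  \<open>1 / n\<close>. The random objects are the points \<open>x k\<close>; \<open>f\<close> will
  come from a fixed path of the field.\<close>

lemma sample_mean_deviation:
  fixes f :: "'a \<Rightarrow> complex"
  assumes f: "f \<in> borel_measurable M" and f2: "integrable M (\<lambda>x. (norm (f x))\<^sup>2)" and n: "n > 0"
  shows "(\<integral>x. norm ((\<Sum>k<n. f (x k)) / of_nat n - integral\<^sup>L M f) \<partial>Pi\<^sub>M {..<n} (\<lambda>_. M))
      \<le> (1 + (\<integral>x. (norm (f x))\<^sup>2 \<partial>M)) / sqrt (real n)"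
    and "integrable (Pi\<^sub>M {..<n} (\<lambda>_. M)) (\<lambda>x. norm ((\<Sum>k<n. f (x k)) / of_nat n - integral\<^sup>L M f))"
proof -
  let ?P = "Pi\<^sub>M {..<n} (\<lambda>_. M)"
  interpret P: prob_space ?P by (rule prob_space_PiM) (rule prob_space_axioms)
  have fi: "integrable M f"
  proof (rule Bochner_Integration.integrable_bound)
    show "integrable M (\<lambda>x. 1 + (norm (f x))\<^sup>2)" using f2 by simp
    have "r \<le> 1 + r\<^sup>2" for r :: real
      using zero_le_power2[of "r - 1 / 2"] by (simp add: power2_eq_square algebra_simps)
    then show "AE x in M. norm (f x) \<le> norm (1 + (norm (f x))\<^sup>2)" by auto
  qed (rule f)
  define \<mu> where "\<mu> = integral\<^sup>L M f"
  define h where "h x = f x - \<mu>" for x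
  have hi: "integrable M h" "integral\<^sup>L M h = 0" using fi by (simp_all add: h_def[abs_def] \<mu>_def prob_space)
  have hc: "integrable M (\<lambda>x. cnj (h x))" using hi by simp
  have fc: "integrable M (\<lambda>x. cnj (f x))" using fi by simp
  have ff: "integrable M (\<lambda>x. f x * cnj (f x))"
    unfolding complex_norm_square[symmetric] using f2 by (rule integrable_of_real)
  have hh_eq: "h x * cnj (h x) = f x * cnj (f x) - \<mu> * cnj (f x) - cnj \<mu> * f x + \<mu> * cnj \<mu>" for x
    by (simp add: h_def algebra_simps)
  have hh: "integrable M (\<lambda>x. h x * cnj (h x))"
    unfolding hh_eq using ff fc fi by simp
  define V where "V = (\<integral>x. (norm (f x))\<^sup>2 \<partial>M)"
  have V: "(\<integral>x. h x * cnj (h x) \<partial>M) = complex_of_real (V - (norm \<mu>)\<^sup>2)"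
  proof -
    have "(\<integral>x. f x * cnj (f x) \<partial>M) = complex_of_real V"
      unfolding V_def integral_complex_of_real[symmetric] by (simp add: complex_norm_square del: of_real_power)
    then show ?thesis
      unfolding hh_eq using ff fc fi by (simp add: \<mu>_def[symmetric] prob_space complex_norm_square[symmetric] mult.commute del: of_real_power)
  qed
  \<comment> \<open>Different sample points are uncorrelated, so only the \<open>n\<close> diagonal
    terms of the double sum remain.\<close>
  have pair: "(\<integral>x. h (x k) * cnj (h (x l)) \<partial>?P) = (if k = l then complex_of_real (V - (norm \<mu>)\<^sup>2) else 0)
     \<and> integrable ?P (\<lambda>x. h (x k) * cnj (h (x l)))" if "k < n" "l < n" for k l
    using integral_PiM_component[of "{..<n}" k "\<lambda>x. h x * cnj (h x)"]
      integral_PiM_component2[of "{..<n}" k l h "\<lambda>x. cnj (h x)"] that hh hc hi V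
    by (cases "k = l") auto
  define Z where "Z x = (\<Sum>k<n. h (x k))" for x
  have ZZ: "complex_of_real ((norm (Z x))\<^sup>2) = (\<Sum>k<n. \<Sum>l<n. h (x k) * cnj (h (x l)))" for x
    unfolding complex_norm_square Z_def by (simp add: sum_product)
  have Zi: "integrable ?P (\<lambda>x. complex_of_real ((norm (Z x))\<^sup>2))"
    unfolding ZZ using pair by (intro Bochner_Integration.integrable_sum) auto
  then have Zi': "integrable ?P (\<lambda>x. (norm (Z x))\<^sup>2)"
    by (simp only: complex_of_real_integrable_eq)
  have "complex_of_real (\<integral>x. (norm (Z x))\<^sup>2 \<partial>?P) = (\<integral>x. (\<Sum>k<n. \<Sum>l<n. h (x k) * cnj (h (x l))) \<partial>?P)"
    unfolding integral_complex_of_real[symmetric] ZZ ..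
  also have "\<dots> = (\<Sum>k<n. \<Sum>l<n. (\<integral>x. h (x k) * cnj (h (x l)) \<partial>?P))"
    using pair by (subst Bochner_Integration.integral_sum, (auto intro!: Bochner_Integration.integrable_sum)[1],
        intro sum.cong refl Bochner_Integration.integral_sum, auto)
  also have "\<dots> = (\<Sum>k<n. \<Sum>l<n. (if k = l then complex_of_real (V - (norm \<mu>)\<^sup>2) else 0))"
    using pair by (intro sum.cong refl) auto
  also have "\<dots> = complex_of_real (real n * (V - (norm \<mu>)\<^sup>2))" by simp
  finally have EZ: "(\<integral>x. (norm (Z x))\<^sup>2 \<partial>?P) = real n * (V - (norm \<mu>)\<^sup>2)" by (simp only: of_real_eq_iff)
  have mean: "(\<Sum>k<n. f (x k)) / of_nat n - \<mu> = Z x / of_nat n" for x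
    using n by (simp add: Z_def h_def sum_subtractf field_simps)
  have meas: "Z \<in> borel_measurable ?P"
  proof -
    have "h \<in> borel_measurable M" using hi by simp
    then show ?thesis unfolding Z_def
      by (intro borel_measurable_sum measurable_compose[OF measurable_component_singleton]) auto
  qed
  define s where "s = sqrt (real n)"
  have s: "s > 0" "s * s = real n" using n by (simp_all add: s_def)
  \<comment> \<open>For \<open>s = sqrt (real n)\<close> and \<open>r = norm (Z x)\<close> this is
    \<open>r * s \<le> s^2 + r^2\<close> divided by \<open>s^3\<close>; it controls the mean of the
    norm by the second moment.\<close>
  have bound: "norm (Z x / of_nat n) \<le> 1 / s + (norm (Z x))\<^sup>2 / (real n * s)" for x
  proof -
    define r where "r = norm (Z x)"
    have "r / (s * s) \<le> 1 / s + r\<^sup>2 / (s * s * s)"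
    proof -
      have "0 \<le> r * s" using s by (simp add: r_def)
      then have "r * s \<le> s * s + r\<^sup>2"
        using sum_squares_bound[of r s] unfolding power2_eq_square[of s] by linarith
      then have "(r * s) / (s * s * s) \<le> (s * s + r\<^sup>2) / (s * s * s)"
        using s by (intro divide_right_mono) auto
      then show ?thesis using s n by (simp add: add_divide_distrib)
    qed
    then show ?thesis using s n by (simp add: norm_divide r_def)
  qed
  have i1: "integrable ?P (\<lambda>x. 1 / s + (norm (Z x))\<^sup>2 / (real n * s))" using Zi' by simp
  show i2: "integrable ?P (\<lambda>x. norm ((\<Sum>k<n. f (x k)) / of_nat n - integral\<^sup>L M f))"
    unfolding \<mu>_def[symmetric] mean
  proof (rule Bochner_Integration.integrable_bound[OF i1])
    show "(\<lambda>x. norm (Z x / of_nat n)) \<in> borel_measurable ?P" using meas by simp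
    show "AE x in ?P. norm (norm (Z x / of_nat n)) \<le> norm (1 / s + (norm (Z x))\<^sup>2 / (real n * s))"
      unfolding real_norm_def abs_norm_cancel by (intro AE_I2 order_trans[OF bound] abs_ge_self)
  qed
  have "(\<integral>x. norm ((\<Sum>k<n. f (x k)) / of_nat n - integral\<^sup>L M f) \<partial>?P) \<le> (\<integral>x. 1 / s + (norm (Z x))\<^sup>2 / (real n * s) \<partial>?P)"
    using i1 i2 unfolding \<mu>_def[symmetric] mean by (intro integral_mono bound)
  also have "\<dots> = 1 / s + (V - (norm \<mu>)\<^sup>2) / s"
    using Zi' n by (simp add: EZ P.prob_space)
  also have "\<dots> \<le> (1 + V) / s"
    using s by (simp add: add_divide_distrib[symmetric] divide_right_mono)
  finally show "(\<integral>x. norm ((\<Sum>k<n. f (x k)) / of_nat n - integral\<^sup>L M f) \<partial>?P) \<le> (1 + (\<integral>x. (norm (f x))\<^sup>2 \<partial>M)) / sqrt (real n)"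
    by (simp add: V_def s_def)
qed

end

section \<open>Invariant laws of finite families\<close>

text \<open>The first form rests on orthonormal columns, the second on orthonormal rows; for
  \<open>cov\<close> they serve left and right translations respectively.\<close>

lemma wD_isometry:
  assumes g: "g \<in> SU2"
  shows "(\<Sum>k\<le>n. (norm (\<Sum>q\<le>n. wD n k q g * u q))\<^sup>2) = (\<Sum>k\<le>n. (norm (u k))\<^sup>2)"
    and "(\<Sum>k\<le>n. (norm (\<Sum>q\<le>n. u q * wD n q k g))\<^sup>2) = (\<Sum>k\<le>n. (norm (u k))\<^sup>2)"
proof -
  have "complex_of_real (\<Sum>k\<le>n. (norm (\<Sum>q\<le>n. wD n k q g * u q))\<^sup>2)
      = (\<Sum>k\<le>n. \<Sum>q\<le>n. \<Sum>p\<le>n. u q * cnj (u p) * (cnj (wD n k p g) * wD n k q g))"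
    unfolding of_real_sum complex_norm_square by (simp add: sum_product mult_ac)
  also have "\<dots> = (\<Sum>q\<le>n. \<Sum>p\<le>n. \<Sum>k\<le>n. u q * cnj (u p) * (cnj (wD n k p g) * wD n k q g))"
    by (rule trans[OF sum.swap]) (intro sum.cong refl sum.swap)
  also have "\<dots> = (\<Sum>q\<le>n. \<Sum>p\<le>n. u q * cnj (u p) * (if p = q then 1 else 0))"
    unfolding sum_distrib_left[symmetric] by (intro sum.cong refl) (simp add: wD_unitary'[OF g])
  also have "\<dots> = complex_of_real (\<Sum>k\<le>n. (norm (u k))\<^sup>2)"
    unfolding of_real_sum complex_norm_square by (intro sum.cong refl) simp
  finally show "(\<Sum>k\<le>n. (norm (\<Sum>q\<le>n. wD n k q g * u q))\<^sup>2) = (\<Sum>k\<le>n. (norm (u k))\<^sup>2)"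
    by (simp only: of_real_eq_iff)
  have "complex_of_real (\<Sum>k\<le>n. (norm (\<Sum>q\<le>n. u q * wD n q k g))\<^sup>2)
      = (\<Sum>k\<le>n. \<Sum>q\<le>n. \<Sum>p\<le>n. u q * cnj (u p) * (wD n q k g * cnj (wD n p k g)))"
    unfolding of_real_sum complex_norm_square by (simp add: sum_product mult_ac)
  also have "\<dots> = (\<Sum>q\<le>n. \<Sum>p\<le>n. \<Sum>k\<le>n. u q * cnj (u p) * (wD n q k g * cnj (wD n p k g)))"
    by (rule trans[OF sum.swap]) (intro sum.cong refl sum.swap)
  also have "\<dots> = (\<Sum>q\<le>n. \<Sum>p\<le>n. u q * cnj (u p) * (if q = p then 1 else 0))"
    unfolding sum_distrib_left[symmetric] by (intro sum.cong refl) (simp add: wD_unitary[OF g])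
  also have "\<dots> = complex_of_real (\<Sum>k\<le>n. (norm (u k))\<^sup>2)"
    unfolding of_real_sum complex_norm_square by (intro sum.cong refl) simp
  finally show "(\<Sum>k\<le>n. (norm (\<Sum>q\<le>n. u q * wD n q k g))\<^sup>2) = (\<Sum>k\<le>n. (norm (u k))\<^sup>2)"
    by (simp only: of_real_eq_iff)
qed

lemma measurable_wD [measurable]: "j \<le> n \<Longrightarrow> k \<le> n \<Longrightarrow> wD n j k \<in> borel_measurable su2_vol"
  by (intro borel_measurable_su2_volI continuous_wD)

context prob_space
begin

text \<open>Cauchy-Schwarz against the constant 1, in the form that a variance is
  nonnegative.\<close>

lemma expectation_norm_le_sqrt:
  fixes f :: "'a \<Rightarrow> complex"
  assumes f: "f \<in> borel_measurable M" and f2: "integrable M (\<lambda>x. (norm (f x))\<^sup>2)"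
  shows "integrable M f" "(\<integral>x. norm (f x) \<partial>M) \<le> sqrt (\<integral>x. (norm (f x))\<^sup>2 \<partial>M)"
proof -
  show i: "integrable M f"
  proof (rule Bochner_Integration.integrable_bound)
    show "integrable M (\<lambda>x. 1 + (norm (f x))\<^sup>2)" using f2 by simp
    have "r \<le> 1 + r\<^sup>2" for r :: real
      using zero_le_power2[of "r - 1 / 2"] by (simp add: power2_eq_square algebra_simps)
    then show "AE x in M. norm (f x) \<le> norm (1 + (norm (f x))\<^sup>2)" by auto
  qed (rule f)
  have "0 \<le> variance (\<lambda>x. norm (f x))" by (rule variance_positive)
  also have "variance (\<lambda>x. norm (f x)) = (\<integral>x. (norm (f x))\<^sup>2 \<partial>M) - (\<integral>x. norm (f x) \<partial>M)\<^sup>2"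
    using i f2 by (intro variance_eq) auto
  finally have "(\<integral>x. norm (f x) \<partial>M)\<^sup>2 \<le> (\<integral>x. (norm (f x))\<^sup>2 \<partial>M)" by simp
  then show "(\<integral>x. norm (f x) \<partial>M) \<le> sqrt (\<integral>x. (norm (f x))\<^sup>2 \<partial>M)" by (rule real_le_rsqrt)
qed

end

text \<open>The kernel that turns the law of a finite family into an equation for \<open>gsm\<close>.\<close>

definition gk :: "'i set \<Rightarrow> ('i \<Rightarrow> complex) \<Rightarrow> ('i \<Rightarrow> complex) \<Rightarrow> real" where
  "gk I t x = exp (- ((\<Sum>i\<in>I. (norm (t i - x i))\<^sup>2) / 2))"

lemma gk_bounds: "0 \<le> gk I t x" "gk I t x \<le> 1" "norm (gk I t x) \<le> 1" "\<bar>gk I t x\<bar> \<le> 1"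
  by (simp_all add: gk_def sum_nonneg)

text \<open>The derivative is \<open>- x * exp (- x^2 / 2)\<close> and is bounded by 1 in absolute
  value.\<close>

lemma exp_neg_half_square_lipschitz:
  assumes "0 \<le> r" "0 \<le> (s :: real)"
  shows "\<bar>exp (- (r\<^sup>2 / 2)) - exp (- (s\<^sup>2 / 2))\<bar> \<le> \<bar>r - s\<bar>"
proof -
  have "norm (exp (- (r\<^sup>2 / 2)) - exp (- (s\<^sup>2 / 2))) \<le> 1 * norm (r - s)"
  proof (rule field_differentiable_bound[of UNIV _ "\<lambda>x. - x * exp (- (x\<^sup>2 / 2))"])
    fix x :: real
    show "((\<lambda>r. exp (- (r\<^sup>2 / 2))) has_field_derivative - x * exp (- (x\<^sup>2 / 2))) (at x within UNIV)"
      by (auto intro!: derivative_eq_intros)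
    have "\<bar>x\<bar> * exp (- (\<bar>x\<bar>\<^sup>2 / 2)) \<le> 1"
    proof (cases "\<bar>x\<bar> \<le> 1")
      case False
      then have "\<bar>x\<bar> \<le> \<bar>x\<bar>\<^sup>2" by (intro self_le_power) auto
      then show ?thesis by (intro order_trans[OF mult_right_mono sq_exp_neg_le]) auto
    qed (intro mult_le_one, auto)
    then show "norm (- x * exp (- (x\<^sup>2 / 2))) \<le> 1" by (simp add: abs_mult)
  qed auto
  then show ?thesis by simp
qed

text \<open>Being bounded and Lipschitz, \<open>gk\<close> has expectations that pass to limits for
  which no moments are known. All factors of the product are at most 1, so their differences simply
  add up.\<close>

lemma gk_lipschitz:
  assumes "finite I"
  shows "\<bar>gk I t x - gk I t y\<bar> \<le> (\<Sum>i\<in>I. norm (x i - y i))"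
proof -
  have p: "gk I t x = (\<Prod>i\<in>I. exp (- ((norm (t i - x i))\<^sup>2 / 2)))" for x
    using assms by (simp add: gk_def exp_sum sum_divide_distrib sum_negf[symmetric])
  have "norm (gk I t x - gk I t y) \<le> (\<Sum>i\<in>I. norm (exp (- ((norm (t i - x i))\<^sup>2 / 2)) - exp (- ((norm (t i - y i))\<^sup>2 / 2))))"
    unfolding p by (rule norm_prod_diff) auto
  also have "\<dots> \<le> (\<Sum>i\<in>I. norm (x i - y i))"
  proof (rule sum_mono)
    fix i
    have "norm (exp (- ((norm (t i - x i))\<^sup>2 / 2)) - exp (- ((norm (t i - y i))\<^sup>2 / 2))) \<le> \<bar>norm (t i - x i) - norm (t i - y i)\<bar>"
      using exp_neg_half_square_lipschitz[of "norm (t i - x i)" "norm (t i - y i)"] by simp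
    also have "\<dots> \<le> norm ((t i - x i) - (t i - y i))" by (rule norm_triangle_ineq3)
    finally show "norm (exp (- ((norm (t i - x i))\<^sup>2 / 2)) - exp (- ((norm (t i - y i))\<^sup>2 / 2))) \<le> norm (x i - y i)"
      by (simp add: norm_minus_commute)
  qed
  finally show ?thesis by simp
qed

context prob_space
begin

lemma expectation_gk_indep:
  fixes Y :: "'i \<Rightarrow> 'a \<Rightarrow> complex"
  assumes I: "finite I" and Y: "indep_vars (\<lambda>_. borel) Y I"
  shows "(\<integral>\<omega>. gk I t (\<lambda>i. Y i \<omega>) \<partial>M) = (\<Prod>i\<in>I. gsm (Y i) (t i))"
proof -
  have m: "Y i \<in> borel_measurable M" if "i \<in> I" for i using Y that by (auto simp: indep_vars_def)
  have "indep_vars (\<lambda>_. borel) (\<lambda>i \<omega>. exp (- ((norm (t i - Y i \<omega>))\<^sup>2 / 2))) I"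
    by (rule indep_vars_compose2[OF Y, where Y = "\<lambda>i y. exp (- ((norm (t i - y))\<^sup>2 / 2))"]) simp
  then have "(\<integral>\<omega>. (\<Prod>i\<in>I. exp (- ((norm (t i - Y i \<omega>))\<^sup>2 / 2))) \<partial>M) = (\<Prod>i\<in>I. gsm (Y i) (t i))"
    unfolding gsm_def using I m integrable_gsm by (intro indep_vars_lebesgue_integral) auto
  then show ?thesis using I by (simp add: gk_def exp_sum sum_divide_distrib sum_negf[symmetric])
qed

text \<open>The kernel depends only on Euclidean distances, so a unitary matrix acting on the random
  vector can be moved to \<open>t\<close> as its inverse. Independence then turns invariance into
  the product equation for \<open>gsm\<close>.\<close>

lemma wD_law_invariant_imp_gaussian:
  fixes B :: "nat \<Rightarrow> 'a \<Rightarrow> complex"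
  assumes n: "n \<ge> 1" and B: "indep_vars (\<lambda>_. borel) B {..n}"
    and sym: "\<And>k. k \<le> n \<Longrightarrow> centrally_symmetric M (B k)"
    and inv: "\<And>g t. g \<in> SU2 \<Longrightarrow>
      (\<integral>\<omega>. gk {..n} t (\<lambda>k. \<Sum>q\<le>n. wD n k q g * B q \<omega>) \<partial>M) = (\<integral>\<omega>. gk {..n} t (\<lambda>k. B k \<omega>) \<partial>M)"
  obtains c where "c \<ge> 0" "\<And>k t. k \<le> n \<Longrightarrow> ccf (B k) t = exp (- (c * (norm t)\<^sup>2))"
proof (rule wD_invariant_imp_gaussian[OF n _ sym])
  show "B k \<in> borel_measurable M" if "k \<le> n" for k using B that by (auto simp: indep_vars_def)
  fix g t assume g: "g \<in> SU2"
  define h where "h = matrix_inv g"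
  have h: "h \<in> SU2" "g ** h = mat 1" using g by (simp_all add: h_def SU2_matrix_inv SU2_inv_mult)
  have "gk {..n} (\<lambda>k. \<Sum>q\<le>n. wD n k q g * t q) v = gk {..n} t (\<lambda>k. \<Sum>q\<le>n. wD n k q h * v q)" for v
  proof -
    have "(\<Sum>q\<le>n. wD n k q g * (t q - (\<Sum>p\<le>n. wD n q p h * v p))) = (\<Sum>q\<le>n. wD n k q g * t q) - v k" if k: "k \<le> n" for k
    proof -
      have "(\<Sum>q\<le>n. wD n k q g * (\<Sum>p\<le>n. wD n q p h * v p)) = (\<Sum>q\<le>n. \<Sum>p\<le>n. wD n k q g * wD n q p h * v p)"
        by (simp add: sum_distrib_left mult.assoc)
      also have "\<dots> = (\<Sum>p\<le>n. (\<Sum>q\<le>n. wD n k q g * wD n q p h) * v p)"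
        by (subst sum.swap) (simp add: sum_distrib_right)
      also have "\<dots> = (\<Sum>p\<le>n. (if k = p then 1 else 0) * v p)"
        using k by (intro sum.cong refl) (simp add: wD_mult[symmetric] g h wD_1)
      also have "\<dots> = v k" using k by simp
      finally show ?thesis by (simp add: right_diff_distrib sum_subtractf)
    qed
    then have "(\<Sum>k\<le>n. (norm ((\<Sum>q\<le>n. wD n k q g * t q) - v k))\<^sup>2)
      = (\<Sum>k\<le>n. (norm (\<Sum>q\<le>n. wD n k q g * (t q - (\<Sum>p\<le>n. wD n q p h * v p))))\<^sup>2)"
      by (intro sum.cong refl) simp
    also have "\<dots> = (\<Sum>k\<le>n. (norm (t k - (\<Sum>p\<le>n. wD n k p h * v p)))\<^sup>2)"
      by (rule wD_isometry[OF g])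
    finally show ?thesis by (simp add: gk_def)
  qed
  then show "(\<Prod>k\<le>n. gsm (B k) (\<Sum>q\<le>n. wD n k q g * t q)) = (\<Prod>k\<le>n. gsm (B k) (t k))"
    using inv[OF h(1), of t] by (simp add: expectation_gk_indep[OF _ B, symmetric])
qed (use that in auto)

lemma ccf_cnj: "ccf (\<lambda>\<omega>. cnj (W \<omega>)) t = ccf W (cnj t)"
  by (simp add: ccf_def)

lemma ccf_linear_combination:
  fixes Y :: "'i \<Rightarrow> 'a \<Rightarrow> complex"
  assumes I: "finite I" and Y: "indep_vars (\<lambda>_. borel) Y I"
    and c: "\<And>i t. i \<in> I \<Longrightarrow> ccf (Y i) t = exp (- (c i * (norm t)\<^sup>2))"
  shows "ccf (\<lambda>\<omega>. \<Sum>i\<in>I. b i * Y i \<omega>) t = exp (- ((\<Sum>i\<in>I. c i * (norm (b i))\<^sup>2) * (norm t)\<^sup>2))"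
proof -
  have cis_sum: "cis (\<Sum>i\<in>I. f i) = (\<Prod>i\<in>I. cis (f i))" for f
    using I by (induction I rule: finite_induct) (simp_all add: cis_mult[symmetric])
  have m: "Y i \<in> borel_measurable M" if "i \<in> I" for i using Y that by (auto simp: indep_vars_def)
  have "ccf (\<lambda>\<omega>. \<Sum>i\<in>I. b i * Y i \<omega>) t = (\<integral>\<omega>. (\<Prod>i\<in>I. cis (Re (cnj (cnj (b i) * t) * Y i \<omega>))) \<partial>M)"
    unfolding ccf_def cis_sum[symmetric]
    by (intro Bochner_Integration.integral_cong refl arg_cong[of _ _ cis])
      (simp only: sum_distrib_left Re_sum[symmetric], simp only: complex_cnj_mult complex_cnj_cnj mult_ac)
  also have "\<dots> = (\<Prod>i\<in>I. \<integral>\<omega>. cis (Re (cnj (cnj (b i) * t) * Y i \<omega>)) \<partial>M)"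
  proof (rule indep_vars_lebesgue_integral[OF I])
    show "indep_vars (\<lambda>_. borel) (\<lambda>i \<omega>. cis (Re (cnj (cnj (b i) * t) * Y i \<omega>))) I"
      by (rule indep_vars_compose2[OF Y, where Y = "\<lambda>i y. cis (Re (cnj (cnj (b i) * t) * y))"]) simp
    show "integrable M (\<lambda>\<omega>. cis (Re (cnj (cnj (b i) * t) * Y i \<omega>)))" if "i \<in> I" for i
      using m[OF that] by (intro integrable_bounded_complex[where B = 1]) auto
  qed
  also have "\<dots> = (\<Prod>i\<in>I. ccf (Y i) (cnj (b i) * t))" by (simp only: ccf_def)
  also have "\<dots> = (\<Prod>i\<in>I. complex_of_real (exp (- (c i * (norm (b i))\<^sup>2 * (norm t)\<^sup>2))))"
    by (intro prod.cong refl) (simp add: c norm_mult power_mult_distrib mult.assoc)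
  also have "\<dots> = complex_of_real (\<Prod>i\<in>I. exp (- (c i * (norm (b i))\<^sup>2 * (norm t)\<^sup>2)))" by simp
  also have "(\<Prod>i\<in>I. exp (- (c i * (norm (b i))\<^sup>2 * (norm t)\<^sup>2))) = exp (- ((\<Sum>i\<in>I. c i * (norm (b i))\<^sup>2) * (norm t)\<^sup>2))"
    using I by (simp add: exp_sum[symmetric] sum_negf sum_distrib_right)
  finally show ?thesis .
qed

text \<open>Independence passes through the blocks indexed by the singletons \<open>{f j}\<close>,
  which are disjoint because \<open>f\<close> is injective.\<close>

lemma indep_vars_reindex:
  assumes X: "indep_vars M' X I" and f: "inj_on f J" "f ` J \<subseteq> I"
  shows "indep_vars (\<lambda>j. M' (f j)) (\<lambda>j. X (f j)) J"
proof -
  have "indep_vars (\<lambda>j. PiM {f j} M') (\<lambda>j \<omega>. restrict (\<lambda>i. X i \<omega>) {f j}) J"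
    using f by (intro indep_vars_restrict[OF X]) (auto simp: disjoint_family_on_def inj_on_def)
  from indep_vars_compose2[OF this, of "\<lambda>j x. x (f j)" "\<lambda>j. M' (f j)"]
  show ?thesis by (simp add: measurable_component_singleton)
qed

lemma norm_cis_diff_le: "norm (cis x - cis y) \<le> \<bar>x - y\<bar>"
proof -
  have "cis x - cis y = cis y * (cis (x - y) - 1)" by (simp add: right_diff_distrib cis_mult)
  then have "norm (cis x - cis y) = norm (cis (x - y) - 1)" by (simp add: norm_mult)
  also have "\<dots> \<le> \<bar>x - y\<bar>" using iexp_approx1[of "x - y" 0] by (simp add: cis_conv_exp)
  finally show ?thesis .
qed

text \<open>The mean of the distance truncated at 1 describes convergence in probability and needs
  no integrability of the variables.\<close>

lemma ccf_tendsto_in_prob: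
  assumes [measurable]: "W \<in> borel_measurable M" "\<And>k. V k \<in> borel_measurable M"
    and lim: "(\<lambda>k. \<integral>\<omega>. min 1 (norm (V k \<omega> - W \<omega>)) \<partial>M) \<longlonglongrightarrow> 0"
  shows "(\<lambda>k. ccf (V k) t) \<longlonglongrightarrow> ccf W t"
proof -
  have b: "norm (ccf (V k) t - ccf W t) \<le> (2 + norm t) * (\<integral>\<omega>. min 1 (norm (V k \<omega> - W \<omega>)) \<partial>M)" for k
  proof -
    have i: "integrable M (\<lambda>\<omega>. cis (Re (cnj t * V k \<omega>)))" "integrable M (\<lambda>\<omega>. cis (Re (cnj t * W \<omega>)))"
      by (auto intro!: integrable_bounded_complex[where B = 1])
    have im: "integrable M (\<lambda>\<omega>. min 1 (norm (V k \<omega> - W \<omega>)))"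
      by (rule integrable_const_bound[where B = 1]) auto
    have "norm (ccf (V k) t - ccf W t) = norm (\<integral>\<omega>. cis (Re (cnj t * V k \<omega>)) - cis (Re (cnj t * W \<omega>)) \<partial>M)"
      unfolding ccf_def using i by simp
    also have "\<dots> \<le> (\<integral>\<omega>. norm (cis (Re (cnj t * V k \<omega>)) - cis (Re (cnj t * W \<omega>))) \<partial>M)" by (rule integral_norm_bound)
    \<comment> \<open>The constant covers both regimes: two unimodular numbers differ by at most 2,
      and for small distances the Lipschitz bound has the factor \<open>norm t\<close>.\<close>
    also have "\<dots> \<le> (\<integral>\<omega>. (2 + norm t) * min 1 (norm (V k \<omega> - W \<omega>)) \<partial>M)"
    proof (rule integral_mono)
      fix \<omega>
      have 1: "norm (cis (Re (cnj t * V k \<omega>)) - cis (Re (cnj t * W \<omega>))) \<le> 2"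
        using norm_triangle_ineq4[of "cis (Re (cnj t * V k \<omega>))" "cis (Re (cnj t * W \<omega>))"] by simp
      have "norm (cis (Re (cnj t * V k \<omega>)) - cis (Re (cnj t * W \<omega>))) \<le> \<bar>Re (cnj t * V k \<omega>) - Re (cnj t * W \<omega>)\<bar>"
        by (rule norm_cis_diff_le)
      also have "\<dots> = \<bar>Re (cnj t * (V k \<omega> - W \<omega>))\<bar>" by (simp only: right_diff_distrib minus_complex.sel)
      also have "\<dots> \<le> norm t * norm (V k \<omega> - W \<omega>)"
        using abs_Re_le_cmod[of "cnj t * (V k \<omega> - W \<omega>)"] by (simp only: norm_mult complex_mod_cnj)
      finally have 2: "norm (cis (Re (cnj t * V k \<omega>)) - cis (Re (cnj t * W \<omega>))) \<le> norm t * norm (V k \<omega> - W \<omega>)" .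
      show "norm (cis (Re (cnj t * V k \<omega>)) - cis (Re (cnj t * W \<omega>))) \<le> (2 + norm t) * min 1 (norm (V k \<omega> - W \<omega>))"
      proof (cases "norm (V k \<omega> - W \<omega>) \<le> 1")
        case True
        have "norm t * norm (V k \<omega> - W \<omega>) \<le> (2 + norm t) * norm (V k \<omega> - W \<omega>)" by (intro mult_right_mono) auto
        with 2 True show ?thesis by (simp add: min_absorb2)
      next
        case False
        then have m: "min 1 (norm (V k \<omega> - W \<omega>)) = 1" by simp
        show ?thesis unfolding m mult_1_right using 1 norm_ge_zero[of t] by linarith
      qed
    next
      show "integrable M (\<lambda>\<omega>. norm (cis (Re (cnj t * V k \<omega>)) - cis (Re (cnj t * W \<omega>))))" using i by (intro integrable_norm) auto
      show "integrable M (\<lambda>\<omega>. (2 + norm t) * min 1 (norm (V k \<omega> - W \<omega>)))" using im by simp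
    qed
    finally show ?thesis by simp
  qed
  have "(\<lambda>k. (2 + norm t) * (\<integral>\<omega>. min 1 (norm (V k \<omega> - W \<omega>)) \<partial>M)) \<longlonglongrightarrow> 0"
    using tendsto_mult_right_zero[OF lim] by simp
  then have "(\<lambda>k. ccf (V k) t - ccf W t) \<longlonglongrightarrow> 0"
    by (rule Lim_null_comparison[rotated]) (simp add: b)
  then show ?thesis by (rule LIM_zero_cancel)
qed

end

section \<open>Fields on the group\<close>

locale su2_field = prob_space M for M :: "'w measure" +
  fixes X :: "'w \<Rightarrow> complex^2^2 \<Rightarrow> complex"
  assumes sq: "square_integrable_field M X"
begin

lemma measurable_X_joint [measurable]: "(\<lambda>p. X (fst p) (snd p)) \<in> borel_measurable (M \<Otimes>\<^sub>M su2_prob)"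
proof -
  have "(\<lambda>(\<omega>, g). X \<omega> g) \<in> borel_measurable (M \<Otimes>\<^sub>M su2_vol)"
    using sq unfolding square_integrable_field_def random_field_def by (rule conjunct1)
  moreover have "(\<lambda>(\<omega>, g). X \<omega> g) = (\<lambda>p. X (fst p) (snd p))" by auto
  moreover have s: "sets (M \<Otimes>\<^sub>M su2_prob) = sets (M \<Otimes>\<^sub>M su2_vol)" by (intro sets_pair_measure_cong) auto
  ultimately show ?thesis unfolding measurable_cong_sets[OF s refl] by simp
qed

lemma measurable_X:
  assumes "g \<in> SU2"
  shows "(\<lambda>\<omega>. X \<omega> g) \<in> borel_measurable M"
proof -
  have "g \<in> space su2_prob" using assms by simp
  from measurable_compose[OF measurable_Pair2'[OF this] measurable_X_joint] show ?thesis
    by (simp only: fst_conv snd_conv)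
qed

lemma measurable_X_section:
  assumes "\<omega> \<in> space M"
  shows "X \<omega> \<in> borel_measurable su2_prob"
  using measurable_compose[OF measurable_Pair1'[OF assms] measurable_X_joint]
  by (simp only: fst_conv snd_conv)

lemma AE_X_L2: "AE \<omega> in M. integrable su2_prob (\<lambda>g. (cmod (X \<omega> g))\<^sup>2)"
  using sq unfolding square_integrable_field_def integrable_su2_prob by (rule conjunct2)

definition sample_mean :: "nat \<Rightarrow> (complex^2^2 \<Rightarrow> complex) \<Rightarrow> 'w \<Rightarrow> (nat \<Rightarrow> complex^2^2) \<Rightarrow> complex" where
  "sample_mean n h \<omega> x = (\<Sum>k<n. X \<omega> (x k) * h (x k)) / of_nat n"

text \<open>No conjugate here: the test functions \<open>hD\<close> contain it.\<close>

definition pairing :: "(complex^2^2 \<Rightarrow> complex) \<Rightarrow> 'w \<Rightarrow> complex" where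
  "pairing h \<omega> = (\<integral>g. X \<omega> g * h g \<partial>su2_prob)"

abbreviation sample_space :: "nat \<Rightarrow> (nat \<Rightarrow> complex^2^2) measure" where
  "sample_space n \<equiv> Pi\<^sub>M {..<n} (\<lambda>_. su2_prob)"

lemma prob_space_sample_space: "prob_space (sample_space n)"
  by (rule prob_space_PiM) (rule prob_space_su2_prob)

lemma measurable_pairing [measurable]:
  assumes "h \<in> borel_measurable su2_prob"
  shows "pairing h \<in> borel_measurable M"
proof -
  have [measurable]: "h \<in> borel_measurable su2_vol" using assms by simp
  have "(\<lambda>p. X (fst p) (snd p) * h (snd p)) \<in> borel_measurable (M \<Otimes>\<^sub>M su2_prob)" by measurable
  then show ?thesis unfolding pairing_def[abs_def]
    by (intro su2.borel_measurable_lebesgue_integral) (simp add: case_prod_beta')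
qed

lemma measurable_sample_mean [measurable]:
  assumes "h \<in> borel_measurable su2_prob"
  shows "(\<lambda>p. sample_mean n h (fst p) (snd p)) \<in> borel_measurable (M \<Otimes>\<^sub>M sample_space n)"
proof -
  have "(\<lambda>p. X (fst p) (snd p k) * h (snd p k)) \<in> borel_measurable (M \<Otimes>\<^sub>M sample_space n)" if "k < n" for k
  proof -
    have "(\<lambda>p. snd p k) \<in> M \<Otimes>\<^sub>M sample_space n \<rightarrow>\<^sub>M su2_prob"
      using that by (intro measurable_compose[OF measurable_snd measurable_component_singleton]) simp
    then have "(\<lambda>p. (fst p, snd p k)) \<in> M \<Otimes>\<^sub>M sample_space n \<rightarrow>\<^sub>M M \<Otimes>\<^sub>M su2_prob"
      by (intro measurable_Pair measurable_fst)
    from measurable_compose[OF this measurable_X_joint] measurable_compose[OF \<open>(\<lambda>p. snd p k) \<in> _\<close> assms]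
    show ?thesis by simp
  qed
  then show ?thesis unfolding sample_mean_def by (intro borel_measurable_divide borel_measurable_sum) auto
qed

text \<open>For fixed \<open>\<omega>\<close> the sample points are the random objects, and the path
  only has to be square integrable. Integrability is recorded because a nonintegrable function has
  integral 0 by convention, and then the limit alone would say nothing.\<close>

lemma AE_sample_deviation:
  assumes h: "h \<in> borel_measurable su2_prob" "\<And>g. g \<in> SU2 \<Longrightarrow> norm (h g) \<le> B"
  shows "AE \<omega> in M. (\<lambda>n. \<integral>x. norm (sample_mean n h \<omega> x - pairing h \<omega>) \<partial>sample_space n) \<longlonglongrightarrow> 0
    \<and> (\<forall>n>0. integrable (sample_space n) (\<lambda>x. norm (sample_mean n h \<omega> x - pairing h \<omega>)))"
  using AE_X_L2
proof (rule AE_mp[OF _ AE_I2[OF impI]])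
  fix \<omega> assume \<omega>: "\<omega> \<in> space M" and L2: "integrable su2_prob (\<lambda>g. (cmod (X \<omega> g))\<^sup>2)"
  define f where "f g = X \<omega> g * h g" for g
  have fm: "f \<in> borel_measurable su2_prob"
    unfolding f_def using measurable_X_section[OF \<omega>] h(1) by (rule borel_measurable_times)
  have f2: "integrable su2_prob (\<lambda>g. (norm (f g))\<^sup>2)"
  proof (rule Bochner_Integration.integrable_bound)
    show "integrable su2_prob (\<lambda>g. B\<^sup>2 * (cmod (X \<omega> g))\<^sup>2)" using L2 by simp
    have "(norm (f g))\<^sup>2 \<le> B\<^sup>2 * (cmod (X \<omega> g))\<^sup>2" if "g \<in> SU2" for g
    proof -
      have "(norm (f g))\<^sup>2 = (norm (h g))\<^sup>2 * (cmod (X \<omega> g))\<^sup>2"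
        by (simp add: f_def norm_mult power_mult_distrib)
      also have "\<dots> \<le> B\<^sup>2 * (cmod (X \<omega> g))\<^sup>2"
        using power_mono[OF h(2)[OF that], of 2] by (intro mult_right_mono) auto
      finally show ?thesis .
    qed
    then show "AE g in su2_prob. norm ((norm (f g))\<^sup>2) \<le> norm (B\<^sup>2 * (cmod (X \<omega> g))\<^sup>2)" by (intro AE_I2) auto
  qed (use fm in simp)
  define V where "V = (\<integral>g. (norm (f g))\<^sup>2 \<partial>su2_prob)"
  have e: "sample_mean n h \<omega> x - pairing h \<omega> = (\<Sum>k<n. f (x k)) / of_nat n - integral\<^sup>L su2_prob f" for n x
    by (simp add: sample_mean_def pairing_def f_def[abs_def])
  have i: "integrable (sample_space n) (\<lambda>x. norm (sample_mean n h \<omega> x - pairing h \<omega>))" if "n > 0" for n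
    unfolding e by (rule prob_space.sample_mean_deviation(2)[OF prob_space_su2_prob fm f2 that])
  have "(\<lambda>n. \<integral>x. norm (sample_mean n h \<omega> x - pairing h \<omega>) \<partial>sample_space n) \<longlonglongrightarrow> 0"
  proof (rule Lim_null_comparison)
    show "(\<lambda>n. (1 + V) / sqrt (real n)) \<longlonglongrightarrow> 0" by real_asymp
    show "\<forall>\<^sub>F n in sequentially. norm (\<integral>x. norm (sample_mean n h \<omega> x - pairing h \<omega>) \<partial>sample_space n) \<le> (1 + V) / sqrt (real n)"
      using eventually_gt_at_top[of 0]
    proof eventually_elim
      case (elim n)
      have "0 \<le> (\<integral>x. norm (sample_mean n h \<omega> x - pairing h \<omega>) \<partial>sample_space n)" by (intro integral_nonneg_AE) auto
      moreover have "(\<integral>x. norm (sample_mean n h \<omega> x - pairing h \<omega>) \<partial>sample_space n) \<le> (1 + V) / sqrt (real n)"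
        unfolding e V_def by (rule prob_space.sample_mean_deviation(1)[OF prob_space_su2_prob fm f2 elim])
      ultimately show ?case by (simp only: real_norm_def abs_of_nonneg)
    qed
  qed
  then show "(\<lambda>n. \<integral>x. norm (sample_mean n h \<omega> x - pairing h \<omega>) \<partial>sample_space n) \<longlonglongrightarrow> 0
    \<and> (\<forall>n>0. integrable (sample_space n) (\<lambda>x. norm (sample_mean n h \<omega> x - pairing h \<omega>)))"
    using i by blast
qed

text \<open>For fixed sample points the inner expectation depends only on a finite-dimensional law.
  Fubini exchanges it with the average over the points, and for almost every path that average
  converges.\<close>

lemma expectation_gk_sample_limit:
  assumes I: "finite I" and h: "\<And>i. i \<in> I \<Longrightarrow> h i \<in> borel_measurable su2_prob" "\<And>i g. i \<in> I \<Longrightarrow> g \<in> SU2 \<Longrightarrow> norm (h i g) \<le> B"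
  shows "(\<lambda>n. \<integral>x. \<integral>\<omega>. gk I t (\<lambda>i. sample_mean n (h i) \<omega> x) \<partial>M \<partial>sample_space n)
    \<longlonglongrightarrow> (\<integral>\<omega>. gk I t (\<lambda>i. pairing (h i) \<omega>) \<partial>M)"
proof -
  define G where "G n \<omega> = (\<integral>x. gk I t (\<lambda>i. sample_mean n (h i) \<omega> x) \<partial>sample_space n)" for n \<omega>
  have gm: "(\<lambda>p. gk I t (\<lambda>i. sample_mean n (h i) (fst p) (snd p))) \<in> borel_measurable (M \<Otimes>\<^sub>M sample_space n)" for n
    unfolding gk_def using h(1)
    by (intro borel_measurable_exp borel_measurable_uminus borel_measurable_divide borel_measurable_sum borel_measurable_power
        borel_measurable_norm borel_measurable_diff measurable_sample_mean borel_measurable_const measurable_compose[OF _ borel_measurable_exp]) auto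
  have swap: "(\<integral>x. \<integral>\<omega>. gk I t (\<lambda>i. sample_mean n (h i) \<omega> x) \<partial>M \<partial>sample_space n) = (\<integral>\<omega>. G n \<omega> \<partial>M)" for n
  proof -
    interpret P: prob_space "sample_space n" by (rule prob_space_sample_space)
    interpret Q: pair_prob_space M "sample_space n" ..
    have "integrable (M \<Otimes>\<^sub>M sample_space n) (\<lambda>p. gk I t (\<lambda>i. sample_mean n (h i) (fst p) (snd p)))"
      using gm by (intro Q.integrable_const_bound[where B = 1]) (auto simp: gk_bounds)
    then show ?thesis unfolding G_def by (intro Q.Fubini_integral) (simp add: case_prod_beta')
  qed
  have "(\<lambda>n. \<integral>\<omega>. G n \<omega> \<partial>M) \<longlonglongrightarrow> (\<integral>\<omega>. gk I t (\<lambda>i. pairing (h i) \<omega>) \<partial>M)"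
  proof (rule integral_dominated_convergence[where w = "\<lambda>_. 1"])
    show "(\<lambda>\<omega>. gk I t (\<lambda>i. pairing (h i) \<omega>)) \<in> borel_measurable M"
      unfolding gk_def using h(1)
      by (intro measurable_compose[OF _ borel_measurable_exp] borel_measurable_uminus borel_measurable_divide borel_measurable_sum borel_measurable_power
        borel_measurable_norm borel_measurable_diff measurable_pairing borel_measurable_const) auto
    show "G n \<in> borel_measurable M" for n
    proof -
      interpret P: prob_space "sample_space n" by (rule prob_space_sample_space)
      show ?thesis unfolding G_def[abs_def] using gm[of n]
        by (intro P.borel_measurable_lebesgue_integral) (simp add: case_prod_beta')
    qed
    show "AE \<omega> in M. norm (G n \<omega>) \<le> 1" for n
    proof (rule AE_I2)
      fix \<omega>
      interpret P: prob_space "sample_space n" by (rule prob_space_sample_space)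
      have "norm (G n \<omega>) \<le> (\<integral>x. norm (gk I t (\<lambda>i. sample_mean n (h i) \<omega> x)) \<partial>sample_space n)"
        unfolding G_def by (rule integral_norm_bound)
      \<comment> \<open>In the nonintegrable case the integral is 0 by convention, and the bound is
        trivial.\<close>
      also have "\<dots> \<le> 1"
        by (cases "integrable (sample_space n) (\<lambda>x. norm (gk I t (\<lambda>i. sample_mean n (h i) \<omega> x)))")
          (auto simp: not_integrable_integral_eq intro!: P.integral_le_const AE_I2 gk_bounds)
      finally show "norm (G n \<omega>) \<le> 1" .
    qed
    have "AE \<omega> in M. \<forall>i\<in>I. (\<lambda>n. \<integral>x. norm (sample_mean n (h i) \<omega> x - pairing (h i) \<omega>) \<partial>sample_space n) \<longlonglongrightarrow> 0
      \<and> (\<forall>n>0. integrable (sample_space n) (\<lambda>x. norm (sample_mean n (h i) \<omega> x - pairing (h i) \<omega>)))"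
      using I h by (intro AE_finite_allI AE_sample_deviation) auto
    then show "AE \<omega> in M. (\<lambda>n. G n \<omega>) \<longlonglongrightarrow> gk I t (\<lambda>i. pairing (h i) \<omega>)"
    proof (rule AE_mp[OF _ AE_I2[OF impI]])
      fix \<omega> assume \<omega>: "\<omega> \<in> space M"
        and D: "\<forall>i\<in>I. (\<lambda>n. \<integral>x. norm (sample_mean n (h i) \<omega> x - pairing (h i) \<omega>) \<partial>sample_space n) \<longlonglongrightarrow> 0
          \<and> (\<forall>n>0. integrable (sample_space n) (\<lambda>x. norm (sample_mean n (h i) \<omega> x - pairing (h i) \<omega>)))"
      have "(\<lambda>n. \<Sum>i\<in>I. \<integral>x. norm (sample_mean n (h i) \<omega> x - pairing (h i) \<omega>) \<partial>sample_space n) \<longlonglongrightarrow> (\<Sum>i\<in>I. 0)"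
        using D by (intro tendsto_sum) auto
      then have s0: "(\<lambda>n. \<Sum>i\<in>I. \<integral>x. norm (sample_mean n (h i) \<omega> x - pairing (h i) \<omega>) \<partial>sample_space n) \<longlonglongrightarrow> 0"
        by simp
      have "(\<lambda>n. G n \<omega> - gk I t (\<lambda>i. pairing (h i) \<omega>)) \<longlonglongrightarrow> 0"
      proof (rule Lim_null_comparison[OF _ s0])
        show "\<forall>\<^sub>F n in sequentially. norm (G n \<omega> - gk I t (\<lambda>i. pairing (h i) \<omega>)) \<le> (\<Sum>i\<in>I. \<integral>x. norm (sample_mean n (h i) \<omega> x - pairing (h i) \<omega>) \<partial>sample_space n)"
          using eventually_gt_at_top[of 0]
        proof eventually_elim
          case (elim n)
          interpret P: prob_space "sample_space n" by (rule prob_space_sample_space)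
          have m: "(\<lambda>x. gk I t (\<lambda>i. sample_mean n (h i) \<omega> x)) \<in> borel_measurable (sample_space n)"
            using measurable_compose[OF measurable_Pair1'[OF \<omega>] gm[of n]] by simp
          have i: "integrable (sample_space n) (\<lambda>x. gk I t (\<lambda>i. sample_mean n (h i) \<omega> x))"
            using m by (intro P.integrable_const_bound[where B = 1]) (auto simp: gk_bounds)
          define E where "E x = gk I t (\<lambda>i. sample_mean n (h i) \<omega> x) - gk I t (\<lambda>i. pairing (h i) \<omega>)" for x
          have e: "G n \<omega> - gk I t (\<lambda>i. pairing (h i) \<omega>) = (\<integral>x. E x \<partial>sample_space n)"
            unfolding G_def E_def using i by (simp add: P.prob_space)
          have iE: "integrable (sample_space n) E" unfolding E_def using i by simp
          have "norm (\<integral>x. E x \<partial>sample_space n) \<le> (\<integral>x. norm (E x) \<partial>sample_space n)"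
            by (rule integral_norm_bound)
          also have "\<dots> \<le> (\<integral>x. (\<Sum>i\<in>I. norm (sample_mean n (h i) \<omega> x - pairing (h i) \<omega>)) \<partial>sample_space n)"
          proof (rule integral_mono)
            show "integrable (sample_space n) (\<lambda>x. \<Sum>i\<in>I. norm (sample_mean n (h i) \<omega> x - pairing (h i) \<omega>))"
              using D elim by (intro Bochner_Integration.integrable_sum) blast
            show "norm (E x) \<le> (\<Sum>i\<in>I. norm (sample_mean n (h i) \<omega> x - pairing (h i) \<omega>))" for x
              unfolding E_def real_norm_def by (rule gk_lipschitz[OF I])
          qed (use iE in simp)
          also have "\<dots> = (\<Sum>i\<in>I. \<integral>x. norm (sample_mean n (h i) \<omega> x - pairing (h i) \<omega>) \<partial>sample_space n)"
            using D elim by (intro Bochner_Integration.integral_sum) blast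
          finally show ?case unfolding e .
        qed
      qed
      then show "(\<lambda>n. G n \<omega>) \<longlonglongrightarrow> gk I t (\<lambda>i. pairing (h i) \<omega>)" by (rule LIM_zero_cancel)
    qed
  qed auto
  then show ?thesis unfolding swap .
qed

text \<open>The Gaussian property concerns fixed points of the group, so the random sample has to be
  replaced by a deterministic one: some sample is no worse than the average over all
  samples.\<close>

lemma exists_sample_converging:
  assumes h: "h \<in> borel_measurable su2_prob" "\<And>g. g \<in> SU2 \<Longrightarrow> norm (h g) \<le> B"
  obtains x where "\<And>n k. k < n \<Longrightarrow> x n k \<in> SU2"
    "(\<lambda>n. \<integral>\<omega>. min 1 (norm (sample_mean n h \<omega> (x n) - pairing h \<omega>)) \<partial>M) \<longlonglongrightarrow> 0"
proof -
  define \<delta> where "\<delta> n \<omega> x = min 1 (norm (sample_mean n h \<omega> x - pairing h \<omega>))" for n \<omega> x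
  define G where "G n \<omega> = (\<integral>x. \<delta> n \<omega> x \<partial>sample_space n)" for n \<omega>
  define H where "H n x = (\<integral>\<omega>. \<delta> n \<omega> x \<partial>M)" for n x
  have \<delta>m: "(\<lambda>p. \<delta> n (fst p) (snd p)) \<in> borel_measurable (M \<Otimes>\<^sub>M sample_space n)" for n
    unfolding \<delta>_def
    by (intro borel_measurable_min borel_measurable_const measurable_compose[OF _ borel_measurable_norm]
        borel_measurable_diff[OF measurable_sample_mean[OF h(1)] measurable_compose[OF measurable_fst measurable_pairing[OF h(1)]]])
  have \<delta>01: "0 \<le> \<delta> n \<omega> x" "\<delta> n \<omega> x \<le> 1" for n \<omega> x by (auto simp: \<delta>_def)
  have ex: "\<exists>x\<in>space (sample_space n). H n x \<le> (\<integral>\<omega>. G n \<omega> \<partial>M)" for n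
  proof (rule ccontr)
    assume *: "\<not> ?thesis"
    interpret P: prob_space "sample_space n" by (rule prob_space_sample_space)
    interpret Q: pair_prob_space M "sample_space n" ..
    have i: "integrable (M \<Otimes>\<^sub>M sample_space n) (case_prod (\<delta> n))"
      using \<delta>m[of n] \<delta>01 by (intro Q.integrable_const_bound[where B = 1]) (auto simp: case_prod_beta')
    have eq: "(\<integral>x. H n x \<partial>sample_space n) = (\<integral>\<omega>. G n \<omega> \<partial>M)"
      unfolding H_def G_def using Q.Fubini_integral[OF i] .
    have Hi: "integrable (sample_space n) (H n)"
      unfolding H_def[abs_def] using Q.integrable_snd[OF i] .
    have "(\<integral>\<omega>. G n \<omega> \<partial>M) < (\<integral>x. H n x \<partial>sample_space n)"
      using * by (intro P.expectation_greater[OF Hi]) (auto simp: not_le)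
    then show False using eq by simp
  qed
  have "(\<lambda>n. \<integral>\<omega>. G n \<omega> \<partial>M) \<longlonglongrightarrow> (\<integral>\<omega>. 0 \<partial>M)"
  proof (rule integral_dominated_convergence[where w = "\<lambda>_. 1"])
    show "G n \<in> borel_measurable M" for n
    proof -
      interpret P: prob_space "sample_space n" by (rule prob_space_sample_space)
      show ?thesis unfolding G_def[abs_def] using \<delta>m[of n]
        by (intro P.borel_measurable_lebesgue_integral) (simp add: case_prod_beta')
    qed
    show "AE \<omega> in M. norm (G n \<omega>) \<le> 1" for n
    proof (rule AE_I2)
      fix \<omega>
      interpret P: prob_space "sample_space n" by (rule prob_space_sample_space)
      have "norm (G n \<omega>) \<le> (\<integral>x. norm (\<delta> n \<omega> x) \<partial>sample_space n)"
        unfolding G_def by (rule integral_norm_bound)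
      also have "\<dots> \<le> 1"
        using \<delta>01 by (cases "integrable (sample_space n) (\<lambda>x. norm (\<delta> n \<omega> x))")
          (auto simp: not_integrable_integral_eq intro!: P.integral_le_const AE_I2)
      finally show "norm (G n \<omega>) \<le> 1" .
    qed
    have dev: "AE \<omega> in M. (\<lambda>n. \<integral>x. norm (sample_mean n h \<omega> x - pairing h \<omega>) \<partial>sample_space n) \<longlonglongrightarrow> 0
      \<and> (\<forall>n>0. integrable (sample_space n) (\<lambda>x. norm (sample_mean n h \<omega> x - pairing h \<omega>)))"
      using h by (rule AE_sample_deviation)
    show "AE \<omega> in M. (\<lambda>n. G n \<omega>) \<longlonglongrightarrow> 0"
      using AE_space dev
    proof eventually_elim
      case (elim \<omega>)
      note \<omega> = elim(1) and D = elim(2)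
      show ?case
      proof (rule Lim_null_comparison[OF _ conjunct1[OF D]])
        show "\<forall>\<^sub>F n in sequentially. norm (G n \<omega>) \<le> (\<integral>x. norm (sample_mean n h \<omega> x - pairing h \<omega>) \<partial>sample_space n)"
          using eventually_gt_at_top[of 0]
        proof eventually_elim
          case (elim n)
          interpret P: prob_space "sample_space n" by (rule prob_space_sample_space)
          have m: "(\<lambda>x. \<delta> n \<omega> x) \<in> borel_measurable (sample_space n)"
            using measurable_compose[OF measurable_Pair1'[OF \<omega>] \<delta>m[of n]] by simp
          have e: "norm (G n \<omega>) = G n \<omega>" unfolding G_def using \<delta>01 by (simp add: integral_nonneg_AE)
          have "G n \<omega> \<le> (\<integral>x. norm (sample_mean n h \<omega> x - pairing h \<omega>) \<partial>sample_space n)"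
            unfolding G_def
          proof (rule integral_mono)
            show "integrable (sample_space n) (\<lambda>x. \<delta> n \<omega> x)"
              using m \<delta>01 by (intro P.integrable_const_bound[where B = 1]) auto
            show "integrable (sample_space n) (\<lambda>x. norm (sample_mean n h \<omega> x - pairing h \<omega>))"
              using D elim by blast
            show "\<delta> n \<omega> x \<le> norm (sample_mean n h \<omega> x - pairing h \<omega>)" for x by (simp add: \<delta>_def)
          qed
          then show ?case unfolding e .
        qed
      qed
    qed
  qed auto
  then have G0: "(\<lambda>n. \<integral>\<omega>. G n \<omega> \<partial>M) \<longlonglongrightarrow> 0" by simp
  define x where "x n = (SOME y. y \<in> space (sample_space n) \<and> H n y \<le> (\<integral>\<omega>. G n \<omega> \<partial>M))" for n
  have "x n \<in> space (sample_space n) \<and> H n (x n) \<le> (\<integral>\<omega>. G n \<omega> \<partial>M)" for n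
  proof -
    have "\<exists>y. y \<in> space (sample_space n) \<and> H n y \<le> (\<integral>\<omega>. G n \<omega> \<partial>M)" using ex[of n] by blast
    from someI_ex[OF this] show ?thesis unfolding x_def .
  qed
  then have x: "x n \<in> space (sample_space n)" "H n (x n) \<le> (\<integral>\<omega>. G n \<omega> \<partial>M)" for n
    by simp_all
  have "(\<lambda>n. H n (x n)) \<longlonglongrightarrow> 0"
  proof (rule Lim_null_comparison[OF _ G0])
    have "0 \<le> H n (x n)" for n unfolding H_def using \<delta>01 by (intro integral_nonneg_AE) auto
    then show "\<forall>\<^sub>F n in sequentially. norm (H n (x n)) \<le> (\<integral>\<omega>. G n \<omega> \<partial>M)" using x(2) by simp
  qed
  moreover have "x n k \<in> SU2" if "k < n" for n k
    using x(1)[of n] that by (auto simp: space_PiM PiE_iff)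
  ultimately show ?thesis using that[of x] unfolding H_def \<delta>_def by blast
qed

end

lemma square_integrable_translate:
  assumes X: "su2_field M X" and T: "T \<in> su2_prob \<rightarrow>\<^sub>M su2_prob" "distr su2_prob su2_prob T = su2_prob"
  shows "su2_field M (\<lambda>\<omega> x. X \<omega> (T x))"
proof -
  interpret su2_field M X by (rule X)
  have s: "sets (M \<Otimes>\<^sub>M su2_prob) = sets (M \<Otimes>\<^sub>M su2_vol)" by (intro sets_pair_measure_cong) auto
  have "(\<lambda>p. (fst p, T (snd p))) \<in> M \<Otimes>\<^sub>M su2_prob \<rightarrow>\<^sub>M M \<Otimes>\<^sub>M su2_prob"
    by (intro measurable_Pair measurable_fst measurable_compose[OF measurable_snd T(1)])
  from measurable_compose[OF this measurable_X_joint]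
  have "(\<lambda>p. X (fst p) (T (snd p))) \<in> borel_measurable (M \<Otimes>\<^sub>M su2_prob)"
    by (simp only: fst_conv snd_conv)
  moreover have "(\<lambda>p. X (fst p) (T (snd p))) = (\<lambda>(\<omega>, g). X \<omega> (T g))" by auto
  ultimately have "random_field M (\<lambda>\<omega> x. X \<omega> (T x))"
    unfolding random_field_def measurable_cong_sets[OF s refl] by simp
  moreover have "AE \<omega> in M. integrable su2_prob (\<lambda>g. (cmod (X \<omega> (T g)))\<^sup>2)"
    using AE_X_L2
  proof eventually_elim
    case (elim \<omega>)
    have "integrable (distr su2_prob su2_prob T) (\<lambda>g. (cmod (X \<omega> g))\<^sup>2)" unfolding T(2) by (rule elim)
    then show ?case by (rule integrable_distr[OF T(1)])
  qed
  ultimately have "square_integrable_field M (\<lambda>\<omega> x. X \<omega> (T x))"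
    unfolding square_integrable_field_def integrable_su2_prob by blast
  then show ?thesis by unfold_locales
qed

context su2_field
begin

text \<open>By sampling, the law of finitely many integrals against the field is determined by the
  finite-dimensional laws.\<close>

lemma expectation_gk_pairing_cong:
  assumes X': "su2_field M X'" and law: "field_law M X' = field_law M X"
    and I: "finite I" and h: "\<And>i. i \<in> I \<Longrightarrow> h i \<in> borel_measurable su2_prob" "\<And>i g. i \<in> I \<Longrightarrow> g \<in> SU2 \<Longrightarrow> norm (h i g) \<le> B"
  shows "(\<integral>\<omega>. gk I t (\<lambda>i. su2_field.pairing X' (h i) \<omega>) \<partial>M) = (\<integral>\<omega>. gk I t (\<lambda>i. pairing (h i) \<omega>) \<partial>M)"
proof (rule LIMSEQ_unique)
  interpret X': su2_field M X' by (rule X')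
  show "(\<lambda>n. \<integral>x. \<integral>\<omega>. gk I t (\<lambda>i. sample_mean n (h i) \<omega> x) \<partial>M \<partial>sample_space n)
    \<longlonglongrightarrow> (\<integral>\<omega>. gk I t (\<lambda>i. pairing (h i) \<omega>) \<partial>M)"
    using I h by (rule expectation_gk_sample_limit)
  have eq: "(\<integral>\<omega>. gk I t (\<lambda>i. X'.sample_mean n (h i) \<omega> x) \<partial>M) = (\<integral>\<omega>. gk I t (\<lambda>i. sample_mean n (h i) \<omega> x) \<partial>M)"
    if x: "x \<in> space (sample_space n)" for n x
  proof -
    have xk: "x k \<in> SU2" if "k < n" for k using x that by (auto simp: space_PiM PiE_iff)
    \<comment> \<open>The sample mean read as a function of the path. It uses the finitely many
      coordinates \<open>x k\<close>, hence is measurable for the product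
      \<open>\<sigma>\<close>-algebra.\<close>
    define \<Gamma> where "\<Gamma> v = gk I t (\<lambda>i. (\<Sum>k<n. v (x k) * h i (x k)) / of_nat n)" for v
    have \<Gamma>m: "\<Gamma> \<in> borel_measurable (Pi\<^sub>M SU2 (\<lambda>_. borel))"
      unfolding \<Gamma>_def gk_def using xk
      by (intro measurable_compose[OF _ borel_measurable_exp] borel_measurable_uminus borel_measurable_divide borel_measurable_sum borel_measurable_power
        measurable_compose[OF _ borel_measurable_norm] borel_measurable_diff borel_measurable_times measurable_component_singleton borel_measurable_const) auto
    have *: "(\<integral>\<omega>. gk I t (\<lambda>i. su2_field.sample_mean Z n (h i) \<omega> x) \<partial>M) = (\<integral>v. \<Gamma> v \<partial>field_law M Z)" if Z: "su2_field M Z" for Z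
    proof -
      interpret Z: su2_field M Z by (rule Z)
      have "(\<lambda>\<omega>. \<lambda>y\<in>SU2. Z \<omega> y) \<in> M \<rightarrow>\<^sub>M Pi\<^sub>M SU2 (\<lambda>_. borel)"
        by (intro measurable_restrict Z.measurable_X)
      then have "(\<integral>v. \<Gamma> v \<partial>field_law M Z) = (\<integral>\<omega>. \<Gamma> (\<lambda>y\<in>SU2. Z \<omega> y) \<partial>M)"
        unfolding field_law_def using \<Gamma>m by (rule integral_distr)
      moreover have "\<Gamma> (\<lambda>y\<in>SU2. Z \<omega> y) = gk I t (\<lambda>i. Z.sample_mean n (h i) \<omega> x)" for \<omega>
      proof -
        have "(\<Sum>k<n. (\<lambda>y\<in>SU2. Z \<omega> y) (x k) * h i (x k)) = (\<Sum>k<n. Z \<omega> (x k) * h i (x k))" for i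
          by (intro sum.cong refl) (simp add: xk)
        then show ?thesis unfolding \<Gamma>_def Z.sample_mean_def by (simp only:)
      qed
      ultimately show ?thesis by (simp only:)
    qed
    show ?thesis unfolding *[OF X'] *[OF su2_field_axioms] law ..
  qed
  have "(\<integral>x. \<integral>\<omega>. gk I t (\<lambda>i. X'.sample_mean n (h i) \<omega> x) \<partial>M \<partial>sample_space n)
    = (\<integral>x. \<integral>\<omega>. gk I t (\<lambda>i. sample_mean n (h i) \<omega> x) \<partial>M \<partial>sample_space n)" for n
    by (rule Bochner_Integration.integral_cong[OF refl]) (rule eq)
  moreover have "(\<lambda>n. \<integral>x. \<integral>\<omega>. gk I t (\<lambda>i. X'.sample_mean n (h i) \<omega> x) \<partial>M \<partial>sample_space n)
    \<longlonglongrightarrow> (\<integral>\<omega>. gk I t (\<lambda>i. X'.pairing (h i) \<omega>) \<partial>M)"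
    using I h by (rule X'.expectation_gk_sample_limit)
  ultimately show "(\<lambda>n. \<integral>x. \<integral>\<omega>. gk I t (\<lambda>i. sample_mean n (h i) \<omega> x) \<partial>M \<partial>sample_space n)
    \<longlonglongrightarrow> (\<integral>\<omega>. gk I t (\<lambda>i. X'.pairing (h i) \<omega>) \<partial>M)" by (simp only:)
qed

lemma pairing_gaussian:
  assumes G: "complex_gaussian_field M X" and h: "h \<in> borel_measurable su2_prob" "\<And>g. g \<in> SU2 \<Longrightarrow> norm (h g) \<le> B"
  obtains c where "c \<ge> 0" "\<And>t. ccf (pairing h) t = exp (- (c * (norm t)\<^sup>2))"
proof -
  obtain x where x: "\<And>n k. k < n \<Longrightarrow> x n k \<in> SU2"
    and lim: "(\<lambda>n. \<integral>\<omega>. min 1 (norm (sample_mean n h \<omega> (x n) - pairing h \<omega>)) \<partial>M) \<longlonglongrightarrow> 0"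
    using exists_sample_converging[OF h] by blast
  have W: "complex_gaussian M (\<lambda>\<omega>. sample_mean n h \<omega> (x n))" for n
  proof -
    define J where "J = x n ` {..<n}"
    \<comment> \<open>Sample points may coincide, whereas the Gaussian property is stated for sums
      over sets of points; the weights of equal points are therefore collected.\<close>
    define d where "d g = (\<Sum>k | k < n \<and> x n k = g. h (x n k) / of_nat n)" for g
    have "sample_mean n h \<omega> (x n) = (\<Sum>g\<in>J. d g * X \<omega> g)" for \<omega>
    proof -
      have "sample_mean n h \<omega> (x n) = (\<Sum>k<n. X \<omega> (x n k) * (h (x n k) / of_nat n))"
        by (simp add: sample_mean_def sum_divide_distrib)
      also have "\<dots> = (\<Sum>g\<in>J. \<Sum>k | k \<in> {..<n} \<and> x n k = g. X \<omega> (x n k) * (h (x n k) / of_nat n))"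
        unfolding J_def by (rule sum.image_gen) simp
      also have "\<dots> = (\<Sum>g\<in>J. d g * X \<omega> g)"
        unfolding d_def sum_distrib_right by (intro sum.cong refl) (auto simp: mult.commute)
      finally show ?thesis .
    qed
    then have "(\<lambda>\<omega>. sample_mean n h \<omega> (x n)) = (\<lambda>\<omega>. \<Sum>g\<in>J. d g * X \<omega> g)" by (rule ext)
    moreover have "finite J" "J \<subseteq> SU2" using x by (auto simp: J_def)
    ultimately show ?thesis using G by (simp add: complex_gaussian_field_def)
  qed
  then have Wm: "(\<lambda>\<omega>. sample_mean n h \<omega> (x n)) \<in> borel_measurable M" for n by (simp add: complex_gaussian_def)
  define P where "P n c \<longleftrightarrow> c \<ge> 0 \<and> (\<forall>t. ccf (\<lambda>\<omega>. sample_mean n h \<omega> (x n)) t = exp (- (c * (norm t)\<^sup>2)))" for n c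
  define c where "c n = (SOME c. P n c)" for n
  have "P n (c n)" for n
  proof -
    obtain c0 where "P n c0"
      unfolding P_def by (rule complex_gaussian_ccf[OF W[of n]]) blast
    then show ?thesis unfolding c_def by (rule someI)
  qed
  then have c: "c n \<ge> 0" "ccf (\<lambda>\<omega>. sample_mean n h \<omega> (x n)) t = exp (- (c n * (norm t)\<^sup>2))" for n t
    unfolding P_def by blast+
  have "(\<lambda>n. complex_of_real (exp (- (c n * (norm t)\<^sup>2)))) \<longlonglongrightarrow> ccf (pairing h) t" for t
    using ccf_tendsto_in_prob[OF measurable_pairing[OF h(1)] Wm lim, of t] unfolding c(2) .
  from measurable_pairing[OF h(1)] c(1) this show ?thesis
    by (rule ccf_gaussian_limit) (rule that)
qed

end

section \<open>Wigner expansions\<close>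

locale wigner_field = su2_field M X for M :: "'w measure" and X +
  fixes a :: "real \<Rightarrow> real \<Rightarrow> real \<Rightarrow> 'w \<Rightarrow> complex"
  assumes expansion: "has_wigner_expansion M X a"
    and indep: "indep_vars (\<lambda>_. borel) (\<lambda>(l, m, s). a l m s) wigner_idx"
    and sym: "\<forall>(l, m, s)\<in>wigner_idx. centrally_symmetric M (a l m s)"
begin

definition A :: "nat \<Rightarrow> nat \<Rightarrow> nat \<Rightarrow> 'w \<Rightarrow> complex" where
  "A n j k = a (real n / 2) (real j - real n / 2) (real k - real n / 2)"

definition cn :: "nat \<Rightarrow> complex" where
  "cn n = complex_of_real (sqrt (real n + 1) / (4 * pi))"

definition Idx :: "(nat \<times> nat \<times> nat) set" where
  "Idx = {(n, j, k). j \<le> n \<and> k \<le> n}"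

definition IdxN :: "nat \<Rightarrow> (nat \<times> nat \<times> nat) set" where
  "IdxN N = (SIGMA n:{..N}. {..n} \<times> {..n})"

definition S :: "nat \<Rightarrow> 'w \<Rightarrow> complex^2^2 \<Rightarrow> complex" where
  "S N \<omega> g = (\<Sum>n\<le>N. \<Sum>j\<le>n. \<Sum>k\<le>n. A n j k \<omega> * (cn n * wD n j k g))"

lemma cn_nonzero [simp]: "cn n \<noteq> 0"
proof -
  have "sqrt (real n + 1) \<noteq> 0" using real_sqrt_gt_zero[of "real n + 1"] by linarith
  then show ?thesis unfolding cn_def by simp
qed

lemma wigner_partial_sum_eq: "wigner_partial_sum a N \<omega> g = S N \<omega> g"
proof -
  have "{l. l \<in> half_nats \<and> l \<le> real N / 2} = (\<lambda>n. real n / 2) ` {..N}"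
    by (auto simp: half_nats_def image_def)
  moreover have "inj_on (\<lambda>n. real n / 2) {..N}" by (auto simp: inj_on_def)
  ultimately have "wigner_partial_sum a N \<omega> g = (\<Sum>n\<le>N. \<Sum>m\<in>weights (real n / 2). \<Sum>s\<in>weights (real n / 2).
      a (real n / 2) m s \<omega> * wigner_phi (real n / 2) m s g)"
    unfolding wigner_partial_sum_def by (simp add: sum.reindex)
  also have "\<dots> = S N \<omega> g"
    unfolding sum_weights_half S_def by (simp add: A_def wigner_phi_def wD_def cn_def)
  finally show ?thesis .
qed

lemma S_alt: "S N \<omega> g = (\<Sum>(n, j, k)\<in>IdxN N. A n j k \<omega> * (cn n * wD n j k g))"
  unfolding S_def IdxN_def by (simp add: sum.Sigma sum.cartesian_product split_def)

lemma finite_IdxN [simp]: "finite (IdxN N)" by (simp add: IdxN_def)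

lemma IdxN_subset: "IdxN N \<subseteq> Idx" by (auto simp: IdxN_def Idx_def)

lemma indep_A: "indep_vars (\<lambda>_. borel) (\<lambda>(n, j, k). A n j k) Idx"
proof -
  define f where "f = (\<lambda>(n, j, k). (real n / 2, real j - real n / 2, real k - real n / 2))"
  have "inj_on f Idx" by (auto simp: f_def inj_on_def)
  moreover have "f ` Idx \<subseteq> wigner_idx"
    by (auto simp: f_def Idx_def wigner_idx_def weights_half half_nats_def)
  ultimately have "indep_vars (\<lambda>_. borel) (\<lambda>p. (\<lambda>(l, m, s). a l m s) (f p)) Idx"
    by (rule indep_vars_reindex[OF indep])
  moreover have "(\<lambda>p. (\<lambda>(l, m, s). a l m s) (f p)) = (\<lambda>(n, j, k). A n j k)"
    by (auto simp: f_def A_def fun_eq_iff)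
  ultimately show ?thesis by simp
qed

lemma measurable_A: "j \<le> n \<Longrightarrow> k \<le> n \<Longrightarrow> A n j k \<in> borel_measurable M"
  using indep_A unfolding indep_vars_def by (auto simp: Idx_def)

lemma sym_A: "j \<le> n \<Longrightarrow> k \<le> n \<Longrightarrow> centrally_symmetric M (A n j k)"
  using sym by (auto simp: wigner_idx_def A_def weights_half half_nats_def)

lemma continuous_S: "continuous_on SU2 (S N \<omega>)"
  unfolding S_def[abs_def] by (intro continuous_intros continuous_wD) auto

lemma measurable_S_joint: "(\<lambda>p. S N (fst p) (snd p)) \<in> borel_measurable (M \<Otimes>\<^sub>M su2_prob)"
proof -
  have "(\<lambda>p. A n j k (fst p) * (cn n * wD n j k (snd p))) \<in> borel_measurable (M \<Otimes>\<^sub>M su2_prob)"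
    if "j \<le> n" "k \<le> n" for n j k
  proof -
    have "wD n j k \<in> borel_measurable su2_prob" using measurable_wD[OF that] by simp
    then show ?thesis
      by (intro borel_measurable_times borel_measurable_const measurable_compose[OF measurable_fst measurable_A[OF that]]
          measurable_compose[OF measurable_snd])
  qed
  then show ?thesis unfolding S_def by (intro borel_measurable_sum) auto
qed

lemma integrable_difference:
  assumes "\<omega> \<in> space M" "integrable su2_prob (\<lambda>g. (cmod (X \<omega> g))\<^sup>2)"
  shows "(\<lambda>g. X \<omega> g - S N \<omega> g) \<in> borel_measurable su2_prob"
    "integrable su2_prob (\<lambda>g. (cmod (X \<omega> g - S N \<omega> g))\<^sup>2)"
proof -
  have Sm: "S N \<omega> \<in> borel_measurable su2_prob"
    by (intro borel_measurable_integrable integrable_su2_continuous continuous_S)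
  show m: "(\<lambda>g. X \<omega> g - S N \<omega> g) \<in> borel_measurable su2_prob"
    using measurable_X_section[OF assms(1)] Sm by (rule borel_measurable_diff)
  have "continuous_on SU2 (\<lambda>g. complex_of_real ((cmod (S N \<omega> g))\<^sup>2))"
    by (intro continuous_intros continuous_S)
  from integrable_su2_continuous[OF this] have S2: "integrable su2_prob (\<lambda>g. (cmod (S N \<omega> g))\<^sup>2)"
    by (simp only: complex_of_real_integrable_eq)
  show "integrable su2_prob (\<lambda>g. (cmod (X \<omega> g - S N \<omega> g))\<^sup>2)"
  proof (rule Bochner_Integration.integrable_bound)
    show "integrable su2_prob (\<lambda>g. 2 * (cmod (X \<omega> g))\<^sup>2 + 2 * (cmod (S N \<omega> g))\<^sup>2)" using S2 assms(2) by simp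
    have "(cmod (z - w))\<^sup>2 \<le> 2 * (cmod z)\<^sup>2 + 2 * (cmod w)\<^sup>2" for z w
    proof -
      have "(cmod (z - w))\<^sup>2 \<le> (cmod z + cmod w)\<^sup>2" by (intro power_mono norm_triangle_ineq4) simp
      also have "\<dots> \<le> 2 * (cmod z)\<^sup>2 + 2 * (cmod w)\<^sup>2"
        using sum_squares_bound[of "cmod z" "cmod w"] by (simp add: power2_sum)
      finally show ?thesis .
    qed
    then show "AE g in su2_prob. norm ((cmod (X \<omega> g - S N \<omega> g))\<^sup>2) \<le> norm (2 * (cmod (X \<omega> g))\<^sup>2 + 2 * (cmod (S N \<omega> g))\<^sup>2)"
      by simp
  qed (use m in simp)
qed

lemma AE_L2_convergence:
  "AE \<omega> in M. \<omega> \<in> space M \<and> integrable su2_prob (\<lambda>g. (cmod (X \<omega> g))\<^sup>2) \<and>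
     (\<lambda>N. \<integral>g. (cmod (X \<omega> g - S N \<omega> g))\<^sup>2 \<partial>su2_prob) \<longlonglongrightarrow> 0"
proof -
  have "AE \<omega> in M. (\<lambda>N. \<integral>g. (cmod (X \<omega> g - S N \<omega> g))\<^sup>2 \<partial>su2_vol) \<longlonglongrightarrow> 0"
    using expansion unfolding has_wigner_expansion_def wigner_partial_sum_eq by blast
  with AE_X_L2 AE_space show ?thesis
  proof eventually_elim
    case (elim \<omega>)
    have "(\<integral>g. (cmod (X \<omega> g - S N \<omega> g))\<^sup>2 \<partial>su2_prob) = (\<integral>g. (cmod (X \<omega> g - S N \<omega> g))\<^sup>2 \<partial>su2_vol) / measure su2_vol SU2" for N
      using integrable_difference(1)[OF elim(2,1), of N] by (intro integral_su2_prob) simp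
    moreover have "(\<lambda>N. (\<integral>g. (cmod (X \<omega> g - S N \<omega> g))\<^sup>2 \<partial>su2_vol) / measure su2_vol SU2) \<longlonglongrightarrow> 0"
      using tendsto_divide_zero[OF elim(3)] by simp
    ultimately show ?case using elim by simp
  qed
qed

text \<open>Dual to the expansion: \<open>wD n j k\<close> has squared norm
  \<open>1 / (n + 1)\<close> for the normalised measure and enters the series with the factor
  \<open>cn n\<close>.\<close>

definition hD :: "nat \<Rightarrow> nat \<Rightarrow> nat \<Rightarrow> complex^2^2 \<Rightarrow> complex" where
  "hD n j k g = of_nat (n + 1) / cn n * cnj (wD n j k g)"

lemma measurable_hD: "j \<le> n \<Longrightarrow> k \<le> n \<Longrightarrow> hD n j k \<in> borel_measurable su2_prob"
  unfolding hD_def[abs_def]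
  by (intro borel_measurable_integrable integrable_su2_continuous continuous_intros continuous_wD)

lemma norm_hD_le: "j \<le> n \<Longrightarrow> k \<le> n \<Longrightarrow> g \<in> SU2 \<Longrightarrow> norm (hD n j k g) \<le> norm (of_nat (n + 1) / cn n)"
  using norm_wD_le_1[of g j n k] unfolding hD_def norm_mult complex_mod_cnj by (intro mult_right_le_one_le) auto

text \<open>From degree \<open>n\<close> on, pairing a partial sum with \<open>hD n j k\<close>
  returns the coefficient exactly, and convergence in mean square carries this to the field. One
  null set serves all indices.\<close>

lemma AE_coefficient:
  "AE \<omega> in M. \<forall>n j k::nat. j \<le> n \<and> k \<le> n \<longrightarrow> A n j k \<omega> = pairing (hD n j k) \<omega>"
  using AE_L2_convergence
proof eventually_elim
  case (elim \<omega>)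
  then have \<omega>: "\<omega> \<in> space M" "integrable su2_prob (\<lambda>g. (cmod (X \<omega> g))\<^sup>2)"
    and lim: "(\<lambda>N. \<integral>g. (cmod (X \<omega> g - S N \<omega> g))\<^sup>2 \<partial>su2_prob) \<longlonglongrightarrow> 0" by auto
  show ?case
  proof (intro allI impI)
    fix n j k :: nat assume jk: "j \<le> n \<and> k \<le> n"
    define B where "B = norm (of_nat (n + 1) / cn n)"
    have hm: "hD n j k \<in> borel_measurable su2_prob" using jk by (intro measurable_hD) auto
    have hB: "norm (hD n j k g) \<le> B" if "g \<in> SU2" for g unfolding B_def using jk that by (intro norm_hD_le) auto
    have iS: "(\<integral>g. S N \<omega> g * hD n j k g \<partial>su2_prob) = A n j k \<omega> \<and> integrable su2_prob (\<lambda>g. S N \<omega> g * hD n j k g)" if N: "n \<le> N" for N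
    proof
      show "integrable su2_prob (\<lambda>g. S N \<omega> g * hD n j k g)"
        unfolding hD_def[abs_def] using jk
        by (intro integrable_su2_continuous continuous_intros continuous_S continuous_wD) auto
      have "(\<integral>g. S N \<omega> g * hD n j k g \<partial>su2_prob)
        = (\<integral>g. (\<Sum>(n', j', k')\<in>IdxN N. A n' j' k' \<omega> * cn n' * of_nat (n + 1) / cn n * (wD n' j' k' g * cnj (wD n j k g))) \<partial>su2_prob)"
        unfolding S_alt hD_def sum_distrib_right by (intro Bochner_Integration.integral_cong sum.cong refl) auto
      also have "\<dots> = (\<Sum>(n', j', k')\<in>IdxN N. A n' j' k' \<omega> * cn n' * of_nat (n + 1) / cn n * (\<integral>g. wD n' j' k' g * cnj (wD n j k g) \<partial>su2_prob))"
        using jk by (subst Bochner_Integration.integral_sum) (auto simp: IdxN_def intro!: sum.cong)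
      also have "\<dots> = (\<Sum>p\<in>IdxN N. if p = (n, j, k) then A n j k \<omega> else 0)"
        using jk by (intro sum.cong refl) (auto simp: IdxN_def wD_orthogonal simp del: of_nat_add of_nat_Suc split: if_splits)
      also have "\<dots> = A n j k \<omega>"
        using jk N unfolding sum.delta[OF finite_IdxN] by (simp add: IdxN_def)
      finally show "(\<integral>g. S N \<omega> g * hD n j k g \<partial>su2_prob) = A n j k \<omega>" .
    qed
    have b: "norm (pairing (hD n j k) \<omega> - A n j k \<omega>) \<le> B * sqrt (\<integral>g. (cmod (X \<omega> g - S N \<omega> g))\<^sup>2 \<partial>su2_prob)" if N: "n \<le> N" for N
    proof -
      note d = integrable_difference[OF \<omega>, of N]
      have i: "integrable su2_prob (\<lambda>g. X \<omega> g - S N \<omega> g)" by (rule su2.expectation_norm_le_sqrt(1)[OF d])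
      have i2: "integrable su2_prob (\<lambda>g. (X \<omega> g - S N \<omega> g) * hD n j k g)"
      proof (rule Bochner_Integration.integrable_bound)
        show "integrable su2_prob (\<lambda>g. B * norm (X \<omega> g - S N \<omega> g))" using i by simp
        show "AE g in su2_prob. norm ((X \<omega> g - S N \<omega> g) * hD n j k g) \<le> norm (B * norm (X \<omega> g - S N \<omega> g))"
          using hB norm_ge_zero[of "of_nat (n + 1) / cn n"]
          by (intro AE_I2) (auto simp: norm_mult mult.commute B_def intro!: mult_right_mono)
      qed (intro borel_measurable_times d(1) hm)
      have "integrable su2_prob (\<lambda>g. (X \<omega> g - S N \<omega> g) * hD n j k g + S N \<omega> g * hD n j k g)"
        using i2 iS[OF N] by (intro Bochner_Integration.integrable_add) auto
      have "pairing (hD n j k) \<omega> = (\<integral>g. (X \<omega> g - S N \<omega> g) * hD n j k g + S N \<omega> g * hD n j k g \<partial>su2_prob)"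
        unfolding pairing_def by (simp add: left_diff_distrib)
      also have "\<dots> = (\<integral>g. (X \<omega> g - S N \<omega> g) * hD n j k g \<partial>su2_prob) + A n j k \<omega>"
        using i2 iS[OF N] by simp
      finally have e: "pairing (hD n j k) \<omega> - A n j k \<omega> = (\<integral>g. (X \<omega> g - S N \<omega> g) * hD n j k g \<partial>su2_prob)" by simp
      have "norm (\<integral>g. (X \<omega> g - S N \<omega> g) * hD n j k g \<partial>su2_prob) \<le> (\<integral>g. norm ((X \<omega> g - S N \<omega> g) * hD n j k g) \<partial>su2_prob)"
        by (rule integral_norm_bound)
      also have "\<dots> \<le> (\<integral>g. B * norm (X \<omega> g - S N \<omega> g) \<partial>su2_prob)"
        using i i2 hB by (intro integral_mono integrable_norm) (auto simp: norm_mult mult.commute intro!: mult_right_mono)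
      also have "\<dots> = B * (\<integral>g. norm (X \<omega> g - S N \<omega> g) \<partial>su2_prob)" by simp
      also have "\<dots> \<le> B * sqrt (\<integral>g. (cmod (X \<omega> g - S N \<omega> g))\<^sup>2 \<partial>su2_prob)"
        by (intro mult_left_mono su2.expectation_norm_le_sqrt(2)[OF d]) (simp add: B_def)
      finally show ?thesis unfolding e .
    qed
    have l0: "(\<lambda>N. B * sqrt (\<integral>g. (cmod (X \<omega> g - S N \<omega> g))\<^sup>2 \<partial>su2_prob)) \<longlonglongrightarrow> 0"
      using tendsto_mult[OF tendsto_const tendsto_real_sqrt[OF lim], of B] by simp
    have "norm (pairing (hD n j k) \<omega> - A n j k \<omega>) \<le> 0"
      by (rule LIMSEQ_le_const[OF l0]) (use b in blast)
    then show "A n j k \<omega> = pairing (hD n j k) \<omega>" by simp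
  qed
qed

end

lemma centrally_symmetric_cnj:
  assumes W: "W \<in> borel_measurable M" and s: "centrally_symmetric M W"
  shows "centrally_symmetric M (\<lambda>\<omega>. cnj (W \<omega>))"
proof -
  have m: "(\<lambda>\<omega>. - W \<omega>) \<in> borel_measurable M" using W by (rule borel_measurable_uminus)
  have "distr M borel (\<lambda>\<omega>. - cnj (W \<omega>)) = distr (distr M borel (\<lambda>\<omega>. - W \<omega>)) borel cnj"
    unfolding distr_distr[OF borel_measurable_cnj m] by (simp add: comp_def)
  also have "\<dots> = distr M borel (\<lambda>\<omega>. cnj (W \<omega>))"
    unfolding s[unfolded centrally_symmetric_def] distr_distr[OF borel_measurable_cnj W] by (simp add: comp_def)
  finally show ?thesis unfolding centrally_symmetric_def .
qed

lemma gk_cnj: "gk I t (\<lambda>i. cnj (x i)) = gk I (\<lambda>i. cnj (t i)) x"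
proof -
  have "norm (t i - cnj (x i)) = norm (cnj (t i) - x i)" for i
    using complex_mod_cnj[of "t i - cnj (x i)"] by simp
  then show ?thesis by (simp add: gk_def)
qed

context su2_field
begin

text \<open>Change of variables: \<open>T'\<close> undoes \<open>T\<close> on the group and moves
  the translation from the field to the test function.\<close>

lemma pairing_translate:
  assumes T: "T \<in> su2_prob \<rightarrow>\<^sub>M su2_prob" "distr su2_prob su2_prob T = su2_prob"
    and T': "T' \<in> su2_prob \<rightarrow>\<^sub>M su2_prob" "\<And>x. x \<in> SU2 \<Longrightarrow> T' (T x) = x"
    and h: "h \<in> borel_measurable su2_prob" and \<omega>: "\<omega> \<in> space M"
  shows "su2_field.pairing (\<lambda>\<omega> x. X \<omega> (T x)) h \<omega> = pairing (\<lambda>y. h (T' y)) \<omega>"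
proof -
  interpret X': su2_field M "\<lambda>\<omega> x. X \<omega> (T x)" by (rule square_integrable_translate[OF su2_field_axioms T])
  define F where "F y = X \<omega> y * h (T' y)" for y
  have F: "F \<in> borel_measurable su2_prob"
    unfolding F_def using measurable_X_section[OF \<omega>] measurable_compose[OF T'(1) h] by (rule borel_measurable_times)
  have "X'.pairing h \<omega> = (\<integral>x. F (T x) \<partial>su2_prob)"
    unfolding X'.pairing_def F_def by (intro Bochner_Integration.integral_cong refl) (simp add: T'(2))
  also have "\<dots> = (\<integral>y. F y \<partial>distr su2_prob su2_prob T)"
    using T(1) F by (rule integral_distr[symmetric])
  also have "\<dots> = pairing (\<lambda>y. h (T' y)) \<omega>" unfolding T(2) F_def pairing_def ..
  finally show ?thesis .
qed

end

section \<open>From invariance of the field to invariance of its coefficients\<close>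

context wigner_field
begin

lemma integrable_X_hD:
  assumes \<omega>: "\<omega> \<in> space M" "integrable su2_prob (\<lambda>g. (cmod (X \<omega> g))\<^sup>2)" and jk: "j \<le> n" "k \<le> n"
  shows "integrable su2_prob (\<lambda>g. X \<omega> g * hD n j k g)"
proof (rule Bochner_Integration.integrable_bound)
  define B where "B = norm (of_nat (n + 1) / cn n)"
  have B0: "0 \<le> B" unfolding B_def by (rule norm_ge_zero)
  note m = measurable_X_section[OF \<omega>(1)]
  show "integrable su2_prob (\<lambda>g. B * norm (X \<omega> g))"
    using su2.expectation_norm_le_sqrt(1)[OF m \<omega>(2)] by simp
  show "(\<lambda>g. X \<omega> g * hD n j k g) \<in> borel_measurable su2_prob"
    using m measurable_hD[OF jk] by (rule borel_measurable_times)
  have "norm (X \<omega> g * hD n j k g) \<le> norm (B * norm (X \<omega> g))" if g: "g \<in> SU2" for g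
  proof -
    have "norm (hD n j k g) \<le> B" unfolding B_def by (rule norm_hD_le[OF jk g])
    then have "norm (X \<omega> g) * norm (hD n j k g) \<le> norm (X \<omega> g) * B" by (intro mult_left_mono) auto
    then show ?thesis using B0 by (simp add: norm_mult mult.commute)
  qed
  then show "AE g in su2_prob. norm (X \<omega> g * hD n j k g) \<le> norm (B * norm (X \<omega> g))"
    by (intro AE_I2) simp
qed

lemma pairing_sum_hD:
  assumes \<omega>: "\<omega> \<in> space M" "integrable su2_prob (\<lambda>g. (cmod (X \<omega> g))\<^sup>2)"
    and pq: "\<And>l. l \<le> n \<Longrightarrow> p l \<le> n" "\<And>l. l \<le> n \<Longrightarrow> q l \<le> n"
    and H: "\<And>y. y \<in> SU2 \<Longrightarrow> H y = (\<Sum>l\<le>n. c l * hD n (p l) (q l) y)"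
  shows "pairing H \<omega> = (\<Sum>l\<le>n. c l * pairing (hD n (p l) (q l)) \<omega>)"
proof -
  have "pairing H \<omega> = (\<integral>g. (\<Sum>l\<le>n. c l * (X \<omega> g * hD n (p l) (q l) g)) \<partial>su2_prob)"
    unfolding pairing_def
    by (intro Bochner_Integration.integral_cong refl) (simp add: H sum_distrib_left mult_ac)
  also have "\<dots> = (\<Sum>l\<le>n. (\<integral>g. c l * (X \<omega> g * hD n (p l) (q l) g) \<partial>su2_prob))"
    using integrable_X_hD[OF \<omega>] pq by (intro Bochner_Integration.integral_sum integrable_mult_right) auto
  also have "\<dots> = (\<Sum>l\<le>n. c l * pairing (hD n (p l) (q l)) \<omega>)"
    unfolding pairing_def by simp
  finally show ?thesis .
qed

text \<open>Common core of the row and column cases. \<open>p\<close> and \<open>q\<close> select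
  the coefficients, and \<open>H\<close> says that translation expands their test functions in those
  of the same degree; invariance of the law of the field then passes to the selected
  coefficients.\<close>

lemma expectation_gk_coefficients_invariant:
  assumes T: "T \<in> su2_prob \<rightarrow>\<^sub>M su2_prob" "distr su2_prob su2_prob T = su2_prob"
    and T': "T' \<in> su2_prob \<rightarrow>\<^sub>M su2_prob" "\<And>x. x \<in> SU2 \<Longrightarrow> T' (T x) = x"
    and law: "field_law M (\<lambda>\<omega> x. X \<omega> (T x)) = field_law M X"
    and pq: "\<And>i. i \<le> n \<Longrightarrow> p i \<le> n" "\<And>i. i \<le> n \<Longrightarrow> q i \<le> n"
      "\<And>i l. i \<le> n \<Longrightarrow> l \<le> n \<Longrightarrow> p' i l \<le> n" "\<And>i l. i \<le> n \<Longrightarrow> l \<le> n \<Longrightarrow> q' i l \<le> n"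
    and H: "\<And>i y. i \<le> n \<Longrightarrow> y \<in> SU2 \<Longrightarrow> hD n (p i) (q i) (T' y) = (\<Sum>l\<le>n. c i l * hD n (p' i l) (q' i l) y)"
  shows "(\<integral>\<omega>. gk {..n} t (\<lambda>i. \<Sum>l\<le>n. c i l * A n (p' i l) (q' i l) \<omega>) \<partial>M) = (\<integral>\<omega>. gk {..n} t (\<lambda>i. A n (p i) (q i) \<omega>) \<partial>M)"
proof -
  define X' where "X' = (\<lambda>\<omega> x. X \<omega> (T x))"
  have X': "su2_field M X'" unfolding X'_def by (rule square_integrable_translate[OF su2_field_axioms T])
  have hm: "hD n (p i) (q i) \<in> borel_measurable su2_prob" if "i \<in> {..n}" for i
    using pq(1,2) that by (intro measurable_hD) auto
  have gm: "(\<lambda>\<omega>. gk {..n} t (\<lambda>i. Y i \<omega>)) \<in> borel_measurable M" if "\<And>i. i \<le> n \<Longrightarrow> Y i \<in> borel_measurable M" for Y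
    unfolding gk_def using that
    by (intro measurable_compose[OF _ borel_measurable_exp] borel_measurable_uminus borel_measurable_divide borel_measurable_sum borel_measurable_power
        measurable_compose[OF _ borel_measurable_norm] borel_measurable_diff borel_measurable_const) auto
  have gk_cong: "gk {..n} t x = gk {..n} t y" if "\<And>i. i \<le> n \<Longrightarrow> x i = y i" for x y
    unfolding gk_def using that by (intro arg_cong[where f = exp] arg_cong[where f = uminus] arg_cong2[where f = "(/)"] sum.cong refl) auto
  have "(\<integral>\<omega>. gk {..n} t (\<lambda>i. \<Sum>l\<le>n. c i l * A n (p' i l) (q' i l) \<omega>) \<partial>M)
    = (\<integral>\<omega>. gk {..n} t (\<lambda>i. su2_field.pairing X' (hD n (p i) (q i)) \<omega>) \<partial>M)"
  proof (rule integral_cong_AE)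
    show "(\<lambda>\<omega>. gk {..n} t (\<lambda>i. \<Sum>l\<le>n. c i l * A n (p' i l) (q' i l) \<omega>)) \<in> borel_measurable M"
      using pq by (intro gm borel_measurable_sum borel_measurable_times borel_measurable_const measurable_A) auto
    show "(\<lambda>\<omega>. gk {..n} t (\<lambda>i. su2_field.pairing X' (hD n (p i) (q i)) \<omega>)) \<in> borel_measurable M"
      using hm by (intro gm su2_field.measurable_pairing[OF X']) auto
    show "AE \<omega> in M. gk {..n} t (\<lambda>i. \<Sum>l\<le>n. c i l * A n (p' i l) (q' i l) \<omega>)
      = gk {..n} t (\<lambda>i. su2_field.pairing X' (hD n (p i) (q i)) \<omega>)"
      using AE_coefficient AE_X_L2 AE_space
    proof eventually_elim
      case (elim \<omega>)
      show ?case
      proof (rule gk_cong)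
        fix i assume i: "i \<le> n"
        have "su2_field.pairing X' (hD n (p i) (q i)) \<omega> = pairing (\<lambda>y. hD n (p i) (q i) (T' y)) \<omega>"
          unfolding X'_def using hm i by (intro pairing_translate[OF T T' _ elim(3)]) auto
        also have "\<dots> = (\<Sum>l\<le>n. c i l * pairing (hD n (p' i l) (q' i l)) \<omega>)"
          using pq(3,4)[OF i] H[OF i] by (intro pairing_sum_hD[OF elim(3,2)]) auto
        also have "\<dots> = (\<Sum>l\<le>n. c i l * A n (p' i l) (q' i l) \<omega>)"
        proof (intro sum.cong refl arg_cong2[where f = "(*)"])
          fix l assume "l \<in> {..n}"
          then have "p' i l \<le> n \<and> q' i l \<le> n" using pq(3,4)[OF i] by auto
          with elim(1) show "pairing (hD n (p' i l) (q' i l)) \<omega> = A n (p' i l) (q' i l) \<omega>" by simp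
        qed
        finally show "(\<Sum>l\<le>n. c i l * A n (p' i l) (q' i l) \<omega>) = su2_field.pairing X' (hD n (p i) (q i)) \<omega>" ..
      qed
    qed
  qed
  also have "\<dots> = (\<integral>\<omega>. gk {..n} t (\<lambda>i. pairing (hD n (p i) (q i)) \<omega>) \<partial>M)"
  proof (rule expectation_gk_pairing_cong[OF X'])
    show "field_law M X' = field_law M X" unfolding X'_def by (rule law)
    show "norm (hD n (p i) (q i) g) \<le> norm (of_nat (n + 1) / cn n)" if "i \<in> {..n}" "g \<in> SU2" for i g
      using pq(1,2) that by (intro norm_hD_le) auto
  qed (use hm in auto)
  also have "\<dots> = (\<integral>\<omega>. gk {..n} t (\<lambda>i. A n (p i) (q i) \<omega>) \<partial>M)"
  proof (rule integral_cong_AE)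
    show "(\<lambda>\<omega>. gk {..n} t (\<lambda>i. pairing (hD n (p i) (q i)) \<omega>)) \<in> borel_measurable M"
      using hm by (intro gm measurable_pairing) auto
    show "(\<lambda>\<omega>. gk {..n} t (\<lambda>i. A n (p i) (q i) \<omega>)) \<in> borel_measurable M"
      using pq by (intro gm measurable_A) auto
    show "AE \<omega> in M. gk {..n} t (\<lambda>i. pairing (hD n (p i) (q i)) \<omega>) = gk {..n} t (\<lambda>i. A n (p i) (q i) \<omega>)"
      using AE_coefficient
    proof eventually_elim
      case (elim \<omega>)
      show ?case using elim pq(1,2) by (intro gk_cong) simp
    qed
  qed
  finally show ?thesis .
qed

lemma law_translate:
  assumes bi: "bi_invariant M X" and g: "g \<in> SU2"
  shows "field_law M (\<lambda>\<omega> x. X \<omega> (x ** g)) = field_law M X"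
    "field_law M (\<lambda>\<omega> x. X \<omega> (matrix_inv g ** x)) = field_law M X"
proof -
  have 1: "matrix_inv (mat 1 :: complex^2^2) = mat 1" using SU2_inv[of 1 0] by (simp add: su2_mat_1)
  show "field_law M (\<lambda>\<omega> x. X \<omega> (x ** g)) = field_law M X"
    using bi[unfolded bi_invariant_def, rule_format, OF one_in_SU2 g] by (simp add: 1)
  show "field_law M (\<lambda>\<omega> x. X \<omega> (matrix_inv g ** x)) = field_law M X"
    using bi[unfolded bi_invariant_def, rule_format, OF g one_in_SU2] by simp
qed

text \<open>Right translation mixes only the second index, and by the matrix \<open>wD n\<close>
  itself; so each row is an independent family with an invariant law.\<close>

lemma bi_invariant_row_gaussian:
  assumes bi: "bi_invariant M X" and n: "n \<ge> 1" and j: "j \<le> n"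
  obtains c where "c \<ge> 0" "\<And>k t. k \<le> n \<Longrightarrow> ccf (A n j k) t = exp (- (c * (norm t)\<^sup>2))"
proof (rule wD_law_invariant_imp_gaussian[OF n])
  have "indep_vars (\<lambda>_. borel) (\<lambda>k. (\<lambda>(n, j, k). A n j k) (n, j, k)) {..n}"
    using j by (intro indep_vars_reindex[OF indep_A]) (auto simp: inj_on_def Idx_def)
  then show "indep_vars (\<lambda>_. borel) (A n j) {..n}" by simp
  show "centrally_symmetric M (A n j k)" if "k \<le> n" for k using j that by (rule sym_A)
  fix g t assume g: "g \<in> SU2"
  have g': "matrix_inv g \<in> SU2" using g by (rule SU2_matrix_inv)
  show "(\<integral>\<omega>. gk {..n} t (\<lambda>k. \<Sum>q\<le>n. wD n k q g * A n j q \<omega>) \<partial>M) = (\<integral>\<omega>. gk {..n} t (\<lambda>k. A n j k \<omega>) \<partial>M)"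
  proof (rule expectation_gk_coefficients_invariant[OF measurable_su2_mult(2)[OF g] su2_prob_invariant(2)[OF g]
        measurable_su2_mult(2)[OF g'] _ law_translate(1)[OF bi g], where p = "\<lambda>_. j" and q = "\<lambda>i. i" and p' = "\<lambda>_ _. j" and q' = "\<lambda>_ l. l"])
    show "x ** g ** matrix_inv g = x" for x
      unfolding matrix_mul_assoc[symmetric] SU2_inv_mult(2)[OF g] by simp
    show "hD n j i (y ** matrix_inv g) = (\<Sum>l\<le>n. wD n i l g * hD n j l y)" if i: "i \<le> n" and y: "y \<in> SU2" for i y
    proof -
      have "wD n j i (y ** matrix_inv g) = (\<Sum>l\<le>n. wD n j l y * cnj (wD n i l g))"
        unfolding wD_mult[OF y g' j i] by (intro sum.cong refl) (simp add: wD_inv[OF g] i)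
      then show ?thesis unfolding hD_def by (simp add: sum_distrib_left mult_ac)
    qed
  qed (use j in auto)
qed blast

text \<open>Left translation mixes the first index by conjugated entries. Conjugating the
  coefficients restores \<open>wD n\<close>, and the result depends on \<open>norm t\<close> only,
  so the conjugation can be removed again.\<close>

lemma bi_invariant_column_gaussian:
  assumes bi: "bi_invariant M X" and n: "n \<ge> 1" and k: "k \<le> n"
  obtains c where "c \<ge> 0" "\<And>j t. j \<le> n \<Longrightarrow> ccf (A n j k) t = exp (- (c * (norm t)\<^sup>2))"
proof (rule wD_law_invariant_imp_gaussian[OF n])
  have "indep_vars (\<lambda>_. borel) (\<lambda>j. (\<lambda>(n, j, k). A n j k) (n, j, k)) {..n}"
    using k by (intro indep_vars_reindex[OF indep_A]) (auto simp: inj_on_def Idx_def)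
  then have "indep_vars (\<lambda>_. borel) (\<lambda>j. A n j k) {..n}" by simp
  from indep_vars_compose2[OF this, of "\<lambda>_. cnj" "\<lambda>_. borel"]
  show "indep_vars (\<lambda>_. borel) (\<lambda>j \<omega>. cnj (A n j k \<omega>)) {..n}" by simp
  show "centrally_symmetric M (\<lambda>\<omega>. cnj (A n j k \<omega>))" if "j \<le> n" for j
    using k that by (intro centrally_symmetric_cnj measurable_A sym_A)
  fix g t assume g: "g \<in> SU2"
  have g': "matrix_inv g \<in> SU2" using g by (rule SU2_matrix_inv)
  have "(\<integral>\<omega>. gk {..n} t' (\<lambda>j. \<Sum>q\<le>n. cnj (wD n j q g) * A n q k \<omega>) \<partial>M) = (\<integral>\<omega>. gk {..n} t' (\<lambda>j. A n j k \<omega>) \<partial>M)" for t'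
  proof (rule expectation_gk_coefficients_invariant[OF measurable_su2_mult(1)[OF g'] su2_prob_invariant(1)[OF g']
        measurable_su2_mult(1)[OF g] _ law_translate(2)[OF bi g], where p = "\<lambda>i. i" and q = "\<lambda>_. k" and p' = "\<lambda>_ l. l" and q' = "\<lambda>_ _. k"])
    show "g ** (matrix_inv g ** x) = x" for x :: "complex^2^2" by (rule SU2_inv_mult_cancel(2)[OF g])
    show "hD n i k (g ** y) = (\<Sum>l\<le>n. cnj (wD n i l g) * hD n l k y)" if i: "i \<le> n" and y: "y \<in> SU2" for i y
      unfolding hD_def wD_mult[OF g y i k] by (simp add: sum_distrib_left mult_ac)
  qed (use k in auto)
  from this[of "\<lambda>i. cnj (t i)"]
  show "(\<integral>\<omega>. gk {..n} t (\<lambda>j. \<Sum>q\<le>n. wD n j q g * cnj (A n q k \<omega>)) \<partial>M) = (\<integral>\<omega>. gk {..n} t (\<lambda>j. cnj (A n j k \<omega>)) \<partial>M)"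
    unfolding gk_cnj[symmetric] by (simp only: cnj_sum complex_cnj_mult complex_cnj_cnj)
next
  fix c assume c: "c \<ge> 0" "\<And>j t. j \<le> n \<Longrightarrow> ccf (\<lambda>\<omega>. cnj (A n j k \<omega>)) t = exp (- (c * (norm t)\<^sup>2))"
  show thesis
  proof (rule that[OF c(1)])
    show "ccf (A n j k) t = exp (- (c * (norm t)\<^sup>2))" if "j \<le> n" for j t
      using c(2)[OF that, of "cnj t"] unfolding ccf_cnj by simp
  qed
qed

section \<open>Gaussian coefficients with one rate for each degree\<close>

definition gaussian_coefficients :: "(nat \<Rightarrow> real) \<Rightarrow> bool" where
  "gaussian_coefficients v \<longleftrightarrow> (\<forall>n. v n \<ge> 0) \<and>
     (\<forall>n j k t. j \<le> n \<longrightarrow> k \<le> n \<longrightarrow> ccf (A n j k) t = exp (- (v n * (norm t)\<^sup>2)))"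

lemma gaussian_coefficientsI:
  assumes "\<And>n. \<exists>c\<ge>0. \<forall>j\<le>n. \<forall>k\<le>n. \<forall>t. ccf (A n j k) t = exp (- (c * (norm t)\<^sup>2))"
  obtains v where "gaussian_coefficients v"
proof
  define P where "P n c \<longleftrightarrow> c \<ge> 0 \<and> (\<forall>j\<le>n. \<forall>k\<le>n. \<forall>t. ccf (A n j k) t = exp (- (c * (norm t)\<^sup>2)))" for n c
  have "P n (SOME c. P n c)" for n
    using assms[of n] unfolding P_def[symmetric] by (rule someI_ex)
  then show "gaussian_coefficients (\<lambda>n. SOME c. P n c)"
    unfolding gaussian_coefficients_def P_def by blast
qed

lemma bi_invariant_imp_gaussian_coefficients:
  assumes bi: "bi_invariant M X" and a0: "complex_gaussian M (a 0 0 0)"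
  obtains v where "gaussian_coefficients v"
proof (rule gaussian_coefficientsI)
  fix n
  show "\<exists>c\<ge>0. \<forall>j\<le>n. \<forall>k\<le>n. \<forall>t. ccf (A n j k) t = exp (- (c * (norm t)\<^sup>2))"
  proof (cases "n = 0")
    case True
    have "A 0 0 0 = a 0 0 0" by (simp add: A_def)
    moreover obtain c where "c \<ge> 0" "\<And>t. ccf (a 0 0 0) t = exp (- (c * (norm t)\<^sup>2))"
      using complex_gaussian_ccf[OF a0] by blast
    ultimately show ?thesis using True by auto
  next
    case False
    then have n: "n \<ge> 1" by simp
    obtain c where c: "c \<ge> 0" "\<And>k t. k \<le> n \<Longrightarrow> ccf (A n 0 k) t = exp (- (c * (norm t)\<^sup>2))"
      using bi_invariant_row_gaussian[OF bi n, of 0] by blast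
    have "ccf (A n j k) t = exp (- (c * (norm t)\<^sup>2))" if jk: "j \<le> n" "k \<le> n" for j k t
    proof -
      \<comment> \<open>Row 0 fixes the rate, and column \<open>k\<close> ties each of its entries
        to the one in row 0.\<close>
      have "ccf (A n j k) t = ccf (A n 0 k) t"
      proof (rule bi_invariant_column_gaussian[OF bi n jk(2)])
        fix d assume "\<And>j t. j \<le> n \<Longrightarrow> ccf (A n j k) t = exp (- (d * (norm t)\<^sup>2))"
        from this[OF jk(1), of t] this[OF le0, of t] show ?thesis by (simp only:)
      qed
      then show ?thesis using c(2)[OF jk(2), of t] by (rule trans)
    qed
    with c(1) show ?thesis by blast
  qed
qed blast

text \<open>Each coefficient is a limit of linear combinations of values of the field, hence
  Gaussian. A centred circular Gaussian law is determined by its variance, so equal variances leave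
  one rate for each degree.\<close>

lemma gaussian_field_imp_gaussian_coefficients:
  assumes G: "complex_gaussian_field M X"
    and var: "\<And>n j k. j \<le> n \<Longrightarrow> k \<le> n \<Longrightarrow> complex_variance M (A n j k) = complex_variance M (A n 0 0)"
  obtains v where "gaussian_coefficients v"
proof (rule gaussian_coefficientsI)
  fix n
  have ex: "\<exists>c\<ge>0. complex_variance M (A n j k) = ennreal (4 * c) \<and> (\<forall>t. ccf (A n j k) t = exp (- (c * (norm t)\<^sup>2)))"
    if jk: "j \<le> n" "k \<le> n" for j k
  proof -
    have "\<exists>c\<ge>0. \<forall>t. ccf (pairing (hD n j k)) t = exp (- (c * (norm t)\<^sup>2))"
    proof (rule pairing_gaussian[OF G measurable_hD[OF jk] norm_hD_le[OF jk]])
      fix c :: real assume "c \<ge> 0" "\<And>t. ccf (pairing (hD n j k)) t = exp (- (c * (norm t)\<^sup>2))"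
      then show ?thesis by (intro exI[of _ c] conjI allI)
    qed
    then obtain c where c: "c \<ge> 0" "\<And>t. ccf (pairing (hD n j k)) t = exp (- (c * (norm t)\<^sup>2))"
      by blast
    have eq: "ccf (A n j k) t = ccf (pairing (hD n j k)) t" for t
      unfolding ccf_def
    proof (rule integral_cong_AE)
      show "(\<lambda>\<omega>. cis (Re (cnj t * A n j k \<omega>))) \<in> borel_measurable M"
        using measurable_A[OF jk] by simp
      show "(\<lambda>\<omega>. cis (Re (cnj t * pairing (hD n j k) \<omega>))) \<in> borel_measurable M"
        using measurable_pairing[OF measurable_hD[OF jk]] by simp
      show "AE \<omega> in M. cis (Re (cnj t * A n j k \<omega>)) = cis (Re (cnj t * pairing (hD n j k) \<omega>))"
        using AE_coefficient by eventually_elim (use jk in simp)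
    qed
    have "ccf (A n j k) t = exp (- (c * (norm t)\<^sup>2))" for t unfolding eq by (rule c(2))
    with complex_gaussian_of_ccf(2)[OF measurable_A[OF jk] c(1)] c(1) show ?thesis by blast
  qed
  from ex[of 0 0] obtain c where c: "c \<ge> 0" "complex_variance M (A n 0 0) = ennreal (4 * c)" by auto
  have "\<forall>t. ccf (A n j k) t = exp (- (c * (norm t)\<^sup>2))" if jk: "j \<le> n" "k \<le> n" for j k
  proof -
    from ex[OF jk] obtain d where d: "d \<ge> 0" "complex_variance M (A n j k) = ennreal (4 * d)"
      "\<forall>t. ccf (A n j k) t = exp (- (d * (norm t)\<^sup>2))" by blast
    have "ennreal (4 * d) = ennreal (4 * c)" using var[OF jk] d(2) c(2) by simp
    then have "d = c" using d(1) c(1) by (subst (asm) ennreal_inj) auto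
    then show ?thesis using d(3) by simp
  qed
  with c(1) show "\<exists>c\<ge>0. \<forall>j\<le>n. \<forall>k\<le>n. \<forall>t. ccf (A n j k) t = exp (- (c * (norm t)\<^sup>2))" by blast
qed blast

lemma complex_variance_gaussian_coefficients:
  assumes v: "gaussian_coefficients v" and jk: "j \<le> n" "k \<le> n"
  shows "complex_variance M (A n j k) = ennreal (4 * v n)"
  using v jk unfolding gaussian_coefficients_def
  by (intro complex_gaussian_of_ccf(2) measurable_A) auto

end

context prob_space
begin

section \<open>The law of a field and its finite-dimensional laws\<close>

lemma field_law_expectation:
  fixes Z :: "'a \<Rightarrow> complex^2^2 \<Rightarrow> complex" and F :: "(complex^2^2 \<Rightarrow> complex) \<Rightarrow> 'b :: {banach, second_countable_topology}"
  assumes "\<And>x. x \<in> SU2 \<Longrightarrow> (\<lambda>\<omega>. Z \<omega> x) \<in> borel_measurable M" and "F \<in> borel_measurable (Pi\<^sub>M SU2 (\<lambda>_. borel))"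
  shows "(\<integral>v. F v \<partial>field_law M Z) = (\<integral>\<omega>. F (\<lambda>x\<in>SU2. Z \<omega> x) \<partial>M)"
  unfolding field_law_def by (rule integral_distr[OF measurable_restrict[OF assms(1)] assms(2)])

lemma ccf_field_law:
  assumes Z: "\<And>x. x \<in> SU2 \<Longrightarrow> (\<lambda>\<omega>. Z \<omega> x) \<in> borel_measurable M" and J: "J \<subseteq> SU2"
  shows "ccf (\<lambda>\<omega>. \<Sum>g\<in>J. c g * Z \<omega> g) t = (\<integral>v. cis (Re (cnj t * (\<Sum>g\<in>J. c g * v g))) \<partial>field_law M Z)"
proof -
  define F where "F v = cis (Re (cnj t * (\<Sum>g\<in>J. c g * v g)))" for v :: "complex^2^2 \<Rightarrow> complex"
  have "F \<in> borel_measurable (Pi\<^sub>M SU2 (\<lambda>_. borel))"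
    unfolding F_def using J
    by (intro measurable_compose[OF _ borel_measurable_cis] measurable_compose[OF _ borel_measurable_Re] borel_measurable_times
        borel_measurable_const borel_measurable_sum measurable_component_singleton) auto
  from field_law_expectation[OF Z this]
  have "(\<integral>v. F v \<partial>field_law M Z) = (\<integral>\<omega>. F (\<lambda>x\<in>SU2. Z \<omega> x) \<partial>M)" .
  moreover have "F (\<lambda>x\<in>SU2. Z \<omega> x) = cis (Re (cnj t * (\<Sum>g\<in>J. c g * Z \<omega> g)))" for \<omega>
  proof -
    have "(\<Sum>g\<in>J. c g * (\<lambda>x\<in>SU2. Z \<omega> x) g) = (\<Sum>g\<in>J. c g * Z \<omega> g)"
      using J by (intro sum.cong refl) auto
    then show ?thesis unfolding F_def by (simp only:)
  qed
  ultimately show ?thesis unfolding ccf_def F_def by (simp only:)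
qed

lemma emeasure_field_law_emb:
  assumes Z: "\<And>x. x \<in> SU2 \<Longrightarrow> (\<lambda>\<omega>. Z \<omega> x) \<in> borel_measurable M"
    and J: "finite J" "J \<subseteq> SU2" and A: "\<And>j. j \<in> J \<Longrightarrow> A j \<in> sets borel"
  shows "emeasure (field_law M Z) (prod_emb SU2 (\<lambda>_. borel) J (Pi\<^sub>E J A))
    = emeasure (distr M (Pi\<^sub>M J (\<lambda>_. borel)) (\<lambda>\<omega>. \<lambda>j\<in>J. Z \<omega> j)) (Pi\<^sub>E J A)"
proof -
  have m: "(\<lambda>\<omega>. \<lambda>x\<in>SU2. Z \<omega> x) \<in> M \<rightarrow>\<^sub>M Pi\<^sub>M SU2 (\<lambda>_. borel)" using Z by (rule measurable_restrict)
  have mJ: "(\<lambda>\<omega>. \<lambda>j\<in>J. Z \<omega> j) \<in> M \<rightarrow>\<^sub>M Pi\<^sub>M J (\<lambda>_. borel)" using Z J by (intro measurable_restrict) auto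
  have sJ: "Pi\<^sub>E J A \<in> sets (Pi\<^sub>M J (\<lambda>_. borel))" using J A by (intro sets_PiM_I_finite) auto
  have s: "prod_emb SU2 (\<lambda>_. borel) J (Pi\<^sub>E J A) \<in> sets (Pi\<^sub>M SU2 (\<lambda>_. borel))"
    using J A by (intro sets_PiM_I) auto
  have "restrict (\<lambda>x\<in>SU2. Z \<omega> x) J = (\<lambda>j\<in>J. Z \<omega> j)" for \<omega>
    using J by (auto simp: restrict_def fun_eq_iff)
  then have "(\<lambda>\<omega>. \<lambda>x\<in>SU2. Z \<omega> x) -` prod_emb SU2 (\<lambda>_. borel) J (Pi\<^sub>E J A) \<inter> space M
    = (\<lambda>\<omega>. \<lambda>j\<in>J. Z \<omega> j) -` Pi\<^sub>E J A \<inter> space M"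
    unfolding prod_emb_def by auto
  then show ?thesis
    unfolding field_law_def emeasure_distr[OF m s] emeasure_distr[OF mJ sJ] by (simp only:)
qed

text \<open>Cylinders determine a finite measure on the product, and finite-dimensional laws are
  determined by characteristic functions. Evaluation at 1 suffices because the coefficients
  \<open>c\<close> are arbitrary.\<close>

lemma field_law_eqI:
  assumes Z: "\<And>x. x \<in> SU2 \<Longrightarrow> (\<lambda>\<omega>. Z \<omega> x) \<in> borel_measurable M"
    and Z': "\<And>x. x \<in> SU2 \<Longrightarrow> (\<lambda>\<omega>. Z' \<omega> x) \<in> borel_measurable M"
    and eq: "\<And>J c. finite J \<Longrightarrow> J \<subseteq> SU2 \<Longrightarrow> ccf (\<lambda>\<omega>. \<Sum>g\<in>J. c g * Z \<omega> g) 1 = ccf (\<lambda>\<omega>. \<Sum>g\<in>J. c g * Z' \<omega> g) 1"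
  shows "field_law M Z = field_law M Z'"
proof (rule measure_eqI_PiM_infinite)
  show "sets (field_law M Z) = sets (Pi\<^sub>M SU2 (\<lambda>_. borel))" "sets (field_law M Z') = sets (Pi\<^sub>M SU2 (\<lambda>_. borel))"
    unfolding field_law_def by (rule sets_distr)+
  show "finite_measure (field_law M Z)"
    unfolding field_law_def using Z by (intro finite_measure_distr measurable_restrict)
  fix A J assume J: "finite J" "J \<subseteq> SU2" and A: "\<And>j. j \<in> J \<Longrightarrow> A j \<in> sets (borel :: complex measure)"
  have "distr M (Pi\<^sub>M J (\<lambda>_. borel)) (\<lambda>\<omega>. \<lambda>j\<in>J. Z \<omega> j) = distr M (Pi\<^sub>M J (\<lambda>_. borel)) (\<lambda>\<omega>. \<lambda>j\<in>J. Z' \<omega> j)"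
  proof (rule distr_PiM_complex_eq_of_char[OF J(1)])
    show "(\<integral>\<omega>. cis (Re (\<Sum>j\<in>J. c j * Z \<omega> j)) \<partial>M) = (\<integral>\<omega>. cis (Re (\<Sum>j\<in>J. c j * Z' \<omega> j)) \<partial>M)" for c
      using eq[OF J, of c] unfolding ccf_def by simp
  qed (use Z Z' J in auto)
  moreover have "emeasure (field_law M Z) (prod_emb SU2 (\<lambda>_. borel) J (Pi\<^sub>E J A))
      = emeasure (distr M (Pi\<^sub>M J (\<lambda>_. borel)) (\<lambda>\<omega>. \<lambda>j\<in>J. Z \<omega> j)) (Pi\<^sub>E J A)"
    using Z J A by (rule emeasure_field_law_emb)
  moreover have "emeasure (field_law M Z') (prod_emb SU2 (\<lambda>_. borel) J (Pi\<^sub>E J A))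
      = emeasure (distr M (Pi\<^sub>M J (\<lambda>_. borel)) (\<lambda>\<omega>. \<lambda>j\<in>J. Z' \<omega> j)) (Pi\<^sub>E J A)"
    using Z' J A by (rule emeasure_field_law_emb)
  ultimately show "emeasure (field_law M Z) (prod_emb SU2 (\<lambda>_. borel) J (Pi\<^sub>E J A))
    = emeasure (field_law M Z') (prod_emb SU2 (\<lambda>_. borel) J (Pi\<^sub>E J A))" by (simp only:)
qed

end

lemma su2_AE_witness:
  assumes "AE x in su2_prob. P x"
  shows "\<exists>x\<in>SU2. P x"
proof (rule ccontr)
  assume "\<not> ?thesis"
  then have "AE x in su2_prob. \<not> P x" by (intro AE_I2) auto
  with assms have "AE x in su2_prob. False" by eventually_elim simp
  then show False by simp
qed

lemma tendsto_of_min_norm: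
  fixes d :: "nat \<Rightarrow> 'a :: real_normed_vector"
  assumes "(\<lambda>k. min 1 (norm (d k))) \<longlonglongrightarrow> 0"
  shows "d \<longlonglongrightarrow> 0"
proof (rule tendstoI)
  fix e :: real assume "e > 0"
  then have "eventually (\<lambda>k. min 1 (norm (d k)) < min 1 e) sequentially"
    by (intro order_tendstoD(2)[OF assms]) auto
  then show "eventually (\<lambda>k. dist (d k) 0 < e) sequentially"
    by eventually_elim (auto simp: min_def split: if_splits)
qed

context wigner_field
begin

text \<open>Mean square convergence holds path by path, with no bound uniform in
  \<open>\<omega>\<close>. Truncating the distance at 1 makes it integrable on the product space,
  where convergence in mean yields an almost surely convergent subsequence; Fubini then fixes the
  point before the path.\<close>

lemma exists_converging_subsequence:
  obtains r :: "nat \<Rightarrow> nat" where "strict_mono r"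
    "AE g in su2_prob. AE \<omega> in M. (\<lambda>k. S (r k) \<omega> g) \<longlonglongrightarrow> X \<omega> g"
proof -
  interpret Q: pair_prob_space su2_prob M ..
  define u where "u N g \<omega> = min 1 (norm (X \<omega> g - S N \<omega> g))" for N g \<omega>
  have um: "(\<lambda>p. u N (snd p) (fst p)) \<in> borel_measurable (M \<Otimes>\<^sub>M su2_prob)" for N
    unfolding u_def
    by (intro borel_measurable_min borel_measurable_const measurable_compose[OF _ borel_measurable_norm]
        borel_measurable_diff[OF measurable_X_joint measurable_S_joint])
  have "(\<lambda>p. (snd p, fst p)) \<in> su2_prob \<Otimes>\<^sub>M M \<rightarrow>\<^sub>M M \<Otimes>\<^sub>M su2_prob"
    by (intro measurable_Pair measurable_snd measurable_fst)
  from measurable_compose[OF this um]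
  have um': "case_prod (u N) \<in> borel_measurable (su2_prob \<Otimes>\<^sub>M M)" for N by (simp add: case_prod_beta')
  have u01: "0 \<le> u N g \<omega>" "u N g \<omega> \<le> 1" for N g \<omega> by (auto simp: u_def)
  have ui: "integrable (su2_prob \<Otimes>\<^sub>M M) (case_prod (u N))" for N
    using um' u01 by (intro Q.integrable_const_bound[where B = 1]) auto
  have "(\<lambda>N. \<integral>\<omega>. (\<integral>g. u N g \<omega> \<partial>su2_prob) \<partial>M) \<longlonglongrightarrow> (\<integral>\<omega>. 0 \<partial>M)"
  proof (rule integral_dominated_convergence[where w = "\<lambda>_. 1"])
    show "(\<lambda>\<omega>. \<integral>g. u N g \<omega> \<partial>su2_prob) \<in> borel_measurable M" for N
      using um by (intro su2.borel_measurable_lebesgue_integral) (simp add: case_prod_beta')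
    show "AE \<omega> in M. (\<lambda>N. \<integral>g. u N g \<omega> \<partial>su2_prob) \<longlonglongrightarrow> 0"
      using AE_L2_convergence
    proof eventually_elim
      case (elim \<omega>)
      then have \<omega>: "\<omega> \<in> space M" "integrable su2_prob (\<lambda>g. (cmod (X \<omega> g))\<^sup>2)"
        and lim: "(\<lambda>N. \<integral>g. (cmod (X \<omega> g - S N \<omega> g))\<^sup>2 \<partial>su2_prob) \<longlonglongrightarrow> 0" by auto
      have l0: "(\<lambda>N. sqrt (\<integral>g. (cmod (X \<omega> g - S N \<omega> g))\<^sup>2 \<partial>su2_prob)) \<longlonglongrightarrow> 0"
        using tendsto_real_sqrt[OF lim] by simp
      have b: "(\<integral>g. u N g \<omega> \<partial>su2_prob) \<le> sqrt (\<integral>g. (cmod (X \<omega> g - S N \<omega> g))\<^sup>2 \<partial>su2_prob)" for N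
      proof -
        note d = integrable_difference[OF \<omega>, of N]
        have i: "integrable su2_prob (\<lambda>g. norm (X \<omega> g - S N \<omega> g))"
          by (intro integrable_norm su2.expectation_norm_le_sqrt(1)[OF d])
        have "(\<integral>g. u N g \<omega> \<partial>su2_prob) \<le> (\<integral>g. norm (X \<omega> g - S N \<omega> g) \<partial>su2_prob)"
          using i by (rule integral_mono'[of su2_prob]) (auto simp: u_def)
        also note su2.expectation_norm_le_sqrt(2)[OF d]
        finally show ?thesis .
      qed
      show ?case
        by (rule tendsto_sandwich[OF _ _ tendsto_const l0])
          (intro always_eventually allI Bochner_Integration.integral_nonneg u01(1) b)+
    qed
    show "AE \<omega> in M. norm (\<integral>g. u N g \<omega> \<partial>su2_prob) \<le> 1" for N
    proof (intro AE_I2)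
      fix \<omega>
      have "0 \<le> (\<integral>g. u N g \<omega> \<partial>su2_prob)" by (intro Bochner_Integration.integral_nonneg u01(1))
      moreover have "(\<integral>g. u N g \<omega> \<partial>su2_prob) \<le> 1"
        using integral_mono'[of su2_prob "\<lambda>_. 1" "\<lambda>g. u N g \<omega>"] u01
        by (simp add: su2.prob_space[unfolded space_su2_prob])
      ultimately show "norm (\<integral>g. u N g \<omega> \<partial>su2_prob) \<le> 1" by simp
    qed
  qed auto
  then have "(\<lambda>N. \<integral>\<omega>. (\<integral>g. u N g \<omega> \<partial>su2_prob) \<partial>M) \<longlonglongrightarrow> 0" by simp
  moreover have "(\<integral>\<omega>. (\<integral>g. u N g \<omega> \<partial>su2_prob) \<partial>M) = (\<integral>p. norm (case_prod (u N) p) \<partial>(su2_prob \<Otimes>\<^sub>M M))" for N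
  proof -
    have "norm (case_prod (u N) p) = case_prod (u N) p" for p using u01(1) by (simp add: case_prod_beta')
    then show ?thesis using Q.integral_snd[OF ui[of N]] by (simp only:)
  qed
  ultimately have "(\<lambda>N. \<integral>p. norm (case_prod (u N) p) \<partial>(su2_prob \<Otimes>\<^sub>M M)) \<longlonglongrightarrow> 0" by (simp only:)
  from tendsto_L1_AE_subseq[OF ui this]
  obtain r :: "nat \<Rightarrow> nat" where r: "strict_mono r"
    and "AE p in su2_prob \<Otimes>\<^sub>M M. (\<lambda>k. case_prod (u (r k)) p) \<longlonglongrightarrow> 0" by blast
  from Q.AE_pair[OF this(2)] have ae: "AE g in su2_prob. AE \<omega> in M. (\<lambda>k. u (r k) g \<omega>) \<longlonglongrightarrow> 0"
    by (simp only: case_prod_conv)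
  have "AE g in su2_prob. AE \<omega> in M. (\<lambda>k. S (r k) \<omega> g) \<longlonglongrightarrow> X \<omega> g"
    using ae
  proof eventually_elim
    case (elim g)
    then show ?case
    proof eventually_elim
      case (elim \<omega>)
      have "(\<lambda>k. X \<omega> g - S (r k) \<omega> g) \<longlonglongrightarrow> 0"
        by (rule tendsto_of_min_norm) (use elim in \<open>simp only: u_def\<close>)
      from tendsto_diff[OF tendsto_const this, of "X \<omega> g"] show ?case by simp
    qed
  qed
  with r show ?thesis by (rule that)
qed

text \<open>For Gaussian coefficients with rates \<open>v\<close>, this is the rate of
  \<open>\<Sum>i\<in>J. \<gamma> i * S N \<omega> (y i)\<close> in \<open>ccf_S\<close>, that is, a
  quarter of its variance.\<close>

definition cov :: "(nat \<Rightarrow> real) \<Rightarrow> nat \<Rightarrow> 'i set \<Rightarrow> ('i \<Rightarrow> complex) \<Rightarrow> ('i \<Rightarrow> complex^2^2) \<Rightarrow> real" where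
  "cov v N J \<gamma> y = (\<Sum>n\<le>N. v n * (\<Sum>j\<le>n. \<Sum>k\<le>n. (norm (\<Sum>i\<in>J. \<gamma> i * (cn n * wD n j k (y i))))\<^sup>2))"

lemma cov_nonneg: "gaussian_coefficients v \<Longrightarrow> 0 \<le> cov v N J \<gamma> y"
  unfolding cov_def gaussian_coefficients_def by (intro sum_nonneg mult_nonneg_nonneg) auto

text \<open>In each row the vector of inner sums is multiplied by a unitary matrix. The rate
  \<open>v n\<close> is the same for all indices of the degree, so the weighted sum of squares does
  not change.\<close>

lemma cov_right_invariant:
  assumes g: "g \<in> SU2" and y: "\<And>i. i \<in> J \<Longrightarrow> y i \<in> SU2"
  shows "cov v N J \<gamma> (\<lambda>i. y i ** g) = cov v N J \<gamma> y"
proof -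
  have *: "(\<Sum>k\<le>n. (norm (\<Sum>i\<in>J. \<gamma> i * (cn n * wD n j k (y i ** g))))\<^sup>2) = (\<Sum>k\<le>n. (norm (\<Sum>i\<in>J. \<gamma> i * (cn n * wD n j k (y i))))\<^sup>2)"
    if j: "j \<le> n" for n j
  proof -
    define u where "u q = (\<Sum>i\<in>J. \<gamma> i * (cn n * wD n j q (y i)))" for q
    have "(\<Sum>i\<in>J. \<gamma> i * (cn n * wD n j k (y i ** g))) = (\<Sum>q\<le>n. u q * wD n q k g)" if k: "k \<le> n" for k
    proof -
      have "(\<Sum>i\<in>J. \<gamma> i * (cn n * wD n j k (y i ** g))) = (\<Sum>i\<in>J. \<Sum>q\<le>n. \<gamma> i * (cn n * wD n j q (y i)) * wD n q k g)"
        by (intro sum.cong refl) (simp add: wD_mult[OF y g j k] sum_distrib_left mult_ac)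
      also have "\<dots> = (\<Sum>q\<le>n. u q * wD n q k g)"
        unfolding u_def sum_distrib_right by (rule sum.swap)
      finally show ?thesis .
    qed
    then have "(\<Sum>k\<le>n. (norm (\<Sum>i\<in>J. \<gamma> i * (cn n * wD n j k (y i ** g))))\<^sup>2) = (\<Sum>k\<le>n. (norm (\<Sum>q\<le>n. u q * wD n q k g))\<^sup>2)"
      by (intro sum.cong refl) simp
    also have "\<dots> = (\<Sum>k\<le>n. (norm (u k))\<^sup>2)" by (rule wD_isometry(2)[OF g])
    finally show ?thesis unfolding u_def .
  qed
  have "(\<Sum>j\<le>n. \<Sum>k\<le>n. (norm (\<Sum>i\<in>J. \<gamma> i * (cn n * wD n j k (y i ** g))))\<^sup>2)
    = (\<Sum>j\<le>n. \<Sum>k\<le>n. (norm (\<Sum>i\<in>J. \<gamma> i * (cn n * wD n j k (y i))))\<^sup>2)" for n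
    by (rule sum.cong[OF refl]) (rule *, simp)
  then show ?thesis unfolding cov_def by (simp only:)
qed

lemma cov_left_invariant:
  assumes g: "g \<in> SU2" and y: "\<And>i. i \<in> J \<Longrightarrow> y i \<in> SU2"
  shows "cov v N J \<gamma> (\<lambda>i. g ** y i) = cov v N J \<gamma> y"
proof -
  have *: "(\<Sum>j\<le>n. (norm (\<Sum>i\<in>J. \<gamma> i * (cn n * wD n j k (g ** y i))))\<^sup>2) = (\<Sum>j\<le>n. (norm (\<Sum>i\<in>J. \<gamma> i * (cn n * wD n j k (y i))))\<^sup>2)"
    if k: "k \<le> n" for n k
  proof -
    define u where "u q = (\<Sum>i\<in>J. \<gamma> i * (cn n * wD n q k (y i)))" for q
    have "(\<Sum>i\<in>J. \<gamma> i * (cn n * wD n j k (g ** y i))) = (\<Sum>q\<le>n. wD n j q g * u q)" if j: "j \<le> n" for j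
    proof -
      have "(\<Sum>i\<in>J. \<gamma> i * (cn n * wD n j k (g ** y i))) = (\<Sum>i\<in>J. \<Sum>q\<le>n. wD n j q g * (\<gamma> i * (cn n * wD n q k (y i))))"
        by (intro sum.cong refl) (simp add: wD_mult[OF g y j k] sum_distrib_left mult_ac)
      also have "\<dots> = (\<Sum>q\<le>n. wD n j q g * u q)"
        unfolding u_def sum_distrib_left by (rule sum.swap)
      finally show ?thesis .
    qed
    then have "(\<Sum>j\<le>n. (norm (\<Sum>i\<in>J. \<gamma> i * (cn n * wD n j k (g ** y i))))\<^sup>2) = (\<Sum>j\<le>n. (norm (\<Sum>q\<le>n. wD n j q g * u q))\<^sup>2)"
      by (intro sum.cong refl) simp
    also have "\<dots> = (\<Sum>j\<le>n. (norm (u j))\<^sup>2)" by (rule wD_isometry(1)[OF g])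
    finally show ?thesis unfolding u_def .
  qed
  \<comment> \<open>Here the columns are rotated, so the sum over \<open>j\<close> has to be the
    inner one.\<close>
  have "(\<Sum>k\<le>n. \<Sum>j\<le>n. (norm (\<Sum>i\<in>J. \<gamma> i * (cn n * wD n j k (g ** y i))))\<^sup>2)
    = (\<Sum>k\<le>n. \<Sum>j\<le>n. (norm (\<Sum>i\<in>J. \<gamma> i * (cn n * wD n j k (y i))))\<^sup>2)" for n
    by (rule sum.cong[OF refl]) (rule *, simp)
  then have "(\<Sum>j\<le>n. \<Sum>k\<le>n. (norm (\<Sum>i\<in>J. \<gamma> i * (cn n * wD n j k (g ** y i))))\<^sup>2)
    = (\<Sum>j\<le>n. \<Sum>k\<le>n. (norm (\<Sum>i\<in>J. \<gamma> i * (cn n * wD n j k (y i))))\<^sup>2)" for n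
    by (rule trans[OF sum.swap trans[OF _ sum.swap]])
  then show ?thesis unfolding cov_def by (simp only:)
qed

lemma ccf_S:
  assumes v: "gaussian_coefficients v"
  shows "ccf (\<lambda>\<omega>. \<Sum>i\<in>J. \<gamma> i * S N \<omega> (y i)) t = exp (- (cov v N J \<gamma> y * (norm t)\<^sup>2))"
proof -
  define b where "b = (\<lambda>(n, j, k). \<Sum>i\<in>J. \<gamma> i * (cn n * wD n j k (y i)))"
  define Y where "Y = (\<lambda>(n, j, k). A n j k)"
  have *: "(\<Sum>i\<in>J. \<gamma> i * S N \<omega> (y i)) = (\<Sum>p\<in>IdxN N. b p * Y p \<omega>)" for \<omega>
  proof -
    have "(\<Sum>i\<in>J. \<gamma> i * S N \<omega> (y i)) = (\<Sum>i\<in>J. \<Sum>(n, j, k)\<in>IdxN N. \<gamma> i * (cn n * wD n j k (y i)) * A n j k \<omega>)"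
      unfolding S_alt sum_distrib_left by (intro sum.cong refl) (auto simp: mult_ac)
    also have "\<dots> = (\<Sum>(n, j, k)\<in>IdxN N. \<Sum>i\<in>J. \<gamma> i * (cn n * wD n j k (y i)) * A n j k \<omega>)"
      unfolding case_prod_beta' by (rule sum.swap)
    also have "\<dots> = (\<Sum>p\<in>IdxN N. b p * Y p \<omega>)"
      unfolding b_def Y_def case_prod_beta' sum_distrib_right ..
    finally show ?thesis .
  qed
  have "ccf (\<lambda>\<omega>. \<Sum>p\<in>IdxN N. b p * Y p \<omega>) t = exp (- ((\<Sum>p\<in>IdxN N. v (fst p) * (norm (b p))\<^sup>2) * (norm t)\<^sup>2))"
  proof (rule ccf_linear_combination[OF finite_IdxN])
    show "indep_vars (\<lambda>_. borel) Y (IdxN N)"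
      unfolding Y_def using indep_A IdxN_subset by (rule indep_vars_subset)
    show "ccf (Y p) t = exp (- (v (fst p) * (norm t)\<^sup>2))" if "p \<in> IdxN N" for p t
      using v that by (auto simp: gaussian_coefficients_def Y_def IdxN_def)
  qed
  moreover have "(\<Sum>p\<in>IdxN N. v (fst p) * (norm (b p))\<^sup>2) = cov v N J \<gamma> y"
    unfolding cov_def IdxN_def b_def by (simp add: sum.Sigma sum.cartesian_product split_def sum_distrib_left)
  ultimately show ?thesis unfolding * by (simp only:)
qed

lemma measurable_S: "g \<in> SU2 \<Longrightarrow> (\<lambda>\<omega>. S N \<omega> g) \<in> borel_measurable M"
  unfolding S_def by (intro borel_measurable_sum borel_measurable_times borel_measurable_const measurable_A) auto

lemma gaussian_limit:
  assumes v: "gaussian_coefficients v" and J: "finite J" and y: "\<And>i. i \<in> J \<Longrightarrow> y i \<in> SU2"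
    and lim: "\<And>i. i \<in> J \<Longrightarrow> AE \<omega> in M. (\<lambda>k. S (r k) \<omega> (y i)) \<longlonglongrightarrow> X \<omega> (y i)"
  shows "(\<lambda>k. complex_of_real (exp (- (cov v (r k) J \<gamma> y * (norm t)\<^sup>2)))) \<longlonglongrightarrow> ccf (\<lambda>\<omega>. \<Sum>i\<in>J. \<gamma> i * X \<omega> (y i)) t"
proof -
  have "AE \<omega> in M. \<forall>i\<in>J. (\<lambda>k. S (r k) \<omega> (y i)) \<longlonglongrightarrow> X \<omega> (y i)"
    using J lim by (rule AE_finite_allI)
  then have "AE \<omega> in M. (\<lambda>k. \<Sum>i\<in>J. \<gamma> i * S (r k) \<omega> (y i)) \<longlonglongrightarrow> (\<Sum>i\<in>J. \<gamma> i * X \<omega> (y i))"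
    by eventually_elim (intro tendsto_sum tendsto_mult tendsto_const, blast)
  moreover have "(\<lambda>\<omega>. \<Sum>i\<in>J. \<gamma> i * X \<omega> (y i)) \<in> borel_measurable M"
    using y by (intro borel_measurable_sum borel_measurable_times borel_measurable_const measurable_X)
  moreover have "(\<lambda>\<omega>. \<Sum>i\<in>J. \<gamma> i * S (r k) \<omega> (y i)) \<in> borel_measurable M" for k
    using y by (intro borel_measurable_sum borel_measurable_times borel_measurable_const measurable_S)
  ultimately have "(\<lambda>k. ccf (\<lambda>\<omega>. \<Sum>i\<in>J. \<gamma> i * S (r k) \<omega> (y i)) t) \<longlonglongrightarrow> ccf (\<lambda>\<omega>. \<Sum>i\<in>J. \<gamma> i * X \<omega> (y i)) t"
    by (intro ccf_tendsto_AE)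
  then show ?thesis unfolding ccf_S[OF v] .
qed

lemma bi_invariant_imp_gaussian_field:
  assumes bi: "bi_invariant M X" and v: "gaussian_coefficients v"
  shows "complex_gaussian_field M X"
  unfolding complex_gaussian_field_def
proof (intro allI impI)
  fix J c assume "finite J \<and> J \<subseteq> SU2"
  then have J: "finite J" "J \<subseteq> SU2" by auto
  obtain r :: "nat \<Rightarrow> nat" where r: "AE g in su2_prob. AE \<omega> in M. (\<lambda>k. S (r k) \<omega> g) \<longlonglongrightarrow> X \<omega> g"
    by (rule exists_converging_subsequence)
  \<comment> \<open>The subsequence is good only at almost every point. For almost every
    \<open>x\<close> all of the finitely many translates \<open>g ** x\<close> are good, and right
    invariance of the law leads back to \<open>J\<close>.\<close>
  have "AE x in su2_prob. \<forall>g\<in>J. AE \<omega> in M. (\<lambda>k. S (r k) \<omega> (g ** x)) \<longlonglongrightarrow> X \<omega> (g ** x)"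
    using J by (intro AE_finite_allI AE_su2_prob_invariant(1)[OF _ r]) auto
  then have "\<exists>x\<in>SU2. \<forall>g\<in>J. AE \<omega> in M. (\<lambda>k. S (r k) \<omega> (g ** x)) \<longlonglongrightarrow> X \<omega> (g ** x)"
    by (rule su2_AE_witness)
  then obtain x where x: "x \<in> SU2" and lim: "\<And>g. g \<in> J \<Longrightarrow> AE \<omega> in M. (\<lambda>k. S (r k) \<omega> (g ** x)) \<longlonglongrightarrow> X \<omega> (g ** x)"
    by blast
  define W where "W \<omega> = (\<Sum>g\<in>J. c g * X \<omega> g)" for \<omega>
  have Wm: "W \<in> borel_measurable M"
    unfolding W_def using J by (intro borel_measurable_sum borel_measurable_times borel_measurable_const measurable_X) auto
  have gx: "g ** x \<in> SU2" if "g \<in> SU2" for g using that x by (rule SU2_mult)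
  have "(\<lambda>k. complex_of_real (exp (- (cov v (r k) J c (\<lambda>g. g ** x) * (norm t)\<^sup>2)))) \<longlonglongrightarrow> ccf W t" for t
  proof -
    have "ccf (\<lambda>\<omega>. \<Sum>g\<in>J. c g * X \<omega> (g ** x)) t
      = (\<integral>u. cis (Re (cnj t * (\<Sum>g\<in>J. c g * u g))) \<partial>field_law M (\<lambda>\<omega> g. X \<omega> (g ** x)))"
      using measurable_X[OF gx] J(2) by (rule ccf_field_law)
    also have "\<dots> = ccf W t"
      unfolding law_translate(1)[OF bi x] W_def using measurable_X J(2) by (rule ccf_field_law[symmetric])
    finally have eq: "ccf (\<lambda>\<omega>. \<Sum>g\<in>J. c g * X \<omega> (g ** x)) t = ccf W t" .
    have "g ** x \<in> SU2" if "g \<in> J" for g using J(2) that by (intro gx) auto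
    then show ?thesis unfolding eq[symmetric] using lim by (rule gaussian_limit[OF v J(1)])
  qed
  from Wm cov_nonneg[OF v] this show "complex_gaussian M (\<lambda>\<omega>. \<Sum>g\<in>J. c g * X \<omega> g)"
    unfolding W_def[symmetric] by (rule ccf_gaussian_limit) (rule complex_gaussian_of_ccf(1)[OF Wm])
qed

text \<open>The rate of the term of degree \<open>n\<close> of the series at a point of the group;
  by unitarity the point does not matter.\<close>

definition wvar :: "(nat \<Rightarrow> real) \<Rightarrow> nat \<Rightarrow> real" where
  "wvar v n = v n * ((norm (cn n))\<^sup>2 * real (n + 1))"

lemma sum_norm_wD:
  assumes g: "g \<in> SU2"
  shows "(\<Sum>j\<le>n. \<Sum>k\<le>n. (norm (cn n * wD n j k g))\<^sup>2) = (norm (cn n))\<^sup>2 * real (n + 1)"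
proof -
  have "(\<Sum>k\<le>n. (norm (wD n j k g))\<^sup>2) = 1" if j: "j \<le> n" for j
  proof -
    have "complex_of_real (\<Sum>k\<le>n. (norm (wD n j k g))\<^sup>2) = 1"
      unfolding of_real_sum complex_norm_square using wD_unitary[OF g j j] by simp
    then show ?thesis by (simp only: of_real_eq_1_iff)
  qed
  then show ?thesis by (simp add: norm_mult power_mult_distrib sum_distrib_left[symmetric])
qed

lemma summable_wvar:
  assumes v: "gaussian_coefficients v"
  shows "summable (wvar v)"
proof -
  obtain r :: "nat \<Rightarrow> nat" where r: "strict_mono r"
    and ae: "AE g in su2_prob. AE \<omega> in M. (\<lambda>k. S (r k) \<omega> g) \<longlonglongrightarrow> X \<omega> g"
    by (rule exists_converging_subsequence)
  from su2_AE_witness[OF ae] obtain g where g: "g \<in> SU2" and lim: "AE \<omega> in M. (\<lambda>k. S (r k) \<omega> g) \<longlonglongrightarrow> X \<omega> g" by blast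
  have cov: "cov v N {g} (\<lambda>_. 1) (\<lambda>g. g) = (\<Sum>n\<le>N. wvar v n)" for N
    unfolding cov_def wvar_def using sum_norm_wD[OF g] by simp
  have nonneg: "0 \<le> wvar v n" for n using v by (simp add: wvar_def gaussian_coefficients_def)
  have "(\<lambda>k. complex_of_real (exp (- (cov v (r k) {g} (\<lambda>_. 1) (\<lambda>g. g) * (norm t)\<^sup>2)))) \<longlonglongrightarrow> ccf (\<lambda>\<omega>. \<Sum>i\<in>{g}. 1 * X \<omega> i) t" for t
    using g lim by (intro gaussian_limit[OF v]) auto
  then have l: "(\<lambda>k. complex_of_real (exp (- (cov v (r k) {g} (\<lambda>_. 1) (\<lambda>g. g) * (norm t)\<^sup>2)))) \<longlonglongrightarrow> ccf (\<lambda>\<omega>. X \<omega> g) t" for t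
    by simp
  \<comment> \<open>The limit is the characteristic function of the value of the field at
    \<open>g\<close>, so the rates converge and in particular stay bounded.\<close>
  have "convergent (\<lambda>k. cov v (r k) {g} (\<lambda>_. 1) (\<lambda>g. g))"
    using measurable_X[OF g] cov_nonneg[OF v] l by (rule ccf_gaussian_limit) (rule convergentI)
  then have "Bseq (\<lambda>k. \<Sum>n\<le>r k. wvar v n)" unfolding cov by (rule convergent_imp_Bseq)
  then obtain K where K: "\<And>k. norm (\<Sum>n\<le>r k. wvar v n) \<le> K" by (auto simp: Bseq_def)
  show ?thesis
  proof (rule summableI_nonneg_bounded[OF nonneg])
    fix N
    \<comment> \<open>\<open>r\<close> is strictly increasing, so \<open>N \<le> r N\<close>, and
      the bound along the subsequence covers all partial sums.\<close>
    have "(\<Sum>n<N. wvar v n) \<le> (\<Sum>n\<le>r N. wvar v n)"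
      using seq_suble[OF r, of N] by (intro sum_mono2 nonneg) auto
    also have "\<dots> \<le> K" using K[of N] by simp
    finally show "(\<Sum>n<N. wvar v n) \<le> K" .
  qed
qed

lemma gaussian_coefficients_imp_convergent:
  assumes v: "gaussian_coefficients v" and g: "g \<in> SU2"
  shows "AE \<omega> in M. (\<lambda>N. S N \<omega> g) \<longlonglongrightarrow> X \<omega> g"
proof -
  define T where "T n \<omega> = (\<Sum>j\<le>n. \<Sum>k\<le>n. A n j k \<omega> * (cn n * wD n j k g))" for n \<omega>
  define Y where "Y = (\<lambda>(n, j, k). A n j k)"
  define K where "K n = {n} \<times> {..n} \<times> {..n}" for n :: nat
  define b where "b = (\<lambda>(n, j, k). cn n * wD n j k g)"
  have K: "K n \<subseteq> Idx" for n by (auto simp: K_def Idx_def)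
  have fK: "finite (K n)" for n by (simp add: K_def)
  have T_alt: "T n \<omega> = (\<Sum>p\<in>K n. b p * Y p \<omega>)" for n \<omega>
  proof -
    have "(\<Sum>p\<in>K n. b p * Y p \<omega>) = (\<Sum>q\<in>{..n} \<times> {..n}. b (n, q) * Y (n, q) \<omega>)"
      unfolding K_def by (rule sum.reindex_cong[of "Pair n"]) (auto simp: inj_on_def)
    also have "\<dots> = T n \<omega>" unfolding T_def sum.cartesian_product by (intro sum.cong refl) (auto simp: b_def Y_def)
    finally show ?thesis ..
  qed
  have indepY: "indep_vars (\<lambda>_. borel) Y Idx" unfolding Y_def by (rule indep_A)
  \<comment> \<open>The blocks \<open>K n\<close> of indices of one degree are disjoint, which makes
    the terms of the series independent.\<close>
  have "indep_vars (\<lambda>n. Pi\<^sub>M (K n) (\<lambda>_. borel)) (\<lambda>n \<omega>. \<lambda>p\<in>K n. Y p \<omega>) UNIV"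
    using K by (intro indep_vars_restrict[OF indepY]) (auto simp: disjoint_family_on_def K_def)
  then have "indep_vars (\<lambda>_. borel) (\<lambda>n \<omega>. \<Sum>p\<in>K n. b p * (\<lambda>p\<in>K n. Y p \<omega>) p) UNIV"
  proof (rule indep_vars_compose2)
    show "(\<lambda>x. \<Sum>p\<in>K n. b p * x p) \<in> borel_measurable (Pi\<^sub>M (K n) (\<lambda>_. borel))" for n
      by (intro borel_measurable_sum borel_measurable_times borel_measurable_const measurable_component_singleton)
  qed
  moreover have "(\<Sum>p\<in>K n. b p * (\<lambda>p\<in>K n. Y p \<omega>) p) = T n \<omega>" for n \<omega>
    unfolding T_alt by (intro sum.cong refl) simp
  ultimately have indepT: "indep_vars (\<lambda>_. borel) T UNIV" by (simp only:)
  have ccfT: "ccf (T n) t = exp (- (wvar v n * (norm t)\<^sup>2))" for n t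
  proof -
    have "ccf (\<lambda>\<omega>. \<Sum>p\<in>K n. b p * Y p \<omega>) t = exp (- ((\<Sum>p\<in>K n. v n * (norm (b p))\<^sup>2) * (norm t)\<^sup>2))"
    proof (rule ccf_linear_combination[OF fK])
      show "indep_vars (\<lambda>_. borel) Y (K n)" using indepY K by (rule indep_vars_subset)
      show "ccf (Y p) t = exp (- (v n * (norm t)\<^sup>2))" if "p \<in> K n" for p t
        using v that by (auto simp: gaussian_coefficients_def Y_def K_def)
    qed
    moreover have "(\<Sum>p\<in>K n. v n * (norm (b p))\<^sup>2) = wvar v n"
    proof -
      have "(\<Sum>p\<in>K n. v n * (norm (b p))\<^sup>2) = (\<Sum>q\<in>{..n} \<times> {..n}. v n * (norm (b (n, q)))\<^sup>2)"
        unfolding K_def by (rule sum.reindex_cong[of "Pair n"]) (auto simp: inj_on_def)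
      also have "\<dots> = v n * (\<Sum>j\<le>n. \<Sum>k\<le>n. (norm (cn n * wD n j k g))\<^sup>2)"
        unfolding sum.cartesian_product sum_distrib_left by (intro sum.cong refl) (auto simp: b_def)
      finally show ?thesis unfolding sum_norm_wD[OF g] wvar_def .
    qed
    ultimately show ?thesis unfolding T_alt[abs_def] by (simp only:)
  qed
  have Tm: "T n \<in> borel_measurable M" for n using indepT by (auto simp: indep_vars_def)
  have nonneg: "0 \<le> wvar v n" for n using v by (simp add: wvar_def gaussian_coefficients_def)
  note gauss = complex_gaussian_of_ccf(3-8)[OF Tm nonneg ccfT]
  \<comment> \<open>Real and imaginary parts of the term of degree \<open>n\<close> have variance
    \<open>2 * wvar v n\<close> each, and the two real series are treated separately.\<close>
  have sm: "summable (\<lambda>n. 2 * wvar v n)" using summable_wvar[OF v] by (rule summable_mult)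
  have "AE \<omega> in M. convergent (\<lambda>N. \<Sum>n<N. Re (T n \<omega>))"
  proof (rule AE_convergent_sum_indep)
    show "indep_vars (\<lambda>_. borel) (\<lambda>n \<omega>. Re (T n \<omega>)) UNIV"
      by (rule indep_vars_compose2[OF indepT, of "\<lambda>_. Re"]) simp
    show "L2 (\<lambda>\<omega>. Re (T n \<omega>))" for n
      unfolding L2_def using gauss(1) measurable_compose[OF Tm borel_measurable_Re] by blast
    show "summable (\<lambda>n. \<integral>\<omega>. (Re (T n \<omega>))\<^sup>2 \<partial>M)" unfolding gauss(3) by (rule sm)
  qed (rule gauss(5))
  moreover have "AE \<omega> in M. convergent (\<lambda>N. \<Sum>n<N. Im (T n \<omega>))"
  proof (rule AE_convergent_sum_indep)
    show "indep_vars (\<lambda>_. borel) (\<lambda>n \<omega>. Im (T n \<omega>)) UNIV"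
      by (rule indep_vars_compose2[OF indepT, of "\<lambda>_. Im"]) simp
    show "L2 (\<lambda>\<omega>. Im (T n \<omega>))" for n
      unfolding L2_def using gauss(2) measurable_compose[OF Tm borel_measurable_Im] by blast
    show "summable (\<lambda>n. \<integral>\<omega>. (Im (T n \<omega>))\<^sup>2 \<partial>M)" unfolding gauss(4) by (rule sm)
  qed (rule gauss(6))
  ultimately have "AE \<omega> in M. convergent (\<lambda>N. wigner_partial_sum a N \<omega> g)"
  proof eventually_elim
    case (elim \<omega>)
    then obtain p q where "(\<lambda>N. \<Sum>n<N. Re (T n \<omega>)) \<longlonglongrightarrow> p" "(\<lambda>N. \<Sum>n<N. Im (T n \<omega>)) \<longlonglongrightarrow> q"
      by (auto simp: convergent_def)
    then have "(\<lambda>N. Complex (\<Sum>n<N. Re (T n \<omega>)) (\<Sum>n<N. Im (T n \<omega>))) \<longlonglongrightarrow> Complex p q"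
      by (rule tendsto_Complex)
    moreover have "Complex (\<Sum>n<N. Re (T n \<omega>)) (\<Sum>n<N. Im (T n \<omega>)) = (\<Sum>n<N. T n \<omega>)" for N
      by (simp add: complex_eq_iff)
    ultimately have "(\<lambda>N. \<Sum>n<N. T n \<omega>) \<longlonglongrightarrow> Complex p q" by (simp only:)
    \<comment> \<open>The partial sums of the expansion include the degree \<open>N\<close>, hence
      the shift by one.\<close>
    from LIMSEQ_Suc[OF this] have "(\<lambda>N. wigner_partial_sum a N \<omega> g) \<longlonglongrightarrow> Complex p q"
      unfolding wigner_partial_sum_eq S_def T_def lessThan_Suc_atMost .
    then show ?case by (rule convergentI)
  qed
  \<comment> \<open>Almost sure convergence at \<open>g\<close> activates the second clause of
    \<open>has_wigner_expansion\<close>, which identifies the sum of the series with the value of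
    the field there.\<close>
  then show ?thesis
    using expansion g unfolding has_wigner_expansion_def wigner_partial_sum_eq by blast
qed

lemma gaussian_coefficients_imp_bi_invariant:
  assumes v: "gaussian_coefficients v"
  shows "bi_invariant M X"
  unfolding bi_invariant_def
proof (intro ballI)
  fix g g' assume g: "g \<in> SU2" and g': "g' \<in> SU2"
  define T where "T x = matrix_inv g ** x ** g'" for x :: "complex^2^2"
  have ig: "matrix_inv g \<in> SU2" using g by (rule SU2_matrix_inv)
  have T: "T x \<in> SU2" if "x \<in> SU2" for x unfolding T_def using that ig g' by (intro SU2_mult)
  have "field_law M (\<lambda>\<omega> x. X \<omega> (T x)) = field_law M X"
  proof (rule field_law_eqI)
    fix J c assume J: "finite J" "J \<subseteq> SU2"
    \<comment> \<open>The partial sums at the translated and at the original points have equal rates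
      for every \<open>N\<close>, so the two limits below agree.\<close>
    have "cov v N J c T = cov v N J c (\<lambda>x. x)" for N
    proof -
      have "cov v N J c T = cov v N J c (\<lambda>x. matrix_inv g ** x)"
        unfolding T_def using J(2) ig by (intro cov_right_invariant[OF g'] SU2_mult) auto
      also have "\<dots> = cov v N J c (\<lambda>x. x)" using J(2) by (intro cov_left_invariant[OF ig]) auto
      finally show ?thesis .
    qed
    moreover have "(\<lambda>N. complex_of_real (exp (- (cov v N J c T * (norm (1 :: complex))\<^sup>2)))) \<longlonglongrightarrow> ccf (\<lambda>\<omega>. \<Sum>x\<in>J. c x * X \<omega> (T x)) 1"
      using T J by (intro gaussian_limit[OF v J(1)] gaussian_coefficients_imp_convergent[OF v]) auto
    moreover have "(\<lambda>N. complex_of_real (exp (- (cov v N J c (\<lambda>x. x) * (norm (1 :: complex))\<^sup>2)))) \<longlonglongrightarrow> ccf (\<lambda>\<omega>. \<Sum>x\<in>J. c x * X \<omega> x) 1"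
      using J by (intro gaussian_limit[OF v J(1)] gaussian_coefficients_imp_convergent[OF v]) auto
    ultimately show "ccf (\<lambda>\<omega>. \<Sum>x\<in>J. c x * X \<omega> (T x)) 1 = ccf (\<lambda>\<omega>. \<Sum>x\<in>J. c x * X \<omega> x) 1"
      by (simp only:) (rule LIMSEQ_unique)
  qed (use measurable_X T in auto)
  then show "field_law M (\<lambda>\<omega> x. X \<omega> (matrix_inv g ** x ** g')) = field_law M X" unfolding T_def .
qed

end

theorem corollary8:
  fixes M :: "'w measure"
    and X :: "'w \<Rightarrow> complex^2^2 \<Rightarrow> complex"
    and a :: "real \<Rightarrow> real \<Rightarrow> real \<Rightarrow> 'w \<Rightarrow> complex"
  assumes "prob_space M"
    and "square_integrable_field M X"
    and "has_wigner_expansion M X a"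
    and "prob_space.indep_vars M (\<lambda>_. borel) (\<lambda>(l, m, s). a l m s) wigner_idx"
    and "\<forall>(l, m, s)\<in>wigner_idx. centrally_symmetric M (a l m s)"
    and "complex_gaussian M (a 0 0 0)"
  shows "bi_invariant M X \<longleftrightarrow>
    complex_gaussian_field M X \<and>
    (\<forall>l\<in>half_nats. \<forall>m\<in>weights l. \<forall>s\<in>weights l. \<forall>m'\<in>weights l. \<forall>s'\<in>weights l.
       complex_variance M (a l m s) = complex_variance M (a l m' s'))"
proof -
  interpret prob_space M by (rule assms(1))
  interpret wigner_field M X a by unfold_locales (fact assms)+
  show ?thesis
  proof (intro iffI conjI)
    assume bi: "bi_invariant M X"
    obtain v where v: "gaussian_coefficients v"
      by (rule bi_invariant_imp_gaussian_coefficients[OF bi assms(6)])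
    show "complex_gaussian_field M X" using bi v by (rule bi_invariant_imp_gaussian_field)
    have var: "complex_variance M (a (real n / 2) m s) = ennreal (4 * v n)"
      if ms: "m \<in> weights (real n / 2)" "s \<in> weights (real n / 2)" for n m s
    proof -
      from ms obtain j k where "j \<le> n" "k \<le> n" "m = real j - real n / 2" "s = real k - real n / 2"
        unfolding weights_half by auto
      then show ?thesis using complex_variance_gaussian_coefficients[OF v, of j n k] by (simp add: A_def)
    qed
    have "complex_variance M (a l m s) = complex_variance M (a l m' s')"
      if l: "l \<in> half_nats" and ms: "m \<in> weights l" "s \<in> weights l" "m' \<in> weights l" "s' \<in> weights l" for l m s m' s'
    proof -
      obtain n where n: "l = real n / 2" using l unfolding half_nats_def by blast
      have var: "complex_variance M (a l m s) = ennreal (4 * v n)"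
        if "m \<in> weights l" "s \<in> weights l" for m s
        using that unfolding n by (rule var)
      show ?thesis unfolding var[OF ms(1,2)] var[OF ms(3,4)] ..
    qed
    then show "\<forall>l\<in>half_nats. \<forall>m\<in>weights l. \<forall>s\<in>weights l. \<forall>m'\<in>weights l. \<forall>s'\<in>weights l.
       complex_variance M (a l m s) = complex_variance M (a l m' s')" by blast
  next
    assume R: "complex_gaussian_field M X \<and>
      (\<forall>l\<in>half_nats. \<forall>m\<in>weights l. \<forall>s\<in>weights l. \<forall>m'\<in>weights l. \<forall>s'\<in>weights l.
       complex_variance M (a l m s) = complex_variance M (a l m' s'))"
    have var: "complex_variance M (A n j k) = complex_variance M (A n 0 0)" if "j \<le> n" "k \<le> n" for n j k
    proof -
      have "real n / 2 \<in> half_nats" by (auto simp: half_nats_def)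
      moreover have "real i - real n / 2 \<in> weights (real n / 2)" if "i \<le> n" for i
        using that unfolding weights_half by auto
      ultimately show ?thesis unfolding A_def using that R by blast
    qed
    from R have "complex_gaussian_field M X" ..
    then show "bi_invariant M X"
    proof (rule gaussian_field_imp_gaussian_coefficients)
      show "complex_variance M (A n j k) = complex_variance M (A n 0 0)" if "j \<le> n" "k \<le> n" for n j k
        using that by (rule var)
    qed (rule gaussian_coefficients_imp_bi_invariant)
  qed
qed

end
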